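(* Let $K$ be a weak Kac algebra satisfying the $\lambda$-Markov condition, and let $K$ act on the left on a unital $C^*$-algebra $A$. Then $$(A\rtimes K)\rtimes K^*\cong A\otimes M_n(\mathbb{C}),\qquad n=\lambda^{-1},$$ where $K^*$ acts on $A\rtimes K$ by the dual action.
   Context: A weak Kac algebra is a finite-dimensional $C^*$-algebra $K$ with linear maps $\Delta:K\to K\otimes K$ (a not necessarily unital $*$-homomorphism), $\varepsilon:K\to\mathbb{C}$ (a positive, not necessarily multiplicative functional) and $S:K\to K$ (a $*$-preserving, anti-multiplicative and anti-comultiplicative map with $S^2=\mathrm{id}$) such that, with $\varepsilon_s(x)=(\mathrm{id}\otimes\varepsilon)((1\otimes x)\Delta(1))$ and $\varepsilon_t(x)=(\varepsilon\otimes\mathrm{id})(\Delta(1)(x\otimes1))$, for all $x,y\in K$: (1) $(\Delta\otimes\mathrm{id})\Delta=(\mathrm{id}\otimes\Delta)\Delta$ and $(\varepsilon\otimes\mathrm{id})\Delta=\mathrm{id}=(\mathrm{id}\otimes\varepsilon)\Delta$; (2) $\varepsilon_s(x)y=(\mathrm{id}\otimes\varepsilon)((1\otimes x)\Delta(y))$; (3) $(\varepsilon_s\otimes\mathrm{id})\Delta(x)=(1\otimes x)\Delta(1)$; (4) $m(S\otimes\mathrm{id})\Delta(x)=\varepsilon_s(x)$, where $m$ is multiplication. Write $\Delta(h)=h_{(1)}\otimes h_{(2)}$. The Cartan subalgebras are $K_s=\varepsilon_s(K)$, $K_t=\varepsilon_t(K)$. The Haar projection $p_\varepsilon\in K$ is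 the unique projection with $p_\varepsilon x=p_\varepsilon\varepsilon_s(x)$, $xp_\varepsilon=\varepsilon_t(x)p_\varepsilon$ for all $x$, and $\varepsilon_s(p_\varepsilon)=\varepsilon_t(p_\varepsilon)=1$. The normalized Haar trace $\tau$ is the unique faithful trace on $K$ with $(\tau\otimes\mathrm{id})\Delta=(\tau\otimes\varepsilon_s)\Delta$, $(\mathrm{id}\otimes\tau)\Delta=(\varepsilon_t\otimes\tau)\Delta$, $\tau\circ\varepsilon_s=\tau\circ\varepsilon_t=\varepsilon$. Put $E_s=(\tau\otimes\mathrm{id})\Delta$, $E_t=(\mathrm{id}\otimes\tau)\Delta$. $K$ satisfies the $\lambda$-Markov condition ($\lambda>0$) if $E_s(p_\varepsilon)=E_t(p_\varepsilon)=\lambda1$ (then $\lambda^{-1}$ is a positive integer). The dual space $K^*$ is a weak Kac algebra with $\langle\phi\psi,x\rangle=\langle\phi\otimes\psi,\Delta(x)\rangle$, $\langle\Delta(\phi),x\otimes y\rangle=\langle\phi,xy\rangle$, $\langle S(\phi),x\rangle=\langle\phi,S(x)\rangle$, $\langle\phi^*,x\rangle=\overline{\langle\phi,S(x^* )\rangle}$, unit $\varepsilon$, counit $\phi\mapsto\langle\phi,1\rangle$. A left action of $K$ on a unital $*$-algebra $A$ is a left $K$-module structure $h\otimes a\mapsto h\triangleright a$ on $A$ such that $h\triangleright ab=(h_{(1)}\triangleright a)(h_{(2)}\triangleright b)$, $(h\triangleright a)^*=S(h)^*\triangleright a^*$, $h\triangleright1=\varepsilon_t(h)\triangleright1$, and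 $h\triangleright1=0$ iff $\varepsilon_t(h)=0$; for a $C^*$-algebra $A$ each map $a\mapsto h\triangleright a$ is also required to be norm continuous. The crossed product $A\rtimes K$ is the space $A\otimes_{K_t}K$ (identifying $a(z\triangleright1)\otimes h\equiv a\otimes zh$ for $z\in K_t$; class denoted $[a\otimes h]$) with $[a\otimes h][b\otimes k]=[a(h_{(1)}\triangleright b)\otimes h_{(2)}k]$ and $[a\otimes h]^*=[(h_{(1)}^*\triangleright a^* )\otimes h_{(2)}^*]$; it is a $C^*$-algebra when $A$ is. The dual left action of $K^*$ on $A\rtimes K$ is $\phi\triangleright[a\otimes h]=[a\otimes h_{(1)}\langle\phi,h_{(2)}\rangle]$. *)

theory Defs
  imports
    "HOL-Analysis.Analysis"
    "HOL-Algebra.QuotRing"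
    "HOL-Algebra.Module"
    "HOL-Library.Poly_Mapping"
    "HOL-Library.Nonpos_Ints"
    "Jordan_Normal_Form.Matrix"
    "Jordan_Normal_Form.Schur_Decomposition"
begin

section \<open>Unital *-algebras and C*-algebras\<close>

record 'a star_alg = "(complex, 'a) module" +
  star :: "'a \<Rightarrow> 'a"

text \<open>The complex numbers, both as ring of scalars and as *-algebra.\<close>

definition CC :: "complex star_alg" where
  "CC = \<lparr>carrier = UNIV, mult = (*), one = 1, zero = 0, add = (+), smult = (*), star = cnj\<rparr>"

locale star_algebra = ring A + cmod?: Module.module CC A
  for A :: "('a, 'm) star_alg_scheme" (structure) +
  assumes smult_mult_left: "\<lbrakk>x \<in> carrier A; y \<in> carrier A\<rbrakk> \<Longrightarrow> (c \<odot> x) \<otimes> y = c \<odot> (x \<otimes> y)"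
    and smult_mult_right: "\<lbrakk>x \<in> carrier A; y \<in> carrier A\<rbrakk> \<Longrightarrow> x \<otimes> (c \<odot> y) = c \<odot> (x \<otimes> y)"
    and star_closed: "x \<in> carrier A \<Longrightarrow> star A x \<in> carrier A"
    and star_star: "x \<in> carrier A \<Longrightarrow> star A (star A x) = x"
    and star_add: "\<lbrakk>x \<in> carrier A; y \<in> carrier A\<rbrakk> \<Longrightarrow> star A (x \<oplus> y) = star A x \<oplus> star A y"
    and star_smult: "x \<in> carrier A \<Longrightarrow> star A (c \<odot> x) = cnj c \<odot> star A x"
    and star_mult: "\<lbrakk>x \<in> carrier A; y \<in> carrier A\<rbrakk> \<Longrightarrow> star A (x \<otimes> y) = star A y \<otimes> star A x"

definition norm_dist :: "('a, 'm) star_alg_scheme \<Rightarrow> ('a \<Rightarrow> real) \<Rightarrow> 'a \<Rightarrow> 'a \<Rightarrow> real" where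
  "norm_dist A N x y = N (x \<ominus>\<^bsub>A\<^esub> y)"

text \<open>A *-algebra carries at most one C*-norm, so the norm is kept outside the record.\<close>

locale cstar_algebra = star_algebra A for A :: "('a, 'm) star_alg_scheme" (structure) +
  fixes N :: "'a \<Rightarrow> real"
  assumes norm_nonneg: "x \<in> carrier A \<Longrightarrow> 0 \<le> N x"
    and norm_eq_0: "x \<in> carrier A \<Longrightarrow> N x = 0 \<longleftrightarrow> x = \<zero>"
    and norm_triangle: "\<lbrakk>x \<in> carrier A; y \<in> carrier A\<rbrakk> \<Longrightarrow> N (x \<oplus> y) \<le> N x + N y"
    and norm_smult: "x \<in> carrier A \<Longrightarrow> N (c \<odot> x) = cmod c * N x"
    and norm_mult_le: "\<lbrakk>x \<in> carrier A; y \<in> carrier A\<rbrakk> \<Longrightarrow> N (x \<otimes> y) \<le> N x * N y"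
    and norm_star_mult: "x \<in> carrier A \<Longrightarrow> N (star A x \<otimes> x) = (N x)\<^sup>2"
    and complete: "Metric_space.mcomplete (carrier A) (norm_dist A N)"

definition norm_topology :: "('a, 'm) star_alg_scheme \<Rightarrow> ('a \<Rightarrow> real) \<Rightarrow> 'a topology" where
  "norm_topology A N = Metric_space.mtopology (carrier A) (norm_dist A N)"

definition linear_between ::
  "(complex, 'a, 'm) module_scheme \<Rightarrow> (complex, 'b, 'n) module_scheme \<Rightarrow> ('a \<Rightarrow> 'b) \<Rightarrow> bool" where
  "linear_between V W f \<longleftrightarrow>
     f \<in> carrier V \<rightarrow> carrier W \<and>
     (\<forall>x\<in>carrier V. \<forall>y\<in>carrier V. f (x \<oplus>\<^bsub>V\<^esub> y) = f x \<oplus>\<^bsub>W\<^esub> f y) \<and>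
     (\<forall>c. \<forall>x\<in>carrier V. f (c \<odot>\<^bsub>V\<^esub> x) = c \<odot>\<^bsub>W\<^esub> f x)"

definition finite_dimensional :: "(complex, 'a, 'm) module_scheme \<Rightarrow> bool" where
  "finite_dimensional V \<longleftrightarrow>
     (\<exists>B. finite B \<and> B \<subseteq> carrier V \<and>
        (\<forall>x\<in>carrier V. \<exists>c. x = (\<Oplus>\<^bsub>V\<^esub>b\<in>B. c b \<odot>\<^bsub>V\<^esub> b)))"

text \<open>An isomorphism of C*-algebras is the same thing as a *-isomorphism: the latter is
  automatically isometric.\<close>

definition star_isomorphic ::
  "('a, 'm) star_alg_scheme \<Rightarrow> ('b, 'n) star_alg_scheme \<Rightarrow> bool" where
  "star_isomorphic A B \<longleftrightarrow>
     (\<exists>f \<in> ring_iso A B. linear_between A B f \<and>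
        (\<forall>x\<in>carrier A. f (star A x) = star B (f x)))"

definition matrix_algebra :: "nat \<Rightarrow> complex mat star_alg" where
  "matrix_algebra n =
     \<lparr>carrier = carrier_mat n n, mult = (*), one = 1\<^sub>m n, zero = 0\<^sub>m n n, add = (+),
      smult = (\<cdot>\<^sub>m), star = mat_adjoint\<rparr>"


section \<open>Tensor products\<close>

text \<open>Finitely supported functions \<^typ>\<open>'x \<Rightarrow>\<^sub>0 complex\<close> are the formal linear combinations of
  elements of \<^typ>\<open>'x\<close>. A tensor product is the quotient of the formal linear combinations of
  pairs by the span of the defining relations; a tensor is a coset.\<close>

type_synonym ('a, 'b) tensor = "('a \<times> 'b \<Rightarrow>\<^sub>0 complex) set"

definition formal_scale :: "complex \<Rightarrow> ('x \<Rightarrow>\<^sub>0 complex) \<Rightarrow> ('x \<Rightarrow>\<^sub>0 complex)" where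
  "formal_scale c f = Poly_Mapping.map ((*) c) f"

global_interpretation formal: vector_space "formal_scale :: complex \<Rightarrow> ('x \<Rightarrow>\<^sub>0 complex) \<Rightarrow> _"
proof -
  have [simp]: "Poly_Mapping.lookup (formal_scale c f) x = c * Poly_Mapping.lookup f x"
    for c and f :: "'x \<Rightarrow>\<^sub>0 complex" and x
    by (simp add: formal_scale_def Poly_Mapping.map.rep_eq Poly_Mapping.when_def)
  show "vector_space (formal_scale :: complex \<Rightarrow> ('x \<Rightarrow>\<^sub>0 complex) \<Rightarrow> _)"
    by unfold_locales (auto intro!: poly_mapping_eqI simp: lookup_add algebra_simps)
qed

abbreviation basis :: "'a \<Rightarrow> 'b \<Rightarrow> ('a \<times> 'b \<Rightarrow>\<^sub>0 complex)" where
  "basis x y \<equiv> Poly_Mapping.single (x, y) 1"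

definition coset_of :: "('x \<Rightarrow>\<^sub>0 complex) set \<Rightarrow> ('x \<Rightarrow>\<^sub>0 complex) \<Rightarrow> ('x \<Rightarrow>\<^sub>0 complex) set" where
  "coset_of U f = {g. g - f \<in> U}"

definition formal_quotient ::
  "'x set \<Rightarrow> ('x \<Rightarrow>\<^sub>0 complex) set \<Rightarrow> (complex, ('x \<Rightarrow>\<^sub>0 complex) set) module" where
  "formal_quotient X U =
     \<lparr>carrier = coset_of U ` {f. Poly_Mapping.keys f \<subseteq> X},
      mult = undefined, one = undefined,
      zero = coset_of U 0,
      add = (\<lambda>s t. \<Union>f\<in>s. \<Union>g\<in>t. coset_of U (f + g)),
      smult = (\<lambda>c t. \<Union>f\<in>t. coset_of U (formal_scale c f))\<rparr>"

definition bilinear_relations ::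
  "(complex, 'a, 'm) module_scheme \<Rightarrow> (complex, 'b, 'n) module_scheme \<Rightarrow> ('a \<times> 'b \<Rightarrow>\<^sub>0 complex) set" where
  "bilinear_relations V W =
     {basis (x \<oplus>\<^bsub>V\<^esub> x') y - basis x y - basis x' y | x x' y.
        x \<in> carrier V \<and> x' \<in> carrier V \<and> y \<in> carrier W} \<union>
     {basis x (y \<oplus>\<^bsub>W\<^esub> y') - basis x y - basis x y' | x y y'.
        x \<in> carrier V \<and> y \<in> carrier W \<and> y' \<in> carrier W} \<union>
     {basis (c \<odot>\<^bsub>V\<^esub> x) y - formal_scale c (basis x y) | c x y.
        x \<in> carrier V \<and> y \<in> carrier W} \<union>
     {basis x (c \<odot>\<^bsub>W\<^esub> y) - formal_scale c (basis x y) | c x y.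
        x \<in> carrier V \<and> y \<in> carrier W}"

definition tensor_null ::
  "(complex, 'a, 'm) module_scheme \<Rightarrow> (complex, 'b, 'n) module_scheme \<Rightarrow> ('a \<times> 'b \<Rightarrow>\<^sub>0 complex) set" where
  "tensor_null V W = formal.span (bilinear_relations V W)"

definition tensor_space ::
  "(complex, 'a, 'm) module_scheme \<Rightarrow> (complex, 'b, 'n) module_scheme \<Rightarrow>
     (complex, ('a, 'b) tensor) module" where
  "tensor_space V W = formal_quotient (carrier V \<times> carrier W) (tensor_null V W)"

definition pure_tensor ::
  "(complex, 'a, 'm) module_scheme \<Rightarrow> (complex, 'b, 'n) module_scheme \<Rightarrow> 'a \<Rightarrow> 'b \<Rightarrow> ('a, 'b) tensor" where
  "pure_tensor V W x y = coset_of (tensor_null V W) (basis x y)"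

text \<open>\<open>lift V b\<close> is the linear map into \<open>V\<close> with \<open>x \<otimes> y \<mapsto> b x y\<close>. It is evaluated on an arbitrary
  representative, so it is meaningful only if \<open>b\<close> respects the relations of the tensor product at
  hand. In Sweedler notation, an expression in \<open>h\<^sub>(\<^sub>1\<^sub>)\<close>, \<open>h\<^sub>(\<^sub>2\<^sub>)\<close> is \<open>lift V (\<lambda>h1 h2. \<dots>) (\<Delta> h)\<close>.\<close>

definition lift ::
  "(complex, 'v, 'm) module_scheme \<Rightarrow> ('a \<Rightarrow> 'b \<Rightarrow> 'v) \<Rightarrow> ('a, 'b) tensor \<Rightarrow> 'v" where
  "lift V b t = (let f = (SOME f. f \<in> t) in
     \<Oplus>\<^bsub>V\<^esub>p\<in>Poly_Mapping.keys f. Poly_Mapping.lookup f p \<odot>\<^bsub>V\<^esub> b (fst p) (snd p))"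

text \<open>Linear maps into the conjugate space are the conjugate-linear maps; \<open>lift (conj_space V) b\<close>
  is the conjugate-linear map with \<open>x \<otimes> y \<mapsto> b x y\<close>.\<close>

definition conj_space ::
  "(complex, 'v, 'm) module_scheme \<Rightarrow> (complex, 'v, 'm) module_scheme" where
  "conj_space V = V\<lparr>smult := \<lambda>c x. cnj c \<odot>\<^bsub>V\<^esub> x\<rparr>"

definition tensor_map ::
  "(complex, 'c, 'm) module_scheme \<Rightarrow> (complex, 'd, 'n) module_scheme \<Rightarrow>
     ('a \<Rightarrow> 'c) \<Rightarrow> ('b \<Rightarrow> 'd) \<Rightarrow> ('a, 'b) tensor \<Rightarrow> ('c, 'd) tensor" where
  "tensor_map V W f g = lift (tensor_space V W) (\<lambda>x y. pure_tensor V W (f x) (g y))"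

text \<open>The canonical map from the tensor product bracketed to the left to the one bracketed to the
  right.\<close>

definition tensor_assoc ::
  "(complex, 'a, 'm) module_scheme \<Rightarrow> (complex, 'b, 'n) module_scheme \<Rightarrow>
     (complex, 'c, 'p) module_scheme \<Rightarrow> (('a, 'b) tensor, 'c) tensor \<Rightarrow> ('a, ('b, 'c) tensor) tensor" where
  "tensor_assoc V W X =
     (let T = tensor_space V (tensor_space W X) in
      lift T (\<lambda>s z. lift T (\<lambda>x y. pure_tensor V (tensor_space W X) x (pure_tensor W X y z)) s))"

text \<open>The slice maps \<open>\<phi> \<otimes> id\<close> and \<open>id \<otimes> \<phi>\<close>.\<close>

definition slice_left ::
  "(complex, 'b, 'm) module_scheme \<Rightarrow> ('a \<Rightarrow> complex) \<Rightarrow> ('a, 'b) tensor \<Rightarrow> 'b" where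
  "slice_left V \<phi> = lift V (\<lambda>x y. \<phi> x \<odot>\<^bsub>V\<^esub> y)"

definition slice_right ::
  "(complex, 'a, 'm) module_scheme \<Rightarrow> ('b \<Rightarrow> complex) \<Rightarrow> ('a, 'b) tensor \<Rightarrow> 'a" where
  "slice_right V \<phi> = lift V (\<lambda>x y. \<phi> y \<odot>\<^bsub>V\<^esub> x)"

definition tensor_algebra ::
  "('a, 'm) star_alg_scheme \<Rightarrow> ('b, 'n) star_alg_scheme \<Rightarrow> ('a, 'b) tensor star_alg" where
  "tensor_algebra A B =
     (let T = tensor_space A B; P = pure_tensor A B in
      \<lparr>carrier = carrier T,
       mult = (\<lambda>s t. lift T (\<lambda>a b. lift T (\<lambda>c d. P (a \<otimes>\<^bsub>A\<^esub> c) (b \<otimes>\<^bsub>B\<^esub> d)) t) s),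
       one = P \<one>\<^bsub>A\<^esub> \<one>\<^bsub>B\<^esub>,
       zero = zero T, add = add T, smult = smult T,
       star = lift (conj_space T) (\<lambda>a b. P (star A a) (star B b))\<rparr>)"


section \<open>Weak Kac algebras\<close>

record 'k weak_kac = "'k star_alg" +
  comult :: "'k \<Rightarrow> ('k, 'k) tensor"
  counit :: "'k \<Rightarrow> complex"
  antipode :: "'k \<Rightarrow> 'k"

definition eps_s :: "'k weak_kac \<Rightarrow> 'k \<Rightarrow> 'k" where
  "eps_s K x = slice_right K (counit K)
     (pure_tensor K K \<one>\<^bsub>K\<^esub> x \<otimes>\<^bsub>tensor_algebra K K\<^esub> comult K \<one>\<^bsub>K\<^esub>)"

definition eps_t :: "'k weak_kac \<Rightarrow> 'k \<Rightarrow> 'k" where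
  "eps_t K x = slice_left K (counit K)
     (comult K \<one>\<^bsub>K\<^esub> \<otimes>\<^bsub>tensor_algebra K K\<^esub> pure_tensor K K x \<one>\<^bsub>K\<^esub>)"

definition Cartan_t :: "'k weak_kac \<Rightarrow> 'k set" where
  "Cartan_t K = eps_t K ` carrier K"

text \<open>The zero algebra is excluded, as otherwise every \<open>\<lambda> > 0\<close> would satisfy the Markov
  condition.\<close>

locale weak_kac_algebra = star_algebra K for K :: "'k weak_kac" (structure) +
  assumes nontrivial: "\<one> \<noteq> \<zero>"
    and finite_dim: "finite_dimensional K"
    and cstar: "\<exists>N. cstar_algebra K N"
    and comult_linear: "linear_between K (tensor_algebra K K) (comult K)"
    and comult_mult: "\<lbrakk>x \<in> carrier K; y \<in> carrier K\<rbrakk> \<Longrightarrow>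
          comult K (x \<otimes> y) = comult K x \<otimes>\<^bsub>tensor_algebra K K\<^esub> comult K y"
    and comult_star: "x \<in> carrier K \<Longrightarrow> comult K (star K x) = star (tensor_algebra K K) (comult K x)"
    and counit_linear: "linear_between K CC (counit K)"
    and counit_positive: "x \<in> carrier K \<Longrightarrow> counit K (star K x \<otimes> x) \<in> \<real>\<^sub>\<ge>\<^sub>0"
    and antipode_linear: "linear_between K K (antipode K)"
    and antipode_star: "x \<in> carrier K \<Longrightarrow> antipode K (star K x) = star K (antipode K x)"
    and antipode_mult: "\<lbrakk>x \<in> carrier K; y \<in> carrier K\<rbrakk> \<Longrightarrow>
          antipode K (x \<otimes> y) = antipode K y \<otimes> antipode K x"
    and antipode_comult: "x \<in> carrier K \<Longrightarrow> comult K (antipode K x) =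
          lift (tensor_space K K) (\<lambda>a b. pure_tensor K K (antipode K b) (antipode K a)) (comult K x)"
    and antipode_antipode: "x \<in> carrier K \<Longrightarrow> antipode K (antipode K x) = x"
    and coassoc: "x \<in> carrier K \<Longrightarrow>
          tensor_assoc K K K (tensor_map (tensor_space K K) K (comult K) id (comult K x)) =
          tensor_map K (tensor_space K K) id (comult K) (comult K x)"
    and counit_left: "x \<in> carrier K \<Longrightarrow> slice_left K (counit K) (comult K x) = x"
    and counit_right: "x \<in> carrier K \<Longrightarrow> slice_right K (counit K) (comult K x) = x"
    and eps_s_mult: "\<lbrakk>x \<in> carrier K; y \<in> carrier K\<rbrakk> \<Longrightarrow> eps_s K x \<otimes> y =
          slice_right K (counit K) (pure_tensor K K \<one> x \<otimes>\<^bsub>tensor_algebra K K\<^esub> comult K y)"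
    and eps_s_comult: "x \<in> carrier K \<Longrightarrow> tensor_map K K (eps_s K) id (comult K x) =
          pure_tensor K K \<one> x \<otimes>\<^bsub>tensor_algebra K K\<^esub> comult K \<one>"
    and antipode_eps_s: "x \<in> carrier K \<Longrightarrow>
          lift K (\<lambda>a b. antipode K a \<otimes> b) (comult K x) = eps_s K x"

definition is_Haar_projection :: "'k weak_kac \<Rightarrow> 'k \<Rightarrow> bool" where
  "is_Haar_projection K p \<longleftrightarrow>
     p \<in> carrier K \<and> p \<otimes>\<^bsub>K\<^esub> p = p \<and> star K p = p \<and>
     (\<forall>x\<in>carrier K. p \<otimes>\<^bsub>K\<^esub> x = p \<otimes>\<^bsub>K\<^esub> eps_s K x \<and> x \<otimes>\<^bsub>K\<^esub> p = eps_t K x \<otimes>\<^bsub>K\<^esub> p) \<and>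
     eps_s K p = \<one>\<^bsub>K\<^esub> \<and> eps_t K p = \<one>\<^bsub>K\<^esub>"

text \<open>As usual for C*-algebras, a trace is a positive tracial functional.\<close>

definition is_faithful_trace :: "('a, 'm) star_alg_scheme \<Rightarrow> ('a \<Rightarrow> complex) \<Rightarrow> bool" where
  "is_faithful_trace A \<tau> \<longleftrightarrow>
     linear_between A CC \<tau> \<and>
     (\<forall>x\<in>carrier A. \<forall>y\<in>carrier A. \<tau> (x \<otimes>\<^bsub>A\<^esub> y) = \<tau> (y \<otimes>\<^bsub>A\<^esub> x)) \<and>
     (\<forall>x\<in>carrier A. \<tau> (star A x \<otimes>\<^bsub>A\<^esub> x) \<in> \<real>\<^sub>\<ge>\<^sub>0) \<and>
     (\<forall>x\<in>carrier A. \<tau> (star A x \<otimes>\<^bsub>A\<^esub> x) = 0 \<longrightarrow> x = \<zero>\<^bsub>A\<^esub>)"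

definition is_Haar_trace :: "'k weak_kac \<Rightarrow> ('k \<Rightarrow> complex) \<Rightarrow> bool" where
  "is_Haar_trace K \<tau> \<longleftrightarrow>
     is_faithful_trace K \<tau> \<and>
     (\<forall>x\<in>carrier K.
        slice_left K \<tau> (comult K x) = lift K (\<lambda>a b. \<tau> a \<odot>\<^bsub>K\<^esub> eps_s K b) (comult K x) \<and>
        slice_right K \<tau> (comult K x) = lift K (\<lambda>a b. \<tau> b \<odot>\<^bsub>K\<^esub> eps_t K a) (comult K x) \<and>
        \<tau> (eps_s K x) = counit K x \<and> \<tau> (eps_t K x) = counit K x)"

text \<open>The Haar projection and the normalized Haar trace are unique, so it does not matter that they
  are quantified here instead of being named by a description operator.\<close>

definition Markov_condition :: "'k weak_kac \<Rightarrow> real \<Rightarrow> bool" where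
  "Markov_condition K lam \<longleftrightarrow>
     lam > 0 \<and>
     (\<exists>p \<tau>. is_Haar_projection K p \<and> is_Haar_trace K \<tau> \<and>
        slice_left K \<tau> (comult K p) = complex_of_real lam \<odot>\<^bsub>K\<^esub> \<one>\<^bsub>K\<^esub> \<and>
        slice_right K \<tau> (comult K p) = complex_of_real lam \<odot>\<^bsub>K\<^esub> \<one>\<^bsub>K\<^esub>)"


section \<open>The dual weak Kac algebra\<close>

text \<open>Functionals are represented by functions that are \<^const>\<open>undefined\<close> outside the carrier.\<close>

definition dual_algebra :: "'k weak_kac \<Rightarrow> ('k \<Rightarrow> complex) star_alg" where
  "dual_algebra K =
     \<lparr>carrier = {\<phi> \<in> extensional (carrier K). linear_between K CC \<phi>},
      mult = (\<lambda>\<phi> \<psi>. restrict (\<lambda>x. lift CC (\<lambda>a b. \<phi> a * \<psi> b) (comult K x)) (carrier K)),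
      one = restrict (counit K) (carrier K),
      zero = restrict (\<lambda>x. 0) (carrier K),
      add = (\<lambda>\<phi> \<psi>. restrict (\<lambda>x. \<phi> x + \<psi> x) (carrier K)),
      smult = (\<lambda>c \<phi>. restrict (\<lambda>x. c * \<phi> x) (carrier K)),
      star = (\<lambda>\<phi>. restrict (\<lambda>x. cnj (\<phi> (antipode K (star K x)))) (carrier K))\<rparr>"

definition dual_kac :: "'k weak_kac \<Rightarrow> ('k \<Rightarrow> complex) weak_kac" where
  "dual_kac K =
     (let D = dual_algebra K in
      \<lparr>carrier = carrier D, mult = mult D, one = one D, zero = zero D, add = add D,
       smult = smult D, star = star D,
       comult = (\<lambda>\<phi>. THE t. t \<in> carrier (tensor_space D D) \<and>
          (\<forall>x\<in>carrier K. \<forall>y\<in>carrier K. lift CC (\<lambda>\<alpha> \<beta>. \<alpha> x * \<beta> y) t = \<phi> (x \<otimes>\<^bsub>K\<^esub> y))),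
       counit = (\<lambda>\<phi>. \<phi> \<one>\<^bsub>K\<^esub>),
       antipode = (\<lambda>\<phi>. restrict (\<lambda>x. \<phi> (antipode K x)) (carrier K))\<rparr>)"


section \<open>Actions and crossed products\<close>

locale left_action =
  fixes K :: "'k weak_kac" and A :: "'a star_alg" and act :: "'k \<Rightarrow> 'a \<Rightarrow> 'a" (infixr \<open>\<triangleright>\<close> 75)
  assumes act_linear: "h \<in> carrier K \<Longrightarrow> linear_between A A (act h)"
    and act_add: "\<lbrakk>h \<in> carrier K; k \<in> carrier K; a \<in> carrier A\<rbrakk> \<Longrightarrow>
          (h \<oplus>\<^bsub>K\<^esub> k) \<triangleright> a = (h \<triangleright> a) \<oplus>\<^bsub>A\<^esub> (k \<triangleright> a)"
    and act_smult: "\<lbrakk>h \<in> carrier K; a \<in> carrier A\<rbrakk> \<Longrightarrow> (c \<odot>\<^bsub>K\<^esub> h) \<triangleright> a = c \<odot>\<^bsub>A\<^esub> (h \<triangleright> a)"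
    and act_act: "\<lbrakk>h \<in> carrier K; k \<in> carrier K; a \<in> carrier A\<rbrakk> \<Longrightarrow>
          (h \<otimes>\<^bsub>K\<^esub> k) \<triangleright> a = h \<triangleright> (k \<triangleright> a)"
    and act_one: "a \<in> carrier A \<Longrightarrow> \<one>\<^bsub>K\<^esub> \<triangleright> a = a"
    and act_mult: "\<lbrakk>h \<in> carrier K; a \<in> carrier A; b \<in> carrier A\<rbrakk> \<Longrightarrow>
          h \<triangleright> (a \<otimes>\<^bsub>A\<^esub> b) = lift A (\<lambda>h1 h2. (h1 \<triangleright> a) \<otimes>\<^bsub>A\<^esub> (h2 \<triangleright> b)) (comult K h)"
    and act_star: "\<lbrakk>h \<in> carrier K; a \<in> carrier A\<rbrakk> \<Longrightarrow>
          star A (h \<triangleright> a) = star K (antipode K h) \<triangleright> star A a"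
    and act_unit: "h \<in> carrier K \<Longrightarrow> h \<triangleright> \<one>\<^bsub>A\<^esub> = eps_t K h \<triangleright> \<one>\<^bsub>A\<^esub>"
    and act_unit_eq_0: "h \<in> carrier K \<Longrightarrow> h \<triangleright> \<one>\<^bsub>A\<^esub> = \<zero>\<^bsub>A\<^esub> \<longleftrightarrow> eps_t K h = \<zero>\<^bsub>K\<^esub>"

locale left_cstar_action = left_action K A act
  for K :: "'k weak_kac" and A :: "'a star_alg" and N :: "'a \<Rightarrow> real"
    and act :: "'k \<Rightarrow> 'a \<Rightarrow> 'a" +
  assumes act_continuous: "h \<in> carrier K \<Longrightarrow>
            continuous_map (norm_topology A N) (norm_topology A N) (act h)"

definition crossed_null ::
  "'k weak_kac \<Rightarrow> 'a star_alg \<Rightarrow> ('k \<Rightarrow> 'a \<Rightarrow> 'a) \<Rightarrow> ('a \<times> 'k \<Rightarrow>\<^sub>0 complex) set" where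
  "crossed_null K A act = formal.span (bilinear_relations A K \<union>
     {basis (a \<otimes>\<^bsub>A\<^esub> act z \<one>\<^bsub>A\<^esub>) h - basis a (z \<otimes>\<^bsub>K\<^esub> h) | a z h.
        a \<in> carrier A \<and> z \<in> Cartan_t K \<and> h \<in> carrier K})"

definition crossed_space ::
  "'k weak_kac \<Rightarrow> 'a star_alg \<Rightarrow> ('k \<Rightarrow> 'a \<Rightarrow> 'a) \<Rightarrow> (complex, ('a, 'k) tensor) module" where
  "crossed_space K A act = formal_quotient (carrier A \<times> carrier K) (crossed_null K A act)"

definition crossed_class ::
  "'k weak_kac \<Rightarrow> 'a star_alg \<Rightarrow> ('k \<Rightarrow> 'a \<Rightarrow> 'a) \<Rightarrow> 'a \<Rightarrow> 'k \<Rightarrow> ('a, 'k) tensor" where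
  "crossed_class K A act a h = coset_of (crossed_null K A act) (basis a h)"

text \<open>In the involution the Sweedler factors \<open>h\<^sub>(\<^sub>1\<^sub>)\<close> and \<open>h\<^sub>(\<^sub>2\<^sub>)\<close> both enter conjugate-linearly, so
  that the inner \<^const>\<open>lift\<close> is conjugate-linear too.\<close>

definition crossed_product ::
  "'k weak_kac \<Rightarrow> 'a star_alg \<Rightarrow> ('k \<Rightarrow> 'a \<Rightarrow> 'a) \<Rightarrow> ('a, 'k) tensor star_alg" where
  "crossed_product K A act =
     (let X = crossed_space K A act; cl = crossed_class K A act in
      \<lparr>carrier = carrier X,
       mult = (\<lambda>s t. lift X (\<lambda>a h. lift X (\<lambda>b k.
          lift X (\<lambda>h1 h2. cl (a \<otimes>\<^bsub>A\<^esub> act h1 b) (h2 \<otimes>\<^bsub>K\<^esub> k)) (comult K h)) t) s),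
       one = cl \<one>\<^bsub>A\<^esub> \<one>\<^bsub>K\<^esub>,
       zero = zero X, add = add X, smult = smult X,
       star = lift (conj_space X) (\<lambda>a h. lift (conj_space X)
          (\<lambda>h1 h2. cl (act (star K h1) (star A a)) (star K h2)) (comult K h))\<rparr>)"

definition dual_action ::
  "'k weak_kac \<Rightarrow> 'a star_alg \<Rightarrow> ('k \<Rightarrow> 'a \<Rightarrow> 'a) \<Rightarrow>
     ('k \<Rightarrow> complex) \<Rightarrow> ('a, 'k) tensor \<Rightarrow> ('a, 'k) tensor" where
  "dual_action K A act \<phi> =
     (let X = crossed_space K A act in
      lift X (\<lambda>a h. lift X (\<lambda>h1 h2. \<phi> h2 \<odot>\<^bsub>X\<^esub> crossed_class K A act a h1) (comult K h)))"

end

(* Let E = (id (x) tau) Delta, a conditional expectation of K onto K_t. By the Markov condition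
   p_(1) and S(p_(2)) are, up to the factor lam, dual bases of K for the trace form. Comparing the
   traces of left and right multiplications on K with the dimensions of e K_t f, for minimal
   projections e and f of K_t, shows that n = 1/lam is an integer and that there are u_1, ..., u_n
   in K with E(u_i^* u_j) = delta_ij and k = sum_i u_i E(u_i^* k) for all k in K.

   Write Q_i(k) = (u_i^* )_(1) tau((u_i^* )_(2) k) and phi.k = k_(1) phi(k_(2)). The isomorphism sends
   [[b (x) h] (x) phi] to the matrix with entries Q_i(h (phi.u_j)) |> b, and its inverse sends
   a (x) e_ij to [[u_i(1) |> a (x) u_i(2) (u_j^* )_(1)] (x) tau((u_j^* )_(2) _)]. Multiplicativity,
   the *-property and the inverse all come down to the strong invariance of tau,
   x_(1) tau(x_(2) y) = S(y_(1)) tau(x y_(2)), and to the balancing identity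
   sum_i beta(u_i, Q_i(k)) = beta(k_(2), S(k_(1))) for K_t-balanced beta.

   Since linear functionals separate points, identities between vectors are proved by evaluating
   functionals; Sweedler expressions then become complex numbers sw h F, the value of the bilinear
   form F on Delta(h). *)

theory Submission
  imports Defs "Jordan_Normal_Form.Spectral_Radius"
begin

section \<open>Formal linear combinations and their quotients\<close>

text \<open>Every element of the double crossed product is a class under two balancing relations,
  over \<open>Cartan_t K\<close> and over its dual counterpart, so the burden of each formula is to
  respect both. The coefficients Q_i suit the first: for z in K_t they satisfy Q_i(k z) = S(z)
  Q_i(k) and Q_i(z k) = Q_i(k) S(z), and S(z) acts on A as right multiplication by z
  \<triangleright> 1.

  K is free over K_t for the following reason. Regard K as a right K_t-module with the K_t-valued
  inner product E(x^* y). For a projection f in K_t, dim K_t f = tau(f), while the dual bases from p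
  give dim K f = tau(f) / lam. Hence Gram-Schmidt with n vectors of each minimal type fills K
  exactly.

  That 1/lam is an integer is not visible from these dimensions, which only make it rational. Each
  module q K is a sum of modules e_i K_t with e_i minimal, so tau(q) = lam * (sum of the tau(e_i))
  with all traces natural numbers. Iterating this relation shows that every power of the denominator
  of 1/lam divides every tau(q), so the denominator is 1.\<close>

definition formal_eval :: "('x \<Rightarrow> complex) \<Rightarrow> ('x \<Rightarrow>\<^sub>0 complex) \<Rightarrow> complex" where
  "formal_eval F f = (\<Sum>x\<in>Poly_Mapping.keys f. Poly_Mapping.lookup f x * F x)"

lemma lookup_formal_scale [simp]:
  "Poly_Mapping.lookup (formal_scale c f) x = c * Poly_Mapping.lookup f x"
  by (simp add: formal_scale_def Poly_Mapping.map.rep_eq Poly_Mapping.when_def)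

lemma formal_eval_superset:
  assumes "finite S" "Poly_Mapping.keys f \<subseteq> S"
  shows "formal_eval F f = (\<Sum>x\<in>S. Poly_Mapping.lookup f x * F x)"
  unfolding formal_eval_def
  by (rule sum.mono_neutral_left) (use assms in \<open>auto simp: in_keys_iff\<close>)

lemma keys_formal_scale: "Poly_Mapping.keys (formal_scale c f) \<subseteq> Poly_Mapping.keys f"
  by (auto simp: in_keys_iff)

lemma keys_diff_subset: "Poly_Mapping.keys (f - g) \<subseteq> Poly_Mapping.keys f \<union> Poly_Mapping.keys g"
  for f g :: "'x \<Rightarrow>\<^sub>0 complex"
  by (auto simp: in_keys_iff lookup_minus)

lemma formal_eval_add: "formal_eval F (f + g) = formal_eval F f + formal_eval F g"
proof -
  let ?S = "Poly_Mapping.keys f \<union> Poly_Mapping.keys g"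
  have "formal_eval F (f + g) = (\<Sum>x\<in>?S. Poly_Mapping.lookup (f + g) x * F x)"
    by (rule formal_eval_superset) (use keys_add[of f g] in auto)
  also have "\<dots> = formal_eval F f + formal_eval F g"
    by (subst (1 2) formal_eval_superset[of ?S])
      (auto simp: lookup_add algebra_simps sum.distrib)
  finally show ?thesis .
qed

lemma formal_eval_scale: "formal_eval F (formal_scale c f) = c * formal_eval F f"
proof -
  have "formal_eval F (formal_scale c f) =
      (\<Sum>x\<in>Poly_Mapping.keys f. Poly_Mapping.lookup (formal_scale c f) x * F x)"
    by (rule formal_eval_superset) (use keys_formal_scale[of c f] in auto)
  then show ?thesis
    by (simp add: formal_eval_def sum_distrib_left mult.assoc)
qed

lemma formal_eval_diff: "formal_eval F (f - g) = formal_eval F f - formal_eval F g"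
  using formal_eval_add[of F "f - g" g] by simp

lemma formal_eval_zero [simp]: "formal_eval F 0 = 0"
  by (simp add: formal_eval_def)

lemma formal_eval_single [simp]: "formal_eval F (Poly_Mapping.single x c) = c * F x"
  by (cases "c = 0") (simp_all add: formal_eval_def)

lemmas formal_eval_simps = formal_eval_add formal_eval_diff formal_eval_scale

lemma formal_eval_cong:
  "(\<And>x. x \<in> Poly_Mapping.keys f \<Longrightarrow> F x = G x) \<Longrightarrow> formal_eval F f = formal_eval G f"
  by (simp add: formal_eval_def)

lemma formal_eval_span:
  assumes "\<And>u. u \<in> R \<Longrightarrow> formal_eval F u = 0" "f \<in> formal.span R"
  shows "formal_eval F f = 0"
  using assms(2) by (induction rule: formal.span_induct_alt)
    (simp_all add: assms(1) formal_eval_simps)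

lemma keys_span:
  assumes "\<And>u. u \<in> R \<Longrightarrow> Poly_Mapping.keys u \<subseteq> X" "f \<in> formal.span R"
  shows "Poly_Mapping.keys f \<subseteq> X"
  using assms(2)
proof (induction rule: formal.span_induct_alt)
  case (step c x y)
  then show ?case
    using keys_add[of "formal_scale c x" y] keys_formal_scale[of c x] assms(1)[of x] by blast
qed simp

lemma formal_expansion:
  "f = (\<Sum>x\<in>Poly_Mapping.keys f. formal_scale (Poly_Mapping.lookup f x) (Poly_Mapping.single x 1))"
  by (rule poly_mapping_eqI) (simp add: lookup_sum lookup_single Poly_Mapping.when_def
      if_distrib[of "(*) _"] sum.delta in_keys_iff cong: if_cong)

text \<open>A basis of \<open>U\<close> stays independent when \<open>v\<close> is added, so some
  linear functional is 0 on the basis and 1 at \<open>v\<close>. A linear functional on formal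
  combinations is determined by its values on the generators, hence it has the form
  \<open>formal_eval F\<close>.\<close>

lemma formal_separation:
  assumes U: "formal.subspace U" and v: "v \<notin> U"
  obtains F where "\<And>u. u \<in> U \<Longrightarrow> formal_eval F u = 0" "formal_eval F v \<noteq> 0"
proof -
  interpret cvs: vector_space "(*) :: complex \<Rightarrow> complex \<Rightarrow> complex"
    by unfold_locales (auto simp: algebra_simps)
  interpret pr: vector_space_pair "formal_scale :: complex \<Rightarrow> ('a \<Rightarrow>\<^sub>0 complex) \<Rightarrow> _"
      "(*) :: complex \<Rightarrow> complex \<Rightarrow> complex" ..
  obtain B where B: "B \<subseteq> U" "formal.independent B" "U \<subseteq> formal.span B"
    using formal.maximal_independent_subset[of U] by metis
  have "formal.span B \<subseteq> U"
    using B U by (simp add: formal.span_minimal)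
  then have ind: "formal.independent (insert v B)"
    using B v by (intro formal.independent_insertI) auto
  obtain g where g: "Vector_Spaces.linear formal_scale (*) g"
      "\<And>x. x \<in> insert v B \<Longrightarrow> g x = (if x = v then 1 else 0)"
    using pr.linear_independent_extend[OF ind, of "\<lambda>x. if x = v then 1 else 0"] by blast
  interpret g: Vector_Spaces.linear formal_scale "(*)" g by (rule g(1))
  have ev: "formal_eval (\<lambda>x. g (Poly_Mapping.single x 1)) f = g f" for f
    by (subst (2) formal_expansion) (simp add: formal_eval_def g.sum g.scale)
  have "g u = 0" if "u \<in> U" for u
  proof -
    have "g x = 0" if "x \<in> B" for x
      using g(2)[of x] that B(1) v by auto
    moreover have "u \<in> formal.span B"
      using B(3) that by blast
    ultimately show ?thesis
      using formal_eval_span[of B "\<lambda>x. g (Poly_Mapping.single x 1)" u] by (simp add: ev)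
  qed
  then show ?thesis
    using that[of "\<lambda>x. g (Poly_Mapping.single x 1)"] g(2)[of v] by (simp add: ev)
qed


subsection \<open>Complex vector spaces with carrier\<close>

abbreviation complex_space :: "(complex, 'v, 'm) module_scheme \<Rightarrow> bool" where
  "complex_space V \<equiv> Module.module CC V"

lemma cring_CC: "cring CC"
  by unfold_locales (auto simp: CC_def algebra_simps Units_def intro: exI[of _ "- _"])

lemma complex_spaceI:
  assumes "abelian_group V"
    and "\<And>a x. x \<in> carrier V \<Longrightarrow> a \<odot>\<^bsub>V\<^esub> x \<in> carrier V"
    and "\<And>a b x. x \<in> carrier V \<Longrightarrow> (a + b) \<odot>\<^bsub>V\<^esub> x = a \<odot>\<^bsub>V\<^esub> x \<oplus>\<^bsub>V\<^esub> b \<odot>\<^bsub>V\<^esub> x"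
    and "\<And>a x y. x \<in> carrier V \<Longrightarrow> y \<in> carrier V \<Longrightarrow> a \<odot>\<^bsub>V\<^esub> (x \<oplus>\<^bsub>V\<^esub> y) = a \<odot>\<^bsub>V\<^esub> x \<oplus>\<^bsub>V\<^esub> a \<odot>\<^bsub>V\<^esub> y"
    and "\<And>a b x. x \<in> carrier V \<Longrightarrow> (a * b) \<odot>\<^bsub>V\<^esub> x = a \<odot>\<^bsub>V\<^esub> (b \<odot>\<^bsub>V\<^esub> x)"
    and "\<And>x. x \<in> carrier V \<Longrightarrow> 1 \<odot>\<^bsub>V\<^esub> x = x"
  shows "complex_space V"
  by (rule moduleI[OF cring_CC]) (use assms in \<open>auto simp: CC_def\<close>)

lemma complex_spaceD:
  assumes "complex_space V"
  shows "abelian_group V"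
    and "\<And>a x. x \<in> carrier V \<Longrightarrow> a \<odot>\<^bsub>V\<^esub> x \<in> carrier V"
    and "\<And>a b x. x \<in> carrier V \<Longrightarrow> (a + b) \<odot>\<^bsub>V\<^esub> x = a \<odot>\<^bsub>V\<^esub> x \<oplus>\<^bsub>V\<^esub> b \<odot>\<^bsub>V\<^esub> x"
    and "\<And>a x y. x \<in> carrier V \<Longrightarrow> y \<in> carrier V \<Longrightarrow> a \<odot>\<^bsub>V\<^esub> (x \<oplus>\<^bsub>V\<^esub> y) = a \<odot>\<^bsub>V\<^esub> x \<oplus>\<^bsub>V\<^esub> a \<odot>\<^bsub>V\<^esub> y"
    and "\<And>a b x. x \<in> carrier V \<Longrightarrow> (a * b) \<odot>\<^bsub>V\<^esub> x = a \<odot>\<^bsub>V\<^esub> (b \<odot>\<^bsub>V\<^esub> x)"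
    and "\<And>x. x \<in> carrier V \<Longrightarrow> 1 \<odot>\<^bsub>V\<^esub> x = x"
    and "\<And>x. x \<in> carrier V \<Longrightarrow> 0 \<odot>\<^bsub>V\<^esub> x = \<zero>\<^bsub>V\<^esub>"
    and "\<And>x. x \<in> carrier V \<Longrightarrow> (- 1) \<odot>\<^bsub>V\<^esub> x = \<ominus>\<^bsub>V\<^esub> x"
    and "\<And>x y. x \<in> carrier V \<Longrightarrow> y \<in> carrier V \<Longrightarrow> x \<oplus>\<^bsub>V\<^esub> y \<in> carrier V"
    and "\<zero>\<^bsub>V\<^esub> \<in> carrier V"
proof -
  interpret module CC V by (rule assms)
  have CCc: "carrier CC = UNIV" "zero CC = 0" "one CC = 1" "add CC = (+)" "mult CC = (*)"
    by (simp_all add: CC_def)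
  have mone: "\<ominus>\<^bsub>CC\<^esub> 1 = (- 1 :: complex)"
  proof -
    have "a_inv CC 1 = a_inv CC 1 + (1 + -1)" by simp
    also have "\<dots> = (a_inv CC 1 + 1) + -1" by (simp only: add.assoc)
    also have "a_inv CC 1 + 1 = 0"
      using R.l_neg[of 1] by (simp add: CCc)
    finally show ?thesis by simp
  qed
  show "abelian_group V" ..
  show "\<And>a x. x \<in> carrier V \<Longrightarrow> a \<odot>\<^bsub>V\<^esub> x \<in> carrier V"
    by (simp add: CCc)
  show "\<And>a b x. x \<in> carrier V \<Longrightarrow> (a + b) \<odot>\<^bsub>V\<^esub> x = a \<odot>\<^bsub>V\<^esub> x \<oplus>\<^bsub>V\<^esub> b \<odot>\<^bsub>V\<^esub> x"
    using smult_l_distr by (simp add: CCc)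
  show "\<And>a x y. x \<in> carrier V \<Longrightarrow> y \<in> carrier V \<Longrightarrow> a \<odot>\<^bsub>V\<^esub> (x \<oplus>\<^bsub>V\<^esub> y) = a \<odot>\<^bsub>V\<^esub> x \<oplus>\<^bsub>V\<^esub> a \<odot>\<^bsub>V\<^esub> y"
    using smult_r_distr by (simp add: CCc)
  show "\<And>a b x. x \<in> carrier V \<Longrightarrow> (a * b) \<odot>\<^bsub>V\<^esub> x = a \<odot>\<^bsub>V\<^esub> (b \<odot>\<^bsub>V\<^esub> x)"
    using smult_assoc1 by (simp add: CCc)
  show "\<And>x. x \<in> carrier V \<Longrightarrow> 1 \<odot>\<^bsub>V\<^esub> x = x"
    using smult_one by (simp add: CCc)
  show "\<And>x. x \<in> carrier V \<Longrightarrow> 0 \<odot>\<^bsub>V\<^esub> x = \<zero>\<^bsub>V\<^esub>"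
    using smult_l_null by (simp add: CCc)
  show "\<And>x y. x \<in> carrier V \<Longrightarrow> y \<in> carrier V \<Longrightarrow> x \<oplus>\<^bsub>V\<^esub> y \<in> carrier V" "\<zero>\<^bsub>V\<^esub> \<in> carrier V"
    by (rule M.add.m_closed M.zero_closed; assumption)+
  show "\<And>x. x \<in> carrier V \<Longrightarrow> (- 1) \<odot>\<^bsub>V\<^esub> x = \<ominus>\<^bsub>V\<^esub> x"
    using smult_l_minus[of 1] smult_one by (simp add: CCc mone)
qed

lemma complex_space_CC: "complex_space CC"
proof (rule complex_spaceI)
  show "abelian_group CC"
    using cring_CC by (simp add: cring_def ring_def)
qed (simp_all add: CC_def algebra_simps)

lemma CC_simps [simp]:
  "carrier CC = UNIV" "zero CC = 0" "one CC = 1" "x \<oplus>\<^bsub>CC\<^esub> y = x + y" "x \<otimes>\<^bsub>CC\<^esub> y = x * y"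
  "c \<odot>\<^bsub>CC\<^esub> x = c * x" "star CC x = cnj x"
  by (simp_all add: CC_def)

lemma linear_betweenI:
  assumes "\<And>x. x \<in> carrier V \<Longrightarrow> f x \<in> carrier W"
    and "\<And>x y. x \<in> carrier V \<Longrightarrow> y \<in> carrier V \<Longrightarrow> f (x \<oplus>\<^bsub>V\<^esub> y) = f x \<oplus>\<^bsub>W\<^esub> f y"
    and "\<And>c x. x \<in> carrier V \<Longrightarrow> f (c \<odot>\<^bsub>V\<^esub> x) = c \<odot>\<^bsub>W\<^esub> f x"
  shows "linear_between V W f"
  using assms by (auto simp: linear_between_def)

lemma linear_betweenD:
  assumes "linear_between V W f"
  shows "\<And>x. x \<in> carrier V \<Longrightarrow> f x \<in> carrier W"
    and "\<And>x y. x \<in> carrier V \<Longrightarrow> y \<in> carrier V \<Longrightarrow> f (x \<oplus>\<^bsub>V\<^esub> y) = f x \<oplus>\<^bsub>W\<^esub> f y"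
    and "\<And>c x. x \<in> carrier V \<Longrightarrow> f (c \<odot>\<^bsub>V\<^esub> x) = c \<odot>\<^bsub>W\<^esub> f x"
  using assms by (auto simp: linear_between_def)

lemma linear_between_zero:
  assumes "linear_between V W f" "complex_space V" "complex_space W"
  shows "f \<zero>\<^bsub>V\<^esub> = \<zero>\<^bsub>W\<^esub>"
  using linear_betweenD(3)[OF assms(1), of "\<zero>\<^bsub>V\<^esub>" 0] linear_betweenD(1)[OF assms(1), of "\<zero>\<^bsub>V\<^esub>"]
  by (simp add: complex_spaceD[OF assms(2)] complex_spaceD[OF assms(3)])

lemma linear_between_finsum:
  assumes f: "linear_between V W f" and V: "complex_space V" and W: "complex_space W"
    and "finite I" "\<And>i. i \<in> I \<Longrightarrow> g i \<in> carrier V"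
  shows "f (finsum V g I) = finsum W (\<lambda>i. f (g i)) I"
proof -
  interpret V: abelian_group V using complex_spaceD(1)[OF V] .
  interpret W: abelian_group W using complex_spaceD(1)[OF W] .
  show ?thesis
    using assms(4,5)
  proof (induction I)
    case empty
    then show ?case by (simp add: linear_between_zero[OF f V W])
  next
    case (insert i I)
    then have "f (finsum V g (insert i I)) = f (g i \<oplus>\<^bsub>V\<^esub> finsum V g I)"
      by (subst V.finsum_insert) auto
    also have "\<dots> = f (g i) \<oplus>\<^bsub>W\<^esub> f (finsum V g I)"
      by (rule linear_betweenD(2)[OF f]) (use insert in auto)
    also have "\<dots> = finsum W (\<lambda>i. f (g i)) (insert i I)"
      using insert by (subst W.finsum_insert) (auto intro: linear_betweenD(1)[OF f])
    finally show ?case .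
  qed
qed

lemma finsum_CC: "finite I \<Longrightarrow> finsum CC g I = sum g I"
proof (induction I rule: finite_induct)
  interpret abelian_group CC using complex_spaceD(1)[OF complex_space_CC] .
  {
    case empty
    show ?case by simp
  next
    case (insert i I)
    then show ?case by (subst finsum_insert) auto
  }
qed

lemma linear_functional_finsum:
  assumes "linear_between V CC f" "complex_space V" "finite I" "\<And>i. i \<in> I \<Longrightarrow> g i \<in> carrier V"
  shows "f (finsum V g I) = (\<Sum>i\<in>I. f (g i))"
  using linear_between_finsum[OF assms(1,2) complex_space_CC assms(3,4)] assms(3)
  by (simp add: finsum_CC)

text \<open>\<open>V\<close> is the quotient of the formal combinations of its own elements by the
  kernel \<open>U\<close> of the evaluation \<open>ev\<close>. A functional that kills
  \<open>U\<close> but not the formal difference of \<open>x\<close> and \<open>y\<close> is given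
  by a function \<open>F\<close> on elements, and \<open>F\<close> is linear because the formal
  relations for sums and multiples lie in \<open>U\<close>.\<close>

lemma linear_functional_separation:
  assumes V: "complex_space V" and x: "x \<in> carrier V" and y: "y \<in> carrier V"
    and eq: "\<And>f. linear_between V CC f \<Longrightarrow> f x = f y"
  shows "x = y"
proof -
  interpret V: abelian_group V using complex_spaceD(1)[OF V] .
  note Vs = complex_spaceD[OF V]
  define ev where "ev u = (\<Oplus>\<^bsub>V\<^esub>x\<in>Poly_Mapping.keys u. Poly_Mapping.lookup u x \<odot>\<^bsub>V\<^esub> x)" for u
  have ev_sup: "ev u = (\<Oplus>\<^bsub>V\<^esub>x\<in>S. Poly_Mapping.lookup u x \<odot>\<^bsub>V\<^esub> x)"
    if "finite S" "Poly_Mapping.keys u \<subseteq> S" "S \<subseteq> carrier V" for u S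
    unfolding ev_def
    by (rule V.add.finprod_mono_neutral_cong_left)
      (use that in \<open>auto simp: in_keys_iff Vs subset_iff\<close>)
  have ev_closed: "ev u \<in> carrier V" if "Poly_Mapping.keys u \<subseteq> carrier V" for u
    unfolding ev_def using that by (intro V.finsum_closed) (auto simp: Vs)
  have ev_add: "ev (u + v) = ev u \<oplus>\<^bsub>V\<^esub> ev v"
    if "Poly_Mapping.keys u \<subseteq> carrier V" "Poly_Mapping.keys v \<subseteq> carrier V" for u v
  proof -
    let ?S = "Poly_Mapping.keys u \<union> Poly_Mapping.keys v"
    have S: "finite ?S" "?S \<subseteq> carrier V" using that by auto
    have "ev (u + v) = (\<Oplus>\<^bsub>V\<^esub>x\<in>?S. Poly_Mapping.lookup u x \<odot>\<^bsub>V\<^esub> x \<oplus>\<^bsub>V\<^esub> Poly_Mapping.lookup v x \<odot>\<^bsub>V\<^esub> x)"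
    proof -
      have "ev (u + v) = (\<Oplus>\<^bsub>V\<^esub>x\<in>?S. Poly_Mapping.lookup (u + v) x \<odot>\<^bsub>V\<^esub> x)"
        using S keys_add[of u v] by (intro ev_sup) auto
      also have "\<dots> = (\<Oplus>\<^bsub>V\<^esub>x\<in>?S. Poly_Mapping.lookup u x \<odot>\<^bsub>V\<^esub> x \<oplus>\<^bsub>V\<^esub> Poly_Mapping.lookup v x \<odot>\<^bsub>V\<^esub> x)"
        by (rule V.finsum_cong') (use S in \<open>auto simp: lookup_add Vs subset_iff\<close>)
      finally show ?thesis .
    qed
    also have "\<dots> = ev u \<oplus>\<^bsub>V\<^esub> ev v"
      using S that by (subst V.finsum_addf) (auto simp: Vs subset_iff ev_sup[of ?S])
    finally show ?thesis .
  qed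
  have ev_scale: "ev (formal_scale c u) = c \<odot>\<^bsub>V\<^esub> ev u" if u: "Poly_Mapping.keys u \<subseteq> carrier V" for c u
  proof -
    have "linear_between V V (\<lambda>x. c \<odot>\<^bsub>V\<^esub> x)"
      by (rule linear_betweenI) (simp_all add: Vs mult.commute flip: Vs(5))
    from linear_between_finsum[OF this V V, of "Poly_Mapping.keys u"] show ?thesis
      using u keys_formal_scale[of c u]
      by (subst ev_sup[of "Poly_Mapping.keys u"])
        (auto simp: ev_def Vs subset_iff intro!: V.finsum_cong')
  qed
  have ev_single: "ev (Poly_Mapping.single x c) = c \<odot>\<^bsub>V\<^esub> x" if "x \<in> carrier V" for x c
    using that by (cases "c = 0") (simp_all add: ev_def Vs)
  define U where "U = {u. Poly_Mapping.keys u \<subseteq> carrier V \<and> ev u = \<zero>\<^bsub>V\<^esub>}"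
  have subU: "formal.subspace U"
  proof (rule formal.subspaceI)
    show "0 \<in> U" by (simp add: U_def ev_def)
    show "u + v \<in> U" if "u \<in> U" "v \<in> U" for u v
      using that keys_add[of u v] by (auto simp: U_def ev_add)
    show "formal_scale c u \<in> U" if "u \<in> U" for c u
      using that keys_formal_scale[of c u] Vs(5)[of "\<zero>\<^bsub>V\<^esub>" c 0]
      by (auto simp: U_def ev_scale Vs)
  qed
  show ?thesis
  proof (rule ccontr)
    assume "x \<noteq> y"
    let ?s = "\<lambda>x. Poly_Mapping.single x (1::complex)"
    have "?s x - ?s y \<notin> U"
    proof
      assume U: "?s x - ?s y \<in> U"
      have "ev (?s x) = ev (?s x - ?s y) \<oplus>\<^bsub>V\<^esub> ev (?s y)"
        using ev_add[of "?s x - ?s y" "?s y"] U y by (simp add: U_def)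
      then show False
        using U x y \<open>x \<noteq> y\<close> by (simp add: U_def ev_single Vs)
    qed
    then obtain F where F: "\<And>u. u \<in> U \<Longrightarrow> formal_eval F u = 0" "formal_eval F (?s x - ?s y) \<noteq> 0"
      using formal_separation[OF subU] by metis
    have "linear_between V CC F"
    proof (rule linear_betweenI)
      fix a b assume ab: "a \<in> carrier V" "b \<in> carrier V"
      have k: "Poly_Mapping.keys (?s a + ?s b) \<subseteq> carrier V"
        using keys_add[of "?s a" "?s b"] ab by (auto split: if_splits)
      have k2: "Poly_Mapping.keys (?s (a \<oplus>\<^bsub>V\<^esub> b) - (?s a + ?s b)) \<subseteq> carrier V"
        using keys_diff_subset[of "?s (a \<oplus>\<^bsub>V\<^esub> b)" "?s a + ?s b"] k ab
        by (auto split: if_splits)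
      have "ev (?s (a \<oplus>\<^bsub>V\<^esub> b)) = ev (?s (a \<oplus>\<^bsub>V\<^esub> b) - (?s a + ?s b)) \<oplus>\<^bsub>V\<^esub> ev (?s a + ?s b)"
        using ev_add[OF k2 k] by simp
      moreover have "ev (?s (a \<oplus>\<^bsub>V\<^esub> b)) = a \<oplus>\<^bsub>V\<^esub> b" "ev (?s a + ?s b) = a \<oplus>\<^bsub>V\<^esub> b"
        using ab by (simp_all add: ev_add ev_single Vs)
      ultimately have "ev (?s (a \<oplus>\<^bsub>V\<^esub> b) - (?s a + ?s b)) = \<zero>\<^bsub>V\<^esub>"
        using ab ev_closed[OF k2] V.add.r_cancel_one' by (metis V.add.m_closed)
      then have "?s (a \<oplus>\<^bsub>V\<^esub> b) - (?s a + ?s b) \<in> U"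
        using k2 by (simp add: U_def)
      from F(1)[OF this] show "F (a \<oplus>\<^bsub>V\<^esub> b) = F a \<oplus>\<^bsub>CC\<^esub> F b"
        by (simp add: formal_eval_simps)
    next
      fix c a assume a: "a \<in> carrier V"
      let ?t = "formal_scale (-c) (?s a)"
      have k1: "Poly_Mapping.keys ?t \<subseteq> carrier V"
        using keys_formal_scale[of "-c" "?s a"] a by auto
      have k2: "Poly_Mapping.keys (?s (c \<odot>\<^bsub>V\<^esub> a) + ?t) \<subseteq> carrier V"
        using keys_add[of "?s (c \<odot>\<^bsub>V\<^esub> a)" ?t] k1 a by (auto simp: Vs)
      have "ev (?s (c \<odot>\<^bsub>V\<^esub> a) + ?t) = c \<odot>\<^bsub>V\<^esub> a \<oplus>\<^bsub>V\<^esub> (- c) \<odot>\<^bsub>V\<^esub> a"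
      proof -
        have "ev (?s (c \<odot>\<^bsub>V\<^esub> a) + ?t) = ev (?s (c \<odot>\<^bsub>V\<^esub> a)) \<oplus>\<^bsub>V\<^esub> ev ?t"
          by (rule ev_add[OF _ k1]) (use a in \<open>simp add: Vs\<close>)
        moreover have "ev ?t = (- c) \<odot>\<^bsub>V\<^esub> ev (?s a)"
          by (rule ev_scale) (use a in simp)
        ultimately show ?thesis
          using a by (simp only: ev_single Vs)
      qed
      also have "\<dots> = \<zero>\<^bsub>V\<^esub>"
        using Vs(3)[OF a, of c "-c"] a by (simp add: Vs)
      finally have "?s (c \<odot>\<^bsub>V\<^esub> a) + ?t \<in> U"
        using k2 by (simp add: U_def)
      from F(1)[OF this] show "F (c \<odot>\<^bsub>V\<^esub> a) = c \<odot>\<^bsub>CC\<^esub> F a"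
        by (simp add: formal_eval_simps)
    qed simp
    then show False
      using eq[of F] F(2) by (simp add: formal_eval_simps)
  qed
qed

lemma complex_space_conj_space:
  assumes "complex_space V"
  shows "complex_space (conj_space V)"
proof (rule complex_spaceI)
  note V = complex_spaceD[OF assms]
  interpret V: abelian_group V by (rule V(1))
  show "abelian_group (conj_space V)"
    by (rule abelian_groupI)
      (use V.l_neg in \<open>auto simp: conj_space_def V.a_ac intro!: bexI[of _ "\<ominus>\<^bsub>V\<^esub> _"]\<close>)
qed (simp_all add: conj_space_def complex_spaceD[OF assms])

subsection \<open>Evaluating tensors on bilinear functions\<close>

text \<open>The same representative is taken as in \<open>lift\<close>, so a functional applied to a
  \<open>lift\<close> becomes a \<open>tensor_eval\<close> term by term. Whether \<open>F\<close>
  respects the relations matters once the representative changes.\<close>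

definition tensor_eval :: "('a, 'b) tensor \<Rightarrow> ('a \<Rightarrow> 'b \<Rightarrow> complex) \<Rightarrow> complex" where
  "tensor_eval t F = formal_eval (\<lambda>p. F (fst p) (snd p)) (SOME f. f \<in> t)"

lemma tensor_eval_add: "tensor_eval t (\<lambda>x y. F x y + G x y) = tensor_eval t F + tensor_eval t G"
  and tensor_eval_cmult: "tensor_eval t (\<lambda>x y. c * F x y) = c * tensor_eval t F"
  and tensor_eval_multc: "tensor_eval t (\<lambda>x y. F x y * c) = tensor_eval t F * c"
  and tensor_eval_zero: "tensor_eval t (\<lambda>x y. 0) = 0"
  by (simp_all add: tensor_eval_def formal_eval_def sum_distrib_left sum_distrib_right
      sum.distrib sum_subtractf algebra_simps)

lemma tensor_eval_sum: "tensor_eval t (\<lambda>x y. \<Sum>i\<in>I. F i x y) = (\<Sum>i\<in>I. tensor_eval t (F i))"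
  unfolding tensor_eval_def formal_eval_def sum_distrib_left by (rule sum.swap)

lemma tensor_eval_swap:
  "tensor_eval s (\<lambda>a b. tensor_eval t (\<lambda>c d. F a b c d)) =
   tensor_eval t (\<lambda>c d. tensor_eval s (\<lambda>a b. F a b c d))"
  unfolding tensor_eval_def formal_eval_def sum_distrib_left
  by (subst sum.swap) (simp add: algebra_simps)

text \<open>The condition for \<open>F\<close> to descend to the quotient by \<open>U\<close>:
  bilinearity for a tensor product, bilinearity and balancing for a crossed product.\<close>

definition vanishes_on :: "('a \<times> 'b \<Rightarrow>\<^sub>0 complex) set \<Rightarrow> ('a \<Rightarrow> 'b \<Rightarrow> complex) \<Rightarrow> bool" where
  "vanishes_on U F \<longleftrightarrow> (\<forall>u\<in>U. formal_eval (\<lambda>p. F (fst p) (snd p)) u = 0)"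

lemma vanishes_on_span: "vanishes_on (formal.span R) F \<longleftrightarrow> vanishes_on R F"
  unfolding vanishes_on_def using formal_eval_span[of R] formal.span_base by blast

text \<open>Covers the plain tensor product as well as the balanced one underlying a crossed
  product. \<open>keys_U\<close> ensures that the representative picked by \<open>SOME\<close> is
  again supported in \<open>X\<close>.\<close>

locale formal_quotient_space =
  fixes X :: "('a \<times> 'b) set" and U :: "('a \<times> 'b \<Rightarrow>\<^sub>0 complex) set"
  assumes subspace_U: "formal.subspace U"
    and keys_U: "u \<in> U \<Longrightarrow> Poly_Mapping.keys u \<subseteq> X"
begin

abbreviation Q where "Q \<equiv> formal_quotient X U"

lemma U_closed: "0 \<in> U" "u \<in> U \<Longrightarrow> v \<in> U \<Longrightarrow> u + v \<in> U" "u \<in> U \<Longrightarrow> formal_scale c u \<in> U"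
  "u \<in> U \<Longrightarrow> v \<in> U \<Longrightarrow> u - v \<in> U"
  using subspace_U by (auto intro: formal.subspace_0 formal.subspace_add formal.subspace_scale
      formal.subspace_diff)

lemma mem_coset: "g \<in> coset_of U f \<longleftrightarrow> g - f \<in> U"
  by (simp add: coset_of_def)

lemma coset_eq_iff: "coset_of U f = coset_of U g \<longleftrightarrow> f - g \<in> U"
proof
  assume "coset_of U f = coset_of U g"
  moreover have "f \<in> coset_of U f" by (simp add: coset_of_def U_closed)
  ultimately show "f - g \<in> U" by (simp add: coset_of_def)
next
  assume *: "f - g \<in> U"
  have "h - f \<in> U \<longleftrightarrow> h - g \<in> U" for h
    using U_closed(2)[OF _ *, of "h - f"] U_closed(4)[OF _ *, of "h - g"] by auto
  then show "coset_of U f = coset_of U g" by (auto simp: coset_of_def)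
qed

lemma coset_self: "f \<in> coset_of U f"
  by (simp add: coset_of_def U_closed)

lemma add_coset: "coset_of U f \<oplus>\<^bsub>Q\<^esub> coset_of U g = coset_of U (f + g)"
proof -
  have "coset_of U (f' + g') = coset_of U (f + g)"
    if "f' \<in> coset_of U f" "g' \<in> coset_of U g" for f' g'
  proof -
    have "(f' + g') - (f + g) = (f' - f) + (g' - g)" by simp
    then show ?thesis
      using U_closed(2)[of "f' - f" "g' - g"] that unfolding coset_eq_iff mem_coset by metis
  qed
  moreover have "coset_of U f \<noteq> {}" "coset_of U g \<noteq> {}"
    using coset_self by blast+
  ultimately show ?thesis
    by (auto simp only: formal_quotient_def partial_object.simps ring.simps module.simps intro!: SUP_eq_const)
qed

lemma smult_coset: "c \<odot>\<^bsub>Q\<^esub> coset_of U f = coset_of U (formal_scale c f)"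
proof -
  have "coset_of U (formal_scale c f') = coset_of U (formal_scale c f)"
    if "f' \<in> coset_of U f" for f'
    using U_closed(3)[of "f' - f" c] that unfolding coset_eq_iff mem_coset
    by (simp add: formal.scale_right_diff_distrib)
  moreover have "coset_of U f \<noteq> {}"
    using coset_self by blast
  ultimately show ?thesis
    by (auto simp only: formal_quotient_def partial_object.simps ring.simps module.simps intro!: SUP_eq_const)
qed

lemma carrier_Q: "carrier Q = coset_of U ` {f. Poly_Mapping.keys f \<subseteq> X}"
  and zero_Q: "\<zero>\<^bsub>Q\<^esub> = coset_of U 0"
  by (simp_all add: formal_quotient_def)

lemma coset_closed: "Poly_Mapping.keys f \<subseteq> X \<Longrightarrow> coset_of U f \<in> carrier Q"
  by (auto simp: carrier_Q)

lemma rep: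
  assumes "t \<in> carrier Q"
  shows "(SOME f. f \<in> t) \<in> t" "Poly_Mapping.keys (SOME f. f \<in> t) \<subseteq> X" "coset_of U (SOME f. f \<in> t) = t"
proof -
  obtain f where f: "t = coset_of U f" "Poly_Mapping.keys f \<subseteq> X"
    using assms by (auto simp: carrier_Q)
  show g: "(SOME f. f \<in> t) \<in> t"
    by (rule someI[of "\<lambda>f. f \<in> t" f]) (simp add: f coset_self)
  let ?g = "SOME f. f \<in> t"
  have gf: "?g - f \<in> U" using g f by (simp add: coset_of_def)
  then show "coset_of U ?g = t"
    using f(1) by (metis coset_eq_iff)
  show "Poly_Mapping.keys ?g \<subseteq> X"
    using keys_U[OF gf] keys_add[of "?g - f" f] f(2) by auto
qed

lemma keys_add_subset: "Poly_Mapping.keys f \<subseteq> X \<Longrightarrow> Poly_Mapping.keys g \<subseteq> X \<Longrightarrow> Poly_Mapping.keys (f + g) \<subseteq> X"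
  for f g :: "'a \<times> 'b \<Rightarrow>\<^sub>0 complex"
  using keys_add[of f g] by blast

lemma keys_scale_subset: "Poly_Mapping.keys f \<subseteq> X \<Longrightarrow> Poly_Mapping.keys (formal_scale c f) \<subseteq> X"
  using keys_formal_scale[of c f] by blast

lemma complex_space_Q: "complex_space Q"
proof (rule complex_spaceI)
  note cs = add_coset smult_coset zero_Q
  show "abelian_group Q"
  proof (rule abelian_groupI)
    fix x assume "x \<in> carrier Q"
    then obtain f where f: "x = coset_of U f" "Poly_Mapping.keys f \<subseteq> X" by (auto simp: carrier_Q)
    show "\<exists>y\<in>carrier Q. y \<oplus>\<^bsub>Q\<^esub> x = \<zero>\<^bsub>Q\<^esub>"
    proof (rule bexI[of _ "coset_of U (formal_scale (-1) f)"])
      show "coset_of U (formal_scale (- 1) f) \<oplus>\<^bsub>Q\<^esub> x = \<zero>\<^bsub>Q\<^esub>"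
        by (simp add: f cs)
      show "coset_of U (formal_scale (- 1) f) \<in> carrier Q"
        using keys_scale_subset[OF f(2)] by (intro coset_closed)
    qed
  qed (auto simp: carrier_Q cs algebra_simps keys_add_subset intro!: imageI)
qed (auto simp: carrier_Q add_coset smult_coset zero_Q algebra_simps formal.scale_right_distrib
    formal.scale_left_distrib keys_scale_subset intro!: imageI)

lemma tensor_eval_coset:
  assumes "vanishes_on U F"
  shows "tensor_eval (coset_of U f) F = formal_eval (\<lambda>p. F (fst p) (snd p)) f"
proof -
  let ?g = "SOME g. g \<in> coset_of U f"
  have "?g \<in> coset_of U f"
    by (rule someI[of "\<lambda>g. g \<in> coset_of U f" f]) (rule coset_self)
  then have "formal_eval (\<lambda>p. F (fst p) (snd p)) (?g - f) = 0"
    using assms by (simp add: coset_of_def vanishes_on_def)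
  then show ?thesis
    by (simp add: tensor_eval_def formal_eval_diff)
qed

lemma tensor_eval_linear:
  assumes "vanishes_on U F"
  shows "linear_between Q CC (\<lambda>t. tensor_eval t F)"
  by (rule linear_betweenI)
    (auto simp: carrier_Q add_coset smult_coset tensor_eval_coset[OF assms] formal_eval_simps)

lemma tensor_eval_cong:
  assumes "t \<in> carrier Q" "\<And>x y. (x, y) \<in> X \<Longrightarrow> F x y = G x y"
  shows "tensor_eval t F = tensor_eval t G"
  unfolding tensor_eval_def
  by (rule formal_eval_cong) (use rep(2)[OF assms(1)] assms(2) in auto)

lemma linear_tensor_eval_on:
  assumes t: "t \<in> carrier Q" and H: "\<And>x y. (x, y) \<in> X \<Longrightarrow> linear_between V CC (\<lambda>v. H v x y)"
  shows "linear_between V CC (\<lambda>v. tensor_eval t (H v))"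
proof (rule linear_betweenI)
  fix v w assume "v \<in> carrier V" "w \<in> carrier V"
  then have "tensor_eval t (H (v \<oplus>\<^bsub>V\<^esub> w)) = tensor_eval t (\<lambda>x y. H v x y + H w x y)"
    by (intro tensor_eval_cong[OF t]) (simp add: linear_betweenD[OF H])
  then show "tensor_eval t (H (v \<oplus>\<^bsub>V\<^esub> w)) = tensor_eval t (H v) \<oplus>\<^bsub>CC\<^esub> tensor_eval t (H w)"
    by (simp add: tensor_eval_add)
next
  fix c v assume "v \<in> carrier V"
  then have "tensor_eval t (H (c \<odot>\<^bsub>V\<^esub> v)) = tensor_eval t (\<lambda>x y. c * H v x y)"
    by (intro tensor_eval_cong[OF t]) (simp add: linear_betweenD[OF H])
  then show "tensor_eval t (H (c \<odot>\<^bsub>V\<^esub> v)) = c \<odot>\<^bsub>CC\<^esub> tensor_eval t (H v)"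
    by (simp add: tensor_eval_cmult)
qed simp

text \<open>Representatives of different cosets differ by a formal combination outside
  \<open>U\<close>, which \<open>formal_separation\<close> detects. Identities between tensors thus
  become identities between numbers.\<close>

lemma tensor_eqI:
  assumes s: "s \<in> carrier Q" and t: "t \<in> carrier Q"
    and eq: "\<And>F. vanishes_on U F \<Longrightarrow> tensor_eval s F = tensor_eval t F"
  shows "s = t"
proof (rule ccontr)
  obtain f g where fg: "s = coset_of U f" "t = coset_of U g"
    using s t by (auto simp: carrier_Q)
  assume "s \<noteq> t"
  then have "f - g \<notin> U" by (simp add: fg coset_eq_iff)
  then obtain F where F: "\<And>u. u \<in> U \<Longrightarrow> formal_eval F u = 0" "formal_eval F (f - g) \<noteq> 0"
    using formal_separation[OF subspace_U] by metis
  have "vanishes_on U (\<lambda>x y. F (x, y))"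
    using F(1) by (simp add: vanishes_on_def)
  from eq[OF this] F(2) show False
    by (simp add: fg tensor_eval_coset[OF \<open>vanishes_on U (\<lambda>x y. F (x, y))\<close>] formal_eval_diff)
qed

text \<open>The converse of \<open>tensor_eval_linear\<close>: expand the representative into
  generators and use that \<open>coset_of U\<close> is linear. An arbitrary functional on a quotient
  can therefore be handled as a form on generators.\<close>

lemma linear_functional_vanishes:
  assumes "linear_between Q CC \<Theta>"
  shows "vanishes_on U (\<lambda>x y. \<Theta> (coset_of U (basis x y)))"
    and "t \<in> carrier Q \<Longrightarrow> \<Theta> t = tensor_eval t (\<lambda>x y. \<Theta> (coset_of U (basis x y)))"
proof -
  have ev: "formal_eval (\<lambda>p. \<Theta> (coset_of U (basis (fst p) (snd p)))) f = \<Theta> (coset_of U f)"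
    if f: "Poly_Mapping.keys f \<subseteq> X" for f
  proof -
    have "\<Theta> (coset_of U (\<Sum>p\<in>S. formal_scale (c p) (Poly_Mapping.single p 1))) =
        (\<Sum>p\<in>S. c p * \<Theta> (coset_of U (Poly_Mapping.single p 1)))" if "finite S" "S \<subseteq> X" for S c
      using that
    proof (induction S)
      case empty
      then show ?case
        using linear_between_zero[OF assms complex_space_Q complex_space_CC] by (simp add: zero_Q)
    next
      case (insert p S)
      let ?s = "formal_scale (c p) (Poly_Mapping.single p 1)"
      let ?r = "\<Sum>p\<in>S. formal_scale (c p) (Poly_Mapping.single p 1)"
      have k: "Poly_Mapping.keys (Poly_Mapping.single p (1::complex)) \<subseteq> X"
          "Poly_Mapping.keys ?s \<subseteq> X"
        using insert.prems keys_formal_scale[of "c p" "Poly_Mapping.single p 1"] by auto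
      have "Poly_Mapping.keys ?r \<subseteq> (\<Union>p\<in>S. Poly_Mapping.keys (formal_scale (c p) (Poly_Mapping.single p 1)))"
        by (rule keys_sum)
      also have "\<dots> \<subseteq> S"
        using keys_formal_scale by (fastforce simp: in_keys_iff lookup_single Poly_Mapping.when_def split: if_splits)
      finally have "Poly_Mapping.keys ?r \<subseteq> X" using insert.prems by auto
      then have "\<Theta> (coset_of U ?s \<oplus>\<^bsub>Q\<^esub> coset_of U ?r) = \<Theta> (coset_of U ?s) + \<Theta> (coset_of U ?r)"
        using linear_betweenD(2)[OF assms] k by (simp add: coset_closed)
      moreover have "\<Theta> (coset_of U ?s) = c p * \<Theta> (coset_of U (Poly_Mapping.single p 1))"
        using linear_betweenD(3)[OF assms coset_closed[OF k(1)], of "c p"] by (simp add: smult_coset)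
      ultimately show ?case
        using insert by (simp add: add_coset)
    qed
    from this[of "Poly_Mapping.keys f" "Poly_Mapping.lookup f"] show ?thesis
      using f by (simp add: formal_eval_def flip: formal_expansion)
  qed
  show v: "vanishes_on U (\<lambda>x y. \<Theta> (coset_of U (basis x y)))"
    unfolding vanishes_on_def
  proof
    fix u assume u: "u \<in> U"
    have "coset_of U u = \<zero>\<^bsub>Q\<^esub>" using u by (simp add: zero_Q coset_eq_iff)
    then show "formal_eval (\<lambda>p. \<Theta> (coset_of U (basis (fst p) (snd p)))) u = 0"
      using ev[OF keys_U[OF u]] linear_between_zero[OF assms complex_space_Q complex_space_CC] by simp
  qed
  show "\<Theta> t = tensor_eval t (\<lambda>x y. \<Theta> (coset_of U (basis x y)))" if "t \<in> carrier Q"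
    using that ev by (auto simp: carrier_Q tensor_eval_coset[OF v])
qed

lemma lift_closed:
  assumes "complex_space V" "t \<in> carrier Q" "\<And>x y. (x, y) \<in> X \<Longrightarrow> b x y \<in> carrier V"
  shows "lift V b t \<in> carrier V"
proof -
  interpret V: abelian_group V using complex_spaceD(1)[OF assms(1)] .
  show ?thesis
    unfolding lift_def Let_def
    by (rule V.finsum_closed)
      (use rep(2)[OF assms(2)] assms(3) in \<open>auto simp: complex_spaceD[OF assms(1)]\<close>)
qed

lemma functional_lift:
  assumes "complex_space V" "t \<in> carrier Q" "\<And>x y. (x, y) \<in> X \<Longrightarrow> b x y \<in> carrier V"
    and f: "linear_between V CC f"
  shows "f (lift V b t) = tensor_eval t (\<lambda>x y. f (b x y))"
  unfolding lift_def Let_def tensor_eval_def formal_eval_def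
  using rep(2)[OF assms(2)] assms(3)
  by (subst linear_functional_finsum[OF f assms(1)])
    (auto simp: complex_spaceD[OF assms(1)] linear_betweenD[OF f] subset_iff intro!: sum.cong)

lemma lift_CC: "t \<in> carrier Q \<Longrightarrow> lift CC F t = tensor_eval t F"
  unfolding lift_def Let_def tensor_eval_def formal_eval_def by (simp add: finsum_CC)

lemma conj_lift_closed:
  assumes "complex_space V" "t \<in> carrier Q" "\<And>x y. (x, y) \<in> X \<Longrightarrow> b x y \<in> carrier V"
  shows "lift (conj_space V) b t \<in> carrier V"
  using lift_closed[OF complex_space_conj_space[OF assms(1)] assms(2), of b] assms(3)
  by (simp add: conj_space_def)

text \<open>The conjugate of \<open>f\<close> is a linear functional on the conjugate space, where
  \<open>functional_lift\<close> applies.\<close>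

lemma functional_conj_lift:
  assumes "complex_space V" "t \<in> carrier Q" "\<And>x y. (x, y) \<in> X \<Longrightarrow> b x y \<in> carrier V"
    and f: "linear_between V CC f"
  shows "f (lift (conj_space V) b t) = cnj (tensor_eval t (\<lambda>x y. cnj (f (b x y))))"
proof -
  have "linear_between (conj_space V) CC (\<lambda>x. cnj (f x))"
    using linear_betweenD[OF f] by (auto simp: conj_space_def intro!: linear_betweenI)
  from functional_lift[OF complex_space_conj_space[OF assms(1)] assms(2) _ this, of b]
  have "cnj (f (lift (conj_space V) b t)) = tensor_eval t (\<lambda>x y. cnj (f (b x y)))"
    using assms(3) by (simp add: conj_space_def)
  then show ?thesis by (metis complex_cnj_cnj)
qed

end


subsection \<open>Tensor products\<close>

definition bilinear_on ::
  "(complex, 'a, 'm) module_scheme \<Rightarrow> (complex, 'b, 'n) module_scheme \<Rightarrow> ('a \<Rightarrow> 'b \<Rightarrow> complex) \<Rightarrow> bool" where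
  "bilinear_on V W F \<longleftrightarrow> (\<forall>x\<in>carrier V. linear_between W CC (F x)) \<and>
     (\<forall>y\<in>carrier W. linear_between V CC (\<lambda>x. F x y))"

lemma bilinear_onI:
  assumes "\<And>x. x \<in> carrier V \<Longrightarrow> linear_between W CC (F x)"
    and "\<And>y. y \<in> carrier W \<Longrightarrow> linear_between V CC (\<lambda>x. F x y)"
  shows "bilinear_on V W F"
  using assms by (simp add: bilinear_on_def)

lemma bilinear_onD:
  assumes "bilinear_on V W F"
  shows "x \<in> carrier V \<Longrightarrow> linear_between W CC (F x)"
    and "y \<in> carrier W \<Longrightarrow> linear_between V CC (\<lambda>x. F x y)"
    and "x \<in> carrier V \<Longrightarrow> x' \<in> carrier V \<Longrightarrow> y \<in> carrier W \<Longrightarrow> F (x \<oplus>\<^bsub>V\<^esub> x') y = F x y + F x' y"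
    and "x \<in> carrier V \<Longrightarrow> y \<in> carrier W \<Longrightarrow> y' \<in> carrier W \<Longrightarrow> F x (y \<oplus>\<^bsub>W\<^esub> y') = F x y + F x y'"
    and "x \<in> carrier V \<Longrightarrow> y \<in> carrier W \<Longrightarrow> F (c \<odot>\<^bsub>V\<^esub> x) y = c * F x y"
    and "x \<in> carrier V \<Longrightarrow> y \<in> carrier W \<Longrightarrow> F x (c \<odot>\<^bsub>W\<^esub> y) = c * F x y"
  using assms linear_betweenD(2,3)[of V CC "\<lambda>x. F x y"] linear_betweenD(2,3)[of W CC "F x"]
  by (auto simp: bilinear_on_def)

lemma bilinear_relationsI:
  "x \<in> carrier V \<Longrightarrow> x' \<in> carrier V \<Longrightarrow> y \<in> carrier W \<Longrightarrow>
     basis (x \<oplus>\<^bsub>V\<^esub> x') y - basis x y - basis x' y \<in> bilinear_relations V W"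
  "x \<in> carrier V \<Longrightarrow> y \<in> carrier W \<Longrightarrow> y' \<in> carrier W \<Longrightarrow>
     basis x (y \<oplus>\<^bsub>W\<^esub> y') - basis x y - basis x y' \<in> bilinear_relations V W"
  "x \<in> carrier V \<Longrightarrow> y \<in> carrier W \<Longrightarrow>
     basis (c \<odot>\<^bsub>V\<^esub> x) y - formal_scale c (basis x y) \<in> bilinear_relations V W"
  "x \<in> carrier V \<Longrightarrow> y \<in> carrier W \<Longrightarrow>
     basis x (c \<odot>\<^bsub>W\<^esub> y) - formal_scale c (basis x y) \<in> bilinear_relations V W"
  unfolding bilinear_relations_def by blast+

lemma vanishes_on_bilinear_relations: "vanishes_on (bilinear_relations V W) F \<longleftrightarrow> bilinear_on V W F"
proof
  assume v: "vanishes_on (bilinear_relations V W) F"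
  then have v: "\<And>u. u \<in> bilinear_relations V W \<Longrightarrow> formal_eval (\<lambda>p. F (fst p) (snd p)) u = 0"
    by (simp add: vanishes_on_def)
  show "bilinear_on V W F"
  proof (intro bilinear_onI linear_betweenI)
    fix x y y' assume *: "x \<in> carrier V" "y \<in> carrier W" "y' \<in> carrier W"
    show "F x (y \<oplus>\<^bsub>W\<^esub> y') = F x y \<oplus>\<^bsub>CC\<^esub> F x y'"
      using v[OF bilinear_relationsI(2)] * by (simp add: formal_eval_simps diff_eq_eq add.commute)
  next
    fix x c y assume *: "x \<in> carrier V" "y \<in> carrier W"
    show "F x (c \<odot>\<^bsub>W\<^esub> y) = c \<odot>\<^bsub>CC\<^esub> F x y"
      using v[OF bilinear_relationsI(4)] * by (simp add: formal_eval_simps diff_eq_eq add.commute)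
  next
    fix x x' y assume *: "x \<in> carrier V" "y \<in> carrier W" "x' \<in> carrier V"
    show "F (x \<oplus>\<^bsub>V\<^esub> x') y = F x y \<oplus>\<^bsub>CC\<^esub> F x' y"
      using v[OF bilinear_relationsI(1)] * by (simp add: formal_eval_simps diff_eq_eq add.commute)
  next
    fix x c y assume *: "x \<in> carrier V" "y \<in> carrier W"
    show "F (c \<odot>\<^bsub>V\<^esub> x) y = c \<odot>\<^bsub>CC\<^esub> F x y"
      using v[OF bilinear_relationsI(3)] * by (simp add: formal_eval_simps diff_eq_eq add.commute)
  qed auto
next
  assume "bilinear_on V W F"
  then show "vanishes_on (bilinear_relations V W) F"
    by (auto simp: vanishes_on_def bilinear_relations_def formal_eval_simps bilinear_onD)
qed

lemma keys_bilinear_relations: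
  fixes V :: "(complex, 'a, 'm) module_scheme" and W :: "(complex, 'b, 'n) module_scheme"
  assumes "complex_space V" "complex_space W" "u \<in> bilinear_relations V W"
  shows "Poly_Mapping.keys u \<subseteq> carrier V \<times> carrier W"
proof -
  have s: "Poly_Mapping.keys (Poly_Mapping.single p (1::complex)) \<subseteq> X" if "p \<in> X" for p :: "'a \<times> 'b" and X
    using that by simp
  have d: "Poly_Mapping.keys (f - g) \<subseteq> X" if "Poly_Mapping.keys f \<subseteq> X" "Poly_Mapping.keys g \<subseteq> X"
    for f g :: "'a \<times> 'b \<Rightarrow>\<^sub>0 complex" and X
    using keys_diff_subset[of f g] that by blast
  have c: "Poly_Mapping.keys (formal_scale c f) \<subseteq> X" if "Poly_Mapping.keys f \<subseteq> X" for c and f :: "'a \<times> 'b \<Rightarrow>\<^sub>0 complex" and X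
    using keys_formal_scale[of c f] that by blast
  note Vs = complex_spaceD[OF assms(1)] and Ws = complex_spaceD[OF assms(2)]
  consider (1) x x' y where "u = basis (x \<oplus>\<^bsub>V\<^esub> x') y - basis x y - basis x' y" "x \<in> carrier V" "x' \<in> carrier V" "y \<in> carrier W"
    | (2) x y y' where "u = basis x (y \<oplus>\<^bsub>W\<^esub> y') - basis x y - basis x y'" "x \<in> carrier V" "y \<in> carrier W" "y' \<in> carrier W"
    | (3) c x y where "u = basis (c \<odot>\<^bsub>V\<^esub> x) y - formal_scale c (basis x y)" "x \<in> carrier V" "y \<in> carrier W"
    | (4) c x y where "u = basis x (c \<odot>\<^bsub>W\<^esub> y) - formal_scale c (basis x y)" "x \<in> carrier V" "y \<in> carrier W"
    using assms(3) unfolding bilinear_relations_def by blast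
  then show ?thesis
  proof cases
    case 1
    then show ?thesis by (simp only:) (intro d c s; simp add: Vs Ws)
  next
    case 2
    then show ?thesis by (simp only:) (intro d c s; simp add: Vs Ws)
  next
    case 3
    then show ?thesis by (simp only:) (intro d c s; simp add: Vs Ws)
  next
    case 4
    then show ?thesis by (simp only:) (intro d c s; simp add: Vs Ws)
  qed
qed

locale tensor_product =
  fixes V :: "(complex, 'a, 'm) module_scheme" and W :: "(complex, 'b, 'n) module_scheme"
  assumes V: "complex_space V" and W: "complex_space W"
begin

sublocale formal_quotient_space "carrier V \<times> carrier W" "tensor_null V W"
proof
  show "formal.subspace (tensor_null V W)"
    by (simp add: tensor_null_def)
  show "Poly_Mapping.keys u \<subseteq> carrier V \<times> carrier W" if "u \<in> tensor_null V W" for u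
    using keys_span[of "bilinear_relations V W" "carrier V \<times> carrier W" u]
      keys_bilinear_relations[OF V W] that
    by (simp add: tensor_null_def)
qed

lemma vanishes_on_tensor_null: "vanishes_on (tensor_null V W) F \<longleftrightarrow> bilinear_on V W F"
  by (simp add: tensor_null_def vanishes_on_span vanishes_on_bilinear_relations)

lemma pure_closed: "x \<in> carrier V \<Longrightarrow> y \<in> carrier W \<Longrightarrow> pure_tensor V W x y \<in> carrier (tensor_space V W)"
  unfolding tensor_space_def pure_tensor_def by (rule coset_closed) simp

lemma pure_eval: "bilinear_on V W F \<Longrightarrow> tensor_eval (pure_tensor V W x y) F = F x y"
  by (simp add: pure_tensor_def tensor_eval_coset vanishes_on_tensor_null)

lemmas eval_linear = tensor_eval_linear[unfolded vanishes_on_tensor_null, folded tensor_space_def]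
lemmas linear_eval_on = linear_tensor_eval_on[folded tensor_space_def]
lemmas eval_eqI = tensor_eqI[unfolded vanishes_on_tensor_null, folded tensor_space_def]
lemmas eval_cong = tensor_eval_cong[folded tensor_space_def]
lemmas space = complex_space_Q[folded tensor_space_def]
lemmas lift_closed' = lift_closed[folded tensor_space_def]
lemmas functional_lift' = functional_lift[folded tensor_space_def]
lemmas lift_CC' = lift_CC[folded tensor_space_def]
lemmas conj_lift_closed' = conj_lift_closed[folded tensor_space_def]
lemmas functional_conj_lift' = functional_conj_lift[folded tensor_space_def]

end

lemma star_algebra_complex_space: "star_algebra A \<Longrightarrow> complex_space A"
  by (simp add: star_algebra_def)

lemma tensor_algebra_sel:
  "carrier (tensor_algebra A B) = carrier (tensor_space A B)"
  "\<zero>\<^bsub>tensor_algebra A B\<^esub> = \<zero>\<^bsub>tensor_space A B\<^esub>"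
  "add (tensor_algebra A B) = add (tensor_space A B)"
  "smult (tensor_algebra A B) = smult (tensor_space A B)"
  "\<one>\<^bsub>tensor_algebra A B\<^esub> = pure_tensor A B \<one>\<^bsub>A\<^esub> \<one>\<^bsub>B\<^esub>"
  "mult (tensor_algebra A B) s t = lift (tensor_space A B) (\<lambda>a b. lift (tensor_space A B)
     (\<lambda>c d. pure_tensor A B (a \<otimes>\<^bsub>A\<^esub> c) (b \<otimes>\<^bsub>B\<^esub> d)) t) s"
  "star (tensor_algebra A B) = lift (conj_space (tensor_space A B))
     (\<lambda>a b. pure_tensor A B (star A a) (star B b))"
  by (simp_all add: tensor_algebra_def Let_def)

text \<open>Stated with closure of products and involutions only, so that it applies at once to
  \<open>K\<close>, to the dual of \<open>K\<close> and to a *-algebra paired with matrices.\<close>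

locale star_tensor_product = tensor_product A B
  for A :: "('a, 'm) star_alg_scheme" and B :: "('b, 'n) star_alg_scheme" +
  assumes mult_A [simp]: "a \<in> carrier A \<Longrightarrow> a' \<in> carrier A \<Longrightarrow> a \<otimes>\<^bsub>A\<^esub> a' \<in> carrier A"
    and mult_B [simp]: "b \<in> carrier B \<Longrightarrow> b' \<in> carrier B \<Longrightarrow> b \<otimes>\<^bsub>B\<^esub> b' \<in> carrier B"
    and star_A [simp]: "a \<in> carrier A \<Longrightarrow> star A a \<in> carrier A"
    and star_B [simp]: "b \<in> carrier B \<Longrightarrow> star B b \<in> carrier B"
begin

lemma mult_closed:
  "s \<in> carrier (tensor_space A B) \<Longrightarrow> t \<in> carrier (tensor_space A B) \<Longrightarrow>
   s \<otimes>\<^bsub>tensor_algebra A B\<^esub> t \<in> carrier (tensor_space A B)"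
  by (auto simp: tensor_algebra_sel intro!: lift_closed' space pure_closed)

lemma mult_eval:
  assumes "s \<in> carrier (tensor_space A B)" "t \<in> carrier (tensor_space A B)" "bilinear_on A B F"
  shows "tensor_eval (s \<otimes>\<^bsub>tensor_algebra A B\<^esub> t) F =
    tensor_eval s (\<lambda>a b. tensor_eval t (\<lambda>c d. F (a \<otimes>\<^bsub>A\<^esub> c) (b \<otimes>\<^bsub>B\<^esub> d)))"
proof -
  have "tensor_eval (lift (tensor_space A B) (\<lambda>c d. pure_tensor A B (a \<otimes>\<^bsub>A\<^esub> c) (b \<otimes>\<^bsub>B\<^esub> d)) t) F =
      tensor_eval t (\<lambda>c d. F (a \<otimes>\<^bsub>A\<^esub> c) (b \<otimes>\<^bsub>B\<^esub> d))" if "a \<in> carrier A" "b \<in> carrier B" for a b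
    using that by (subst functional_lift'[OF space assms(2) _ eval_linear[OF assms(3)]])
      (simp_all add: pure_closed pure_eval[OF assms(3)])
  then show ?thesis
    unfolding tensor_algebra_sel
    by (subst functional_lift'[OF space assms(1) _ eval_linear[OF assms(3)]])
      (auto intro!: eval_cong assms lift_closed' space pure_closed)
qed

lemma star_eval:
  assumes "t \<in> carrier (tensor_space A B)" "bilinear_on A B F"
  shows "tensor_eval (star (tensor_algebra A B) t) F =
    cnj (tensor_eval t (\<lambda>a b. cnj (F (star A a) (star B b))))"
  unfolding tensor_algebra_sel
  by (subst functional_conj_lift'[OF space assms(1) _ eval_linear[OF assms(2)]])
    (auto simp: pure_eval[OF assms(2)] pure_closed)

end

section \<open>Sweedler calculus\<close>

text \<open>Introduction rules that settle linearity goals by following the syntax of the term; the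
  rules for bilinear and trilinear forms split such goals into one linearity goal per
  argument.\<close>

named_theorems lin

lemma linear_between_id [lin]: "linear_between V V (\<lambda>x. x)"
  by (simp add: linear_between_def)

lemma linear_between_comp:
  "linear_between W X f \<Longrightarrow> linear_between V W g \<Longrightarrow> linear_between V X (\<lambda>x. f (g x))"
  by (auto simp: linear_between_def Pi_iff)

lemma linear_cmult [lin]: "linear_between V CC f \<Longrightarrow> linear_between V CC (\<lambda>x. c * f x)"
  and linear_multc [lin]: "linear_between V CC f \<Longrightarrow> linear_between V CC (\<lambda>x. f x * c)"
  by (auto simp: linear_between_def algebra_simps)

lemma linear_tensor_eval [lin]:
  assumes "\<And>a b. linear_between V CC (\<lambda>x. H x a b)"
  shows "linear_between V CC (\<lambda>x. tensor_eval t (H x))"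
proof (rule linear_betweenI)
  fix x y assume "x \<in> carrier V" "y \<in> carrier V"
  then have "H (x \<oplus>\<^bsub>V\<^esub> y) = (\<lambda>a b. H x a b + H y a b)"
    by (simp add: fun_eq_iff linear_betweenD[OF assms])
  then show "tensor_eval t (H (x \<oplus>\<^bsub>V\<^esub> y)) = tensor_eval t (H x) \<oplus>\<^bsub>CC\<^esub> tensor_eval t (H y)"
    by (simp add: tensor_eval_add)
next
  fix c x assume "x \<in> carrier V"
  then have "H (c \<odot>\<^bsub>V\<^esub> x) = (\<lambda>a b. c * H x a b)"
    by (simp add: fun_eq_iff linear_betweenD[OF assms])
  then show "tensor_eval t (H (c \<odot>\<^bsub>V\<^esub> x)) = c \<odot>\<^bsub>CC\<^esub> tensor_eval t (H x)"
    by (simp add: tensor_eval_cmult)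
qed simp

declare bilinear_onI [lin]

lemma bilinear_on_comp:
  assumes "bilinear_on V W F"
  shows "linear_between X V g \<Longrightarrow> y \<in> carrier W \<Longrightarrow> linear_between X CC (\<lambda>x. F (g x) y)"
    and "linear_between X W h \<Longrightarrow> y' \<in> carrier V \<Longrightarrow> linear_between X CC (\<lambda>x. F y' (h x))"
proof -
  show "linear_between X V g \<Longrightarrow> y \<in> carrier W \<Longrightarrow> linear_between X CC (\<lambda>x. F (g x) y)"
    by (rule linear_between_comp[OF bilinear_onD(2)[OF assms]])
  show "linear_between X W h \<Longrightarrow> y' \<in> carrier V \<Longrightarrow> linear_between X CC (\<lambda>x. F y' (h x))"
    by (rule linear_between_comp[OF bilinear_onD(1)[OF assms]])
qed

definition trilinear_on ::
  "(complex, 'a, 'm) module_scheme \<Rightarrow> (complex, 'b, 'n) module_scheme \<Rightarrow>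
   (complex, 'c, 'k) module_scheme \<Rightarrow> ('a \<Rightarrow> 'b \<Rightarrow> 'c \<Rightarrow> complex) \<Rightarrow> bool" where
  "trilinear_on U V W F \<longleftrightarrow>
     (\<forall>y\<in>carrier V. \<forall>z\<in>carrier W. linear_between U CC (\<lambda>x. F x y z)) \<and>
     (\<forall>x\<in>carrier U. \<forall>z\<in>carrier W. linear_between V CC (\<lambda>y. F x y z)) \<and>
     (\<forall>x\<in>carrier U. \<forall>y\<in>carrier V. linear_between W CC (\<lambda>z. F x y z))"

lemma trilinear_onI [lin]:
  assumes "\<And>y z. y \<in> carrier V \<Longrightarrow> z \<in> carrier W \<Longrightarrow> linear_between U CC (\<lambda>x. F x y z)"
    and "\<And>x z. x \<in> carrier U \<Longrightarrow> z \<in> carrier W \<Longrightarrow> linear_between V CC (\<lambda>y. F x y z)"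
    and "\<And>x y. x \<in> carrier U \<Longrightarrow> y \<in> carrier V \<Longrightarrow> linear_between W CC (\<lambda>z. F x y z)"
  shows "trilinear_on U V W F"
  using assms by (simp add: trilinear_on_def)

lemma trilinear_on_comp:
  assumes "trilinear_on U V W F"
  shows "linear_between X U f \<Longrightarrow> y \<in> carrier V \<Longrightarrow> z \<in> carrier W \<Longrightarrow> linear_between X CC (\<lambda>x. F (f x) y z)"
    and "linear_between X V g \<Longrightarrow> u \<in> carrier U \<Longrightarrow> z \<in> carrier W \<Longrightarrow> linear_between X CC (\<lambda>x. F u (g x) z)"
    and "linear_between X W h \<Longrightarrow> u \<in> carrier U \<Longrightarrow> y \<in> carrier V \<Longrightarrow> linear_between X CC (\<lambda>x. F u y (h x))"
  using assms linear_between_comp[where W = U and f = "\<lambda>x. F x y z" and g = f and X = CC and V = X]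
    linear_between_comp[where W = V and f = "\<lambda>y. F u y z" and g = g and X = CC and V = X]
    linear_between_comp[where W = W and f = "F u y" and g = h and X = CC and V = X]
  unfolding trilinear_on_def by simp_all

context star_algebra begin

declare star_closed [simp] star_star [simp]

text \<open>The unqualified names of the ring laws refer to the scalars.\<close>

lemma ring_A: "ring A"
  by (rule star_algebra.axioms(1)) (rule star_algebra_axioms)

lemma A_distrib_right: "x \<in> carrier A \<Longrightarrow> y \<in> carrier A \<Longrightarrow> z \<in> carrier A \<Longrightarrow> (x \<oplus> y) \<otimes> z = x \<otimes> z \<oplus> y \<otimes> z"
  and A_distrib_left: "x \<in> carrier A \<Longrightarrow> y \<in> carrier A \<Longrightarrow> z \<in> carrier A \<Longrightarrow> z \<otimes> (x \<oplus> y) = z \<otimes> x \<oplus> z \<otimes> y"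
  and A_assoc: "x \<in> carrier A \<Longrightarrow> y \<in> carrier A \<Longrightarrow> z \<in> carrier A \<Longrightarrow> (x \<otimes> y) \<otimes> z = x \<otimes> (y \<otimes> z)"
  by (simp_all only: ring.ring_simprules[OF ring_A])

lemma A_closed [simp]: "\<one> \<in> carrier A" "\<zero> \<in> carrier A"
    "x \<in> carrier A \<Longrightarrow> y \<in> carrier A \<Longrightarrow> x \<otimes> y \<in> carrier A"
    "x \<in> carrier A \<Longrightarrow> y \<in> carrier A \<Longrightarrow> x \<oplus> y \<in> carrier A"
    "x \<in> carrier A \<Longrightarrow> c \<odot> x \<in> carrier A"
  and A_one [simp]: "x \<in> carrier A \<Longrightarrow> x \<otimes> \<one> = x" "x \<in> carrier A \<Longrightarrow> \<one> \<otimes> x = x"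
  using complex_spaceD(2)[OF star_algebra_complex_space[OF star_algebra_axioms]]
    ring.ring_simprules[OF ring_A] monoid.r_one[OF ring.is_monoid[OF ring_A]]
  by auto

lemma star_one [simp]: "star A \<one> = \<one>"
proof -
  have "star A (star A \<one> \<otimes> \<one>) = star A \<one> \<otimes> star A (star A \<one>)"
    by (rule star_mult) simp_all
  then show ?thesis by simp
qed

lemma linear_mult_left [lin]: "linear_between V A g \<Longrightarrow> b \<in> carrier A \<Longrightarrow> linear_between V A (\<lambda>x. g x \<otimes> b)"
  and linear_mult_right [lin]: "linear_between V A g \<Longrightarrow> b \<in> carrier A \<Longrightarrow> linear_between V A (\<lambda>x. b \<otimes> g x)"
  by (auto simp: linear_between_def Pi_iff smult_mult_left smult_mult_right A_distrib_left A_distrib_right)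

text \<open>Functionals are stable under this twist, so an identity tested on all functionals can be
  replaced by its image under the involution. Several left-handed identities below are obtained from
  right-handed ones in this way.\<close>

lemma linear_cnj_star:
  assumes "linear_between A CC f"
  shows "linear_between A CC (\<lambda>x. cnj (f (star A x)))"
  by (rule linear_betweenI)
    (simp_all add: star_add star_smult linear_betweenD[OF assms] complex_spaceD(2)[OF star_algebra_complex_space[OF star_algebra_axioms]])

lemma bilinear_cnj_star:
  assumes "bilinear_on A A F"
  shows "bilinear_on A A (\<lambda>x y. cnj (F (star A x) (star A y)))"
  using bilinear_onD(1,2)[OF assms]
  by (intro bilinear_onI) (auto intro: linear_cnj_star[of "F _"] linear_cnj_star[of "\<lambda>x. F x _"])

end

context weak_kac_algebra begin

abbreviation klin :: "('k \<Rightarrow> complex) \<Rightarrow> bool" where "klin \<equiv> linear_between K CC"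
abbreviation kbil :: "('k \<Rightarrow> 'k \<Rightarrow> complex) \<Rightarrow> bool" where "kbil \<equiv> bilinear_on K K"
abbreviation ktri :: "('k \<Rightarrow> 'k \<Rightarrow> 'k \<Rightarrow> complex) \<Rightarrow> bool" where "ktri \<equiv> trilinear_on K K K"
abbreviation S :: "'k \<Rightarrow> 'k" where "S \<equiv> antipode K"
abbreviation \<epsilon> :: "'k \<Rightarrow> complex" where "\<epsilon> \<equiv> counit K"

lemma complex_space_K: "complex_space K"
  by (rule star_algebra_complex_space) (rule star_algebra_axioms)

sublocale KK: star_tensor_product K K
  by (intro star_tensor_product.intro tensor_product.intro star_tensor_product_axioms.intro complex_space_K)
    simp_all

text \<open>Restricting to the carrier makes congruence for \<open>sw\<close> unconditional.\<close>

definition sw :: "'k \<Rightarrow> ('k \<Rightarrow> 'k \<Rightarrow> complex) \<Rightarrow> complex" where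
  "sw h F = tensor_eval (comult K h) (\<lambda>a b. if a \<in> carrier K \<and> b \<in> carrier K then F a b else 0)"

lemma sw_cong:
  "(\<And>a b. a \<in> carrier K \<Longrightarrow> b \<in> carrier K \<Longrightarrow> F a b = G a b) \<Longrightarrow> sw h F = sw h G"
  unfolding sw_def by (rule arg_cong[of _ _ "tensor_eval _"]) (auto simp: fun_eq_iff)

lemma sw_cong_simp:
  "h = h' \<Longrightarrow> (\<And>a b. a \<in> carrier K \<Longrightarrow> b \<in> carrier K \<Longrightarrow> F a b = G a b) \<Longrightarrow> sw h F = sw h' G"
  by (hypsubst, rule sw_cong)

lemma comult_closed [simp]: "h \<in> carrier K \<Longrightarrow> comult K h \<in> carrier (tensor_space K K)"
  using linear_betweenD(1)[OF comult_linear, of h] by (simp add: tensor_algebra_sel)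

lemma antipode_closed [simp]: "x \<in> carrier K \<Longrightarrow> S x \<in> carrier K"
  by (rule linear_betweenD(1)[OF antipode_linear])

declare antipode_antipode [simp]

lemma sw_eval: "h \<in> carrier K \<Longrightarrow> sw h F = tensor_eval (comult K h) F"
  unfolding sw_def by (rule KK.eval_cong) auto

lemma sw_add: "sw h (\<lambda>a b. F a b + G a b) = sw h F + sw h G"
  and sw_cmult: "sw h (\<lambda>a b. c * F a b) = c * sw h F"
  and sw_multc: "sw h (\<lambda>a b. F a b * c) = sw h F * c"
  unfolding sw_def by (simp_all flip: tensor_eval_add tensor_eval_cmult tensor_eval_multc
      add: if_distrib[of "\<lambda>x. _ * x"] if_distrib[of "\<lambda>x. x * _"] if_distrib[of "\<lambda>x. _ + x"] cong: if_cong)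

lemma sw_swap: "sw g (\<lambda>a b. sw h (\<lambda>c d. F a b c d)) = sw h (\<lambda>c d. sw g (\<lambda>a b. F a b c d))"
proof -
  let ?i = "\<lambda>a b z. if a \<in> carrier K \<and> b \<in> carrier K then z else (0::complex)"
  have "sw g (\<lambda>a b. sw h (\<lambda>c d. F a b c d)) =
      tensor_eval (comult K g) (\<lambda>a b. tensor_eval (comult K h) (\<lambda>c d. ?i a b (?i c d (F a b c d))))"
    unfolding sw_def
    by (rule arg_cong[of _ _ "tensor_eval _"]) (auto simp: fun_eq_iff tensor_eval_zero cong: if_cong)
  also have "\<dots> = sw h (\<lambda>c d. sw g (\<lambda>a b. F a b c d))"
    unfolding sw_def by (subst tensor_eval_swap, rule arg_cong[of _ _ "tensor_eval _"])
      (auto simp: fun_eq_iff tensor_eval_zero cong: if_cong)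
  finally show ?thesis .
qed

lemma linear_sw1 [lin]:
  assumes "\<And>a b. a \<in> carrier K \<Longrightarrow> b \<in> carrier K \<Longrightarrow> linear_between V CC (\<lambda>x. H x a b)"
  shows "linear_between V CC (\<lambda>x. sw h (\<lambda>a b. H x a b))"
proof (rule linear_betweenI)
  fix x y assume "x \<in> carrier V" "y \<in> carrier V"
  then have "sw h (\<lambda>a b. H (x \<oplus>\<^bsub>V\<^esub> y) a b) = sw h (\<lambda>a b. H x a b + H y a b)"
    by (intro sw_cong) (simp add: linear_betweenD[OF assms])
  then show "sw h (H (x \<oplus>\<^bsub>V\<^esub> y)) = sw h (H x) \<oplus>\<^bsub>CC\<^esub> sw h (H y)"
    by (simp add: sw_add)
next
  fix c x assume "x \<in> carrier V"
  then have "sw h (\<lambda>a b. H (c \<odot>\<^bsub>V\<^esub> x) a b) = sw h (\<lambda>a b. c * H x a b)"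
    by (intro sw_cong) (simp add: linear_betweenD[OF assms])
  then show "sw h (H (c \<odot>\<^bsub>V\<^esub> x)) = c \<odot>\<^bsub>CC\<^esub> sw h (H x)"
    by (simp add: sw_cmult)
qed simp

lemma linear_sw2 [lin]:
  assumes F: "kbil F" and g: "linear_between V K g"
  shows "linear_between V CC (\<lambda>x. sw (g x) F)"
proof -
  have "linear_between K (tensor_space K K) (comult K)"
    using comult_linear by (simp add: linear_between_def tensor_algebra_sel)
  then have "klin (\<lambda>x. tensor_eval (comult K x) F)"
    by (rule linear_between_comp[OF KK.eval_linear[OF F]])
  then have "klin (\<lambda>x. sw x F)"
    using complex_spaceD(2,9)[OF complex_space_K]
    by (auto simp: linear_between_def sw_eval)
  then show ?thesis
    by (rule linear_between_comp) (rule g)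
qed

lemma linear_antipode [lin]: "linear_between V K g \<Longrightarrow> linear_between V K (\<lambda>x. S (g x))"
  by (rule linear_between_comp[OF antipode_linear])

lemma linear_counit [lin]: "linear_between V K g \<Longrightarrow> linear_between V CC (\<lambda>x. \<epsilon> (g x))"
  by (rule linear_between_comp[OF counit_linear])

lemma sw_mult:
  assumes "x \<in> carrier K" "y \<in> carrier K" "kbil F"
  shows "sw (x \<otimes> y) F = sw x (\<lambda>a b. sw y (\<lambda>c d. F (a \<otimes> c) (b \<otimes> d)))"
  using assms by (simp add: sw_eval comult_mult KK.mult_eval)

lemma sw_star:
  assumes "x \<in> carrier K" "kbil F"
  shows "sw (star K x) F = cnj (sw x (\<lambda>a b. cnj (F (star K a) (star K b))))"
  using assms by (simp add: sw_eval comult_star KK.star_eval)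

lemma sw_antipode:
  assumes x: "x \<in> carrier K" and F: "kbil F"
  shows "sw (S x) F = sw x (\<lambda>a b. F (S b) (S a))"
proof -
  have "sw (S x) F = tensor_eval (lift (tensor_space K K) (\<lambda>a b. pure_tensor K K (S b) (S a)) (comult K x)) F"
    using x by (simp add: sw_eval antipode_comult)
  also have "\<dots> = tensor_eval (comult K x) (\<lambda>a b. tensor_eval (pure_tensor K K (S b) (S a)) F)"
    by (rule KK.functional_lift'[OF KK.space _ _ KK.eval_linear[OF F]]) (use x in \<open>auto intro: KK.pure_closed\<close>)
  finally show ?thesis
    using x by (simp add: sw_eval KK.pure_eval[OF F])
qed

lemma sw_coassoc:
  assumes x: "x \<in> carrier K" and F: "ktri F"
  shows "sw x (\<lambda>a b. sw a (\<lambda>c d. F c d b)) = sw x (\<lambda>a b. sw b (\<lambda>c d. F a c d))"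
proof -
  interpret L: tensor_product "tensor_space K K" K
    by (rule tensor_product.intro[OF KK.space complex_space_K])
  interpret R: tensor_product K "tensor_space K K"
    by (rule tensor_product.intro[OF complex_space_K KK.space])
  let ?T = "tensor_space K K"
  note tr = trilinear_on_comp[OF F]
  \<comment> \<open>The trilinear form is read as a bilinear form on \<open>K\<close> and the tensor
    square. Testing both sides of the coassociativity axiom against it produces the two iterated
    sums.\<close>
  have bR: "bilinear_on K ?T (\<lambda>a s. tensor_eval s (F a))"
  proof (intro bilinear_onI)
    fix s assume s: "s \<in> carrier ?T"
    show "linear_between K CC (\<lambda>a. tensor_eval s (F a))"
      by (rule KK.linear_eval_on[OF s]) (use tr(1)[OF linear_between_id] in auto)
  next
    fix a assume "a \<in> carrier K"
    then show "linear_between ?T CC (\<lambda>s. tensor_eval s (F a))"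
      by (intro KK.eval_linear) (intro lin tr; simp)
  qed
  have bL: "bilinear_on ?T K (\<lambda>s z. tensor_eval s (\<lambda>x y. F x y z))"
  proof (intro bilinear_onI)
    fix s assume s: "s \<in> carrier ?T"
    show "linear_between K CC (\<lambda>a. tensor_eval s (\<lambda>c d. F c d a))"
      by (rule KK.linear_eval_on[OF s]) (use tr(3)[OF linear_between_id] in auto)
  next
    fix a assume "a \<in> carrier K"
    then show "linear_between ?T CC (\<lambda>s. tensor_eval s (\<lambda>x y. F x y a))"
      by (intro KK.eval_linear) (intro lin tr; simp)
  qed
  let ?l = "tensor_map ?T K (comult K) id (comult K x)"
  let ?r = "tensor_map K ?T id (comult K) (comult K x)"
  have lc: "?l \<in> carrier (tensor_space ?T K)"
    unfolding tensor_map_def by (rule KK.lift_closed'[OF L.space]) (use x in \<open>auto intro!: L.pure_closed\<close>)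
  have "tensor_eval ?r (\<lambda>a s. tensor_eval s (F a)) = tensor_eval (comult K x)
      (\<lambda>a b. tensor_eval (pure_tensor K ?T (id a) (comult K b)) (\<lambda>a s. tensor_eval s (F a)))"
    unfolding tensor_map_def
    by (rule KK.functional_lift'[OF R.space _ _ R.eval_linear[OF bR]]) (use x in \<open>auto intro!: R.pure_closed\<close>)
  also have "\<dots> = sw x (\<lambda>a b. sw b (\<lambda>c d. F a c d))"
    using x by (simp add: R.pure_eval[OF bR] sw_eval[of x]) (auto intro!: KK.eval_cong simp: sw_eval)
  finally have R: "tensor_eval ?r (\<lambda>a s. tensor_eval s (F a)) = sw x (\<lambda>a b. sw b (\<lambda>c d. F a c d))" .
  have "tensor_eval ?l (\<lambda>s z. tensor_eval s (\<lambda>x y. F x y z)) = tensor_eval (comult K x)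
      (\<lambda>a b. tensor_eval (pure_tensor ?T K (comult K a) (id b)) (\<lambda>s z. tensor_eval s (\<lambda>x y. F x y z)))"
    unfolding tensor_map_def
    by (rule KK.functional_lift'[OF L.space _ _ L.eval_linear[OF bL]]) (use x in \<open>auto intro!: L.pure_closed\<close>)
  also have "\<dots> = sw x (\<lambda>a b. sw a (\<lambda>c d. F c d b))"
    using x by (simp add: L.pure_eval[OF bL] sw_eval[of x]) (auto intro!: KK.eval_cong simp: sw_eval)
  finally have L: "tensor_eval ?l (\<lambda>s z. tensor_eval s (\<lambda>x y. F x y z)) = sw x (\<lambda>a b. sw a (\<lambda>c d. F c d b))" .
  have inner: "tensor_eval (lift (tensor_space K ?T) (\<lambda>x y. pure_tensor K ?T x (pure_tensor K K y z)) s)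
      (\<lambda>a s. tensor_eval s (F a)) = tensor_eval s (\<lambda>x y. F x y z)"
    if "s \<in> carrier ?T" "z \<in> carrier K" for s z
  proof -
    have "tensor_eval (lift (tensor_space K ?T) (\<lambda>x y. pure_tensor K ?T x (pure_tensor K K y z)) s)
        (\<lambda>a s. tensor_eval s (F a)) = tensor_eval s (\<lambda>x y. tensor_eval (pure_tensor K ?T x (pure_tensor K K y z))
        (\<lambda>a s. tensor_eval s (F a)))"
      by (rule KK.functional_lift'[OF R.space _ _ R.eval_linear[OF bR]])
        (use that in \<open>auto intro!: R.pure_closed KK.pure_closed\<close>)
    also have "\<dots> = tensor_eval s (\<lambda>x y. F x y z)"
    proof (rule KK.eval_cong[OF that(1)])
      fix x y assume "(x, y) \<in> carrier K \<times> carrier K"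
      then have "kbil (F x)" by (intro lin tr; simp)
      then show "tensor_eval (pure_tensor K ?T x (pure_tensor K K y z)) (\<lambda>a s. tensor_eval s (F a)) = F x y z"
        by (simp add: R.pure_eval[OF bR] KK.pure_eval)
    qed
    finally show ?thesis .
  qed
  have "tensor_eval (tensor_assoc K K K ?l) (\<lambda>a s. tensor_eval s (F a)) =
      tensor_eval ?l (\<lambda>s z. tensor_eval (lift (tensor_space K ?T)
        (\<lambda>x y. pure_tensor K ?T x (pure_tensor K K y z)) s) (\<lambda>a s. tensor_eval s (F a)))"
    unfolding tensor_assoc_def Let_def
    by (rule L.functional_lift'[OF R.space lc _ R.eval_linear[OF bR]])
      (auto intro!: KK.lift_closed' R.space R.pure_closed KK.pure_closed)
  also have "\<dots> = tensor_eval ?l (\<lambda>s z. tensor_eval s (\<lambda>x y. F x y z))"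
    by (rule L.eval_cong[OF lc]) (simp add: inner)
  finally show ?thesis
    using R L coassoc[OF x] by simp
qed

section \<open>The axioms of a weak Kac algebra as identities between complex numbers\<close>

lemma functional_eqI:
  assumes "x \<in> carrier K" "y \<in> carrier K" "\<And>f. klin f \<Longrightarrow> f x = f y"
  shows "x = y"
  by (rule linear_functional_separation[OF complex_space_K assms])

lemma functional_lift_comult:
  assumes "klin f" "h \<in> carrier K" "\<And>a b. a \<in> carrier K \<Longrightarrow> b \<in> carrier K \<Longrightarrow> B a b \<in> carrier K"
  shows "f (lift K B (comult K h)) = sw h (\<lambda>a b. f (B a b))"
  using assms by (subst KK.functional_lift'[OF complex_space_K]) (auto simp: sw_eval)

lemma sw_counit_left: "klin f \<Longrightarrow> h \<in> carrier K \<Longrightarrow> sw h (\<lambda>a b. \<epsilon> a * f b) = f h"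
  using functional_lift_comult[of f h "\<lambda>x y. \<epsilon> x \<odot> y"] counit_left[of h]
  by (simp add: slice_left_def linear_betweenD[of K CC f] cong: sw_cong_simp)

lemma sw_counit_right: "klin f \<Longrightarrow> h \<in> carrier K \<Longrightarrow> sw h (\<lambda>a b. \<epsilon> b * f a) = f h"
  using functional_lift_comult[of f h "\<lambda>x y. \<epsilon> y \<odot> x"] counit_right[of h]
  by (simp add: slice_right_def linear_betweenD[of K CC f] cong: sw_cong_simp)

lemma sw_exists:
  assumes "h \<in> carrier K" "\<And>a b. a \<in> carrier K \<Longrightarrow> b \<in> carrier K \<Longrightarrow> B a b \<in> carrier K"
  obtains c where "c \<in> carrier K" "\<And>f. klin f \<Longrightarrow> f c = sw h (\<lambda>a b. f (B a b))"
  using KK.lift_closed'[OF complex_space_K, of "comult K h" B] functional_lift_comult[of _ h B] assms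
  by auto

lemma slice_mult:
  assumes f: "klin f" and g: "klin g" and st: "s \<in> carrier (tensor_space K K)" "t \<in> carrier (tensor_space K K)"
  shows "f (slice_right K g (s \<otimes>\<^bsub>tensor_algebra K K\<^esub> t)) =
      tensor_eval s (\<lambda>a b. tensor_eval t (\<lambda>c d. g (b \<otimes> d) * f (a \<otimes> c)))"
    and "f (slice_left K g (s \<otimes>\<^bsub>tensor_algebra K K\<^esub> t)) =
      tensor_eval s (\<lambda>a b. tensor_eval t (\<lambda>c d. g (a \<otimes> c) * f (b \<otimes> d)))"
proof -
  have b: "kbil (\<lambda>a b. g b * f a)" "kbil (\<lambda>a b. g a * f b)"
    by (intro lin f g)+
  have c: "s \<otimes>\<^bsub>tensor_algebra K K\<^esub> t \<in> carrier (tensor_space K K)"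
    using st by (rule KK.mult_closed)
  have "f (slice_right K g (s \<otimes>\<^bsub>tensor_algebra K K\<^esub> t)) =
      tensor_eval (s \<otimes>\<^bsub>tensor_algebra K K\<^esub> t) (\<lambda>a b. f (g b \<odot> a))"
    unfolding slice_right_def by (rule KK.functional_lift'[OF complex_space_K c _ f]) auto
  also have "\<dots> = tensor_eval (s \<otimes>\<^bsub>tensor_algebra K K\<^esub> t) (\<lambda>a b. g b * f a)"
    by (rule KK.eval_cong[OF c]) (simp add: linear_betweenD[OF f])
  finally show "f (slice_right K g (s \<otimes>\<^bsub>tensor_algebra K K\<^esub> t)) =
      tensor_eval s (\<lambda>a b. tensor_eval t (\<lambda>c d. g (b \<otimes> d) * f (a \<otimes> c)))"
    by (simp add: KK.mult_eval[OF st b(1)])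
  have "f (slice_left K g (s \<otimes>\<^bsub>tensor_algebra K K\<^esub> t)) =
      tensor_eval (s \<otimes>\<^bsub>tensor_algebra K K\<^esub> t) (\<lambda>a b. f (g a \<odot> b))"
    unfolding slice_left_def by (rule KK.functional_lift'[OF complex_space_K c _ f]) auto
  also have "\<dots> = tensor_eval (s \<otimes>\<^bsub>tensor_algebra K K\<^esub> t) (\<lambda>a b. g a * f b)"
    by (rule KK.eval_cong[OF c]) (simp add: linear_betweenD[OF f])
  finally show "f (slice_left K g (s \<otimes>\<^bsub>tensor_algebra K K\<^esub> t)) =
      tensor_eval s (\<lambda>a b. tensor_eval t (\<lambda>c d. g (a \<otimes> c) * f (b \<otimes> d)))"
    by (simp add: KK.mult_eval[OF st b(2)])
qed

lemma tensor_eval_one_pure: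
  assumes "kbil F" "x \<in> carrier K" "y \<in> carrier K" "h \<in> carrier K"
  shows "tensor_eval (pure_tensor K K x y) (\<lambda>a b. tensor_eval (comult K h) (\<lambda>c d. F (a \<otimes> c) (b \<otimes> d))) =
      sw h (\<lambda>c d. F (x \<otimes> c) (y \<otimes> d))"
    and "tensor_eval (comult K h) (\<lambda>a b. tensor_eval (pure_tensor K K x y) (\<lambda>c d. F (a \<otimes> c) (b \<otimes> d))) =
      sw h (\<lambda>c d. F (c \<otimes> x) (d \<otimes> y))"
proof -
  note Fl = bilinear_on_comp[OF assms(1)]
  have *: "tensor_eval (pure_tensor K K x y) F' = tensor_eval (pure_tensor K K x y) G'"
    if "\<And>a b. a \<in> carrier K \<Longrightarrow> b \<in> carrier K \<Longrightarrow> F' a b = G' a b" for F' G'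
    by (rule KK.eval_cong[OF KK.pure_closed]) (use assms that in auto)
  have "tensor_eval (pure_tensor K K x y) (\<lambda>a b. tensor_eval (comult K h) (\<lambda>c d. F (a \<otimes> c) (b \<otimes> d))) =
     tensor_eval (pure_tensor K K x y) (\<lambda>a b. sw h (\<lambda>c d. F (a \<otimes> c) (b \<otimes> d)))"
    using assms by (simp add: sw_eval)
  also have "\<dots> = sw h (\<lambda>c d. F (x \<otimes> c) (y \<otimes> d))"
    by (rule KK.pure_eval) (intro lin Fl; simp)
  finally show "tensor_eval (pure_tensor K K x y) (\<lambda>a b. tensor_eval (comult K h) (\<lambda>c d. F (a \<otimes> c) (b \<otimes> d))) =
      sw h (\<lambda>c d. F (x \<otimes> c) (y \<otimes> d))" .
  have "tensor_eval (comult K h) (\<lambda>a b. tensor_eval (pure_tensor K K x y) (\<lambda>c d. F (a \<otimes> c) (b \<otimes> d))) =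
    sw h (\<lambda>a b. tensor_eval (pure_tensor K K x y) (\<lambda>c d. F (a \<otimes> c) (b \<otimes> d)))"
    using assms by (simp add: sw_eval)
  also have "\<dots> = sw h (\<lambda>c d. F (c \<otimes> x) (d \<otimes> y))"
    by (intro sw_cong KK.pure_eval) (intro lin Fl; simp)
  finally show "tensor_eval (comult K h) (\<lambda>a b. tensor_eval (pure_tensor K K x y) (\<lambda>c d. F (a \<otimes> c) (b \<otimes> d))) =
      sw h (\<lambda>c d. F (c \<otimes> x) (d \<otimes> y))" .
qed

lemma slice_right_closed [simp]: "t \<in> carrier (tensor_space K K) \<Longrightarrow> slice_right K g t \<in> carrier K"
  and slice_left_closed [simp]: "t \<in> carrier (tensor_space K K) \<Longrightarrow> slice_left K g t \<in> carrier K"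
  unfolding slice_right_def slice_left_def by (auto intro!: KK.lift_closed'[OF complex_space_K])

lemma eps_closed [simp]: "x \<in> carrier K \<Longrightarrow> eps_s K x \<in> carrier K" "x \<in> carrier K \<Longrightarrow> eps_t K x \<in> carrier K"
  by (simp_all add: eps_s_def eps_t_def KK.mult_closed KK.pure_closed)

lemma eps_s_eval:
  assumes f: "klin f" and x: "x \<in> carrier K"
  shows "f (eps_s K x) = sw \<one> (\<lambda>a b. \<epsilon> (x \<otimes> b) * f a)"
proof -
  have b: "kbil (\<lambda>a b. \<epsilon> b * f a)" by (intro lin f)
  show ?thesis
    unfolding eps_s_def using x
    by (simp add: slice_mult(1)[OF f counit_linear] KK.pure_closed tensor_eval_one_pure[OF b] cong: sw_cong_simp)
qed

lemma eps_t_eval: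
  assumes f: "klin f" and x: "x \<in> carrier K"
  shows "f (eps_t K x) = sw \<one> (\<lambda>a b. \<epsilon> (a \<otimes> x) * f b)"
proof -
  have b: "kbil (\<lambda>a b. \<epsilon> a * f b)" by (intro lin f)
  show ?thesis
    unfolding eps_t_def using x
    by (simp add: slice_mult(2)[OF f counit_linear] KK.pure_closed tensor_eval_one_pure[OF b] cong: sw_cong_simp)
qed

lemma eps_s_mult_eval:
  assumes f: "klin f" and x: "x \<in> carrier K" and y: "y \<in> carrier K"
  shows "f (eps_s K x \<otimes> y) = sw y (\<lambda>a b. \<epsilon> (x \<otimes> b) * f a)"
proof -
  have b: "kbil (\<lambda>a b. \<epsilon> b * f a)" by (intro lin f)
  show ?thesis
    using x y
    by (simp add: eps_s_mult slice_mult(1)[OF f counit_linear] KK.pure_closed tensor_eval_one_pure[OF b] cong: sw_cong_simp)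
qed

lemma sw_eps_s:
  assumes F: "kbil F" and x: "x \<in> carrier K"
  shows "sw x (\<lambda>a b. F (eps_s K a) b) = sw \<one> (\<lambda>a b. F a (x \<otimes> b))"
proof -
  have "tensor_eval (tensor_map K K (eps_s K) id (comult K x)) F =
      tensor_eval (comult K x) (\<lambda>a b. tensor_eval (pure_tensor K K (eps_s K a) (id b)) F)"
    unfolding tensor_map_def
    by (rule KK.functional_lift'[OF KK.space _ _ KK.eval_linear[OF F]]) (use x in \<open>auto intro: KK.pure_closed\<close>)
  also have "\<dots> = sw x (\<lambda>a b. F (eps_s K a) b)"
    using x by (simp add: KK.pure_eval[OF F] sw_eval)
  finally have *: "tensor_eval (tensor_map K K (eps_s K) id (comult K x)) F = sw x (\<lambda>a b. F (eps_s K a) b)" .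
  show ?thesis
    using x * by (simp add: eps_s_comult KK.mult_eval[OF _ _ F] KK.pure_closed tensor_eval_one_pure[OF F] cong: sw_cong_simp)
qed

lemma antipode_eps_s_eval:
  assumes f: "klin f" and x: "x \<in> carrier K"
  shows "f (eps_s K x) = sw x (\<lambda>a b. f (S a \<otimes> b))"
  using functional_lift_comult[OF f x, of "\<lambda>a b. S a \<otimes> b"] x by (simp add: antipode_eps_s)

lemma linear_eps [lin]:
  "linear_between V K g \<Longrightarrow> linear_between V K (\<lambda>x. eps_s K (g x))"
  "linear_between V K g \<Longrightarrow> linear_between V K (\<lambda>x. eps_t K (g x))"
proof -
  have s: "linear_between K K (eps_s K)" and t: "linear_between K K (eps_t K)"
  proof -
    show "linear_between K K (eps_s K)"
    proof (rule linear_betweenI)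
      fix x y assume [simp]: "x \<in> carrier K" "y \<in> carrier K"
      show "eps_s K (x \<oplus> y) = eps_s K x \<oplus> eps_s K y"
        by (rule functional_eqI)
          (simp_all add: eps_s_eval A_distrib_right linear_betweenD[of K CC] linear_betweenD[OF counit_linear]
            distrib_right sw_add cong: sw_cong_simp)
    next
      fix c x assume [simp]: "x \<in> carrier K"
      show "eps_s K (c \<odot> x) = c \<odot> eps_s K x"
        by (rule functional_eqI)
          (simp_all add: eps_s_eval smult_mult_left linear_betweenD[of K CC] linear_betweenD[OF counit_linear]
            mult.assoc sw_cmult cong: sw_cong_simp)
    qed simp
    show "linear_between K K (eps_t K)"
    proof (rule linear_betweenI)
      fix x y assume [simp]: "x \<in> carrier K" "y \<in> carrier K"
      show "eps_t K (x \<oplus> y) = eps_t K x \<oplus> eps_t K y"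
        by (rule functional_eqI)
          (simp_all add: eps_t_eval A_distrib_left linear_betweenD[of K CC] linear_betweenD[OF counit_linear]
            distrib_right sw_add cong: sw_cong_simp)
    next
      fix c x assume [simp]: "x \<in> carrier K"
      show "eps_t K (c \<odot> x) = c \<odot> eps_t K x"
        by (rule functional_eqI)
          (simp_all add: eps_t_eval smult_mult_right linear_betweenD[of K CC] linear_betweenD[OF counit_linear]
            mult.assoc sw_cmult cong: sw_cong_simp)
    qed simp
  qed
  show "linear_between V K g \<Longrightarrow> linear_between V K (\<lambda>x. eps_s K (g x))"
    by (rule linear_between_comp[OF s])
  show "linear_between V K g \<Longrightarrow> linear_between V K (\<lambda>x. eps_t K (g x))"
    by (rule linear_between_comp[OF t])
qed

end

section \<open>Identities in weak Kac algebras\<close>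

context weak_kac_algebra begin

lemmas klin_comp = linear_between_comp[of K CC]

lemma antipode_one [simp]: "S \<one> = \<one>"
proof -
  have "S (S \<one> \<otimes> \<one>) = S \<one> \<otimes> S (S \<one>)"
    by (rule antipode_mult) simp_all
  then show ?thesis by simp
qed

lemma sw_one_antipode: "kbil F \<Longrightarrow> sw \<one> F = sw \<one> (\<lambda>a b. F (S b) (S a))"
  using sw_antipode[of \<one> F] by simp

text \<open>Both \<open>\<epsilon> x\<close> and \<open>\<epsilon> (S x)\<close> equal
  \<epsilon>(x_1) \<epsilon>(S(x_2)): the counit law for \<open>x\<close> gives one, the counit law
  for \<open>S x\<close> together with anti-comultiplicativity and involutivity of \<open>S\<close>
  gives the other.\<close>

lemma counit_antipode [simp]:
  assumes x: "x \<in> carrier K"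
  shows "\<epsilon> (S x) = \<epsilon> x"
proof -
  have b: "kbil (\<lambda>a b. \<epsilon> a * \<epsilon> (S b))" by (intro lin)
  have "\<epsilon> (S (S x)) = sw (S x) (\<lambda>a b. \<epsilon> a * \<epsilon> (S b))"
    by (rule sw_counit_left[symmetric]) (use x in \<open>simp_all add: lin\<close>)
  also have "\<dots> = sw x (\<lambda>a b. \<epsilon> (S b) * \<epsilon> (S (S a)))"
    by (rule sw_antipode[OF x b])
  also have "\<dots> = sw x (\<lambda>a b. \<epsilon> a * \<epsilon> (S b))"
    by (rule sw_cong) simp
  also have "\<dots> = \<epsilon> (S x)"
    by (rule sw_counit_left) (use x in \<open>simp_all add: lin\<close>)
  finally show ?thesis using x by simp
qed

text \<open>Delta(1) is invariant under \<open>S\<close> on both legs followed by the flip, so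
  \<open>S\<close> interchanges source and target. The lemmas that follow use this to turn each
  axiom for \<open>eps_s\<close> into its mirror image for \<open>eps_t\<close>.\<close>

lemma eps_t_antipode: 
  assumes x: "x \<in> carrier K"
  shows "eps_t K (S x) = S (eps_s K x)"
proof (rule functional_eqI)
  fix f assume f: "klin f"
  have fS: "klin (\<lambda>x. f (S x))" by (intro lin klin_comp[OF f])
  have b: "kbil (\<lambda>a b. \<epsilon> (a \<otimes> S x) * f b)" using x by (intro lin klin_comp[OF f]; simp)
  have "f (eps_t K (S x)) = sw \<one> (\<lambda>a b. \<epsilon> (S b \<otimes> S x) * f (S a))"
    using x by (subst eps_t_eval[OF f]) (simp_all add: sw_one_antipode[OF b])
  also have "\<dots> = sw \<one> (\<lambda>a b. \<epsilon> (x \<otimes> b) * f (S a))"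
    using x by (intro sw_cong) (simp flip: antipode_mult)
  also have "\<dots> = f (S (eps_s K x))"
    using eps_s_eval[OF fS x] by simp
  finally show "f (eps_t K (S x)) = f (S (eps_s K x))" .
qed (use x in simp_all)

lemma eps_s_antipode: "x \<in> carrier K \<Longrightarrow> eps_s K (S x) = S (eps_t K x)"
  using eps_t_antipode[of "S x"] by simp

lemma mult_eps_t_eval:
  assumes f: "klin f" and x: "x \<in> carrier K" and y: "y \<in> carrier K"
  shows "f (y \<otimes> eps_t K x) = sw y (\<lambda>a b. \<epsilon> (a \<otimes> x) * f b)"
proof -
  have fS: "klin (\<lambda>x. f (S x))" by (intro lin klin_comp[OF f])
  have b: "kbil (\<lambda>a b. \<epsilon> (S x \<otimes> b) * f (S a))" using x by (intro lin klin_comp[OF f]; simp)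
  have "f (y \<otimes> eps_t K x) = f (S (eps_s K (S x) \<otimes> S y))"
    using x y by (simp add: antipode_mult eps_s_antipode)
  also have "\<dots> = sw (S y) (\<lambda>a b. \<epsilon> (S x \<otimes> b) * f (S a))"
    using eps_s_mult_eval[OF fS, of "S x" "S y"] x y by simp
  also have "\<dots> = sw y (\<lambda>a b. \<epsilon> (S x \<otimes> S a) * f (S (S b)))"
    by (rule sw_antipode[OF y b])
  also have "\<dots> = sw y (\<lambda>a b. \<epsilon> (a \<otimes> x) * f b)"
    using x by (intro sw_cong) (simp flip: antipode_mult)
  finally show ?thesis .
qed

lemma sw_eps_t:
  assumes F: "kbil F" and x: "x \<in> carrier K"
  shows "sw x (\<lambda>a b. F a (eps_t K b)) = sw \<one> (\<lambda>a b. F (a \<otimes> x) b)"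
proof -
  note Fl = bilinear_on_comp[OF F]
  have b1: "kbil (\<lambda>a b. F (S b) (S (eps_s K a)))" and b2: "kbil (\<lambda>a b. F (S b) (S a))"
    by (intro lin Fl; simp)+
  have b3: "kbil (\<lambda>a b. F (S (S x \<otimes> b)) (S a))" using x by (intro lin Fl; simp)
  have "sw x (\<lambda>a b. F a (eps_t K b)) = sw (S x) (\<lambda>a b. F (S b) (S (eps_s K a)))"
    by (subst sw_antipode[OF x b1], rule sw_cong) (simp flip: eps_t_antipode)
  also have "\<dots> = sw \<one> (\<lambda>a b. F (S (S x \<otimes> b)) (S a))"
    using sw_eps_s[OF b2, of "S x"] x by simp
  also have "\<dots> = sw \<one> (\<lambda>a b. F (a \<otimes> x) b)"
    using x by (subst sw_one_antipode[OF b3]) (auto intro!: sw_cong simp: antipode_mult)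
  finally show ?thesis .
qed

lemma eps_t_antipode_eval:
  assumes f: "klin f" and x: "x \<in> carrier K"
  shows "f (eps_t K x) = sw x (\<lambda>a b. f (a \<otimes> S b))"
proof -
  have fS: "klin (\<lambda>x. f (S x))" by (intro lin klin_comp[OF f])
  have b: "kbil (\<lambda>a b. f (S (S a \<otimes> b)))" by (intro lin klin_comp[OF f]; simp)
  have "f (eps_t K x) = sw (S x) (\<lambda>a b. f (S (S a \<otimes> b)))"
    using antipode_eps_s_eval[OF fS, of "S x"] x by (simp add: eps_s_antipode)
  also have "\<dots> = sw x (\<lambda>a b. f (a \<otimes> S b))"
    by (subst sw_antipode[OF x b], rule sw_cong) (simp add: antipode_mult)
  finally show ?thesis .
qed

lemma antipode_eps_t_eval:
  assumes f: "klin f" and x: "x \<in> carrier K"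
  shows "f (S (eps_t K x)) = sw x (\<lambda>a b. f (b \<otimes> S a))"
proof -
  have fS: "klin (\<lambda>x. f (S x))" by (intro lin klin_comp[OF f])
  show ?thesis
    unfolding eps_t_antipode_eval[OF fS x] by (rule sw_cong) (simp add: antipode_mult)
qed

lemma antipode_eps_s_eval':
  assumes f: "klin f" and x: "x \<in> carrier K"
  shows "f (S (eps_s K x)) = sw x (\<lambda>a b. f (S b \<otimes> a))"
proof -
  have fS: "klin (\<lambda>x. f (S x))" by (intro lin klin_comp[OF f])
  show ?thesis
    unfolding antipode_eps_s_eval[OF fS x] by (rule sw_cong) (simp add: antipode_mult)
qed

text \<open>By \<open>antipode_eps_s_eval\<close> the left side is the star of S(x_1) x_2, that is
  x_2^* S(x_1^* ), which is the expression for S(eps_t(x^* )) in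
  \<open>antipode_eps_t_eval\<close>.\<close>

lemma star_eps_s:
  assumes x: "x \<in> carrier K"
  shows "star K (eps_s K x) = S (eps_t K (star K x))"
proof (rule functional_eqI)
  fix f assume f: "klin f"
  have g: "klin (\<lambda>x. cnj (f (star K x)))" by (rule linear_cnj_star[OF f])
  have b: "kbil (\<lambda>a b. f (b \<otimes> S a))" by (intro lin klin_comp[OF f]; simp)
  have "f (star K (eps_s K x)) = cnj (sw x (\<lambda>a b. cnj (f (star K (S a \<otimes> b)))))"
    using antipode_eps_s_eval[OF g x] by (metis complex_cnj_cnj)
  also have "\<dots> = sw (star K x) (\<lambda>a b. f (b \<otimes> S a))"
    by (subst sw_star[OF x b]) (simp add: star_mult antipode_star cong: sw_cong_simp)
  also have "\<dots> = f (S (eps_t K (star K x)))"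
    using x by (simp add: antipode_eps_t_eval[OF f])
  finally show "f (star K (eps_s K x)) = f (S (eps_t K (star K x)))" .
qed (use x in simp_all)

text \<open>The image of \<open>sw_eps_s\<close> under the involution, which carries
  \<open>eps_s\<close> to \<open>eps_t\<close> followed by \<open>S\<close> and reverses the product
  in the second leg.\<close>

lemma sw_antipode_eps_t:
  assumes F: "kbil F" and y: "y \<in> carrier K"
  shows "sw y (\<lambda>a b. F (S (eps_t K a)) b) = sw \<one> (\<lambda>a b. F a (b \<otimes> y))"
proof -
  note Fl = bilinear_on_comp[OF F]
  define G where "G = (\<lambda>u v. cnj (F (star K u) (star K v)))"
  have G: "kbil G" unfolding G_def by (rule bilinear_cnj_star[OF F])
  have b1: "kbil (\<lambda>a b. F (S (eps_t K a)) b)" by (intro lin Fl; simp)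
  have b2: "kbil (\<lambda>a b. F a (b \<otimes> y))" using y by (intro lin Fl; simp)
  have "cnj (sw y (\<lambda>a b. F (S (eps_t K a)) b)) = sw (star K y) (\<lambda>a b. G (eps_s K a) b)"
    using sw_star[of "star K y", OF _ b1] y
    by (simp add: G_def star_eps_s cong: sw_cong_simp)
  also have "\<dots> = sw \<one> (\<lambda>a b. G a (star K y \<otimes> b))"
    by (rule sw_eps_s[OF G]) (use y in simp)
  also have "\<dots> = cnj (sw \<one> (\<lambda>a b. F a (b \<otimes> y)))"
    using sw_star[of "\<one>", OF _ b2] y
    by (simp add: G_def star_mult cong: sw_cong_simp)
  finally show ?thesis by (metis complex_cnj_cnj)
qed

lemma sw_eps_t_left:
  assumes F: "kbil F" and y: "y \<in> carrier K"
  shows "sw y (\<lambda>a b. F (eps_t K a) b) = sw \<one> (\<lambda>a b. F (S a) (b \<otimes> y))"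
proof -
  note Fl = bilinear_on_comp[OF F]
  have b: "kbil (\<lambda>a b. F (S a) b)" by (intro lin Fl; simp)
  show ?thesis
    unfolding sw_antipode_eps_t[OF b y, symmetric] by (rule sw_cong) simp
qed

lemma sw_eps_s_right:
  assumes F: "kbil F" and x: "x \<in> carrier K"
  shows "sw x (\<lambda>a b. F a (eps_s K b)) = sw \<one> (\<lambda>a b. F (x \<otimes> a) (S b))"
proof -
  note Fl = bilinear_on_comp[OF F]
  have b1: "kbil (\<lambda>a b. F (S b) (S (eps_t K a)))" and b2: "kbil (\<lambda>a b. F (S b) a)"
    by (intro lin Fl; simp)+
  have b3: "kbil (\<lambda>a b. F (S (b \<otimes> S x)) a)" using x by (intro lin Fl; simp)
  have "sw x (\<lambda>a b. F a (eps_s K b)) = sw (S x) (\<lambda>a b. F (S b) (S (eps_t K a)))"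
    by (subst sw_antipode[OF x b1], rule sw_cong) (simp flip: eps_s_antipode)
  also have "\<dots> = sw \<one> (\<lambda>a b. F (S (b \<otimes> S x)) a)"
    using sw_antipode_eps_t[OF b2, of "S x"] x by simp
  also have "\<dots> = sw \<one> (\<lambda>a b. F (x \<otimes> a) (S b))"
    using x by (subst sw_one_antipode[OF b3]) (auto intro!: sw_cong simp: antipode_mult)
  finally show ?thesis .
qed

text \<open>The case x = 1 of \<open>sw_eps_t\<close>: the second leg of Delta(1) may be taken in
  \<open>R\<close>. Inserting \<open>eps_t\<close> there and removing it again is how that leg is
  pulled out of \<open>E\<close> in later computations.\<close>

lemma sw_one_eps_t: "kbil F \<Longrightarrow> sw \<one> (\<lambda>a b. F a (eps_t K b)) = sw \<one> F"
  using sw_eps_t[of F \<one>] by (simp cong: sw_cong_simp)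

subsection \<open>The target Cartan subalgebra\<close>

abbreviation R :: "'k set" where "R \<equiv> Cartan_t K"

lemma R_closed [simp]: "z \<in> R \<Longrightarrow> z \<in> carrier K"
  by (auto simp: Cartan_t_def)

lemma eps_t_in_R [simp]: "x \<in> carrier K \<Longrightarrow> eps_t K x \<in> R"
  by (auto simp: Cartan_t_def)

lemma star_in_R [simp]:
  assumes "z \<in> R"
  shows "star K z \<in> R"
proof -
  obtain x where x: "x \<in> carrier K" "z = eps_t K x"
    using assms by (auto simp: Cartan_t_def)
  have "star K z = star K (S (eps_s K (S x)))"
    using x by (simp add: eps_s_antipode)
  also have "\<dots> = eps_t K (star K (S x))"
    using x star_eps_s[of "S x"] by (simp flip: antipode_star)
  finally show ?thesis using x by simp
qed

text \<open>For z = eps_t(x) one has z = \<epsilon>(1_1 x) 1_2, so coassociativity of Delta(1)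
  writes Delta(z) as \<epsilon>(1_1 x) 1_2 \<otimes> 1_3, and \<open>mult_eps_t_eval\<close>
  collapses the first two legs to 1_1 z.\<close>

lemma sw_R_one_right:
  assumes z: "z \<in> R" and F: "kbil F"
  shows "sw z F = sw \<one> (\<lambda>a b. F (a \<otimes> z) b)"
proof -
  note Fl = bilinear_on_comp[OF F]
  obtain x where x: "x \<in> carrier K" "z = eps_t K x"
    using z by (auto simp: Cartan_t_def)
  have l: "klin (\<lambda>y. sw y F)" by (intro lin F)
  have t: "ktri (\<lambda>c d b. \<epsilon> (c \<otimes> x) * F d b)"
    using x by (intro lin Fl; simp)
  have "sw z F = sw \<one> (\<lambda>a b. sw b (\<lambda>c d. \<epsilon> (a \<otimes> x) * F c d))"
    unfolding x(2) by (subst eps_t_eval[OF l x(1)]) (simp add: sw_cmult)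
  also have "\<dots> = sw \<one> (\<lambda>a b. sw a (\<lambda>c d. \<epsilon> (c \<otimes> x) * F d b))"
    using sw_coassoc[OF _ t, of \<one>] by simp
  also have "\<dots> = sw \<one> (\<lambda>a b. F (a \<otimes> z) b)"
  proof (rule sw_cong)
    fix a b assume ab: "a \<in> carrier K" "b \<in> carrier K"
    have l: "klin (\<lambda>y. F y b)" using ab by (intro lin Fl; simp)
    show "sw a (\<lambda>c d. \<epsilon> (c \<otimes> x) * F d b) = F (a \<otimes> z) b"
      unfolding x(2) using mult_eps_t_eval[OF l x(1), of a] ab by simp
  qed
  finally show ?thesis .
qed

text \<open>The image of \<open>sw_R_one_right\<close> under the involution, which maps
  \<open>R\<close> to itself.\<close>

lemma sw_R_one_left:
  assumes z: "z \<in> R" and F: "kbil F"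
  shows "sw z F = sw \<one> (\<lambda>a b. F (z \<otimes> a) b)"
proof -
  note Fl = bilinear_on_comp[OF F]
  define G where "G = (\<lambda>u v. cnj (F (star K u) (star K v)))"
  have G: "kbil G" unfolding G_def by (rule bilinear_cnj_star[OF F])
  have b: "kbil (\<lambda>a b. F (z \<otimes> a) b)" using z by (intro lin Fl; simp)
  have "cnj (sw z F) = sw (star K z) G"
    using sw_star[of "star K z", OF _ F] z by (simp add: G_def)
  also have "\<dots> = sw \<one> (\<lambda>a b. G (a \<otimes> star K z) b)"
    by (rule sw_R_one_right[OF _ G]) (use z in simp)
  also have "\<dots> = cnj (sw \<one> (\<lambda>a b. F (z \<otimes> a) b))"
    using sw_star[of "\<one>", OF _ b] z by (simp add: G_def star_mult cong: sw_cong_simp)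
  finally show ?thesis by (metis complex_cnj_cnj)
qed

lemma sw_R_left:
  assumes z: "z \<in> R" and h: "h \<in> carrier K" and F: "kbil F"
  shows "sw (z \<otimes> h) F = sw h (\<lambda>a b. F (z \<otimes> a) b)"
proof -
  note Fl = bilinear_on_comp[OF F]
  have b1: "kbil (\<lambda>a b. sw h (\<lambda>c d. F (a \<otimes> c) (b \<otimes> d)))"
    using h by (intro lin Fl; simp)
  have b2: "kbil (\<lambda>a b. F (z \<otimes> a) b)" using z by (intro lin Fl; simp)
  have "sw (z \<otimes> h) F = sw \<one> (\<lambda>a b. sw h (\<lambda>c d. F ((z \<otimes> a) \<otimes> c) (b \<otimes> d)))"
    using z h by (simp add: sw_mult[OF _ _ F] sw_R_one_left[OF z b1])
  also have "\<dots> = sw (\<one> \<otimes> h) (\<lambda>a b. F (z \<otimes> a) b)"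
    using z by (subst sw_mult[OF _ h b2]) (simp_all add: A_assoc cong: sw_cong_simp)
  finally show ?thesis using h by simp
qed

lemma sw_R_right:
  assumes z: "z \<in> R" and h: "h \<in> carrier K" and F: "kbil F"
  shows "sw (h \<otimes> z) F = sw h (\<lambda>a b. F (a \<otimes> z) b)"
proof -
  note Fl = bilinear_on_comp[OF F]
  have b2: "kbil (\<lambda>a b. F (a \<otimes> z) b)" using z by (intro lin Fl; simp)
  have "sw (h \<otimes> z) F = sw h (\<lambda>a b. sw z (\<lambda>c d. F (a \<otimes> c) (b \<otimes> d)))"
    using z h by (simp add: sw_mult[OF _ _ F])
  also have "\<dots> = sw h (\<lambda>a b. sw \<one> (\<lambda>c d. F (a \<otimes> (c \<otimes> z)) (b \<otimes> d)))"
    by (intro sw_cong sw_R_one_right[OF z]) (intro lin Fl; simp)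
  also have "\<dots> = sw (h \<otimes> \<one>) (\<lambda>a b. F (a \<otimes> z) b)"
    using z by (subst sw_mult[OF h _ b2]) (simp_all add: A_assoc cong: sw_cong_simp)
  finally show ?thesis using h by simp
qed

lemma eps_t_one [simp]: "eps_t K \<one> = \<one>"
  by (rule functional_eqI)
    (simp_all add: eps_t_eval sw_counit_left cong: sw_cong_simp)

lemma one_in_R [simp]: "\<one> \<in> R"
  using eps_t_in_R[of \<one>] by simp

lemma eps_t_mult_left:
  assumes z: "z \<in> R" and x: "x \<in> carrier K"
  shows "eps_t K (z \<otimes> x) = z \<otimes> eps_t K x"
proof (rule functional_eqI)
  fix f assume f: "klin f"
  have b: "kbil (\<lambda>a b. f (a \<otimes> S b))" by (intro lin klin_comp[OF f]; simp)
  have l: "klin (\<lambda>y. f (z \<otimes> y))" using z by (intro lin klin_comp[OF f]; simp)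
  show "f (eps_t K (z \<otimes> x)) = f (z \<otimes> eps_t K x)"
    using z x by (simp add: eps_t_antipode_eval[OF f] sw_R_left[OF z x b]
        eps_t_antipode_eval[OF l] A_assoc cong: sw_cong_simp)
qed (use z x in simp_all)

text \<open>So \<open>R\<close> consists of the fixed points of \<open>eps_t\<close>, and closure of
  \<open>R\<close> under an operation is shown by letting \<open>eps_t\<close> fix the
  result.\<close>

lemma eps_t_R [simp]: "z \<in> R \<Longrightarrow> eps_t K z = z"
  using eps_t_mult_left[of z \<one>] by simp

lemma mult_in_R [simp]: "z \<in> R \<Longrightarrow> w \<in> R \<Longrightarrow> z \<otimes> w \<in> R"
  using eps_t_in_R[of "z \<otimes> w"] by (simp add: eps_t_mult_left)

lemma linear_eps_t: "linear_between K K (eps_t K)"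
  by (rule linear_eps(2)[OF linear_between_id])

lemma add_in_R [simp]: "z \<in> R \<Longrightarrow> w \<in> R \<Longrightarrow> z \<oplus> w \<in> R"
  using eps_t_in_R[of "z \<oplus> w"] by (simp add: linear_betweenD[OF linear_eps_t])

lemma smult_in_R [simp]: "z \<in> R \<Longrightarrow> c \<odot> z \<in> R"
  using eps_t_in_R[of "c \<odot> z"] by (simp add: linear_betweenD[OF linear_eps_t])

text \<open>For h = 1 both sides are Delta(z) with S(eps_t) applied to the first leg:
  \<open>sw_antipode_eps_t\<close> evaluates this as 1_1 \<otimes> 1_2 z, and Delta(z) = (z
  \<otimes> 1) Delta(1) evaluates it as 1_1 S(z) \<otimes> 1_2. The general case follows from
  Delta(h) = Delta(h) Delta(1).\<close>

lemma sw_antipode_R_right: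
  assumes z: "z \<in> R" and h: "h \<in> carrier K" and F: "kbil F"
  shows "sw h (\<lambda>a b. F (a \<otimes> S z) b) = sw h (\<lambda>a b. F a (b \<otimes> z))"
proof -
  have one: "sw \<one> (\<lambda>a b. F (a \<otimes> S z) b) = sw \<one> (\<lambda>a b. F a (b \<otimes> z))" if F: "kbil F" for F
  proof -
    note Fl = bilinear_on_comp[OF F]
    have b1: "kbil (\<lambda>a b. F (S (eps_t K a)) b)" by (intro lin Fl; simp)
    have b2: "kbil (\<lambda>a b. F (a \<otimes> S z) b)" using z by (intro lin Fl; simp)
    have "sw \<one> (\<lambda>a b. F a (b \<otimes> z)) = sw z (\<lambda>a b. F (S (eps_t K a)) b)"
      using z by (intro sw_antipode_eps_t[OF F, symmetric]) simp
    also have "\<dots> = sw \<one> (\<lambda>a b. F (S (eps_t K a) \<otimes> S z) b)"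
      using z by (subst sw_R_one_left[OF z b1])
        (simp add: eps_t_mult_left antipode_mult cong: sw_cong_simp)
    also have "\<dots> = sw \<one> (\<lambda>a b. F (a \<otimes> S z) b)"
      using sw_antipode_eps_t[OF b2, of \<one>] by (simp cong: sw_cong_simp)
    finally show ?thesis by simp
  qed
  note Fl = bilinear_on_comp[OF F]
  have b1: "kbil (\<lambda>a b. F (a \<otimes> S z) b)" and b2: "kbil (\<lambda>a b. F a (b \<otimes> z))"
    using z by (intro lin Fl; simp)+
  have "sw (h \<otimes> \<one>) (\<lambda>a b. F (a \<otimes> S z) b) = sw h (\<lambda>a b. sw \<one> (\<lambda>c d. F (a \<otimes> (c \<otimes> S z)) (b \<otimes> d)))"
    using z by (subst sw_mult[OF h _ b1]) (simp_all add: A_assoc cong: sw_cong_simp)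
  also have "\<dots> = sw h (\<lambda>a b. sw \<one> (\<lambda>c d. F (a \<otimes> c) (b \<otimes> (d \<otimes> z))))"
    by (intro sw_cong one) (intro lin Fl; simp)
  also have "\<dots> = sw (h \<otimes> \<one>) (\<lambda>a b. F a (b \<otimes> z))"
    using z by (subst sw_mult[OF h _ b2]) (simp_all add: A_assoc cong: sw_cong_simp)
  finally show ?thesis using h by simp
qed

text \<open>The image of \<open>sw_antipode_R_right\<close> under the involution.\<close>

lemma sw_antipode_R_left:
  assumes z: "z \<in> R" and h: "h \<in> carrier K" and F: "kbil F"
  shows "sw h (\<lambda>a b. F (S z \<otimes> a) b) = sw h (\<lambda>a b. F a (z \<otimes> b))"
proof -
  note Fl = bilinear_on_comp[OF F]
  define G where "G = (\<lambda>u v. cnj (F (star K u) (star K v)))"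
  have G: "kbil G" unfolding G_def by (rule bilinear_cnj_star[OF F])
  have b1: "kbil (\<lambda>a b. F (S z \<otimes> a) b)" and b2: "kbil (\<lambda>a b. F a (z \<otimes> b))"
    using z by (intro lin Fl; simp)+
  have "cnj (sw h (\<lambda>a b. F (S z \<otimes> a) b)) = sw (star K h) (\<lambda>a b. G (a \<otimes> S (star K z)) b)"
    using sw_star[of "star K h", OF _ b1] z h by (simp add: G_def star_mult antipode_star cong: sw_cong_simp)
  also have "\<dots> = sw (star K h) (\<lambda>a b. G a (b \<otimes> star K z))"
    by (rule sw_antipode_R_right[OF _ _ G]) (use z h in simp_all)
  also have "\<dots> = cnj (sw h (\<lambda>a b. F a (z \<otimes> b)))"
    using sw_star[of "star K h", OF _ b2] z h by (simp add: G_def star_mult cong: sw_cong_simp)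
  finally show ?thesis by (metis complex_cnj_cnj)
qed

end

section \<open>The Haar trace\<close>

lemma nonneg_Reals_cnj: "z \<in> \<real>\<^sub>\<ge>\<^sub>0 \<Longrightarrow> cnj z = z"
  by (auto simp: nonneg_Reals_def)

locale haar_kac_algebra = weak_kac_algebra K for K :: "'k weak_kac" (structure) +
  fixes \<tau> :: "'k \<Rightarrow> complex"
  assumes haar: "is_Haar_trace K \<tau>"
begin

lemma tr_linear: "klin \<tau>"
  and tr_comm: "x \<in> carrier K \<Longrightarrow> y \<in> carrier K \<Longrightarrow> \<tau> (x \<otimes> y) = \<tau> (y \<otimes> x)"
  and tr_pos: "x \<in> carrier K \<Longrightarrow> \<tau> (star K x \<otimes> x) \<in> \<real>\<^sub>\<ge>\<^sub>0"
  and tr_faithful: "x \<in> carrier K \<Longrightarrow> \<tau> (star K x \<otimes> x) = 0 \<Longrightarrow> x = \<zero>"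
  and tr_eps_s: "x \<in> carrier K \<Longrightarrow> \<tau> (eps_s K x) = \<epsilon> x"
  and tr_eps_t: "x \<in> carrier K \<Longrightarrow> \<tau> (eps_t K x) = \<epsilon> x"
  using haar by (auto simp: is_Haar_trace_def is_faithful_trace_def)

lemma linear_tr [lin]: "linear_between V K g \<Longrightarrow> linear_between V CC (\<lambda>x. \<tau> (g x))"
  by (rule linear_between_comp[OF tr_linear])

lemmas tr_simps = linear_betweenD(2,3)[OF tr_linear]

text \<open>By positivity \<open>?h\<close> takes real values. Reality at x + 1 and at x + i gives
  two linear relations between \<tau>(x) and \<tau>(x^* ), which together force them to be
  conjugate.\<close>

lemma tr_star:
  assumes x: "x \<in> carrier K"
  shows "\<tau> (star K x) = cnj (\<tau> x)"
proof -
  let ?h = "\<lambda>y. \<tau> (star K y \<otimes> y)"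
  have e: "?h (x \<oplus> c \<odot> \<one>) = ?h x + c * \<tau> (star K x) + cnj c * \<tau> x + cnj c * c * \<tau> \<one>" for c
    using x by (simp add: star_add star_smult A_distrib_left A_distrib_right smult_mult_left smult_mult_right
        tr_simps algebra_simps)
  have r: "cnj (?h y) = ?h y" if "y \<in> carrier K" for y
    using tr_pos[OF that] by (rule nonneg_Reals_cnj)
  have t1: "cnj (\<tau> \<one>) = \<tau> \<one>" using r[of \<one>] by simp
  have "cnj (\<tau> (star K x)) + cnj (\<tau> x) = \<tau> (star K x) + \<tau> x"
    using r[of "x \<oplus> 1 \<odot> \<one>"] r[of x] x t1 by (simp only: e) simp
  moreover have "cnj \<i> * cnj (\<tau> (star K x)) + \<i> * cnj (\<tau> x) = \<i> * \<tau> (star K x) - \<i> * \<tau> x"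
    using r[of "x \<oplus> \<i> \<odot> \<one>"] r[of x] x t1 by (simp only: e) (simp add: algebra_simps)
  ultimately show ?thesis
    by (simp add: complex_eq_iff)
qed

lemma tr_R: "z \<in> R \<Longrightarrow> \<tau> z = \<epsilon> z"
  using tr_eps_t[of z] by simp

lemma tr_antipode_R:
  assumes z: "z \<in> R"
  shows "\<tau> (S z) = \<tau> z"
  using tr_eps_s[of "S z"] z by (simp add: eps_s_antipode tr_R)

definition E :: "'k \<Rightarrow> 'k" where "E x = slice_right K \<tau> (comult K x)"

lemma E_closed [simp]: "x \<in> carrier K \<Longrightarrow> E x \<in> carrier K"
  by (simp add: E_def)

lemma E_eval:
  assumes f: "klin f" and x: "x \<in> carrier K"
  shows "f (E x) = sw x (\<lambda>a b. \<tau> b * f a)"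
  unfolding E_def slice_right_def
  by (subst functional_lift_comult[OF f x]) (simp_all add: linear_betweenD[OF f] cong: sw_cong_simp)

lemma E_eval_eps_t:
  assumes f: "klin f" and x: "x \<in> carrier K"
  shows "f (E x) = sw x (\<lambda>a b. \<tau> b * f (eps_t K a))"
proof -
  have "E x = lift K (\<lambda>a b. \<tau> b \<odot> eps_t K a) (comult K x)"
    using haar x by (simp add: is_Haar_trace_def E_def)
  then show ?thesis
    using x by (simp add: functional_lift_comult[OF f x] linear_betweenD[OF f] cong: sw_cong_simp)
qed

text \<open>The invariance condition for \<open>slice_right\<close> in \<open>is_Haar_trace\<close>
  says precisely that \<open>eps_t\<close> fixes \<open>E x\<close>.\<close>

lemma E_in_R [simp]:
  assumes x: "x \<in> carrier K"
  shows "E x \<in> R"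
proof -
  have "eps_t K (E x) = E x"
  proof (rule functional_eqI)
    fix f assume f: "klin f"
    have l: "klin (\<lambda>x. f (eps_t K x))" by (intro lin klin_comp[OF f])
    show "f (eps_t K (E x)) = f (E x)"
      using E_eval[OF l x] E_eval_eps_t[OF f x] by simp
  qed (use x in simp_all)
  then show ?thesis using eps_t_in_R[of "E x"] x by simp
qed

lemma linear_E [lin]: "linear_between V K g \<Longrightarrow> linear_between V K (\<lambda>x. E (g x))"
proof (erule linear_between_comp[rotated], rule linear_betweenI)
  fix x y assume [simp]: "x \<in> carrier K" "y \<in> carrier K"
  show "E (x \<oplus> y) = E x \<oplus> E y"
  proof (rule functional_eqI)
    fix f assume f: "klin f"
    have "klin (\<lambda>x. sw x (\<lambda>a b. \<tau> b * f a))" by (intro lin klin_comp[OF f])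
    then show "f (E (x \<oplus> y)) = f (E x \<oplus> E y)"
      by (simp add: linear_betweenD[OF f] E_eval[OF f] linear_betweenD[of K CC "\<lambda>x. sw x _"])
  qed simp_all
next
  fix c x assume [simp]: "x \<in> carrier K"
  show "E (c \<odot> x) = c \<odot> E x"
  proof (rule functional_eqI)
    fix f assume f: "klin f"
    have "klin (\<lambda>x. sw x (\<lambda>a b. \<tau> b * f a))" by (intro lin klin_comp[OF f])
    then show "f (E (c \<odot> x)) = f (c \<odot> E x)"
      by (simp add: linear_betweenD[OF f] E_eval[OF f] linear_betweenD[of K CC "\<lambda>x. sw x _"])
  qed simp_all
qed simp

lemma E_left:
  assumes z: "z \<in> R" and x: "x \<in> carrier K"
  shows "E (z \<otimes> x) = z \<otimes> E x"
proof (rule functional_eqI)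
  fix f assume f: "klin f"
  have b: "kbil (\<lambda>a b. \<tau> b * f a)" by (intro lin klin_comp[OF f])
  have l: "klin (\<lambda>x. f (z \<otimes> x))" using z by (intro lin klin_comp[OF f]; simp)
  show "f (E (z \<otimes> x)) = f (z \<otimes> E x)"
    using z x by (simp add: E_eval[OF f] sw_R_left[OF z x b] E_eval[OF l])
qed (use z x in simp_all)

lemma E_right:
  assumes z: "z \<in> R" and x: "x \<in> carrier K"
  shows "E (x \<otimes> z) = E x \<otimes> z"
proof (rule functional_eqI)
  fix f assume f: "klin f"
  have b: "kbil (\<lambda>a b. \<tau> b * f a)" by (intro lin klin_comp[OF f])
  have l: "klin (\<lambda>x. f (x \<otimes> z))" using z by (intro lin klin_comp[OF f]; simp)
  show "f (E (x \<otimes> z)) = f (E x \<otimes> z)"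
    using z x by (simp add: E_eval[OF f] sw_R_right[OF z x b] E_eval[OF l])
qed (use z x in simp_all)

lemma tr_E: 
  assumes x: "x \<in> carrier K"
  shows "\<tau> (E x) = \<tau> x"
proof -
  have "\<tau> (E x) = sw x (\<lambda>a b. \<tau> b * \<epsilon> a)"
    by (simp add: E_eval_eps_t[OF tr_linear x] tr_eps_t cong: sw_cong_simp)
  then show ?thesis
    using sw_counit_left[OF tr_linear x] by (simp add: mult.commute)
qed

lemma sw_one_tr: "klin f \<Longrightarrow> sw \<one> (\<lambda>a b. \<tau> b * f a) = f \<one>"
proof -
  assume f: "klin f"
  have b: "kbil (\<lambda>a b. \<tau> b * f a)" by (intro lin klin_comp[OF f])
  have "sw \<one> (\<lambda>a b. \<tau> b * f a) = sw \<one> (\<lambda>a b. \<epsilon> b * f a)"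
    using sw_one_eps_t[OF b] by (simp add: tr_eps_t cong: sw_cong_simp)
  then show ?thesis by (simp add: sw_counit_right[OF f])
qed

lemma E_one [simp]: "E \<one> = \<one>"
  by (rule functional_eqI) (simp_all add: E_eval sw_one_tr)

lemma E_R: "z \<in> R \<Longrightarrow> E z = z"
  using E_left[of z \<one>] by simp

lemma E_star:
  assumes x: "x \<in> carrier K"
  shows "E (star K x) = star K (E x)"
proof (rule functional_eqI)
  fix f assume f: "klin f"
  have b: "kbil (\<lambda>a b. \<tau> b * f a)" by (intro lin klin_comp[OF f])
  have "f (E (star K x)) = cnj (sw x (\<lambda>a b. \<tau> b * cnj (f (star K a))))"
    using x by (simp add: E_eval[OF f] sw_star[OF x b] tr_star cong: sw_cong_simp)
  also have "\<dots> = f (star K (E x))"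
    using E_eval[OF linear_cnj_star[OF f] x] by (metis complex_cnj_cnj)
  finally show "f (E (star K x)) = f (star K (E x))" .
qed (use x in simp_all)

section \<open>Uniqueness of the conditional expectation and strong invariance of the trace\<close>

lemma diff_eq_zeroD:
  assumes "x \<in> carrier K" "y \<in> carrier K" "x \<oplus> (-1) \<odot> y = \<zero>"
  shows "x = y"
proof -
  note rs = ring.ring_simprules[OF ring_A]
  have "\<ominus> y \<in> carrier K" "x \<oplus> \<ominus> y = \<zero>"
    using assms complex_spaceD(8)[OF complex_space_K, of y] by (auto simp: rs)
  then have "(x \<oplus> \<ominus> y) \<oplus> y = y" using assms(2) by (simp only: rs)
  moreover have "(x \<oplus> \<ominus> y) \<oplus> y = x \<oplus> (\<ominus> y \<oplus> y)"
    using assms(1,2) \<open>\<ominus> y \<in> carrier K\<close> by (simp only: rs)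
  moreover have "x \<oplus> (\<ominus> y \<oplus> y) = x"
    using assms(1,2) by (simp only: rs)
  ultimately show ?thesis by simp
qed

text \<open>The difference d of both sides lies in \<open>R\<close>. Taking z = d^* and using that
  \<open>E\<close> preserves the trace and is right \<open>R\<close>-linear gives \<tau>(d^* d) = 0,
  so faithfulness applies.\<close>

lemma E_unique:
  assumes c: "c \<in> R" and w: "w \<in> carrier K" and eq: "\<And>z. z \<in> R \<Longrightarrow> \<tau> (c \<otimes> z) = \<tau> (w \<otimes> z)"
  shows "c = E w"
proof -
  define d where "d = c \<oplus> (-1) \<odot> E w"
  have d: "d \<in> R" unfolding d_def using c w by simp
  have "\<tau> (d \<otimes> star K d) = \<tau> (c \<otimes> star K d) - \<tau> (E w \<otimes> star K d)"
    using c w d by (subst (1) d_def) (simp add: A_distrib_right smult_mult_left tr_simps)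
  also have "E w \<otimes> star K d = E (w \<otimes> star K d)"
    using w d by (simp add: E_right)
  finally have "\<tau> (star K d \<otimes> d) = 0"
    using eq[of "star K d"] w d by (simp add: tr_E tr_comm)
  then have "d = \<zero>" using tr_faithful[of d] d by simp
  then show ?thesis using diff_eq_zeroD[of c "E w"] c w by (simp add: d_def)
qed

text \<open>In Sweedler notation, E(w) = \<tau>(S(1_1) w) 1_2. The right side lies in
  \<open>R\<close> because the second leg of Delta(1) does. By \<open>E_unique\<close> it is enough
  to test it against z in \<open>R\<close>; there \<open>sw_antipode_R_right\<close> moves z from
  the second leg into the first, and 1_1 \<tau>(1_2) = 1 finishes.\<close>

lemma E_antipode_eval:
  assumes f: "klin f" and w: "w \<in> carrier K"
  shows "f (E w) = sw \<one> (\<lambda>a b. \<tau> (S a \<otimes> w) * f b)"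
proof -
  obtain c where c: "c \<in> carrier K" "\<And>f. klin f \<Longrightarrow> f c = sw \<one> (\<lambda>a b. f (\<tau> (S a \<otimes> w) \<odot> b))"
    by (rule sw_exists[of \<one> "\<lambda>a b. \<tau> (S a \<otimes> w) \<odot> b"]) auto
  have c': "f c = sw \<one> (\<lambda>a b. \<tau> (S a \<otimes> w) * f b)" if f: "klin f" for f
    using c(2)[OF f] by (simp add: linear_betweenD[OF f] cong: sw_cong_simp)
  have "eps_t K c = c"
  proof (rule functional_eqI)
    fix f assume f: "klin f"
    have l: "klin (\<lambda>x. f (eps_t K x))" by (intro lin klin_comp[OF f])
    have b: "kbil (\<lambda>a b. \<tau> (S a \<otimes> w) * f b)" using w by (intro lin klin_comp[OF f]; simp)
    show "f (eps_t K c) = f c"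
      unfolding c'[OF l] c'[OF f] by (rule sw_one_eps_t[OF b])
  qed (use c in simp_all)
  then have cR: "c \<in> R" using eps_t_in_R[OF c(1)] by simp
  have "\<tau> (c \<otimes> z) = \<tau> (w \<otimes> z)" if z: "z \<in> R" for z
  proof -
    have l: "klin (\<lambda>c. \<tau> (c \<otimes> z))" and l2: "klin (\<lambda>a. \<tau> (z \<otimes> (S a \<otimes> w)))" using z w by (intro lin; simp)+
    have b: "kbil (\<lambda>a b. \<tau> (S a \<otimes> w) * \<tau> b)" using w by (intro lin; simp)
    have "\<tau> (c \<otimes> z) = sw \<one> (\<lambda>a b. \<tau> (S (a \<otimes> S z) \<otimes> w) * \<tau> b)"
      using z by (simp add: c'[OF l] sw_antipode_R_right[OF z _ b])
    also have "\<dots> = sw \<one> (\<lambda>a b. \<tau> b * \<tau> (z \<otimes> (S a \<otimes> w)))"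
      using z w by (intro sw_cong) (simp add: antipode_mult A_assoc)
    also have "\<dots> = \<tau> (w \<otimes> z)"
      using z w by (simp add: sw_one_tr[OF l2] tr_comm)
    finally show ?thesis .
  qed
  then have "c = E w" by (rule E_unique[OF cR w])
  then show ?thesis using c'[OF f] by simp
qed

text \<open>Expanding \<open>E\<close> gives x_1 y_2 S(y_1) \<tau>(x_2 y_3). Here y_2 S(y_1)
  collapses to S(eps_t), and \<open>sw_antipode_eps_t\<close> leaves Delta(1) with y multiplied into
  its second leg; this Delta(1) is absorbed by Delta(x).\<close>

lemma E_mult_antipode_left:
  assumes f: "klin f" and x: "x \<in> carrier K" and y: "y \<in> carrier K"
  shows "sw y (\<lambda>a b. f (E (x \<otimes> b) \<otimes> S a)) = sw x (\<lambda>c d. f c * \<tau> (d \<otimes> y))"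
proof -
  note fl = klin_comp[OF f]
  have "sw y (\<lambda>a b. f (E (x \<otimes> b) \<otimes> S a)) =
      sw y (\<lambda>a b. sw x (\<lambda>c d. sw b (\<lambda>c' d'. \<tau> (d \<otimes> d') * f (c \<otimes> (c' \<otimes> S a)))))"
  proof (rule sw_cong)
    fix a b assume ab: "a \<in> carrier K" "b \<in> carrier K"
    have l: "klin (\<lambda>u. f (u \<otimes> S a))" using ab by (intro lin fl; simp)
    have bb: "kbil (\<lambda>c d. \<tau> d * f (c \<otimes> S a))" using ab by (intro lin fl; simp)
    show "f (E (x \<otimes> b) \<otimes> S a) = sw x (\<lambda>c d. sw b (\<lambda>c' d'. \<tau> (d \<otimes> d') * f (c \<otimes> (c' \<otimes> S a))))"
      using ab x by (simp add: E_eval[OF l] sw_mult[OF x _ bb] A_assoc cong: sw_cong_simp)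
  qed
  also have "\<dots> = sw x (\<lambda>c d. sw y (\<lambda>a b. sw b (\<lambda>c' d'. \<tau> (d \<otimes> d') * f (c \<otimes> (c' \<otimes> S a)))))"
    by (rule sw_swap)
  also have "\<dots> = sw x (\<lambda>c d. sw \<one> (\<lambda>a b. \<tau> (d \<otimes> (b \<otimes> y)) * f (c \<otimes> a)))"
  proof (rule sw_cong)
    fix c d assume cd: "c \<in> carrier K" "d \<in> carrier K"
    have t: "ktri (\<lambda>a c' d'. \<tau> (d \<otimes> d') * f (c \<otimes> (c' \<otimes> S a)))" using cd by (intro lin fl; simp)
    have b: "kbil (\<lambda>a b. \<tau> (d \<otimes> b) * f (c \<otimes> a))" using cd by (intro lin fl; simp)
    have "sw y (\<lambda>a b. sw b (\<lambda>c' d'. \<tau> (d \<otimes> d') * f (c \<otimes> (c' \<otimes> S a)))) =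
        sw y (\<lambda>a b. sw a (\<lambda>a' c'. \<tau> (d \<otimes> b) * f (c \<otimes> (c' \<otimes> S a'))))"
      by (rule sw_coassoc[OF y t, symmetric])
    also have "\<dots> = sw y (\<lambda>a b. \<tau> (d \<otimes> b) * f (c \<otimes> S (eps_t K a)))"
    proof (rule sw_cong)
      fix a b assume ab: "a \<in> carrier K" "b \<in> carrier K"
      have l: "klin (\<lambda>u. \<tau> (d \<otimes> b) * f (c \<otimes> u))" using ab cd by (intro lin fl; simp)
      show "sw a (\<lambda>a' c'. \<tau> (d \<otimes> b) * f (c \<otimes> (c' \<otimes> S a'))) = \<tau> (d \<otimes> b) * f (c \<otimes> S (eps_t K a))"
        using antipode_eps_t_eval[OF l ab(1)] by simp
    qed
    also have "\<dots> = sw \<one> (\<lambda>a b. \<tau> (d \<otimes> (b \<otimes> y)) * f (c \<otimes> a))"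
      by (rule sw_antipode_eps_t[OF b y])
    finally show "sw y (\<lambda>a b. sw b (\<lambda>c' d'. \<tau> (d \<otimes> d') * f (c \<otimes> (c' \<otimes> S a)))) =
        sw \<one> (\<lambda>a b. \<tau> (d \<otimes> (b \<otimes> y)) * f (c \<otimes> a))" .
  qed
  also have "\<dots> = sw (x \<otimes> \<one>) (\<lambda>c d. f c * \<tau> (d \<otimes> y))"
  proof -
    have b: "kbil (\<lambda>c d. f c * \<tau> (d \<otimes> y))" using y by (intro lin fl; simp)
    show ?thesis
      using y by (simp only: sw_mult[OF x A_closed(1) b]) (simp add: A_assoc mult.commute cong: sw_cong_simp)
  qed
  finally show ?thesis using x by simp
qed

text \<open>With \<open>E_antipode_eval\<close> the left side is \<tau>(S(1_1) x y_2) 1_2 S(y_1).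
  Replacing Delta(1) by its flipped image under \<open>S\<close> turns this into S(y_1 1_1) \<tau>(x
  y_2 1_2), where Delta(1) is absorbed by Delta(y).\<close>

lemma E_mult_antipode_right:
  assumes f: "klin f" and x: "x \<in> carrier K" and y: "y \<in> carrier K"
  shows "sw y (\<lambda>a b. f (E (x \<otimes> b) \<otimes> S a)) = sw y (\<lambda>a b. f (S a) * \<tau> (x \<otimes> b))"
proof -
  note fl = klin_comp[OF f]
  have "sw y (\<lambda>a b. f (E (x \<otimes> b) \<otimes> S a)) =
      sw y (\<lambda>a b. sw \<one> (\<lambda>c d. f (S (a \<otimes> c)) * \<tau> (x \<otimes> (b \<otimes> d))))"
  proof (rule sw_cong)
    fix a b assume ab: "a \<in> carrier K" "b \<in> carrier K"
    have l: "klin (\<lambda>u. f (u \<otimes> S a))" using ab by (intro lin fl; simp)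
    have bb: "kbil (\<lambda>c d. f (S (a \<otimes> c)) * \<tau> (x \<otimes> (b \<otimes> d)))" using ab x by (intro lin fl; simp)
    have "f (E (x \<otimes> b) \<otimes> S a) = sw \<one> (\<lambda>c d. \<tau> (S c \<otimes> (x \<otimes> b)) * f (d \<otimes> S a))"
      using ab x by (simp add: E_antipode_eval[OF l])
    also have "\<dots> = sw \<one> (\<lambda>c d. f (S (a \<otimes> S d)) * \<tau> (x \<otimes> (b \<otimes> S c)))"
      using ab x by (intro sw_cong) (simp add: antipode_mult tr_comm[of "S _" "x \<otimes> b"] A_assoc mult.commute)
    also have "\<dots> = sw \<one> (\<lambda>c d. f (S (a \<otimes> c)) * \<tau> (x \<otimes> (b \<otimes> d)))"
      by (rule sw_one_antipode[OF bb, symmetric])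
    finally show "f (E (x \<otimes> b) \<otimes> S a) = sw \<one> (\<lambda>c d. f (S (a \<otimes> c)) * \<tau> (x \<otimes> (b \<otimes> d)))" .
  qed
  also have "\<dots> = sw (y \<otimes> \<one>) (\<lambda>a b. f (S a) * \<tau> (x \<otimes> b))"
  proof -
    have b: "kbil (\<lambda>a b. f (S a) * \<tau> (x \<otimes> b))" using x by (intro lin fl; simp)
    show ?thesis by (simp only: sw_mult[OF y A_closed(1) b])
  qed
  finally show ?thesis using y by simp
qed

text \<open>Strong left invariance of the Haar trace: \<open>x\<^sub>1 \<tau>(x\<^sub>2 y) = S(y\<^sub>1) \<tau>(x y\<^sub>2)\<close>. Both sides equal
  \<open>E(x y\<^sub>2) S(y\<^sub>1)\<close>.\<close>

lemma left_invariance: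
  assumes f: "klin f" and x: "x \<in> carrier K" and y: "y \<in> carrier K"
  shows "sw x (\<lambda>a b. f a * \<tau> (b \<otimes> y)) = sw y (\<lambda>a b. f (S a) * \<tau> (x \<otimes> b))"
  using E_mult_antipode_left[OF assms] E_mult_antipode_right[OF assms] by simp

text \<open>On \<open>R\<close> the trace is invariant under \<open>S\<close>, so \<tau>(x) =
  \<tau>(S(E(x))) = \<tau>(S(x_1)) \<tau>(x_2), and this last expression does not change when x is
  replaced by S(x).\<close>

lemma tr_antipode [simp]:
  assumes x: "x \<in> carrier K"
  shows "\<tau> (S x) = \<tau> x"
proof -
  have l: "klin (\<lambda>x. \<tau> (S x))" by (intro lin)
  have b: "kbil (\<lambda>a b. \<tau> b * \<tau> (S a))" by (intro lin)
  have "\<tau> x = \<tau> (S (E x))"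
    using x by (simp add: tr_antipode_R tr_E)
  also have "\<dots> = sw x (\<lambda>a b. \<tau> b * \<tau> (S a))"
    by (rule E_eval[OF l x])
  also have "\<dots> = sw (S x) (\<lambda>a b. \<tau> b * \<tau> (S a))"
    by (subst sw_antipode[OF x b]) (simp add: mult.commute cong: sw_cong_simp)
  also have "\<dots> = \<tau> (S (E (S x)))"
    by (rule E_eval[OF l, symmetric]) (use x in simp)
  also have "\<dots> = \<tau> (S x)"
    using x by (simp add: tr_antipode_R tr_E)
  finally show ?thesis by simp
qed

text \<open>\<open>left_invariance\<close> for \<open>S x\<close> and \<open>S y\<close>, carried
  back by the invariance of the trace under \<open>S\<close>.\<close>

lemma right_invariance:
  assumes f: "klin f" and x: "x \<in> carrier K" and y: "y \<in> carrier K"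
  shows "sw x (\<lambda>a b. \<tau> (y \<otimes> a) * f b) = sw y (\<lambda>a b. f (S b) * \<tau> (a \<otimes> x))"
proof -
  have l: "klin (\<lambda>u. f (S u))" by (intro lin klin_comp[OF f])
  have b1: "kbil (\<lambda>a b. f (S a) * \<tau> (b \<otimes> S y))" and b2: "kbil (\<lambda>a b. f a * \<tau> (S x \<otimes> b))"
    using x y by (intro lin klin_comp[OF f]; simp)+
  have t: "\<tau> (S a \<otimes> S b) = \<tau> (b \<otimes> a)" if "a \<in> carrier K" "b \<in> carrier K" for a b
    using that by (simp flip: antipode_mult)
  have "sw (S x) (\<lambda>a b. f (S a) * \<tau> (b \<otimes> S y)) = sw (S y) (\<lambda>a b. f (S (S a)) * \<tau> (S x \<otimes> b))"
    by (rule left_invariance[OF l]) (use x y in simp_all)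
  then show ?thesis
    using x y by (simp add: sw_antipode[OF x b1] sw_antipode[OF y b2] t mult.commute cong: sw_cong_simp)
qed

end


subsection \<open>The Haar projection\<close>

locale markov_kac_algebra = haar_kac_algebra K \<tau> for K :: "'k weak_kac" (structure) and \<tau> +
  fixes p :: 'k and lam :: real
  assumes haar_projection: "is_Haar_projection K p"
    and lam_pos: "lam > 0"
    and markov: "E p = complex_of_real lam \<odot> \<one>"
begin

lemma p_closed [simp]: "p \<in> carrier K"
  and mult_p: "x \<in> carrier K \<Longrightarrow> x \<otimes> p = eps_t K x \<otimes> p"
  and eps_p: "eps_s K p = \<one>" "eps_t K p = \<one>"
  using haar_projection unfolding is_Haar_projection_def by blast+

text \<open>Delta(z) = Delta(1) (z \<otimes> 1) makes S(z_1) z_2 equal to S(z) S(1_1) 1_2, and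
  S(1_1) 1_2 is 1.\<close>

lemma eps_s_R: "z \<in> R \<Longrightarrow> eps_s K z = S z"
proof (rule functional_eqI)
  fix f assume z: "z \<in> R" and f: "klin f"
  have b: "kbil (\<lambda>a b. f (S a \<otimes> b))" by (intro lin klin_comp[OF f]; simp)
  have l: "klin (\<lambda>u. f (S z \<otimes> u))" using z by (intro lin klin_comp[OF f]; simp)
  have e1: "eps_s K \<one> = \<one>" using eps_s_antipode[of \<one>] by simp
  have "f (eps_s K z) = sw \<one> (\<lambda>a b. f (S z \<otimes> (S a \<otimes> b)))"
    using z by (simp add: antipode_eps_s_eval[OF f] sw_R_one_right[OF z b] antipode_mult A_assoc cong: sw_cong_simp)
  also have "\<dots> = f (S z \<otimes> eps_s K \<one>)"
    using antipode_eps_s_eval[OF l, of \<one>] by simp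
  finally show "f (eps_s K z) = f (S z)" using z by (simp add: e1)
qed simp_all

lemma antipode_R_mult_p: "z \<in> R \<Longrightarrow> S z \<otimes> p = z \<otimes> p"
  by (simp add: mult_p[of "S z"] eps_t_antipode eps_s_R)

lemma sw_antipode_R_mult:
  assumes z: "z \<in> R" and h: "h \<in> carrier K" and F: "kbil F"
  shows "sw (S z \<otimes> h) F = sw h (\<lambda>a b. F a (S z \<otimes> b))"
proof -
  note Fl = bilinear_on_comp[OF F]
  have b1: "kbil (\<lambda>a b. F a (S z \<otimes> b))" using z by (intro lin Fl; simp)
  have one: "sw (S z) G = sw \<one> (\<lambda>a b. G a (S z \<otimes> b))" if G: "kbil G" for G
  proof -
    note Gl = bilinear_on_comp[OF G]
    have b1: "kbil (\<lambda>a b. G (S b) (S a))" by (intro lin Gl; simp)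
    have b2: "kbil (\<lambda>a b. G a (S z \<otimes> b))" using z by (intro lin Gl; simp)
    show ?thesis
      using z by (simp add: sw_antipode[OF _ G] sw_R_one_right[OF z b1] sw_one_antipode[OF b2] antipode_mult
        cong: sw_cong_simp)
  qed
  have b2: "kbil (\<lambda>a b. sw h (\<lambda>c d. F (a \<otimes> c) (b \<otimes> d)))"
    using h by (intro lin Fl; simp)
  have "sw (S z \<otimes> h) F = sw \<one> (\<lambda>a b. sw h (\<lambda>c d. F (a \<otimes> c) ((S z \<otimes> b) \<otimes> d)))"
    using z h by (simp add: sw_mult[OF _ _ F] one[OF b2])
  also have "\<dots> = sw (\<one> \<otimes> h) (\<lambda>a b. F a (S z \<otimes> b))"
    using z by (simp only: sw_mult[OF A_closed(1) h b1]) (simp add: A_assoc cong: sw_cong_simp)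
  finally show ?thesis using h by simp
qed

text \<open>The element \<open>p\<^sub>1 \<otimes> S(p\<^sub>2)\<close> is a Casimir element; this makes \<open>p\<^sub>1\<close> and \<open>S(p\<^sub>2)\<close> dual bases for
  the trace form, up to the factor \<open>\<lambda>\<close>.\<close>

lemma casimir:
  assumes x: "x \<in> carrier K" and F: "kbil F"
  shows "sw p (\<lambda>a b. F (x \<otimes> a) (S b)) = sw p (\<lambda>a b. F a (S b \<otimes> x))"
proof -
  note Fl = bilinear_on_comp[OF F]
  let ?G = "\<lambda>u v. sw p (\<lambda>a b. F (u \<otimes> a) (S b \<otimes> v))"
  have G: "kbil ?G" by (intro lin Fl; simp)
  have t: "ktri (\<lambda>x1 x2 x3. sw p (\<lambda>a b. F (x1 \<otimes> a) (S (x2 \<otimes> b) \<otimes> x3)))" by (intro lin Fl; simp)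
  have bx: "kbil (\<lambda>a b. F (x \<otimes> a) (S b))" using x by (intro lin Fl; simp)
  \<comment> \<open>The tensor x_1 p_1 \<otimes> S(x_2 p_2) x_3 is computed in two ways. First
    S(x_2) x_3 collapses to \<open>eps_s\<close>, and \<open>sw_eps_s_right\<close> leaves a
    Delta(1) that is absorbed by Delta(p).\<close>
  have "sw x (\<lambda>x1 x'. sw x' (\<lambda>x2 x3. sw p (\<lambda>a b. F (x1 \<otimes> a) (S (x2 \<otimes> b) \<otimes> x3)))) =
      sw p (\<lambda>a b. F (x \<otimes> a) (S b))"
  proof -
    have "sw x (\<lambda>x1 x'. sw x' (\<lambda>x2 x3. sw p (\<lambda>a b. F (x1 \<otimes> a) (S (x2 \<otimes> b) \<otimes> x3)))) =
        sw x (\<lambda>x1 x'. ?G x1 (eps_s K x'))"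
    proof (rule sw_cong)
      fix x1 x' assume xx: "x1 \<in> carrier K" "x' \<in> carrier K"
      have l: "klin (?G x1)" using xx by (intro lin Fl; simp)
      show "sw x' (\<lambda>x2 x3. sw p (\<lambda>a b. F (x1 \<otimes> a) (S (x2 \<otimes> b) \<otimes> x3))) = ?G x1 (eps_s K x')"
        unfolding antipode_eps_s_eval[OF l xx(2)]
        by (intro sw_cong) (simp add: antipode_mult A_assoc)
    qed
    also have "\<dots> = sw \<one> (\<lambda>u v. ?G (x \<otimes> u) (S v))"
      by (rule sw_eps_s_right[OF G x])
    also have "\<dots> = sw (\<one> \<otimes> p) (\<lambda>a b. F (x \<otimes> a) (S b))"
      using x by (simp only: sw_mult[OF A_closed(1) p_closed bx]) (simp add: A_assoc antipode_mult cong: sw_cong_simp)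
    finally show ?thesis by simp
  qed
  \<comment> \<open>The other way starts from x_1 p_1 \<otimes> x_2 p_2 = Delta(x' p), which is
    Delta(eps_t(x') p) by the defining property of the Haar projection.\<close>
  moreover have "sw x (\<lambda>x1 x'. sw x' (\<lambda>x2 x3. sw p (\<lambda>a b. F (x1 \<otimes> a) (S (x2 \<otimes> b) \<otimes> x3)))) =
      sw p (\<lambda>a b. F a (S b \<otimes> x))"
  proof -
    have "sw x (\<lambda>x1 x'. sw x' (\<lambda>x2 x3. sw p (\<lambda>a b. F (x1 \<otimes> a) (S (x2 \<otimes> b) \<otimes> x3)))) =
        sw x (\<lambda>x' x3. sw x' (\<lambda>x1 x2. sw p (\<lambda>a b. F (x1 \<otimes> a) (S (x2 \<otimes> b) \<otimes> x3))))"
      by (rule sw_coassoc[OF x t, symmetric])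
    also have "\<dots> = sw x (\<lambda>x' x3. ?G (eps_t K x') x3)"
    proof (rule sw_cong)
      fix x' x3 assume xx: "x' \<in> carrier K" "x3 \<in> carrier K"
      have b: "kbil (\<lambda>a b. F a (S b \<otimes> x3))" using xx by (intro lin Fl; simp)
      have "sw x' (\<lambda>x1 x2. sw p (\<lambda>a b. F (x1 \<otimes> a) (S (x2 \<otimes> b) \<otimes> x3))) = sw (x' \<otimes> p) (\<lambda>a b. F a (S b \<otimes> x3))"
        by (rule sw_mult[OF xx(1) p_closed b, symmetric])
      also have "\<dots> = ?G (eps_t K x') x3"
        using xx by (simp add: mult_p[of x'] sw_R_left[OF _ _ b])
      finally show "sw x' (\<lambda>x1 x2. sw p (\<lambda>a b. F (x1 \<otimes> a) (S (x2 \<otimes> b) \<otimes> x3))) = ?G (eps_t K x') x3" .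
    qed
    also have "\<dots> = sw \<one> (\<lambda>u v. ?G (S u) (v \<otimes> x))"
      by (rule sw_eps_t_left[OF G x])
    also have "\<dots> = sw \<one> (\<lambda>u v. ?G v (S u \<otimes> x))"
    proof -
      have b: "kbil (\<lambda>u v. ?G v (S u \<otimes> x))" using x by (intro lin Fl; simp)
      show ?thesis by (simp add: sw_one_antipode[OF b] cong: sw_cong_simp)
    qed
    \<comment> \<open>The factor \<open>v\<close> is put into \<open>R\<close> in order to cross
      \<open>p\<close>: for z in \<open>R\<close> one has z p = S(z) p, and S(z) multiplies the
      second leg of Delta(p), where \<open>S\<close> turns it back into z.\<close>
    also have "\<dots> = sw \<one> (\<lambda>u v. ?G (eps_t K v) (S u \<otimes> x))"
    proof -
      have b: "kbil (\<lambda>u v. ?G v (S u \<otimes> x))" using x by (intro lin Fl; simp)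
      show ?thesis by (rule sw_one_eps_t[OF b, symmetric])
    qed
    also have "\<dots> = sw \<one> (\<lambda>u v. sw p (\<lambda>a b. F a (S b \<otimes> (eps_t K v \<otimes> (S u \<otimes> x)))))"
    proof (rule sw_cong)
      fix u v assume uv: "u \<in> carrier K" "v \<in> carrier K"
      have b: "kbil (\<lambda>a b. F a (S b \<otimes> (S u \<otimes> x)))" using uv x by (intro lin Fl; simp)
      have "?G (eps_t K v) (S u \<otimes> x) = sw (S (eps_t K v) \<otimes> p) (\<lambda>a b. F a (S b \<otimes> (S u \<otimes> x)))"
        using uv by (simp only: antipode_R_mult_p eps_t_in_R sw_R_left[OF eps_t_in_R p_closed b])
      also have "\<dots> = sw p (\<lambda>a b. F a (S b \<otimes> (eps_t K v \<otimes> (S u \<otimes> x))))"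
        using uv x by (simp add: sw_antipode_R_mult[OF _ _ b] antipode_mult A_assoc cong: sw_cong_simp)
      finally show "?G (eps_t K v) (S u \<otimes> x) = sw p (\<lambda>a b. F a (S b \<otimes> (eps_t K v \<otimes> (S u \<otimes> x))))" .
    qed
    also have "\<dots> = sw \<one> (\<lambda>u v. sw p (\<lambda>a b. F a (S b \<otimes> ((v \<otimes> S u) \<otimes> x))))"
    proof -
      have b: "kbil (\<lambda>u v. sw p (\<lambda>a b. F a (S b \<otimes> (v \<otimes> (S u \<otimes> x)))))" using x by (intro lin Fl; simp)
      show ?thesis using x by (simp add: sw_one_eps_t[OF b] A_assoc cong: sw_cong_simp)
    qed
    also have "\<dots> = sw p (\<lambda>a b. F a (S b \<otimes> x))"
    proof -
      have l: "klin (\<lambda>y. sw p (\<lambda>a b. F a (S b \<otimes> (y \<otimes> x))))" using x by (intro lin Fl; simp)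
      show ?thesis using antipode_eps_t_eval[OF l, of \<one>] x by simp
    qed
    finally show ?thesis .
  qed
  ultimately show ?thesis by simp
qed

text \<open>By \<open>casimir\<close> the left side is f(x p_1) \<tau>(p_2) = f(x E(p)). Here the
  Markov condition enters.\<close>

lemma dual_basis:
  fixes f :: "'k \<Rightarrow> complex"
  assumes f: "klin f" and x: "x \<in> carrier K"
  shows "sw p (\<lambda>a b. f a * \<tau> (S b \<otimes> x)) = complex_of_real lam * f x"
proof -
  have b: "kbil (\<lambda>a b. f a * \<tau> b)" by (intro lin klin_comp[OF f])
  have l: "klin (\<lambda>y. f (x \<otimes> y))" using x by (intro lin klin_comp[OF f]; simp)
  have "sw p (\<lambda>a b. f a * \<tau> (S b \<otimes> x)) = sw p (\<lambda>a b. \<tau> b * f (x \<otimes> a))"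
    using casimir[OF x b] by (simp add: mult.commute cong: sw_cong_simp)
  also have "\<dots> = f (x \<otimes> E p)"
    by (rule E_eval[OF l, symmetric]) simp
  finally show ?thesis
    using x by (simp add: markov smult_mult_right linear_betweenD[OF f])
qed

text \<open>Cyclicity of the trace brings p_1 S(p_2) together, which is eps_t(p) = 1. In view of
  \<open>dual_basis\<close> the left side is lam times the operator trace of left multiplication by
  \<open>e\<close>.\<close>

lemma tr_left_mult:
  assumes e: "e \<in> carrier K"
  shows "sw p (\<lambda>a b. \<tau> (S b \<otimes> (e \<otimes> a))) = \<tau> e"
proof -
  have l: "klin (\<lambda>u. \<tau> (u \<otimes> e))" using e by (intro lin; simp)
  have "sw p (\<lambda>a b. \<tau> (S b \<otimes> (e \<otimes> a))) = sw p (\<lambda>a b. \<tau> ((a \<otimes> S b) \<otimes> e))"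
  proof (rule sw_cong)
    fix a b assume "a \<in> carrier K" "b \<in> carrier K"
    then show "\<tau> (S b \<otimes> (e \<otimes> a)) = \<tau> ((a \<otimes> S b) \<otimes> e)"
      using e tr_comm[of "S b \<otimes> e" a] by (simp add: A_assoc)
  qed
  also have "\<dots> = \<tau> e"
    using eps_t_antipode_eval[OF l p_closed] e by (simp add: eps_p)
  finally show ?thesis .
qed

text \<open>Now S(p_2) p_1 is adjacent already, and it equals S(eps_s(p)) = 1.\<close>

lemma tr_right_mult:
  assumes e: "e \<in> carrier K"
  shows "sw p (\<lambda>a b. \<tau> (S b \<otimes> (a \<otimes> e))) = \<tau> e"
proof -
  have l: "klin (\<lambda>u. \<tau> (u \<otimes> e))" using e by (intro lin; simp)
  show ?thesis
    using antipode_eps_s_eval'[OF l p_closed] e by (simp add: eps_p A_assoc cong: sw_cong_simp)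
qed

end

section \<open>Orthonormal families\<close>

context weak_kac_algebra begin

lemma sw_sum: "(\<Sum>i\<in>I. sw h (F i)) = sw h (\<lambda>a b. \<Sum>i\<in>I. F i a b)"
proof -
  have "(\<Sum>i\<in>I. sw h (F i)) = tensor_eval (comult K h)
      (\<lambda>a b. \<Sum>i\<in>I. if a \<in> carrier K \<and> b \<in> carrier K then F i a b else 0)"
    by (simp add: sw_def tensor_eval_sum)
  also have "\<dots> = sw h (\<lambda>a b. \<Sum>i\<in>I. F i a b)"
    unfolding sw_def by (rule arg_cong[of _ _ "tensor_eval _"]) (auto simp: fun_eq_iff)
  finally show ?thesis .
qed

text \<open>The chosen representative of Delta(h) is one fixed finite sum, so the bound depends on
  \<open>F\<close> only through \<open>G\<close>. It serves to bound the size of orthonormal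
  sets.\<close>

lemma sw_bound:
  assumes h: "h \<in> carrier K"
  obtains C where "\<And>F. (\<And>a b. a \<in> carrier K \<Longrightarrow> b \<in> carrier K \<Longrightarrow> cmod (F a b) \<le> G a b) \<Longrightarrow> cmod (sw h F) \<le> C"
proof
  let ?f = "SOME f. f \<in> comult K h"
  have k: "Poly_Mapping.keys ?f \<subseteq> carrier K \<times> carrier K"
    using KK.rep(2)[of "comult K h"] comult_closed[OF h] by (simp add: tensor_space_def)
  fix F assume F: "\<And>a b. a \<in> carrier K \<Longrightarrow> b \<in> carrier K \<Longrightarrow> cmod (F a b) \<le> G a b"
  show "cmod (sw h F) \<le> (\<Sum>q\<in>Poly_Mapping.keys ?f. cmod (Poly_Mapping.lookup ?f q) * G (fst q) (snd q))"
    unfolding sw_eval[OF h] tensor_eval_def formal_eval_def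
    by (rule order_trans[OF norm_sum sum_mono])
      (use k in \<open>auto simp: norm_mult subset_iff intro!: mult_left_mono F\<close>)
qed

definition lincomb :: "('k \<Rightarrow> complex) \<Rightarrow> 'k set \<Rightarrow> 'k" where
  "lincomb c B = finsum K (\<lambda>x. c x \<odot> x) B"

definition ksubspace :: "'k set \<Rightarrow> bool" where
  "ksubspace N \<longleftrightarrow> N \<subseteq> carrier K \<and> \<zero> \<in> N \<and> (\<forall>x\<in>N. \<forall>y\<in>N. x \<oplus> y \<in> N) \<and> (\<forall>c. \<forall>x\<in>N. c \<odot> x \<in> N)"

lemma ksubspaceD:
  assumes "ksubspace N"
  shows "x \<in> N \<Longrightarrow> x \<in> carrier K" "\<zero> \<in> N" "x \<in> N \<Longrightarrow> y \<in> N \<Longrightarrow> x \<oplus> y \<in> N" "x \<in> N \<Longrightarrow> c \<odot> x \<in> N"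
  using assms by (auto simp: ksubspace_def)

lemma abelian_group_K: "abelian_group K"
  by (rule complex_spaceD(1)[OF complex_space_K])

lemma abelian_monoid_K: "abelian_monoid K"
  using abelian_group_K by (rule abelian_group.axioms)

lemma finsum_in_ksubspace:
  assumes N: "ksubspace N" and "finite B" "\<And>x. x \<in> B \<Longrightarrow> g x \<in> N"
  shows "finsum K g B \<in> N"
  using assms(2,3)
proof (induction B)
  case empty
  show ?case using ksubspaceD(2)[OF N] by (simp add: abelian_monoid.finsum_empty[OF abelian_monoid_K])
next
  case (insert x B)
  have "finsum K g (insert x B) = g x \<oplus> finsum K g B"
    using insert ksubspaceD(1)[OF N] by (intro abelian_monoid.finsum_insert[OF abelian_monoid_K]) auto
  then show ?case using insert ksubspaceD(3)[OF N] by auto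
qed

lemma ksubspace_carrier: "ksubspace (carrier K)"
  by (simp add: ksubspace_def)

lemma lincomb_in: "ksubspace N \<Longrightarrow> finite B \<Longrightarrow> B \<subseteq> N \<Longrightarrow> lincomb c B \<in> N"
  unfolding lincomb_def by (rule finsum_in_ksubspace) (auto intro: ksubspaceD(4))

lemma functional_finsum:
  assumes "klin f" "finite I" "\<And>i. i \<in> I \<Longrightarrow> g i \<in> carrier K"
  shows "f (finsum K g I) = (\<Sum>i\<in>I. f (g i))"
  by (rule linear_functional_finsum[OF assms(1) complex_space_K assms(2,3)])

lemma functional_lincomb:
  assumes "klin f" "finite B" "B \<subseteq> carrier K"
  shows "f (lincomb c B) = (\<Sum>x\<in>B. c x * f x)"
  unfolding lincomb_def using assms
  by (subst functional_finsum) (auto simp: linear_betweenD[OF assms(1)] intro!: sum.cong)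

lemma finsum_closed_K: "finite I \<Longrightarrow> (\<And>i. i \<in> I \<Longrightarrow> g i \<in> carrier K) \<Longrightarrow> finsum K g I \<in> carrier K"
  by (rule finsum_in_ksubspace[OF ksubspace_carrier])

end

section \<open>The inner product given by the Haar trace\<close>

context haar_kac_algebra begin

definition ip :: "'k \<Rightarrow> 'k \<Rightarrow> complex" where "ip x y = \<tau> (star K x \<otimes> y)"

lemma linear_ip [lin]: "linear_between V K g \<Longrightarrow> x \<in> carrier K \<Longrightarrow> linear_between V CC (\<lambda>y. ip x (g y))"
  unfolding ip_def by (intro lin; simp)

lemma klin_ip: "x \<in> carrier K \<Longrightarrow> klin (ip x)"
  using linear_ip[OF linear_between_id] by simp

lemma ip_simps:
  "x \<in> carrier K \<Longrightarrow> y \<in> carrier K \<Longrightarrow> z \<in> carrier K \<Longrightarrow> ip x (y \<oplus> z) = ip x y + ip x z"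
  "x \<in> carrier K \<Longrightarrow> y \<in> carrier K \<Longrightarrow> ip x (c \<odot> y) = c * ip x y"
  "x \<in> carrier K \<Longrightarrow> y \<in> carrier K \<Longrightarrow> z \<in> carrier K \<Longrightarrow> ip (x \<oplus> y) z = ip x z + ip y z"
  "x \<in> carrier K \<Longrightarrow> y \<in> carrier K \<Longrightarrow> ip (c \<odot> x) y = cnj c * ip x y"
  by (simp_all add: ip_def star_add star_smult A_distrib_left A_distrib_right smult_mult_left smult_mult_right tr_simps)

lemma ip_cnj: "x \<in> carrier K \<Longrightarrow> y \<in> carrier K \<Longrightarrow> cnj (ip x y) = ip y x"
  unfolding ip_def by (simp add: star_mult flip: tr_star)

lemma ip_self: "x \<in> carrier K \<Longrightarrow> ip x x = of_real (Re (ip x x))" "x \<in> carrier K \<Longrightarrow> Re (ip x x) \<ge> 0"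
  using tr_pos[of x] unfolding ip_def by (auto elim!: nonneg_Reals_cases)

lemma ip_self_eq_0: "x \<in> carrier K \<Longrightarrow> ip x x = 0 \<Longrightarrow> x = \<zero>"
  unfolding ip_def by (rule tr_faithful)

lemma ip_self_pos: "x \<in> carrier K \<Longrightarrow> x \<noteq> \<zero> \<Longrightarrow> Re (ip x x) > 0"
  using ip_self[of x] ip_self_eq_0[of x] by (metis of_real_0 order_less_le)

definition orthonormal :: "'k set \<Rightarrow> bool" where
  "orthonormal B \<longleftrightarrow> finite B \<and> B \<subseteq> carrier K \<and> (\<forall>x\<in>B. \<forall>y\<in>B. ip x y = (if x = y then 1 else 0))"

lemma orthonormalD:
  assumes "orthonormal B"
  shows "finite B" "x \<in> B \<Longrightarrow> x \<in> carrier K" "x \<in> B \<Longrightarrow> y \<in> B \<Longrightarrow> ip x y = (if x = y then 1 else 0)"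
  using assms by (auto simp: orthonormal_def)

definition residue :: "'k set \<Rightarrow> 'k \<Rightarrow> 'k" where
  "residue B v = v \<oplus> (-1) \<odot> lincomb (\<lambda>x. ip x v) B"

lemma lincomb_closed: "orthonormal B \<Longrightarrow> lincomb c B \<in> carrier K"
  by (rule lincomb_in[OF ksubspace_carrier]) (auto simp: orthonormal_def)

lemma residue_closed: "orthonormal B \<Longrightarrow> v \<in> carrier K \<Longrightarrow> residue B v \<in> carrier K"
  unfolding residue_def by (simp add: lincomb_closed)

lemma functional_residue:
  assumes "orthonormal B" "v \<in> carrier K" "klin f"
  shows "f (residue B v) = f v - (\<Sum>x\<in>B. ip x v * f x)"
  unfolding residue_def using assms orthonormalD[OF assms(1)] lincomb_closed[OF assms(1)]
  by (simp add: linear_betweenD[OF assms(3)] functional_lincomb subset_iff)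

lemma ip_residue:
  assumes B: "orthonormal B" and v: "v \<in> carrier K" and x: "x \<in> B"
  shows "ip x (residue B v) = 0"
proof -
  have "(\<Sum>z\<in>B. ip z v * ip x z) = (\<Sum>z\<in>B. if z = x then ip z v else 0)"
    using x orthonormalD(3)[OF B] by (intro sum.cong) auto
  then show ?thesis
    using functional_residue[OF B v klin_ip[of x]] orthonormalD(1,2)[OF B] x by simp
qed

lemma bessel:
  assumes B: "orthonormal B" and v: "v \<in> carrier K"
  shows "(\<Sum>x\<in>B. (cmod (ip x v))\<^sup>2) \<le> Re (ip v v)"
proof -
  note Bc = orthonormalD(2)[OF B]
  let ?w = "residue B v"
  have w: "?w \<in> carrier K" by (rule residue_closed[OF B v])
  have wx: "ip ?w x = 0" if "x \<in> B" for x
    using ip_cnj[OF Bc[OF that] w] ip_residue[OF B v that] by simp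
  have "ip ?w ?w = ip ?w v"
    using functional_residue[OF B v klin_ip[OF w]] wx by simp
  also have "\<dots> = cnj (ip v ?w)"
    using ip_cnj[OF v w] by simp
  also have "ip v ?w = ip v v - (\<Sum>x\<in>B. ip x v * cnj (ip x v))"
    using functional_residue[OF B v klin_ip[OF v]] ip_cnj[OF Bc v] by simp
  also have "(\<Sum>x\<in>B. ip x v * cnj (ip x v)) = of_real (\<Sum>x\<in>B. (cmod (ip x v))\<^sup>2)"
    by (simp only: complex_norm_square of_real_sum)
  finally have "Re (ip ?w ?w) = Re (ip v v) - (\<Sum>x\<in>B. (cmod (ip x v))\<^sup>2)"
    by simp
  then show ?thesis using ip_self(2)[OF w] by simp
qed

end

context markov_kac_algebra begin

text \<open>Summing \<open>dual_basis\<close> over an orthonormal set \<open>B\<close>, with f = ip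
  x at each of its members x, gives lam * card B on one side. On the other side stands a sum over
  the fixed representative of Delta(p) whose terms Bessel's inequality bounds independently of
  \<open>B\<close>.\<close>

lemma orthonormal_bound: 
  obtains C :: nat where "\<And>B. orthonormal B \<Longrightarrow> card B \<le> C"
proof -
  let ?G = "\<lambda>a b. Re (ip a a) + Re (ip (star K (S b)) (star K (S b)))"
  obtain C where C: "\<And>F. (\<And>a b. a \<in> carrier K \<Longrightarrow> b \<in> carrier K \<Longrightarrow> cmod (F a b) \<le> ?G a b) \<Longrightarrow> cmod (sw p F) \<le> C"
    using sw_bound[OF p_closed, of ?G] by blast
  have "card B \<le> nat \<lceil>C / lam\<rceil>" if B: "orthonormal B" for B
  proof -
    note Bc = orthonormalD(2)[OF B]
    have t: "\<tau> (S b \<otimes> x) = cnj (ip x (star K (S b)))" if "x \<in> carrier K" "b \<in> carrier K" for x b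
      using that unfolding ip_def by (simp add: star_mult flip: tr_star)
    have "complex_of_real lam * of_nat (card B) = (\<Sum>x\<in>B. complex_of_real lam * ip x x)"
      using orthonormalD(3)[OF B] by simp
    also have "\<dots> = (\<Sum>x\<in>B. sw p (\<lambda>a b. ip x a * \<tau> (S b \<otimes> x)))"
      using dual_basis[OF klin_ip] Bc by simp
    also have "\<dots> = sw p (\<lambda>a b. \<Sum>x\<in>B. ip x a * cnj (ip x (star K (S b))))"
      using Bc by (subst sw_sum) (auto intro!: sw_cong sum.cong simp: t)
    finally have e: "complex_of_real lam * of_nat (card B) = sw p (\<lambda>a b. \<Sum>x\<in>B. ip x a * cnj (ip x (star K (S b))))" .
    have "cmod (complex_of_real lam * of_nat (card B)) \<le> C"
      unfolding e
    proof (rule C)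
      fix a b assume ab: "a \<in> carrier K" "b \<in> carrier K"
      let ?c = "star K (S b)"
      have "cmod (\<Sum>x\<in>B. ip x a * cnj (ip x ?c)) \<le> (\<Sum>x\<in>B. cmod (ip x a) * cmod (ip x ?c))"
        by (rule order_trans[OF norm_sum]) (simp add: norm_mult)
      also have "\<dots> \<le> (\<Sum>x\<in>B. (cmod (ip x a))\<^sup>2 + (cmod (ip x ?c))\<^sup>2)"
      proof (rule sum_mono)
        fix x
        have "0 \<le> (cmod (ip x a) - cmod (ip x ?c))\<^sup>2" by simp
        then have "2 * (cmod (ip x a) * cmod (ip x ?c)) \<le> (cmod (ip x a))\<^sup>2 + (cmod (ip x ?c))\<^sup>2"
          by (simp add: power2_diff)
        moreover have "0 \<le> cmod (ip x a) * cmod (ip x ?c)" by simp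
        ultimately show "cmod (ip x a) * cmod (ip x ?c) \<le> (cmod (ip x a))\<^sup>2 + (cmod (ip x ?c))\<^sup>2"
          by linarith
      qed
      also have "\<dots> \<le> ?G a b"
        unfolding sum.distrib using bessel[OF B, of a] bessel[OF B, of ?c] ab by simp
      finally show "cmod (\<Sum>x\<in>B. ip x a * cnj (ip x ?c)) \<le> ?G a b" .
    qed
    then have "lam * card B \<le> C" using lam_pos by (simp add: norm_mult)
    then have "card B \<le> C / lam" using lam_pos by (simp add: field_simps)
    then show ?thesis by linarith
  qed
  then show ?thesis by (rule that)
qed

definition onb :: "'k set \<Rightarrow> 'k set \<Rightarrow> bool" where
  "onb N B \<longleftrightarrow> orthonormal B \<and> B \<subseteq> N \<and> (\<forall>v\<in>N. \<forall>f. klin f \<longrightarrow> f v = (\<Sum>x\<in>B. ip x v * f x))"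

lemma onbD:
  assumes "onb N B"
  shows "orthonormal B" "finite B" "x \<in> B \<Longrightarrow> x \<in> N" "x \<in> B \<Longrightarrow> x \<in> carrier K"
    "x \<in> B \<Longrightarrow> y \<in> B \<Longrightarrow> ip x y = (if x = y then 1 else 0)"
    "v \<in> N \<Longrightarrow> klin f \<Longrightarrow> (\<Sum>x\<in>B. ip x v * f x) = f v"
  using assms orthonormalD[of B] by (auto simp: onb_def)

text \<open>By \<open>orthonormal_bound\<close> there is an orthonormal subset of \<open>N\<close>
  of greatest cardinality. A nonzero residue could be normalized and added to it, so all residues
  vanish, which is the expansion property.\<close>

lemma onb_exists:
  assumes N: "ksubspace N"
  obtains B where "onb N B"
proof -
  obtain C :: nat where C: "\<And>B. orthonormal B \<Longrightarrow> card B \<le> C" using orthonormal_bound by blast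
  let ?P = "\<lambda>B. orthonormal B \<and> B \<subseteq> N"
  have "?P {}" by (simp add: orthonormal_def)
  then obtain B where B: "?P B" and max: "\<And>B'. ?P B' \<Longrightarrow> card B' \<le> card B"
    using ex_has_greatest_nat[of ?P "{}" card "Suc C"] C less_Suc_eq_le by blast
  note Bc = orthonormalD(2)[of B] and fin = orthonormalD(1)[of B]
  have "residue B v = \<zero>" if v: "v \<in> N" for v
  proof (rule ccontr)
    let ?w = "residue B v"
    assume nz: "?w \<noteq> \<zero>"
    have vc: "v \<in> carrier K" using ksubspaceD(1)[OF N v] .
    have wN: "?w \<in> N"
      unfolding residue_def using ksubspaceD[OF N] v lincomb_in[OF N] B fin by blast
    have w: "?w \<in> carrier K" using ksubspaceD(1)[OF N wN] .
    have pos: "Re (ip ?w ?w) > 0" by (rule ip_self_pos[OF w nz])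
    define c where "c = 1 / sqrt (Re (ip ?w ?w))"
    define y where "y = complex_of_real c \<odot> ?w"
    have y: "y \<in> carrier K" "y \<in> N" using w ksubspaceD(4)[OF N wN] by (simp_all add: y_def)
    have "ip y y = complex_of_real (c * c * Re (ip ?w ?w))"
      using w ip_self(1)[OF w] by (simp add: y_def ip_simps)
    also have "c * c * Re (ip ?w ?w) = 1"
      using pos by (simp add: c_def field_simps)
    finally have yy: "ip y y = 1" by simp
    have xy: "ip x y = 0" "ip y x = 0" if "x \<in> B" for x
    proof -
      show "ip x y = 0" using ip_residue[of B v x] B vc that w Bc[of x] by (simp add: y_def ip_simps)
      then show "ip y x = 0" using ip_cnj[of x y] Bc[of x] B y that by simp
    qed
    have "y \<notin> B" using xy[of y] yy by auto
    have "?P (insert y B)"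
      using B yy xy y unfolding orthonormal_def by auto
    then have "card (insert y B) \<le> card B" by (rule max)
    then show False using \<open>y \<notin> B\<close> fin B by simp
  qed
  then have "f v = (\<Sum>x\<in>B. ip x v * f x)" if "v \<in> N" "klin f" for v f
    using functional_residue[of B v f] B that ksubspaceD(1)[OF N that(1)]
      linear_between_zero[OF that(2) complex_space_K complex_space_CC] by simp
  then have "onb N B" using B by (simp add: onb_def)
  then show ?thesis by (rule that)
qed

lemma orthogonal_projection:
  assumes N: "ksubspace N" and w: "w \<in> carrier K"
  obtains f where "f \<in> N" "\<And>x. x \<in> N \<Longrightarrow> ip x f = ip x w"
proof -
  obtain B where B: "onb N B" using onb_exists[OF N] by blast
  note O = onbD(1)[OF B]
  let ?f = "lincomb (\<lambda>x. ip x w) B"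
  have f: "?f \<in> N" by (rule lincomb_in[OF N]) (use onbD[OF B] in auto)
  have fc: "?f \<in> carrier K" using ksubspaceD(1)[OF N f] .
  have "ip x ?f = ip x w" if x: "x \<in> N" for x
  proof -
    have xc: "x \<in> carrier K" using ksubspaceD(1)[OF N x] .
    let ?r = "residue B w"
    have r: "?r \<in> carrier K" by (rule residue_closed[OF O w])
    have "ip ?r x = (\<Sum>b\<in>B. ip b x * ip ?r b)"
      by (rule onbD(6)[OF B x klin_ip[OF r], symmetric])
    also have "\<dots> = 0"
      using ip_residue[OF O w] ip_cnj[OF r] onbD(4)[OF B] by (intro sum.neutral) (metis complex_cnj_zero complex_cnj_cnj mult_zero_right)
    finally have "ip x ?r = 0" using ip_cnj[OF xc r] by simp
    then show ?thesis
      unfolding residue_def using xc w fc by (simp add: ip_simps)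
  qed
  with f show ?thesis by (rule that)
qed

end

section \<open>Minimal projections of the target Cartan subalgebra\<close>

lemma linear_sum [lin]:
  "(\<And>i. i \<in> I \<Longrightarrow> linear_between V CC (H i)) \<Longrightarrow> linear_between V CC (\<lambda>x. \<Sum>i\<in>I. H i x)"
  by (simp add: linear_between_def sum.distrib sum_distrib_left)

context star_algebra begin

lemma A_zero [simp]: "x \<in> carrier A \<Longrightarrow> x \<otimes> \<zero> = \<zero>" "x \<in> carrier A \<Longrightarrow> \<zero> \<otimes> x = \<zero>"
    "x \<in> carrier A \<Longrightarrow> x \<oplus> \<zero> = x" "x \<in> carrier A \<Longrightarrow> \<zero> \<oplus> x = x"
  and star_zero [simp]: "star A \<zero> = \<zero>"
proof -
  note V = complex_spaceD[OF star_algebra_complex_space[OF star_algebra_axioms]]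
  show "x \<in> carrier A \<Longrightarrow> x \<otimes> \<zero> = \<zero>" "x \<in> carrier A \<Longrightarrow> \<zero> \<otimes> x = \<zero>"
    using smult_mult_left[of \<one> x 0] smult_mult_right[of x \<one> 0] by (simp_all add: V(7))
  show "x \<in> carrier A \<Longrightarrow> x \<oplus> \<zero> = x" "x \<in> carrier A \<Longrightarrow> \<zero> \<oplus> x = x"
    using ring.ring_simprules[OF ring_A] by auto
  show "star A \<zero> = \<zero>"
    using star_smult[of \<zero> 0] by (simp add: V(7))
qed

end

context markov_kac_algebra begin

lemma smult_zero_K [simp]: "x \<in> carrier K \<Longrightarrow> 0 \<odot> x = \<zero>" "c \<odot> \<zero> = \<zero>" "x \<in> carrier K \<Longrightarrow> 1 \<odot> x = x"
proof -
  note V = complex_spaceD[OF complex_space_K]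
  show "x \<in> carrier K \<Longrightarrow> 0 \<odot> x = \<zero>" "x \<in> carrier K \<Longrightarrow> 1 \<odot> x = x" by (simp_all add: V(6,7))
  show "c \<odot> \<zero> = \<zero>" using V(5)[of \<zero> c 0] by (simp add: V(7))
qed

lemma zero_in_R [simp]: "\<zero> \<in> R"
  using smult_in_R[of \<one> 0] by simp

lemma ksubspace_R: "ksubspace R"
  by (auto simp: ksubspace_def)

lemma functional_zero: "klin f \<Longrightarrow> f \<zero> = 0"
  using linear_between_zero[OF _ complex_space_K complex_space_CC] by simp

lemma eps_s_one [simp]: "eps_s K \<one> = \<one>"
  using eps_s_antipode[of \<one>] by simp

text \<open>The matrix of \<open>T\<close> on \<open>N\<close> in an orthonormal basis is a nonempty
  complex square matrix, so its spectrum is nonempty; an eigenvector of it gives the coordinates of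
  \<open>x\<close>.\<close>

lemma eigenvector_exists:
  assumes N: "ksubspace N" and v0: "v0 \<in> N" "v0 \<noteq> \<zero>"
    and T: "linear_between K K T" and TN: "\<And>x. x \<in> N \<Longrightarrow> T x \<in> N"
  obtains c x where "x \<in> N" "x \<noteq> \<zero>" "T x = c \<odot> x"
proof -
  obtain B where B: "onb N B" using onb_exists[OF N] by blast
  obtain xs where xs: "set xs = B" "distinct xs"
    using finite_distinct_list[OF onbD(2)[OF B]] by blast
  define n where "n = length xs"
  have xsB: "xs ! i \<in> B" if "i < n" for i using xs that by (auto simp: n_def)
  note xc = onbD(4)[OF B xsB] and xN = onbD(3)[OF B xsB]
  have sumB: "(\<Sum>b\<in>B. g b) = (\<Sum>i\<in>{0..<n}. g (xs ! i))" for g :: "'k \<Rightarrow> complex"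
    using sum.reindex_bij_betw[OF bij_betw_nth[OF xs(2) _ xs(1)[symmetric]], of "{0..<n}" g]
    by (simp add: n_def lessThan_atLeast0)
  have "n > 0"
  proof (rule ccontr)
    assume "\<not> n > 0"
    then have "B = {}" using xs by (simp add: n_def)
    then have "v0 = \<zero>"
      using onbD(6)[OF B v0(1)] ksubspaceD(1)[OF N v0(1)]
      by (intro functional_eqI) (simp_all add: functional_zero)
    then show False using v0 by simp
  qed
  define A where "A = mat n n (\<lambda>(i, j). ip (xs ! i) (T (xs ! j)))"
  have A: "A \<in> carrier_mat n n" by (simp add: A_def)
  obtain c v where v: "v \<in> carrier_vec n" "v \<noteq> 0\<^sub>v n" "A *\<^sub>v v = c \<cdot>\<^sub>v v"
    using spectrum_non_empty[OF A \<open>n > 0\<close>] A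
    by (auto simp: spectrum_def eigenvalue_def eigenvector_def)
  define x where "x = finsum K (\<lambda>j. (v $ j) \<odot> (xs ! j)) {0..<n}"
  have xK: "x \<in> N" unfolding x_def
    by (rule finsum_in_ksubspace[OF N]) (auto intro!: ksubspaceD(4)[OF N] xN)
  have fx: "f x = (\<Sum>j\<in>{0..<n}. v $ j * f (xs ! j))" if f: "klin f" for f
    unfolding x_def by (subst functional_finsum[OF f]) (auto simp: xc linear_betweenD[OF f] intro!: sum.cong)
  have "T x = c \<odot> x"
  proof (rule functional_eqI)
    fix f assume f: "klin f"
    have fT: "klin (\<lambda>y. f (T y))" by (rule linear_between_comp[OF f T])
    have "f (T x) = (\<Sum>j\<in>{0..<n}. v $ j * f (T (xs ! j)))" by (rule fx[OF fT])
    also have "\<dots> = (\<Sum>j\<in>{0..<n}. v $ j * (\<Sum>i\<in>{0..<n}. A $$ (i, j) * f (xs ! i)))"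
    proof (rule sum.cong[OF refl])
      fix j assume j: "j \<in> {0..<n}"
      have "f (T (xs ! j)) = (\<Sum>b\<in>B. ip b (T (xs ! j)) * f b)"
        by (rule onbD(6)[OF B _ f, symmetric]) (use j in \<open>auto intro: TN xN\<close>)
      then show "v $ j * f (T (xs ! j)) = v $ j * (\<Sum>i\<in>{0..<n}. A $$ (i, j) * f (xs ! i))"
        using j by (simp add: sumB A_def)
    qed
    also have "\<dots> = (\<Sum>i\<in>{0..<n}. (\<Sum>j\<in>{0..<n}. A $$ (i, j) * v $ j) * f (xs ! i))"
      unfolding sum_distrib_left sum_distrib_right by (subst sum.swap) (simp add: algebra_simps)
    also have "\<dots> = (\<Sum>i\<in>{0..<n}. (c * v $ i) * f (xs ! i))"
    proof (rule sum.cong[OF refl])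
      fix i assume i: "i \<in> {0..<n}"
      have "(\<Sum>j\<in>{0..<n}. A $$ (i, j) * v $ j) = (A *\<^sub>v v) $ i"
        using i v(1) A by (simp add: scalar_prod_def)
      then show "(\<Sum>j\<in>{0..<n}. A $$ (i, j) * v $ j) * f (xs ! i) = (c * v $ i) * f (xs ! i)"
        using i v by simp
    qed
    also have "\<dots> = c * f x"
      by (simp add: fx[OF f] sum_distrib_left mult.assoc)
    finally show "f (T x) = f (c \<odot> x)"
      using ksubspaceD(1)[OF N xK] by (simp add: linear_betweenD[OF f])
  qed (use ksubspaceD(1)[OF N xK] linear_betweenD(1)[OF T] in auto)
  moreover have "x \<noteq> \<zero>"
  proof
    assume "x = \<zero>"
    have "v $ i = 0" if i: "i < n" for i
    proof -
      have "ip (xs ! i) (xs ! j) = (if j = i then 1 else 0)" if "j < n" for j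
        using onbD(5)[OF B xsB[OF i] xsB[OF that]] i that xs(2) by (auto simp: n_def nth_eq_iff_index_eq)
      then have "ip (xs ! i) x = (\<Sum>j\<in>{0..<n}. if j = i then v $ j else 0)"
        unfolding fx[OF klin_ip[OF xc[OF i]]] by (intro sum.cong) auto
      then show ?thesis using i \<open>x = \<zero>\<close> functional_zero[OF klin_ip[OF xc[OF i]]] by simp
    qed
    then have "v = 0\<^sub>v n" using v(1) by (intro eq_vecI) auto
    then show False using v(2) by simp
  qed
  ultimately show ?thesis using that xK by blast
qed

definition pr :: "'k \<Rightarrow> bool" where "pr e \<longleftrightarrow> e \<in> R \<and> e \<otimes> e = e \<and> star K e = e"

lemma prD: assumes "pr e" shows "e \<in> R" "e \<otimes> e = e" "star K e = e" "e \<in> carrier K"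
    "x \<in> carrier K \<Longrightarrow> e \<otimes> (e \<otimes> x) = e \<otimes> x"
  using assms unfolding pr_def by (simp_all flip: A_assoc)

lemma pr_one: "pr \<one>"
  by (simp add: pr_def)

text \<open>An orthogonal decomposition of the unit into nonzero projections of \<open>R\<close>.
  That the members add up to 1 is stated through functionals, the form in which it is applied to
  traces and to \<open>bidim\<close>.\<close>

definition decomposition :: "'k set \<Rightarrow> bool" where
  "decomposition P \<longleftrightarrow> finite P \<and> (\<forall>e\<in>P. pr e \<and> e \<noteq> \<zero>) \<and>
     (\<forall>e\<in>P. \<forall>f\<in>P. e \<noteq> f \<longrightarrow> e \<otimes> f = \<zero>) \<and> (\<forall>h. klin h \<longrightarrow> (\<Sum>e\<in>P. h e) = h \<one>)"

lemma decompositionD: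
  assumes "decomposition P"
  shows "finite P" "e \<in> P \<Longrightarrow> pr e" "e \<in> P \<Longrightarrow> e \<noteq> \<zero>"
    "e \<in> P \<Longrightarrow> f \<in> P \<Longrightarrow> e \<noteq> f \<Longrightarrow> e \<otimes> f = \<zero>" "klin h \<Longrightarrow> (\<Sum>e\<in>P. h e) = h \<one>"
  using assms unfolding decomposition_def by blast+

lemma tr_pr_pos: "pr e \<Longrightarrow> e \<noteq> \<zero> \<Longrightarrow> \<tau> e = of_real (Re (\<tau> e)) \<and> Re (\<tau> e) > 0"
  using ip_self[of e] ip_self_pos[of e] prD[of e] by (simp add: ip_def)

text \<open>The members are pairwise orthogonal for the trace inner product, so dividing each by the
  square root of its trace yields an orthonormal set of the same size.\<close>

lemma decomposition_card:
  obtains C :: nat where "\<And>P. decomposition P \<Longrightarrow> card P \<le> C"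
proof -
  obtain C :: nat where C: "\<And>B. orthonormal B \<Longrightarrow> card B \<le> C" using orthonormal_bound by blast
  have "card P \<le> C" if P: "decomposition P" for P
  proof -
    define r where "r e = 1 / sqrt (Re (\<tau> e))" for e
    define g where "g e = complex_of_real (r e) \<odot> e" for e
    have prP: "e \<in> carrier K" "e \<otimes> e = e" "star K e = e" if "e \<in> P" for e
      using prD[OF decompositionD(2)[OF P that]] by auto
    have ipg: "ip (g e) (g f) = (if e = f then 1 else 0)" if ef: "e \<in> P" "f \<in> P" for e f
    proof (cases "e = f")
      case True
      have t: "\<tau> e = of_real (Re (\<tau> e))" "Re (\<tau> e) > 0"
        using tr_pr_pos[of e] decompositionD[OF P] ef by blast+
      have "ip (g e) (g e) = of_real (r e * r e) * \<tau> e"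
        using prP[OF ef(1)] by (simp add: g_def ip_simps) (simp add: ip_def)
      also have "\<dots> = of_real (r e * r e * Re (\<tau> e))"
        by (simp only: of_real_mult flip: t(1))
      also have "r e * r e * Re (\<tau> e) = 1"
        using t(2) real_sqrt_mult_self[of "Re (\<tau> e)"] by (simp add: r_def field_simps)
      finally show ?thesis using True by (simp only: of_real_1 simp_thms if_True)
    next
      case False
      then show ?thesis
        using prP ef decompositionD(4)[OF P ef]
        by (simp add: g_def ip_simps) (simp add: ip_def functional_zero[OF tr_linear])
    qed
    have inj: "inj_on g P"
    proof (rule inj_onI, rule ccontr)
      fix e f assume "e \<in> P" "f \<in> P" "g e = g f" "e \<noteq> f"
      then show False using ipg[of e e] ipg[of e f] by simp
    qed
    have "orthonormal (g ` P)"
      unfolding orthonormal_def using decompositionD(1)[OF P] prP ipg inj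
      by (auto simp: g_def inj_on_def)
    then show ?thesis using C card_image[OF inj] by metis
  qed
  then show ?thesis by (rule that)
qed

text \<open>Replace \<open>e\<close> by \<open>f\<close> and e - f; the latter is again a nonzero
  projection, and both are orthogonal to the remaining members because \<open>e\<close> is.\<close>

lemma split_decomposition:
  assumes P: "decomposition P" and e: "e \<in> P" and f: "pr f" "e \<otimes> f = f" "f \<otimes> e = f" "f \<noteq> \<zero>" "f \<noteq> e"
  shows "\<exists>P'. decomposition P' \<and> card P < card P'"
proof -
  note pe = prD[OF decompositionD(2)[OF P e]] and pf = prD[OF f(1)]
  define g where "g = e \<oplus> (-1) \<odot> f"
  have gc: "g \<in> R" using pe pf by (simp add: g_def)
  have lin: "h g = h e - h f" if "klin h" for h
    using that pe pf by (simp add: g_def linear_betweenD[OF that])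
  have mult: "(e \<oplus> (-1) \<odot> f) \<otimes> x = e \<otimes> x \<oplus> (-1) \<odot> (f \<otimes> x)"
     "x \<otimes> (e \<oplus> (-1) \<odot> f) = x \<otimes> e \<oplus> (-1) \<odot> (x \<otimes> f)" if "x \<in> carrier K" for x
    using that pe pf by (simp_all add: A_distrib_left A_distrib_right smult_mult_left smult_mult_right)
  have zz: "x \<oplus> (-1) \<odot> x = \<zero>" if "x \<in> carrier K" for x
    using that complex_spaceD(3)[OF complex_space_K that, of 1 "-1"] by simp
  have gf: "g \<otimes> f = \<zero>" "f \<otimes> g = \<zero>"
    using pe pf f zz[of f] by (simp_all add: g_def mult)
  have eg: "e \<otimes> g = g" "g \<otimes> e = g" using pe pf f by (simp_all add: g_def mult)
  have gg: "g \<otimes> g = g"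
  proof -
    have "g \<otimes> g = e \<otimes> g \<oplus> (-1) \<odot> (f \<otimes> g)" unfolding g_def by (rule mult) (use pe pf in simp)
    then show ?thesis using eg gf gc by simp
  qed
  have gpr: "pr g" unfolding pr_def using gc gg pe pf by (simp add: g_def star_add star_smult)
  have g0: "g \<noteq> \<zero>" using diff_eq_zeroD[of e f] pe pf f(5) by (auto simp: g_def)
  have oth: "f \<otimes> h = \<zero>" "h \<otimes> f = \<zero>" "g \<otimes> h = \<zero>" "h \<otimes> g = \<zero>" if h: "h \<in> P - {e}" for h
  proof -
    have hc: "h \<in> carrier K" using prD[OF decompositionD(2)[OF P]] h by blast
    have he: "h \<otimes> e = \<zero>" "e \<otimes> h = \<zero>" using decompositionD(4)[OF P] h e by blast+
    have a: "x \<otimes> h = \<zero>" if "x \<otimes> e = x" "x \<in> carrier K" for x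
    proof -
      have "x \<otimes> h = (x \<otimes> e) \<otimes> h" using that by simp
      also have "\<dots> = \<zero>" using that(2) hc pe he by (simp only: A_assoc A_zero)
      finally show ?thesis .
    qed
    have b: "h \<otimes> x = \<zero>" if "e \<otimes> x = x" "x \<in> carrier K" for x
    proof -
      have "h \<otimes> x = h \<otimes> (e \<otimes> x)" using that by simp
      also have "\<dots> = (h \<otimes> e) \<otimes> x" using that(2) hc pe by (simp only: A_assoc)
      finally show ?thesis using that(2) he by simp
    qed
    show "f \<otimes> h = \<zero>" "h \<otimes> f = \<zero>" "g \<otimes> h = \<zero>" "h \<otimes> g = \<zero>"
      using a[of f] a[of g] b[of f] b[of g] f eg pf gc by auto
  qed
  have ff: "f \<notin> P - {e}" using oth(1)[of f] pf f(4) by auto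
  have gP: "g \<notin> P - {e}" using oth(3)[of g] gg g0 by auto
  have fg: "f \<noteq> g" using gf gg g0 by auto
  let ?P = "insert f (insert g (P - {e}))"
  have fin: "finite (P - {e})" using decompositionD(1)[OF P] by simp
  have "decomposition ?P"
    unfolding decomposition_def
  proof (intro conjI)
    show "finite ?P" using fin by simp
    show "\<forall>e\<in>?P. pr e \<and> e \<noteq> \<zero>" using f gpr g0 decompositionD[OF P] by auto
    show "\<forall>e\<in>?P. \<forall>f\<in>?P. e \<noteq> f \<longrightarrow> e \<otimes> f = \<zero>"
      using gf oth decompositionD(4)[OF P] by auto
    show "\<forall>h. klin h \<longrightarrow> (\<Sum>e\<in>?P. h e) = h \<one>"
    proof (intro allI impI)
      fix h assume h: "klin h"
      have "(\<Sum>e\<in>?P. h e) = h f + (h g + (\<Sum>e\<in>P - {e}. h e))"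
        using fin ff gP fg by simp
      also have "\<dots> = (\<Sum>e\<in>P. h e)"
        using lin[OF h] decompositionD(1)[OF P] e by (simp add: sum.remove)
      finally show "(\<Sum>e\<in>?P. h e) = h \<one>" using decompositionD(5)[OF P h] by simp
    qed
  qed
  moreover have "card ?P = card P + 1"
    using fin ff gP fg card_Suc_Diff1[OF decompositionD(1)[OF P] e] by simp
  ultimately show ?thesis by (intro exI[of _ ?P]) simp
qed

text \<open>Take a decomposition with the most members. For e in it and a in \<open>R\<close>, left
  multiplication by e a e has an eigenvector in e \<open>R\<close>. The eigenspace is a nonzero
  right ideal of \<open>R\<close> and is generated by a projection f with e f = f. Splitting e along
  f is impossible by maximality unless f = e, and then e a e is a multiple of e.\<close>

lemma minimal_projections:
  obtains P where "decomposition P" "\<And>e a. e \<in> P \<Longrightarrow> a \<in> R \<Longrightarrow> \<exists>c. e \<otimes> (a \<otimes> e) = c \<odot> e"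
proof -
  obtain C :: nat where C: "\<And>P. decomposition P \<Longrightarrow> card P \<le> C" using decomposition_card by blast
  have "decomposition {\<one>}" using pr_one nontrivial by (simp add: decomposition_def)
  then obtain P where P: "decomposition P" and max: "\<And>P'. decomposition P' \<Longrightarrow> card P' \<le> card P"
    using ex_has_greatest_nat[of decomposition "{\<one>}" card "Suc C"] C less_Suc_eq_le by blast
  have "\<exists>c. e \<otimes> (a \<otimes> e) = c \<odot> e" if e: "e \<in> P" and a: "a \<in> R" for e a
  proof -
    note pe = prD[OF decompositionD(2)[OF P e]]
    define a' where "a' = e \<otimes> (a \<otimes> e)"
    have a': "a' \<in> R" using a pe by (simp add: a'_def)
    have ea: "e \<otimes> a' = a'" using a pe by (simp add: a'_def)
    have ae: "a' \<otimes> e = a'" using a pe by (simp add: a'_def A_assoc)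
    define N where "N = {v \<in> R. e \<otimes> v = v}"
    have N: "ksubspace N" unfolding ksubspace_def N_def using pe
      by (auto simp: A_distrib_left smult_mult_right)
    obtain c x where x: "x \<in> N" "x \<noteq> \<zero>" "a' \<otimes> x = c \<odot> x"
    proof (rule eigenvector_exists[OF N, of e "\<lambda>x. a' \<otimes> x"])
      show "e \<in> N" "e \<noteq> \<zero>" using pe decompositionD(3)[OF P e] by (auto simp: N_def)
      show "linear_between K K (\<lambda>x. a' \<otimes> x)" using a' by (intro lin; simp)
      show "a' \<otimes> x \<in> N" if "x \<in> N" for x
        using that a' pe ea unfolding N_def by (simp flip: A_assoc)
    qed blast
    \<comment> \<open>The eigenspace, a right ideal of \<open>R\<close>. The orthogonal projection
      \<open>f\<close> of \<open>e\<close> onto it turns out to be a projection in \<open>R\<close>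
      with f v = v for all v in it.\<close>
    define M where "M = {v \<in> N. a' \<otimes> v = c \<odot> v}"
    have M: "ksubspace M"
      using N a' unfolding ksubspace_def M_def
      by (auto simp: A_distrib_left smult_mult_right subset_iff complex_spaceD(4)[OF complex_space_K]
          mult.commute simp flip: complex_spaceD(5)[OF complex_space_K])
    have MR: "v \<in> R" "e \<otimes> v = v" "a' \<otimes> v = c \<odot> v" "v \<in> carrier K" if "v \<in> M" for v
      using that by (auto simp: M_def N_def)
    have Mideal: "v \<otimes> y \<in> M" if v: "v \<in> M" and y: "y \<in> R" for v y
      using MR[OF v] y a' pe unfolding M_def N_def by (simp add: smult_mult_left flip: A_assoc)
    obtain f where f: "f \<in> M" "\<And>v. v \<in> M \<Longrightarrow> ip v f = ip v e"
      using orthogonal_projection[OF M, of e] pe by blast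
    note fc = MR[OF f(1)]
    \<comment> \<open>Since e - f is orthogonal to \<open>M\<close>, it may be tested on v y in
      \<open>M\<close>, where y is the difference of both sides. This gives \<tau>(y^* y) =
      0.\<close>
    have key: "star K v = star K v \<otimes> f" if v: "v \<in> M" for v
    proof -
      note vc = MR[OF v]
      define y where "y = star K v \<oplus> (-1) \<odot> (star K v \<otimes> f)"
      have y: "y \<in> R" using vc fc by (simp add: y_def)
      have ve: "star K v \<otimes> e = star K v"
        using star_mult[of e v] vc pe by simp
      have "\<tau> (star K y \<otimes> (star K v \<otimes> f)) = \<tau> (star K y \<otimes> (star K v \<otimes> e))"
        using f(2)[OF Mideal[OF v y]] y vc fc pe by (simp add: ip_def star_mult A_assoc)
      then have "\<tau> (star K y \<otimes> (star K v \<otimes> f)) = \<tau> (star K y \<otimes> star K v)" by (simp only: ve)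
      then have "\<tau> (star K y \<otimes> (star K v \<oplus> (-1) \<odot> (star K v \<otimes> f))) = 0"
        using y vc fc by (simp add: A_distrib_left smult_mult_right tr_simps)
      then have "\<tau> (star K y \<otimes> y) = 0" by (simp only: y_def)
      then have "y = \<zero>" using tr_faithful[of y] y by simp
      then show ?thesis unfolding y_def using diff_eq_zeroD[of "star K v"] vc fc by simp
    qed
    \<comment> \<open>The case v = f reads f^* = f^* f, and the right side is self-adjoint.\<close>
    have sf: "star K f = f"
      using star_mult[of "star K f" f] key[OF f(1)] fc by simp
    have "x \<in> M" using x by (simp add: M_def)
    have f0: "f \<noteq> \<zero>"
    proof
      assume "f = \<zero>"
      then have "star K x = \<zero>" using key[OF \<open>x \<in> M\<close>] MR[OF \<open>x \<in> M\<close>] by simp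
      then show False using x(2) MR[OF \<open>x \<in> M\<close>] star_star[of x] by simp
    qed
    have "pr f" using fc key[OF f(1)] sf by (simp add: pr_def)
    moreover have "f \<otimes> e = f"
      using star_mult[of e f] fc pe sf by simp
    ultimately have "f = e"
      using split_decomposition[OF P e, of f] fc f0 max by (metis not_less)
    then have "a' = c \<odot> e" using fc ae by simp
    then show ?thesis by (auto simp: a'_def)
  qed
  with P show ?thesis by (rule that)
qed

end

section \<open>The target Cartan subalgebra over itself and frames\<close>

context markov_kac_algebra begin

text \<open>For projections \<open>e\<close>, \<open>f\<close> the number \<open>bidim e f\<close> is the dimension of \<open>e R f\<close>.\<close>

definition bidim :: "'k \<Rightarrow> 'k \<Rightarrow> complex" where
  "bidim e f = sw \<one> (\<lambda>a b. \<tau> (S a \<otimes> (e \<otimes> (b \<otimes> f))))"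

lemma linear_bidim [lin]: "linear_between V K g \<Longrightarrow> f \<in> carrier K \<Longrightarrow> linear_between V CC (\<lambda>x. bidim (g x) f)"
  unfolding bidim_def by (intro lin; simp)

text \<open>The left side is the operator trace of r \<mapsto> e r f on \<open>R\<close>. For r in
  \<open>R\<close>, \<open>E_antipode_eval\<close> reads r = \<tau>(S(1_1) r) 1_2, so S(1_1) and 1_2
  are dual bases of \<open>R\<close> for the trace form and compute the same operator trace.\<close>

lemma bidim_onb:
  assumes B: "onb R B" and e: "e \<in> R" and f: "f \<in> R"
  shows "(\<Sum>r\<in>B. \<tau> (star K r \<otimes> (e \<otimes> (r \<otimes> f)))) = bidim e f"
proof -
  note Bc = onbD(4)[OF B] and BR = onbD(3)[OF B]
  let ?F = "\<lambda>a b. \<Sum>r\<in>B. ip r (e \<otimes> (b \<otimes> f)) * \<tau> (S a \<otimes> r)"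
  have b1: "kbil ?F" using e f Bc by (intro lin; simp)
  have b2: "kbil (\<lambda>a b. \<tau> (S a \<otimes> (e \<otimes> (b \<otimes> f))))" using e f by (intro lin; simp)
  have "(\<Sum>r\<in>B. \<tau> (star K r \<otimes> (e \<otimes> (r \<otimes> f)))) = (\<Sum>r\<in>B. sw \<one> (\<lambda>a b. ip r (e \<otimes> (b \<otimes> f)) * \<tau> (S a \<otimes> r)))"
  proof (rule sum.cong[OF refl])
    fix r assume r: "r \<in> B"
    have l: "klin (\<lambda>y. \<tau> (star K r \<otimes> (e \<otimes> (y \<otimes> f))))" using Bc[OF r] e f by (intro lin; simp)
    have "\<tau> (star K r \<otimes> (e \<otimes> (E r \<otimes> f))) = sw \<one> (\<lambda>a b. \<tau> (S a \<otimes> r) * \<tau> (star K r \<otimes> (e \<otimes> (b \<otimes> f))))"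
      by (rule E_antipode_eval[OF l Bc[OF r]])
    then show "\<tau> (star K r \<otimes> (e \<otimes> (r \<otimes> f))) = sw \<one> (\<lambda>a b. ip r (e \<otimes> (b \<otimes> f)) * \<tau> (S a \<otimes> r))"
      using BR[OF r] by (simp add: E_R ip_def mult.commute)
  qed
  also have "\<dots> = sw \<one> (\<lambda>a b. ?F a (eps_t K b))"
    by (simp only: sw_sum sw_one_eps_t[OF b1])
  also have "\<dots> = sw \<one> (\<lambda>a b. \<tau> (S a \<otimes> (e \<otimes> (eps_t K b \<otimes> f))))"
  proof (rule sw_cong)
    fix a b assume ab: "a \<in> carrier K" "b \<in> carrier K"
    have l: "klin (\<lambda>r. \<tau> (S a \<otimes> r))" using ab by (intro lin; simp)
    show "?F a (eps_t K b) = \<tau> (S a \<otimes> (e \<otimes> (eps_t K b \<otimes> f)))"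
      by (rule onbD(6)[OF B _ l]) (use ab e f in simp)
  qed
  also have "\<dots> = bidim e f"
    unfolding bidim_def by (rule sw_one_eps_t[OF b2])
  finally show ?thesis .
qed

lemma bidim_one_left: "f \<in> carrier K \<Longrightarrow> bidim \<one> f = \<tau> f"
proof -
  assume f: "f \<in> carrier K"
  have l: "klin (\<lambda>u. \<tau> (u \<otimes> f))" using f by (intro lin; simp)
  show ?thesis
    unfolding bidim_def using antipode_eps_s_eval[OF l, of \<one>] f by (simp add: A_assoc cong: sw_cong_simp)
qed

lemma bidim_one_right: "e \<in> carrier K \<Longrightarrow> bidim e \<one> = \<tau> e"
proof -
  assume e: "e \<in> carrier K"
  have l: "klin (\<lambda>u. \<tau> (u \<otimes> e))" using e by (intro lin; simp)
  have "bidim e \<one> = sw \<one> (\<lambda>a b. \<tau> ((b \<otimes> S a) \<otimes> e))"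
    unfolding bidim_def
  proof (rule sw_cong)
    fix a b assume "a \<in> carrier K" "b \<in> carrier K"
    then show "\<tau> (S a \<otimes> (e \<otimes> (b \<otimes> \<one>))) = \<tau> ((b \<otimes> S a) \<otimes> e)"
      using e tr_comm[of "S a \<otimes> e" b] by (simp add: A_assoc)
  qed
  then show ?thesis
    using antipode_eps_t_eval[OF l, of \<one>] e by simp
qed

lemma bidim_ip:
  assumes B: "onb R B" and e: "pr e" and f: "pr f"
  shows "bidim e f = (\<Sum>r\<in>B. ip (e \<otimes> (r \<otimes> f)) (e \<otimes> (r \<otimes> f)))"
proof -
  note pe = prD[OF e] and pf = prD[OF f]
  have "ip (e \<otimes> (r \<otimes> f)) (e \<otimes> (r \<otimes> f)) = \<tau> (star K r \<otimes> (e \<otimes> (r \<otimes> f)))" if "r \<in> B" for r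
  proof -
    have r: "r \<in> carrier K" using onbD(4)[OF B that] .
    have "ip (e \<otimes> (r \<otimes> f)) (e \<otimes> (r \<otimes> f)) = \<tau> (f \<otimes> (star K r \<otimes> (e \<otimes> (r \<otimes> f))))"
      using r pe pf by (simp add: ip_def star_mult A_assoc)
    also have "\<dots> = \<tau> ((star K r \<otimes> (e \<otimes> (r \<otimes> f))) \<otimes> f)"
      by (rule tr_comm) (use r pe pf in simp_all)
    finally show ?thesis using r pe pf by (simp add: A_assoc)
  qed
  then show ?thesis
    using bidim_onb[OF B pe(1) pf(1)] by simp
qed

lemma bidim_nonneg: "pr e \<Longrightarrow> pr f \<Longrightarrow> bidim e f = of_real (Re (bidim e f)) \<and> Re (bidim e f) \<ge> 0"
proof -
  assume ef: "pr e" "pr f"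
  obtain B where B: "onb R B" using onb_exists[OF ksubspace_R] by blast
  have c: "e \<otimes> (r \<otimes> f) \<in> carrier K" if "r \<in> B" for r
    using onbD(4)[OF B that] prD[OF ef(1)] prD[OF ef(2)] by simp
  have "bidim e f = (\<Sum>r\<in>B. of_real (Re (ip (e \<otimes> (r \<otimes> f)) (e \<otimes> (r \<otimes> f)))))"
    unfolding bidim_ip[OF B ef] using ip_self(1)[OF c] by (intro sum.cong) auto
  then have "bidim e f = of_real (\<Sum>r\<in>B. Re (ip (e \<otimes> (r \<otimes> f)) (e \<otimes> (r \<otimes> f))))"
    by simp
  moreover have "0 \<le> (\<Sum>r\<in>B. Re (ip (e \<otimes> (r \<otimes> f)) (e \<otimes> (r \<otimes> f))))"
    by (intro sum_nonneg ip_self(2) c)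
  ultimately show ?thesis by simp
qed

text \<open>\<open>bidim e e\<close> is the sum of the squared norms of e r e over an orthonormal
  basis of \<open>R\<close>. If it vanished, then e y e = 0 for all y in \<open>R\<close>, in
  particular for y = e.\<close>

lemma bidim_self_pos:
  assumes e: "pr e" "e \<noteq> \<zero>"
  shows "Re (bidim e e) > 0"
proof (rule ccontr)
  note pe = prD[OF e(1)]
  obtain B where B: "onb R B" using onb_exists[OF ksubspace_R] by blast
  have c: "e \<otimes> (r \<otimes> e) \<in> carrier K" if "r \<in> B" for r
    using onbD(4)[OF B that] pe by simp
  assume "\<not> Re (bidim e e) > 0"
  then have "(\<Sum>r\<in>B. Re (ip (e \<otimes> (r \<otimes> e)) (e \<otimes> (r \<otimes> e)))) = 0"
    using bidim_nonneg[OF e(1) e(1)] bidim_ip[OF B e(1) e(1)] by simp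
  then have "Re (ip (e \<otimes> (r \<otimes> e)) (e \<otimes> (r \<otimes> e))) = 0" if "r \<in> B" for r
    using that ip_self(2)[OF c]
      sum_nonneg_0[OF onbD(2)[OF B], of "\<lambda>r. Re (ip (e \<otimes> (r \<otimes> e)) (e \<otimes> (r \<otimes> e)))" r] by simp
  then have z: "e \<otimes> (r \<otimes> e) = \<zero>" if "r \<in> B" for r
    using ip_self(1)[OF c[OF that]] ip_self_eq_0[OF c[OF that]] that by simp
  have "e = \<zero>"
  proof (rule functional_eqI)
    fix g assume g: "klin g"
    have l: "klin (\<lambda>y. g (e \<otimes> (y \<otimes> e)))" using pe by (intro lin klin_comp[OF g]; simp)
    have "g (e \<otimes> (e \<otimes> e)) = (\<Sum>r\<in>B. ip r e * g (e \<otimes> (r \<otimes> e)))"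
      by (rule onbD(6)[OF B pe(1) l, symmetric])
    then show "g e = g \<zero>" using z pe by (simp add: functional_zero[OF g])
  qed (use pe in simp_all)
  then show False using e(2) by simp
qed

text \<open>\<tau>(e) = \<open>bidim e \<one>\<close> is the operator trace of the projection r
  \<mapsto> e r on \<open>R\<close>. Computed with an orthonormal basis \<open>D\<close> of its
  range, it is the cardinality of \<open>D\<close>.\<close>

lemma tr_projection_nat:
  assumes e: "pr e"
  shows "\<exists>n::nat. \<tau> e = of_nat n"
proof -
  note pe = prD[OF e]
  obtain B where B: "onb R B" using onb_exists[OF ksubspace_R] by blast
  define N where "N = {v \<in> R. e \<otimes> v = v}"
  have N: "ksubspace N" unfolding ksubspace_def N_def using pe
    by (auto simp: A_distrib_left smult_mult_right)
  obtain D where D: "onb N D" using onb_exists[OF N] by blast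
  note Bc = onbD(4)[OF B] and BR = onbD(3)[OF B] and Dc = onbD(4)[OF D]
  have DN: "d \<in> R" "e \<otimes> d = d" if "d \<in> D" for d using onbD(3)[OF D that] by (auto simp: N_def)
  have "\<tau> e = (\<Sum>r\<in>B. ip r (e \<otimes> r))"
    using bidim_onb[OF B pe(1), of \<one>] bidim_one_right[OF pe(4)] Bc pe by (simp add: ip_def cong: sum.cong)
  also have "\<dots> = (\<Sum>r\<in>B. \<Sum>d\<in>D. ip d r * ip r d)"
  proof (rule sum.cong[OF refl])
    fix r assume r: "r \<in> B"
    have er: "e \<otimes> r \<in> N" using BR[OF r] Bc[OF r] pe by (simp add: N_def)
    have "ip d (e \<otimes> r) = ip d r" if "d \<in> D" for d
    proof -
      have "ip d (e \<otimes> r) = \<tau> (star K (e \<otimes> d) \<otimes> r)"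
        using pe Bc[OF r] Dc[OF that] by (simp only: ip_def star_mult) (simp add: A_assoc)
      then show ?thesis by (simp add: DN[OF that] ip_def)
    qed
    then show "ip r (e \<otimes> r) = (\<Sum>d\<in>D. ip d r * ip r d)"
      using onbD(6)[OF D er klin_ip[OF Bc[OF r]]] by simp
  qed
  also have "\<dots> = (\<Sum>d\<in>D. \<Sum>r\<in>B. ip r d * ip d r)"
    by (subst sum.swap) (simp add: mult.commute)
  also have "\<dots> = (\<Sum>d\<in>D. ip d d)"
    using onbD(6)[OF B DN(1) klin_ip[OF Dc]] by (intro sum.cong) auto
  also have "\<dots> = of_nat (card D)"
    using onbD(5)[OF D] by simp
  finally show ?thesis by blast
qed

text \<open>The sum is the operator trace of left multiplication by \<open>e\<close> on
  \<open>K\<close>. \<open>dual_basis\<close> replaces the orthonormal basis by the dual bases p_1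
  and S(p_2), at the cost of the factor lam, and \<open>tr_left_mult\<close> evaluates the
  result.\<close>

lemma tr_left_onb:
  assumes B: "onb (carrier K) B" and e: "e \<in> carrier K"
  shows "of_real lam * (\<Sum>b\<in>B. ip b (e \<otimes> b)) = \<tau> e"
proof -
  note Bc = onbD(4)[OF B]
  have "of_real lam * (\<Sum>b\<in>B. ip b (e \<otimes> b)) = (\<Sum>b\<in>B. sw p (\<lambda>a c. ip b (e \<otimes> a) * \<tau> (S c \<otimes> b)))"
    unfolding sum_distrib_left
  proof (rule sum.cong[OF refl])
    fix b assume b: "b \<in> B"
    have l: "klin (\<lambda>y. ip b (e \<otimes> y))" using Bc[OF b] e by (intro lin; simp)
    show "complex_of_real lam * ip b (e \<otimes> b) = sw p (\<lambda>a c. ip b (e \<otimes> a) * \<tau> (S c \<otimes> b))"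
      by (rule dual_basis[OF l Bc[OF b], symmetric])
  qed
  also have "\<dots> = sw p (\<lambda>a c. \<tau> (S c \<otimes> (e \<otimes> a)))"
    unfolding sw_sum
  proof (rule sw_cong)
    fix a c assume ac: "a \<in> carrier K" "c \<in> carrier K"
    have l: "klin (\<lambda>y. \<tau> (S c \<otimes> y))" using ac by (intro lin; simp)
    show "(\<Sum>b\<in>B. ip b (e \<otimes> a) * \<tau> (S c \<otimes> b)) = \<tau> (S c \<otimes> (e \<otimes> a))"
      by (rule onbD(6)[OF B _ l]) (use ac e in simp)
  qed
  finally show ?thesis by (simp add: tr_left_mult[OF e])
qed

lemma tr_right_onb:
  assumes B: "onb (carrier K) B" and e: "e \<in> carrier K"
  shows "of_real lam * (\<Sum>b\<in>B. ip b (b \<otimes> e)) = \<tau> e"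
proof -
  note Bc = onbD(4)[OF B]
  have "of_real lam * (\<Sum>b\<in>B. ip b (b \<otimes> e)) = (\<Sum>b\<in>B. sw p (\<lambda>a c. ip b (a \<otimes> e) * \<tau> (S c \<otimes> b)))"
    unfolding sum_distrib_left
  proof (rule sum.cong[OF refl])
    fix b assume b: "b \<in> B"
    have l: "klin (\<lambda>y. ip b (y \<otimes> e))" using Bc[OF b] e by (intro lin; simp)
    show "complex_of_real lam * ip b (b \<otimes> e) = sw p (\<lambda>a c. ip b (a \<otimes> e) * \<tau> (S c \<otimes> b))"
      by (rule dual_basis[OF l Bc[OF b], symmetric])
  qed
  also have "\<dots> = sw p (\<lambda>a c. \<tau> (S c \<otimes> (a \<otimes> e)))"
    unfolding sw_sum
  proof (rule sw_cong)
    fix a c assume ac: "a \<in> carrier K" "c \<in> carrier K"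
    have l: "klin (\<lambda>y. \<tau> (S c \<otimes> y))" using ac by (intro lin; simp)
    show "(\<Sum>b\<in>B. ip b (a \<otimes> e) * \<tau> (S c \<otimes> b)) = \<tau> (S c \<otimes> (a \<otimes> e))"
      by (rule onbD(6)[OF B _ l]) (use ac e in simp)
  qed
  finally show ?thesis by (simp add: tr_right_mult[OF e])
qed

text \<open>The operator b \<mapsto> x E(x^* b f) on \<open>K\<close> factors through
  \<open>R\<close> as b \<mapsto> E(x^* b) followed by r \<mapsto> x r f. Composing in the opposite
  order gives r \<mapsto> E(x^* x) r f on \<open>R\<close>, which has the same trace, namely
  \<open>bidim\<close>.\<close>

lemma tr_rank_onb:
  assumes B: "onb (carrier K) B" and x: "x \<in> carrier K" and f: "f \<in> R"
  shows "(\<Sum>b\<in>B. ip b (x \<otimes> E (star K x \<otimes> (b \<otimes> f)))) = bidim (E (star K x \<otimes> x)) f"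
proof -
  obtain D where D: "onb R D" using onb_exists[OF ksubspace_R] by blast
  note Bc = onbD(4)[OF B] and Dc = onbD(4)[OF D] and DR = onbD(3)[OF D]
  have fc: "f \<in> carrier K" using f by simp
  have tE: "\<tau> (star K r \<otimes> E w) = \<tau> (star K r \<otimes> w)" if "r \<in> D" "w \<in> carrier K" for r w
    using tr_E[of "star K r \<otimes> w"] E_left[of "star K r" w] DR[OF that(1)] that Dc by simp
  have "(\<Sum>b\<in>B. ip b (x \<otimes> E (star K x \<otimes> (b \<otimes> f)))) =
      (\<Sum>b\<in>B. \<Sum>r\<in>D. \<tau> (star K r \<otimes> (star K x \<otimes> b)) * ip b (x \<otimes> (r \<otimes> f)))"
  proof (rule sum.cong[OF refl])
    fix b assume b: "b \<in> B"
    have l: "klin (\<lambda>y. ip b (x \<otimes> (y \<otimes> f)))" using Bc[OF b] x fc by (intro lin; simp)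
    have "E (star K x \<otimes> (b \<otimes> f)) = E (star K x \<otimes> b) \<otimes> f"
      using E_right[OF f, of "star K x \<otimes> b"] x fc Bc[OF b] by (simp add: A_assoc)
    moreover have "ip b (x \<otimes> (E (star K x \<otimes> b) \<otimes> f)) = (\<Sum>r\<in>D. ip r (E (star K x \<otimes> b)) * ip b (x \<otimes> (r \<otimes> f)))"
      by (rule onbD(6)[OF D _ l, symmetric]) (use x Bc[OF b] in simp)
    ultimately show "ip b (x \<otimes> E (star K x \<otimes> (b \<otimes> f))) =
        (\<Sum>r\<in>D. \<tau> (star K r \<otimes> (star K x \<otimes> b)) * ip b (x \<otimes> (r \<otimes> f)))"
      using x Bc[OF b] by (simp add: ip_def tE cong: sum.cong)
  qed
  also have "\<dots> = (\<Sum>r\<in>D. \<Sum>b\<in>B. ip b (x \<otimes> (r \<otimes> f)) * \<tau> (star K r \<otimes> (star K x \<otimes> b)))"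
    by (subst sum.swap) (simp add: mult.commute)
  also have "\<dots> = (\<Sum>r\<in>D. \<tau> (star K r \<otimes> (E (star K x \<otimes> x) \<otimes> (r \<otimes> f))))"
  proof (rule sum.cong[OF refl])
    fix r assume r: "r \<in> D"
    note rc = Dc[OF r]
    have l: "klin (\<lambda>b. \<tau> (star K r \<otimes> (star K x \<otimes> b)))" using rc x by (intro lin; simp)
    have "(\<Sum>b\<in>B. ip b (x \<otimes> (r \<otimes> f)) * \<tau> (star K r \<otimes> (star K x \<otimes> b))) =
        \<tau> (star K r \<otimes> (star K x \<otimes> (x \<otimes> (r \<otimes> f))))"
      by (rule onbD(6)[OF B _ l]) (use rc x fc in simp)
    also have "\<dots> = \<tau> (star K r \<otimes> E ((star K x \<otimes> x) \<otimes> (r \<otimes> f)))"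
      using tE[OF r, of "(star K x \<otimes> x) \<otimes> (r \<otimes> f)"] rc x fc by (simp add: A_assoc)
    also have "E ((star K x \<otimes> x) \<otimes> (r \<otimes> f)) = E (star K x \<otimes> x) \<otimes> (r \<otimes> f)"
      by (rule E_right) (use DR[OF r] f x in simp_all)
    finally show "(\<Sum>b\<in>B. ip b (x \<otimes> (r \<otimes> f)) * \<tau> (star K r \<otimes> (star K x \<otimes> b))) =
        \<tau> (star K r \<otimes> (E (star K x \<otimes> x) \<otimes> (r \<otimes> f)))" .
  qed
  also have "\<dots> = bidim (E (star K x \<otimes> x)) f"
    by (rule bidim_onb[OF D _ f]) (use x in simp)
  finally show ?thesis .
qed

text \<open>An orthogonal family for the \<open>R\<close>-valued inner product E(x^* y) on the right
  \<open>R\<close>-module \<open>K\<close>. Its members have projections as squared lengths, so x_i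
  generates a copy of e_i \<open>R\<close>. The index type is left free because both initial
  segments and pairs occur.\<close>

definition frame :: "'i set \<Rightarrow> ('i \<Rightarrow> 'k) \<Rightarrow> ('i \<Rightarrow> 'k) \<Rightarrow> bool" where
  "frame J x e \<longleftrightarrow> finite J \<and> (\<forall>i\<in>J. x i \<in> carrier K \<and> pr (e i) \<and> x i \<otimes> e i = x i) \<and>
     (\<forall>i\<in>J. \<forall>j\<in>J. E (star K (x i) \<otimes> x j) = (if i = j then e i else \<zero>))"

lemma frameD:
  assumes "frame J x e"
  shows "finite J" "i \<in> J \<Longrightarrow> x i \<in> carrier K" "i \<in> J \<Longrightarrow> pr (e i)" "i \<in> J \<Longrightarrow> x i \<otimes> e i = x i"
    "i \<in> J \<Longrightarrow> j \<in> J \<Longrightarrow> E (star K (x i) \<otimes> x j) = (if i = j then e i else \<zero>)"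
  using assms by (auto simp: frame_def)

text \<open>The Gram-Schmidt residue: the part of q k orthogonal to all x_i for the
  \<open>R\<close>-valued inner product.\<close>

definition fres :: "'k \<Rightarrow> 'i set \<Rightarrow> ('i \<Rightarrow> 'k) \<Rightarrow> 'k \<Rightarrow> 'k" where
  "fres q J x k = q \<otimes> k \<oplus> (-1) \<odot> finsum K (\<lambda>i. x i \<otimes> E (star K (x i) \<otimes> k)) J"

context
  fixes J :: "'i set" and x e q
  assumes fr: "frame J x e" and q: "pr q" and qx: "\<forall>i\<in>J. q \<otimes> x i = x i"
begin

lemma fres_closed: "k \<in> carrier K \<Longrightarrow> fres q J x k \<in> carrier K"
  unfolding fres_def using prD[OF q] frameD[OF fr] by (simp add: finsum_closed_K)

lemma functional_fres:
  assumes "klin f" "k \<in> carrier K"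
  shows "f (fres q J x k) = f (q \<otimes> k) - (\<Sum>i\<in>J. f (x i \<otimes> E (star K (x i) \<otimes> k)))"
  unfolding fres_def using assms prD[OF q] frameD[OF fr]
  by (simp add: linear_betweenD[OF assms(1)] finsum_closed_K functional_finsum)

lemma E_fres:
  assumes i: "i \<in> J" and k: "k \<in> carrier K"
  shows "E (star K (x i) \<otimes> fres q J x k) = \<zero>"
proof (rule functional_eqI)
  fix g assume g: "klin g"
  note xc = frameD(2)[OF fr] and pq = prD[OF q] and ei = prD[OF frameD(3)[OF fr i]]
  have l: "klin (\<lambda>y. g (E (star K (x i) \<otimes> y)))" using xc[OF i] by (intro lin klin_comp[OF g]; simp)
  let ?z = "E (star K (x i) \<otimes> k)"
  have "(\<Sum>j\<in>J. g (E (star K (x i) \<otimes> (x j \<otimes> E (star K (x j) \<otimes> k))))) = (\<Sum>j\<in>J. if j = i then g (e i \<otimes> ?z) else 0)"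
  proof (rule sum.cong[OF refl])
    fix j assume j: "j \<in> J"
    have "E (star K (x i) \<otimes> (x j \<otimes> E (star K (x j) \<otimes> k))) = E (star K (x i) \<otimes> x j) \<otimes> E (star K (x j) \<otimes> k)"
      using E_right[of "E (star K (x j) \<otimes> k)" "star K (x i) \<otimes> x j"] xc[OF i] xc[OF j] k by (simp add: A_assoc)
    then show "g (E (star K (x i) \<otimes> (x j \<otimes> E (star K (x j) \<otimes> k)))) = (if j = i then g (e i \<otimes> ?z) else 0)"
      using frameD(5)[OF fr i j] xc[OF i] xc[OF j] k functional_zero[OF g] by auto
  qed
  also have "\<dots> = g ?z"
  proof -
    have "e i \<otimes> star K (x i) = star K (x i)"
      using star_mult[of "x i" "e i"] frameD(4)[OF fr i] xc[OF i] ei by simp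
    then have "?z = E (e i \<otimes> (star K (x i) \<otimes> k))"
      using xc[OF i] ei k by (simp flip: A_assoc)
    also have "\<dots> = e i \<otimes> ?z" using xc[OF i] ei k by (intro E_left) simp_all
    finally show ?thesis using frameD(1)[OF fr] i by simp
  qed
  also have "g (E (star K (x i) \<otimes> (q \<otimes> k))) = g ?z"
  proof -
    have "star K (x i) \<otimes> q = star K (x i)"
      using star_mult[of q "x i"] bspec[OF qx i] xc[OF i] pq by simp
    then show ?thesis using xc[OF i] pq k by (simp flip: A_assoc)
  qed
  finally show "g (E (star K (x i) \<otimes> fres q J x k)) = g \<zero>"
    using functional_fres[OF l k] functional_zero[OF g] 
    \<open>g (E (star K (x i) \<otimes> (q \<otimes> k))) = g ?z\<close> by simp
qed (use assms frameD(2)[OF fr] fres_closed in simp_all)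

lemma fres_right:
  assumes k: "k \<in> carrier K" and f: "f \<in> R"
  shows "fres q J x (k \<otimes> f) = fres q J x k \<otimes> f"
proof (rule functional_eqI)
  fix g assume g: "klin g"
  note xc = frameD(2)[OF fr] and pq = prD[OF q]
  have l: "klin (\<lambda>y. g (y \<otimes> f))" using f by (intro lin klin_comp[OF g]; simp)
  have "E (star K (x i) \<otimes> (k \<otimes> f)) = E (star K (x i) \<otimes> k) \<otimes> f" if "i \<in> J" for i
    using E_right[OF f, of "star K (x i) \<otimes> k"] k f xc[OF that] by (simp add: A_assoc)
  then show "g (fres q J x (k \<otimes> f)) = g (fres q J x k \<otimes> f)"
    using k f pq xc by (simp add: functional_fres[OF g] functional_fres[OF l] A_assoc cong: sum.cong)
qed (use k f fres_closed in simp_all)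

lemma fres_left:
  assumes k: "k \<in> carrier K"
  shows "q \<otimes> fres q J x k = fres q J x k"
proof (rule functional_eqI)
  fix g assume g: "klin g"
  note xc = frameD(2)[OF fr] and pq = prD[OF q]
  have l: "klin (\<lambda>y. g (q \<otimes> y))" using pq by (intro lin klin_comp[OF g]; simp)
  have "q \<otimes> (x i \<otimes> E (star K (x i) \<otimes> k)) = x i \<otimes> E (star K (x i) \<otimes> k)" if "i \<in> J" for i
    using bspec[OF qx that] k pq xc[OF that] by (simp flip: A_assoc)
  then show "g (q \<otimes> fres q J x k) = g (fres q J x k)"
    using k pq xc by (simp add: functional_fres[OF g] functional_fres[OF l] cong: sum.cong)
qed (use k prD[OF q] fres_closed in simp_all)

text \<open>The residue is orthogonal to each x_i z with z in \<open>R\<close>, also for the scalar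
  inner product because \<tau> = \<tau> E. So only the term q k contributes on one side, and q is
  absorbed by the residue.\<close>

lemma ip_fres_fres:
  assumes k: "k \<in> carrier K"
  shows "ip (fres q J x k) (fres q J x k) = ip k (fres q J x k)"
proof -
  note xc = frameD(2)[OF fr] and pq = prD[OF q]
  let ?w = "fres q J x k"
  have w: "?w \<in> carrier K" by (rule fres_closed[OF k])
  have "ip ?w (x i \<otimes> E (star K (x i) \<otimes> k)) = 0" if i: "i \<in> J" for i
  proof -
    let ?z = "E (star K (x i) \<otimes> k)"
    have z: "?z \<in> R" "?z \<in> carrier K" using k xc[OF i] by simp_all
    have "ip (x i \<otimes> ?z) ?w = \<tau> (star K ?z \<otimes> (star K (x i) \<otimes> ?w))"
      using z w xc[OF i] by (simp add: ip_def star_mult A_assoc)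
    also have "\<dots> = \<tau> (E (star K ?z \<otimes> (star K (x i) \<otimes> ?w)))"
      using z w xc[OF i] by (intro tr_E[symmetric]) simp
    also have "\<dots> = \<tau> (star K ?z \<otimes> E (star K (x i) \<otimes> ?w))"
      using z w xc[OF i] by (subst E_left) simp_all
    also have "\<dots> = 0"
      using z by (simp add: E_fres[OF i k] functional_zero[OF tr_linear])
    finally show ?thesis using ip_cnj[of "x i \<otimes> ?z" ?w] z w xc[OF i] by simp
  qed
  then have "ip ?w ?w = ip ?w (q \<otimes> k)"
    using functional_fres[OF klin_ip[OF w] k] by simp
  also have "\<dots> = ip (q \<otimes> ?w) k"
    using w k pq by (simp add: ip_def star_mult A_assoc)
  also have "\<dots> = cnj (ip k ?w)"
    using fres_left[OF k] ip_cnj[OF k w] by simp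
  finally have "cnj (ip ?w ?w) = ip k ?w" by simp
  then show ?thesis using ip_cnj[OF w w] by simp
qed

text \<open>The left side is the operator trace of the projection k \<mapsto>
  \<open>fres q J x (k \<otimes> f)\<close> on \<open>K\<close>, that is, the dimension of the part
  of q K f not yet exhausted by the frame. Each x_i takes away dim e_i \<open>R\<close> f, by
  \<open>tr_rank_onb\<close>. Vanishing of the right side therefore means that the frame is complete
  there.\<close>

lemma sum_ip_fres:
  assumes B: "onb (carrier K) B" and f: "pr f"
  shows "(\<Sum>b\<in>B. ip (fres q J x (b \<otimes> f)) (fres q J x (b \<otimes> f))) =
     (\<Sum>b\<in>B. ip b (q \<otimes> (b \<otimes> f))) - (\<Sum>i\<in>J. bidim (e i) f)"
proof -
  note Bc = onbD(4)[OF B] and pf = prD[OF f] and xc = frameD(2)[OF fr]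
  have "ip (fres q J x (b \<otimes> f)) (fres q J x (b \<otimes> f)) =
      ip b (q \<otimes> (b \<otimes> f)) - (\<Sum>i\<in>J. ip b (x i \<otimes> E (star K (x i) \<otimes> (b \<otimes> f))))" if b: "b \<in> B" for b
  proof -
    let ?w = "fres q J x (b \<otimes> f)"
    have bf: "b \<otimes> f \<in> carrier K" using Bc[OF b] pf by simp
    have w: "?w \<in> carrier K" by (rule fres_closed[OF bf])
    have wf: "?w \<otimes> f = ?w"
      using fres_right[OF bf pf(1)] Bc[OF b] pf by (simp add: A_assoc)
    have "ip ?w ?w = ip (b \<otimes> f) ?w" by (rule ip_fres_fres[OF bf])
    also have "\<dots> = \<tau> (f \<otimes> (star K b \<otimes> ?w))"
      using Bc[OF b] pf w by (simp add: ip_def star_mult A_assoc)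
    also have "\<dots> = \<tau> ((star K b \<otimes> ?w) \<otimes> f)"
      by (rule tr_comm) (use Bc[OF b] pf w in simp_all)
    also have "\<dots> = ip b ?w"
      using Bc[OF b] pf w by (simp add: ip_def A_assoc wf)
    finally show ?thesis using functional_fres[OF klin_ip[OF Bc[OF b]] bf] by simp
  qed
  then have "(\<Sum>b\<in>B. ip (fres q J x (b \<otimes> f)) (fres q J x (b \<otimes> f))) =
     (\<Sum>b\<in>B. ip b (q \<otimes> (b \<otimes> f))) - (\<Sum>b\<in>B. \<Sum>i\<in>J. ip b (x i \<otimes> E (star K (x i) \<otimes> (b \<otimes> f))))"
    by (simp add: sum_subtractf)
  also have "(\<Sum>b\<in>B. \<Sum>i\<in>J. ip b (x i \<otimes> E (star K (x i) \<otimes> (b \<otimes> f)))) = (\<Sum>i\<in>J. bidim (e i) f)"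
    by (subst sum.swap) (simp add: tr_rank_onb[OF B xc pf(1)] frameD(5)[OF fr])
  finally show ?thesis .
qed

end

text \<open>E(w^* w) lies in the corner s \<open>R\<close> s, which is scalar by minimality, so it
  equals c s. Applying \<tau> shows c > 0, because w is nonzero and \<tau> is faithful; scaling
  \<open>w\<close> by 1 / sqrt c then gives squared length s.\<close>

lemma normalize_minimal:
  assumes w: "w \<in> carrier K" "w \<noteq> \<zero>" "w \<otimes> s = w" and s: "pr s" "s \<noteq> \<zero>"
    and min: "\<forall>a\<in>R. \<exists>c. s \<otimes> (a \<otimes> s) = c \<odot> s"
  obtains c where "E (star K (c \<odot> w) \<otimes> (c \<odot> w)) = s"
proof -
  note ps = prD[OF s(1)]
  have corner: "E (star K w \<otimes> w) = s \<otimes> (E (star K w \<otimes> w) \<otimes> s)"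
  proof -
    have "s \<otimes> star K w = star K w" using star_mult[of w s] w ps by simp
    moreover have "(s \<otimes> star K w) \<otimes> (w \<otimes> s) = s \<otimes> ((star K w \<otimes> w) \<otimes> s)"
      using w(1) ps(4) by (simp add: A_assoc)
    ultimately have "star K w \<otimes> w = s \<otimes> ((star K w \<otimes> w) \<otimes> s)"
      by (simp only: w(3))
    then have "E (star K w \<otimes> w) = E (s \<otimes> ((star K w \<otimes> w) \<otimes> s))" by simp
    also have "\<dots> = s \<otimes> (E (star K w \<otimes> w) \<otimes> s)"
      using w ps by (simp add: E_left E_right)
    finally show ?thesis .
  qed
  obtain c where "s \<otimes> (E (star K w \<otimes> w) \<otimes> s) = c \<odot> s"
    using bspec[OF min, of "E (star K w \<otimes> w)"] w by auto
  with corner have c: "E (star K w \<otimes> w) = c \<odot> s" by (rule trans)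
  have "ip w w = \<tau> (E (star K w \<otimes> w))" using w by (simp add: ip_def tr_E)
  then have ct: "ip w w = c * \<tau> s" using ps by (simp add: c tr_simps)
  define iw t where "iw = Re (ip w w)" and "t = Re (\<tau> s)"
  have iw: "ip w w = of_real iw" "iw > 0"
    unfolding iw_def by (rule ip_self(1)[OF w(1)], rule ip_self_pos[OF w(1,2)])
  have t: "\<tau> s = of_real t" "t > 0"
    unfolding t_def using tr_pr_pos[OF s] by blast+
  define r where "r = iw / t"
  have r: "c = of_real r" "r > 0"
    using ct iw t by (simp_all add: r_def field_simps)
  let ?d = "complex_of_real (1 / sqrt r)"
  have scale: "E (star K (d \<odot> w) \<otimes> (d \<odot> w)) = ((cnj d * d) * c) \<odot> s" for d
  proof -
    have "star K (d \<odot> w) \<otimes> (d \<odot> w) = (cnj d * d) \<odot> (star K w \<otimes> w)"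
      using w(1) by (simp add: star_smult smult_mult_left smult_mult_right mult.commute
          flip: complex_spaceD(5)[OF complex_space_K])
    then have "E (star K (d \<odot> w) \<otimes> (d \<odot> w)) = (cnj d * d) \<odot> E (star K w \<otimes> w)"
      using w(1) by (simp only:) (rule linear_betweenD(3)[OF linear_E[OF linear_between_id]], simp)
    also have "\<dots> = ((cnj d * d) * c) \<odot> s"
      unfolding c by (rule complex_spaceD(5)[OF complex_space_K ps(4), symmetric])
    finally show ?thesis .
  qed
  have "E (star K (?d \<odot> w) \<otimes> (?d \<odot> w)) = ((cnj ?d * ?d) * c) \<odot> s"
    by (rule scale)
  also have "(cnj ?d * ?d) * c = of_real (1 / sqrt r * (1 / sqrt r) * r)"
    by (simp only: r(1) of_real_mult complex_cnj_complex_of_real)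
  also have "1 / sqrt r * (1 / sqrt r) * r = 1"
    using r(2) real_sqrt_mult_self[of r] by (simp add: field_simps)
  finally have "E (star K (?d \<odot> w) \<otimes> (?d \<odot> w)) = s"
    using ps(4) by (simp only: of_real_1 smult_zero_K)
  then show ?thesis by (rule that)
qed

end

section \<open>A module basis over the target Cartan subalgebra\<close>

text \<open>By induction on r, the relation a D(u) = b (sum of values of D) and coprimality show
  that b^r divides every value of \<open>D\<close> on \<open>P\<close>. A positive value bounds all
  powers of b, and b = 0 would force a = 1 and D(u) = 0.\<close>

lemma coprime_power_descent:
  fixes D :: "'a \<Rightarrow> nat"
  assumes "coprime a b" and step: "\<And>u. u \<in> P \<Longrightarrow> \<exists>m f. (\<forall>j<m. f j \<in> P) \<and> a * D u = b * (\<Sum>j<(m::nat). D (f j))"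
    and u: "u \<in> P" "D u > 0"
  shows "b = 1"
proof -
  have dvd: "\<forall>u\<in>P. b ^ r dvd D u" for r
  proof (induction r)
    case (Suc r)
    show ?case
    proof
      fix u assume "u \<in> P"
      then obtain m :: nat and f where mf: "\<forall>j<m. f j \<in> P" "a * D u = b * (\<Sum>j<m. D (f j))"
        using step by blast
      have "b ^ r dvd (\<Sum>j<m. D (f j))" using Suc mf(1) by (intro dvd_sum) auto
      then have "b ^ Suc r dvd a * D u" by (simp add: mf(2))
      moreover have "coprime (b ^ Suc r) a" using assms(1) by (simp add: coprime_commute)
      ultimately show "b ^ Suc r dvd D u" using coprime_dvd_mult_right_iff by blast
    qed
  qed simp
  have le: "b ^ r \<le> D u" for r
    using dvd[of r] u by (auto intro: dvd_imp_le)
  have "\<not> b \<ge> 2"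
  proof
    assume "b \<ge> 2"
    then have "2 ^ D u \<le> b ^ D u" by (rule power_mono) simp
    moreover have "D u < 2 ^ D u" by (rule less_exp)
    ultimately show False using le[of "D u"] by linarith
  qed
  moreover have "b \<noteq> 0"
  proof
    assume "b = 0"
    then have "a = 1" using assms(1) by simp
    then show False using step[OF u(1)] u(2) \<open>b = 0\<close> by auto
  qed
  ultimately show ?thesis by simp
qed

context markov_kac_algebra begin

lemma frame_insert:
  assumes fr: "frame J x e" and i: "i \<notin> J" and y: "y \<in> carrier K" "y \<otimes> s = y" "E (star K y \<otimes> y) = s"
    and s: "pr s" and orth: "\<And>j. j \<in> J \<Longrightarrow> E (star K (x j) \<otimes> y) = \<zero>"
  shows "frame (insert i J) (x(i := y)) (e(i := s))"
proof -
  have "E (star K y \<otimes> x j) = \<zero>" if "j \<in> J" for j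
  proof -
    have "E (star K y \<otimes> x j) = star K (E (star K (x j) \<otimes> y))"
      using y frameD(2)[OF fr that] by (subst E_star[symmetric]) (simp_all add: star_mult)
    then show ?thesis using orth[OF that] by simp
  qed
  then show ?thesis
    using fr i y s orth unfolding frame_def by auto
qed

text \<open>One step of Gram-Schmidt: a nonzero residue supported under a minimal \<open>s\<close>
  is normalized to have squared length s and joins the frame.\<close>

lemma frame_extend:
  assumes fr: "frame J x e" and q: "pr q" and qx: "\<forall>i\<in>J. q \<otimes> x i = x i"
    and i: "i \<notin> J" and k: "k \<in> carrier K" "fres q J x k \<noteq> \<zero>" "fres q J x k \<otimes> s = fres q J x k"
    and s: "pr s" "s \<noteq> \<zero>" and min: "\<forall>a\<in>R. \<exists>c. s \<otimes> (a \<otimes> s) = c \<odot> s"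
  obtains y where "frame (insert i J) (x(i := y)) (e(i := s))" "q \<otimes> y = y"
proof -
  let ?w = "fres q J x k"
  have w: "?w \<in> carrier K" by (rule fres_closed[OF fr q qx k(1)])
  obtain c where c: "E (star K (c \<odot> ?w) \<otimes> (c \<odot> ?w)) = s"
    using normalize_minimal[OF w k(2,3) s min] by blast
  note xc = frameD(2)[OF fr]
  have "frame (insert i J) (x(i := c \<odot> ?w)) (e(i := s))"
  proof (rule frame_insert[OF fr i _ _ c s(1)])
    show "(c \<odot> ?w) \<otimes> s = c \<odot> ?w" using w k(3) prD[OF s(1)] by (simp add: smult_mult_left)
    show "E (star K (x j) \<otimes> (c \<odot> ?w)) = \<zero>" if j: "j \<in> J" for j
      using E_fres[OF fr q qx j k(1)] w xc[OF j]
      by (simp add: smult_mult_right linear_betweenD(3)[OF linear_E[OF linear_between_id]])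
  qed (use w in simp)
  moreover have "q \<otimes> (c \<odot> ?w) = c \<odot> ?w"
    using fres_left[OF fr q qx k(1)] w prD[OF q] by (simp add: smult_mult_right)
  ultimately show ?thesis by (rule that)
qed

section \<open>Integrality of 1 / lam and a full frame, by counting dimensions\<close>

context
  fixes P :: "'k set"
  assumes P: "decomposition P" and Pmin: "\<And>e. e \<in> P \<Longrightarrow> \<forall>a\<in>R. \<exists>c. e \<otimes> (a \<otimes> e) = c \<odot> e"
begin

lemma prP: "e \<in> P \<Longrightarrow> pr e" "e \<in> P \<Longrightarrow> e \<noteq> \<zero>"
  using decompositionD[OF P] by auto

text \<open>A frame in q K with squared lengths in \<open>P\<close> has bounded size, so there is
  one of greatest size. If it left a nonzero residue, \<open>frame_extend\<close> would enlarge it.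
  Hence q K is the orthogonal sum of the modules e_i \<open>R\<close>, and comparing dimensions
  gives the formula.\<close>

lemma tr_projection_decomposes:
  assumes q: "q \<in> P"
  obtains m f where "\<forall>j<m. f j \<in> P" "\<tau> q = of_real lam * (\<Sum>j<(m::nat). \<tau> (f j))"
proof -
  note pq = prD[OF prP(1)[OF q]]
  obtain B where B: "onb (carrier K) B" using onb_exists[OF ksubspace_carrier] by blast
  note Bc = onbD(4)[OF B]
  let ?Q = "\<lambda>m. \<exists>x e. frame {..<m::nat} x e \<and> (\<forall>i<m. q \<otimes> x i = x i \<and> e i \<in> P)"
  have formula: "\<tau> q = of_real lam * (\<Sum>b\<in>B. ip (fres q {..<m} x b) (fres q {..<m} x b)) + of_real lam * (\<Sum>i<m. \<tau> (e i))"
    if fr: "frame {..<m} x e" and x: "\<forall>i<m. q \<otimes> x i = x i \<and> e i \<in> P" for m x e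
  proof -
    have "(\<Sum>b\<in>B. ip (fres q {..<m} x (b \<otimes> \<one>)) (fres q {..<m} x (b \<otimes> \<one>))) =
       (\<Sum>b\<in>B. ip b (q \<otimes> (b \<otimes> \<one>))) - (\<Sum>i<m. bidim (e i) \<one>)"
      by (rule sum_ip_fres[OF fr prP(1)[OF q] _ B pr_one]) (use x in auto)
    moreover have "(\<Sum>i<m. bidim (e i) \<one>) = (\<Sum>i<m. \<tau> (e i))"
      using bidim_one_right prD(4)[OF prP(1)] x by (intro sum.cong) auto
    ultimately have "(\<Sum>b\<in>B. ip (fres q {..<m} x b) (fres q {..<m} x b)) + (\<Sum>i<m. \<tau> (e i)) = (\<Sum>b\<in>B. ip b (q \<otimes> b))"
      using Bc by (simp cong: sum.cong)
    then show ?thesis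
      using tr_left_onb[OF B pq(4)] by (simp flip: distrib_left)
  qed
  \<comment> \<open>Each \<tau>(e_i) is a nonzero natural number, hence at least 1, so a frame in q
    K has at most \<tau>(q) / lam members.\<close>
  obtain C :: nat where C: "Re (\<tau> q) / lam \<le> C" using real_arch_simple by blast
  have bound: "m \<le> C" if m: "?Q m" for m
  proof -
    obtain x e where fr: "frame {..<m} x e" and x: "\<forall>i<m. q \<otimes> x i = x i \<and> e i \<in> P"
      using m by blast
    have "Re (\<tau> (e i)) \<ge> 1" if "i < m" for i
    proof -
      have ei: "pr (e i)" "e i \<noteq> \<zero>" using x that prP by blast+
      obtain n :: nat where "\<tau> (e i) = of_nat n" using tr_projection_nat[OF ei(1)] by blast
      then show ?thesis using tr_pr_pos[OF ei] by simp
    qed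
    then have "(\<Sum>i<m. (1::real)) \<le> (\<Sum>i<m. Re (\<tau> (e i)))" by (intro sum_mono) simp
    moreover have "0 \<le> Re (\<Sum>b\<in>B. ip (fres q {..<m} x b) (fres q {..<m} x b))"
    proof -
      have "0 \<le> Re (ip (fres q {..<m} x b) (fres q {..<m} x b))" if "b \<in> B" for b
        by (rule ip_self(2), rule fres_closed[OF fr prP(1)[OF q]]) (use x Bc[OF that] in auto)
      then show ?thesis by (simp add: sum_nonneg)
    qed
    moreover have "Re (\<tau> q) = lam * Re (\<Sum>b\<in>B. ip (fres q {..<m} x b) (fres q {..<m} x b)) + lam * (\<Sum>i<m. Re (\<tau> (e i)))"
      by (subst formula[OF fr x]) simp
    ultimately have "lam * m \<le> Re (\<tau> q)"
      using lam_pos by (simp add: add_increasing)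
    then have "real m \<le> Re (\<tau> q) / lam" using lam_pos by (simp add: field_simps)
    then show ?thesis using C by linarith
  qed
  have "?Q 0" by (simp add: frame_def)
  then obtain m where m: "?Q m" and max: "\<And>m'. ?Q m' \<Longrightarrow> m' \<le> m"
    using ex_has_greatest_nat[of ?Q 0 "\<lambda>m. m" "Suc C"] bound less_Suc_eq_le by blast
  obtain x e where fr: "frame {..<m} x e" and x: "\<forall>i<m. q \<otimes> x i = x i \<and> e i \<in> P"
    using m by blast
  have qx: "\<forall>i\<in>{..<m}. q \<otimes> x i = x i" using x by auto
  have "fres q {..<m} x b = \<zero>" if b: "b \<in> B" for b
  proof (rule ccontr)
    assume nz: "fres q {..<m} x b \<noteq> \<zero>"
    note fc = fres_closed[OF fr prP(1)[OF q] qx]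
    \<comment> \<open>The members of \<open>P\<close> add up to 1, so right multiplication by one of
      them keeps the residue nonzero. This places its squared length in a minimal corner.\<close>
    have "\<exists>s\<in>P. fres q {..<m} x b \<otimes> s \<noteq> \<zero>"
    proof (rule ccontr)
      assume "\<not> ?thesis"
      then have z: "\<forall>s\<in>P. fres q {..<m} x b \<otimes> s = \<zero>" by blast
      have "fres q {..<m} x b = \<zero>"
      proof (rule functional_eqI)
        fix h assume h: "klin h"
        have l: "klin (\<lambda>s. h (fres q {..<m} x b \<otimes> s))" using fc[OF Bc[OF b]] by (intro lin klin_comp[OF h]; simp)
        show "h (fres q {..<m} x b) = h \<zero>"
          using decompositionD(5)[OF P l] z fc[OF Bc[OF b]] by (simp add: functional_zero[OF h])
      qed (use fc[OF Bc[OF b]] in simp_all)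
      with nz show False by simp
    qed
    then obtain s where s: "s \<in> P" "fres q {..<m} x b \<otimes> s \<noteq> \<zero>" by blast
    note ps = prD[OF prP(1)[OF s(1)]]
    have bs: "b \<otimes> s \<in> carrier K" using Bc[OF b] ps by simp
    have fs: "fres q {..<m} x (b \<otimes> s) = fres q {..<m} x b \<otimes> s"
      by (rule fres_right[OF fr prP(1)[OF q] qx Bc[OF b] ps(1)])
    have ws: "fres q {..<m} x (b \<otimes> s) \<otimes> s = fres q {..<m} x (b \<otimes> s)"
      unfolding fs using fc[OF Bc[OF b]] ps by (simp add: A_assoc)
    have nz': "fres q {..<m} x (b \<otimes> s) \<noteq> \<zero>" using s fs by simp
    obtain y where y: "frame (insert m {..<m}) (x(m := y)) (e(m := s))" "q \<otimes> y = y"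
      by (rule frame_extend[OF fr prP(1)[OF q] qx _ bs nz' ws prP[OF s(1)] Pmin[OF s(1)], of m]) simp_all
    have "?Q (Suc m)"
      by (rule exI[of _ "x(m := y)"], rule exI[of _ "e(m := s)"])
        (use x y s in \<open>auto simp: lessThan_Suc less_Suc_eq\<close>)
    then show False using max[of "Suc m"] by simp
  qed
  then have "\<tau> q = of_real lam * (\<Sum>i<m. \<tau> (e i))"
    using formula[OF fr x] by (simp add: ip_def functional_zero[OF tr_linear])
  then show ?thesis using that[of m e] x by blast
qed

text \<open>With D the natural number valued trace, one application of
  \<open>tr_projection_decomposes\<close> gives lam = b / a with a and b coprime. Every further
  application reads a D(v) = b (sum of values of D), so \<open>coprime_power_descent\<close> yields
  b = 1 and 1 / lam = a.\<close>

lemma inverse_lam_nat: "\<exists>n::nat. real n = 1 / lam"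
proof -
  obtain D :: "'k \<Rightarrow> nat" where D: "\<And>e. pr e \<Longrightarrow> \<tau> e = of_nat (D e)"
    using tr_projection_nat by metis
  have Dpos: "D e > 0" if "e \<in> P" for e
    using tr_pr_pos[OF prP[OF that]] D[OF prP(1)[OF that]] by auto
  have step: "\<exists>m f. (\<forall>j<m. f j \<in> P) \<and> real (D u) = lam * (\<Sum>j<(m::nat). D (f j))" if u: "u \<in> P" for u
  proof -
    obtain m f where f: "\<forall>j<m. f j \<in> P" "\<tau> u = of_real lam * (\<Sum>j<(m::nat). \<tau> (f j))"
      using tr_projection_decomposes[OF u] by blast
    have "complex_of_real (D u) = complex_of_real (lam * (\<Sum>j<m. D (f j)))"
      using f D prP u by simp
    then show ?thesis using f(1) unfolding of_real_eq_iff by blast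
  qed
  obtain u where u: "u \<in> P"
    using decompositionD(5)[OF P tr_linear] tr_pr_pos[OF pr_one nontrivial] by (cases "P = {}") auto
  obtain m f where mf: "\<forall>j<m. f j \<in> P" "real (D u) = lam * (\<Sum>j<(m::nat). D (f j))"
    using step[OF u] by blast
  define s where "s = (\<Sum>j<m. D (f j))"
  have s: "s > 0" using mf(2) Dpos[OF u] unfolding s_def[symmetric] by (intro Nat.gr0I) auto
  define g where "g = gcd s (D u)"
  \<comment> \<open>lam = b / a in lowest terms.\<close>
  define a b where "a = s div g" and "b = D u div g"
  have g: "g > 0" using s by (simp add: g_def)
  have ab: "s = a * g" "D u = b * g" by (simp_all add: a_def b_def g_def)
  have cop: "coprime a b" using s unfolding a_def b_def g_def by (intro div_gcd_coprime) auto
  have lam: "lam * a = b"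
    using mf(2) g unfolding s_def[symmetric] ab by simp
  have "b = 1"
  proof (rule coprime_power_descent[OF cop, of P D u])
    fix v assume v: "v \<in> P"
    obtain m f where mf: "\<forall>j<m. f j \<in> P" "real (D v) = lam * (\<Sum>j<(m::nat). D (f j))"
      using step[OF v] by blast
    have "real (a * D v) = (lam * real a) * real (\<Sum>j<m. D (f j))"
      using mf(2) by simp
    then have "real (a * D v) = real (b * (\<Sum>j<m. D (f j)))"
      by (simp only: lam of_nat_mult)
    then have "a * D v = b * (\<Sum>j<m. D (f j))" by (simp only: of_nat_eq_iff)
    with mf(1) show "\<exists>m f. (\<forall>j<m. f j \<in> P) \<and> a * D v = b * (\<Sum>j<(m::nat). D (f j))" by blast
  qed (use u Dpos in auto)
  then have "real a = 1 / lam" using lam lam_pos by (simp add: field_simps)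
  then show ?thesis by blast
qed

text \<open>The frame contains each e in \<open>P\<close> exactly n times as squared length and is
  built one index at a time. Suppose no residue of type s = \<open>snd i\<close> were left. Then the
  members present would exhaust K s, whose dimension \<tau>(s) / lam = n \<tau>(s) is the sum of
  \<open>bidim (snd j) s\<close> over all indices j. So the missing indices would contribute 0,
  contradicting \<open>bidim s s\<close> > 0.\<close>

lemma full_frame:
  fixes n :: nat
  assumes n: "real n = 1 / lam"
  obtains x where "frame ({..<n} \<times> P) x snd"
proof -
  obtain B where B: "onb (carrier K) B" using onb_exists[OF ksubspace_carrier] by blast
  note Bc = onbD(4)[OF B]
  let ?I = "{..<n} \<times> P"
  have nl: "complex_of_nat n = 1 / complex_of_real lam"
    using arg_cong[OF n, of complex_of_real] by simp
  have finI: "finite ?I" using decompositionD(1)[OF P] by simp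
  have "\<exists>x. frame J x snd" if "J \<subseteq> ?I" for J
    using finite_subset[OF that finI] that
  proof (induction J)
    case empty
    then show ?case by (simp add: frame_def)
  next
    case (insert i J)
    then obtain x where fr: "frame J x snd" by blast
    define s where "s = snd i"
    have s: "s \<in> P" using insert.prems by (auto simp: s_def)
    note prs = prP[OF s] and ps = prD[OF prP(1)[OF s]]
    have qx: "\<forall>j\<in>J. \<one> \<otimes> x j = x j" using frameD(2)[OF fr] by simp
    have sP: "snd j \<in> P" if "j \<in> ?I" for j using that by auto
    have "\<exists>b\<in>B. fres \<one> J x (b \<otimes> s) \<noteq> \<zero>"
    proof (rule ccontr)
      assume "\<not> ?thesis"
      then have z: "fres \<one> J x (b \<otimes> s) = \<zero>" if "b \<in> B" for b using that by blast
      have "(\<Sum>b\<in>B. ip (fres \<one> J x (b \<otimes> s)) (fres \<one> J x (b \<otimes> s))) = 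
          (\<Sum>b\<in>B. ip b (\<one> \<otimes> (b \<otimes> s))) - (\<Sum>j\<in>J. bidim (snd j) s)"
        by (rule sum_ip_fres[OF fr pr_one qx B prs(1)])
      then have "(\<Sum>j\<in>J. bidim (snd j) s) = (\<Sum>b\<in>B. ip b (b \<otimes> s))"
        using z Bc ps by (simp add: ip_def functional_zero[OF tr_linear] cong: sum.cong)
      then have "of_real lam * (\<Sum>j\<in>J. bidim (snd j) s) = \<tau> s"
        using tr_right_onb[OF B ps(4)] by simp
      also have "\<tau> s = of_real lam * (\<Sum>j\<in>?I. bidim (snd j) s)"
      proof -
        have l: "klin (\<lambda>e. bidim e s)" using ps by (intro lin; simp)
        have "(\<Sum>j\<in>?I. bidim (snd j) s) = (\<Sum>k<n. \<Sum>e\<in>P. bidim e s)"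
      by (simp only: sum.cartesian_product) (simp add: split_beta)
        also have "\<dots> = of_nat n * \<tau> s"
          using decompositionD(5)[OF P l] bidim_one_left[OF ps(4)] by simp
        finally show ?thesis
          using lam_pos by (simp add: nl)
      qed
      finally have "(\<Sum>j\<in>J. bidim (snd j) s) = (\<Sum>j\<in>?I. bidim (snd j) s)"
        using lam_pos by simp
      also have "\<dots> = (\<Sum>j\<in>J. bidim (snd j) s) + (\<Sum>j\<in>?I - J. bidim (snd j) s)"
        using insert.prems finI by (subst sum.subset_diff[of J]) (auto simp: add.commute)
      finally have "(\<Sum>j\<in>?I - J. Re (bidim (snd j) s)) = 0"
        by (simp flip: Re_sum)
      then have "Re (bidim (snd i) s) = 0"
        by (rule sum_nonneg_0[rotated 2]) 
          (use finI insert bidim_nonneg[OF prP(1) prs(1)] sP in auto)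
      then show False using bidim_self_pos[OF prs] by (simp add: s_def)
    qed
    then obtain b where b: "b \<in> B" "fres \<one> J x (b \<otimes> s) \<noteq> \<zero>" by blast
    have bs: "b \<otimes> s \<in> carrier K" using Bc[OF b(1)] ps by simp
    have ws: "fres \<one> J x (b \<otimes> s) \<otimes> s = fres \<one> J x (b \<otimes> s)"
      using fres_right[OF fr pr_one qx bs ps(1)] Bc[OF b(1)] ps by (simp add: A_assoc)
    obtain y where "frame (insert i J) (x(i := y)) (snd(i := s))" "\<one> \<otimes> y = y"
      by (rule frame_extend[OF fr pr_one qx insert.hyps(2) bs b(2) ws prs Pmin[OF s]])
    then have "frame (insert i J) (x(i := y)) snd"
      by (simp add: s_def fun_upd_triv)
    then show ?case by blast
  qed
  then show ?thesis using that by blast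
qed

end

text \<open>In the frame x(i, s), the sum u_i of x(i, s) over s in \<open>P\<close> has squared
  length 1, the members of \<open>P\<close> being a decomposition of 1 and the cross terms being 0.
  Completeness holds since both terms on the right of \<open>sum_ip_fres\<close> with q = f = 1 are
  n \<tau>(1), so every residue vanishes.\<close>

lemma module_basis:
  obtains n :: nat and u where "real n = 1 / lam" "\<And>i. i < n \<Longrightarrow> u i \<in> carrier K"
    "\<And>i j. i < n \<Longrightarrow> j < n \<Longrightarrow> E (star K (u i) \<otimes> u j) = (if i = j then \<one> else \<zero>)"
    "\<And>f k. klin f \<Longrightarrow> k \<in> carrier K \<Longrightarrow> (\<Sum>i<n. f (u i \<otimes> E (star K (u i) \<otimes> k))) = f k"
proof -
  obtain P where P: "decomposition P" and "\<And>e a. e \<in> P \<Longrightarrow> a \<in> R \<Longrightarrow> \<exists>c. e \<otimes> (a \<otimes> e) = c \<odot> e"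
    using minimal_projections by blast
  then have Pmin: "\<And>e. e \<in> P \<Longrightarrow> \<forall>a\<in>R. \<exists>c. e \<otimes> (a \<otimes> e) = c \<odot> e" by blast
  obtain n :: nat where n: "real n = 1 / lam" using inverse_lam_nat[OF P Pmin] by blast
  obtain x where fr: "frame ({..<n} \<times> P) x snd" using full_frame[OF P Pmin n] by blast
  have fP: "finite P" by (rule decompositionD(1)[OF P])
  note pP = decompositionD(2)[OF P]
  have xc: "x (i, s) \<in> carrier K" "x (i, s) \<otimes> s = x (i, s)" if "i < n" "s \<in> P" for i s
    using frameD(2,4)[OF fr, of "(i, s)"] that by auto
  have Ex: "E (star K (x (i, s)) \<otimes> x (j, t)) = (if i = j \<and> s = t then s else \<zero>)"
    if "i < n" "s \<in> P" "j < n" "t \<in> P" for i s j t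
    using frameD(5)[OF fr, of "(i, s)" "(j, t)"] that by auto
  define u where "u i = finsum K (\<lambda>s. x (i, s)) P" for i
  have u: "u i \<in> carrier K" if "i < n" for i
    unfolding u_def by (rule finsum_closed_K[OF fP]) (use xc that in auto)
  have fu: "f (u i) = (\<Sum>s\<in>P. f (x (i, s)))" if "klin f" "i < n" for f i
    unfolding u_def by (rule functional_finsum[OF that(1) fP]) (use xc that in auto)
  have star_u: "f (star K (u i)) = (\<Sum>s\<in>P. f (star K (x (i, s))))" if f: "klin f" and i: "i < n" for f i
  proof -
    have "cnj (f (star K (u i))) = (\<Sum>s\<in>P. cnj (f (star K (x (i, s)))))"
      by (rule fu[OF linear_cnj_star[OF f] i])
    then have "f (star K (u i)) = cnj (\<Sum>s\<in>P. cnj (f (star K (x (i, s)))))" by (metis complex_cnj_cnj)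
    then show ?thesis by simp
  qed
  have Euu: "E (star K (u i) \<otimes> u j) = (if i = j then \<one> else \<zero>)" if ij: "i < n" "j < n" for i j
  proof (rule functional_eqI)
    fix f assume f: "klin f"
    have l1: "klin (\<lambda>y. f (E (y \<otimes> u j)))" using u[OF ij(2)] by (intro lin klin_comp[OF f]; simp)
    have "f (E (star K (u i) \<otimes> u j)) = (\<Sum>s\<in>P. \<Sum>t\<in>P. f (E (star K (x (i, s)) \<otimes> x (j, t))))"
      unfolding star_u[OF l1 ij(1)]
    proof (rule sum.cong[OF refl])
      fix s assume s: "s \<in> P"
      have l2: "klin (\<lambda>y. f (E (star K (x (i, s)) \<otimes> y)))" using xc[OF ij(1) s] by (intro lin klin_comp[OF f]; simp)
      show "f (E (star K (x (i, s)) \<otimes> u j)) = (\<Sum>t\<in>P. f (E (star K (x (i, s)) \<otimes> x (j, t))))"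
        by (rule fu[OF l2 ij(2)])
    qed
    also have "\<dots> = (\<Sum>s\<in>P. \<Sum>t\<in>P. if t = s then (if i = j then f s else 0) else 0)"
      using Ex ij functional_zero[OF f] by (intro sum.cong) auto
    also have "\<dots> = f (if i = j then \<one> else \<zero>)"
      using fP decompositionD(5)[OF P f] functional_zero[OF f] by simp
    finally show "f (E (star K (u i) \<otimes> u j)) = f (if i = j then \<one> else \<zero>)" .
  qed (use u ij in auto)
  obtain B where B: "onb (carrier K) B" using onb_exists[OF ksubspace_carrier] by blast
  note Bc = onbD(4)[OF B]
  let ?I = "{..<n} \<times> P"
  have qx: "\<forall>j\<in>?I. \<one> \<otimes> x j = x j" using frameD(2)[OF fr] by simp
  note fc = fres_closed[OF fr pr_one qx]
  have "(\<Sum>b\<in>B. ip (fres \<one> ?I x (b \<otimes> \<one>)) (fres \<one> ?I x (b \<otimes> \<one>))) =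
      (\<Sum>b\<in>B. ip b (\<one> \<otimes> (b \<otimes> \<one>))) - (\<Sum>j\<in>?I. bidim (snd j) \<one>)"
    by (rule sum_ip_fres[OF fr pr_one qx B pr_one])
  also have "(\<Sum>j\<in>?I. bidim (snd j) \<one>) = of_nat n * \<tau> \<one>"
  proof -
    have l: "klin (\<lambda>e. bidim e \<one>)" by (intro lin; simp)
    have "(\<Sum>j\<in>?I. bidim (snd j) \<one>) = (\<Sum>k<n. \<Sum>e\<in>P. bidim e \<one>)"
      by (simp only: sum.cartesian_product) (simp add: split_beta)
    then show ?thesis
      using decompositionD(5)[OF P l] bidim_one_left[of \<one>] by simp
  qed
  also have "(\<Sum>b\<in>B. ip b (\<one> \<otimes> (b \<otimes> \<one>))) = of_nat n * \<tau> \<one>"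
  proof -
    have "of_real lam * (\<Sum>b\<in>B. ip b (\<one> \<otimes> b)) = \<tau> \<one>" by (rule tr_left_onb[OF B]) simp
    then have "complex_of_nat n * \<tau> \<one> = (complex_of_nat n * of_real lam) * (\<Sum>b\<in>B. ip b (\<one> \<otimes> b))"
      by simp
    moreover have "complex_of_nat n * of_real lam = 1"
      using arg_cong[OF n, of complex_of_real] lam_pos by simp
    ultimately show ?thesis
      using Bc by (simp cong: sum.cong)
  qed
  finally have sum0: "(\<Sum>b\<in>B. ip (fres \<one> ?I x b) (fres \<one> ?I x b)) = 0"
    using Bc by (simp cong: sum.cong)
  have z: "fres \<one> ?I x b = \<zero>" if b: "b \<in> B" for b
  proof -
    have "(\<Sum>b\<in>B. Re (ip (fres \<one> ?I x b) (fres \<one> ?I x b))) = 0"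
      using sum0 by (simp flip: Re_sum)
    then have "Re (ip (fres \<one> ?I x b) (fres \<one> ?I x b)) = 0"
      by (rule sum_nonneg_0[rotated 2]) (use onbD(2)[OF B] b ip_self(2)[OF fc[OF Bc]] in auto)
    then show ?thesis
      using ip_self(1)[OF fc[OF Bc[OF b]]] ip_self_eq_0[OF fc[OF Bc[OF b]]] by simp
  qed
  have expand: "f k = (\<Sum>i<n. f (u i \<otimes> E (star K (u i) \<otimes> k)))" if f: "klin f" and k: "k \<in> carrier K" for f k
  proof -
    have lg: "klin (\<lambda>y. \<Sum>j\<in>?I. f (x j \<otimes> E (star K (x j) \<otimes> y)))"
      using frameD(2)[OF fr] by (intro lin klin_comp[OF f]; simp)
    have "f k = (\<Sum>b\<in>B. ip b k * f b)" by (rule onbD(6)[OF B k f, symmetric])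
    also have "\<dots> = (\<Sum>b\<in>B. ip b k * (\<Sum>j\<in>?I. f (x j \<otimes> E (star K (x j) \<otimes> b))))"
    proof (rule sum.cong[OF refl])
      fix b assume b: "b \<in> B"
      show "ip b k * f b = ip b k * (\<Sum>j\<in>?I. f (x j \<otimes> E (star K (x j) \<otimes> b)))"
        using functional_fres[OF fr pr_one qx f Bc[OF b]] z[OF b] Bc[OF b] functional_zero[OF f] by simp
    qed
    also have "\<dots> = (\<Sum>j\<in>?I. f (x j \<otimes> E (star K (x j) \<otimes> k)))"
      by (rule onbD(6)[OF B k lg])
    also have "\<dots> = (\<Sum>i<n. \<Sum>s\<in>P. f (x (i, s) \<otimes> E (star K (x (i, s)) \<otimes> k)))"
      by (simp only: sum.cartesian_product) (simp add: split_beta)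
    also have "\<dots> = (\<Sum>i<n. f (u i \<otimes> E (star K (u i) \<otimes> k)))"
    proof (rule sum.cong[OF refl])
      fix i assume "i \<in> {..<n}"
      then have i: "i < n" by simp
      have Ek: "E (star K (u i) \<otimes> k) \<in> carrier K" using u[OF i] k by simp
      have l1: "klin (\<lambda>y. f (y \<otimes> E (star K (u i) \<otimes> k)))" using Ek by (intro lin klin_comp[OF f]; simp)
      have tx: "t \<otimes> star K (x (i, t)) = star K (x (i, t))" if "t \<in> P" for t
        using star_mult[of "x (i, t)" t] xc[OF i that] prD[OF pP[OF that]] by simp
      \<comment> \<open>x(i, s) absorbs s on the right and E(x(i, t)^* k) absorbs t on the left, so
        the cross terms contain s t = 0. This lets the expansion over pairs be regrouped as one over
        the u_i.\<close>
      have xE: "x (i, s) \<otimes> E (star K (x (i, t)) \<otimes> k) = (if t = s then x (i, s) \<otimes> E (star K (x (i, s)) \<otimes> k) else \<zero>)"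
        if s: "s \<in> P" and t: "t \<in> P" for s t
      proof -
        note ps = prD[OF pP[OF s]] and pt = prD[OF pP[OF t]]
        have "E (star K (x (i, t)) \<otimes> k) = E ((t \<otimes> star K (x (i, t))) \<otimes> k)"
          by (simp only: tx[OF t])
        also have "\<dots> = t \<otimes> E (star K (x (i, t)) \<otimes> k)"
          using pt xc[OF i t] k by (simp add: A_assoc E_left)
        finally have Et: "E (star K (x (i, t)) \<otimes> k) = t \<otimes> E (star K (x (i, t)) \<otimes> k)" .
        have "x (i, s) \<otimes> E (star K (x (i, t)) \<otimes> k) = (x (i, s) \<otimes> s) \<otimes> (t \<otimes> E (star K (x (i, t)) \<otimes> k))"
          by (subst Et) (simp only: xc(2)[OF i s])
        also have "\<dots> = x (i, s) \<otimes> ((s \<otimes> t) \<otimes> E (star K (x (i, t)) \<otimes> k))"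
          using ps pt xc(1)[OF i s] xc(1)[OF i t] k by (simp add: A_assoc)
        finally show ?thesis
          using decompositionD(4)[OF P s t] xc(1)[OF i s] xc(1)[OF i t] k by auto
      qed
      have "f (u i \<otimes> E (star K (u i) \<otimes> k)) = (\<Sum>s\<in>P. \<Sum>t\<in>P. f (x (i, s) \<otimes> E (star K (x (i, t)) \<otimes> k)))"
        unfolding fu[OF l1 i]
      proof (rule sum.cong[OF refl])
        fix s assume s: "s \<in> P"
        have l2: "klin (\<lambda>y. f (x (i, s) \<otimes> E (y \<otimes> k)))" using xc[OF i s] k by (intro lin klin_comp[OF f]; simp)
        show "f (x (i, s) \<otimes> E (star K (u i) \<otimes> k)) = (\<Sum>t\<in>P. f (x (i, s) \<otimes> E (star K (x (i, t)) \<otimes> k)))"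
          by (rule star_u[OF l2 i])
      qed
      also have "\<dots> = (\<Sum>s\<in>P. \<Sum>t\<in>P. if t = s then f (x (i, s) \<otimes> E (star K (x (i, s)) \<otimes> k)) else 0)"
      proof (intro sum.cong refl)
        fix s t assume st: "s \<in> P" "t \<in> P"
        show "f (x (i, s) \<otimes> E (star K (x (i, t)) \<otimes> k)) =
            (if t = s then f (x (i, s) \<otimes> E (star K (x (i, s)) \<otimes> k)) else 0)"
          unfolding xE[OF st] using functional_zero[OF f] by simp
      qed
      also have "\<dots> = (\<Sum>s\<in>P. f (x (i, s) \<otimes> E (star K (x (i, s)) \<otimes> k)))"
        using fP by simp
      finally show "(\<Sum>s\<in>P. f (x (i, s) \<otimes> E (star K (x (i, s)) \<otimes> k))) = f (u i \<otimes> E (star K (u i) \<otimes> k))" by simp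
    qed
    finally show ?thesis .
  qed
  show ?thesis
    by (rule that[of n u]) (use n u Euu expand in auto)
qed

end

section \<open>Evaluating elements of crossed products\<close>

text \<open>The assumptions are mere closure properties, so that the same evaluation formulas serve
  \<open>K\<close> acting on \<open>A\<close> and the dual of \<open>K\<close> acting on the crossed
  product.\<close>

locale crossed_data =
  fixes K :: "'k weak_kac" and A :: "'a star_alg" and act :: "'k \<Rightarrow> 'a \<Rightarrow> 'a"
  assumes space_A: "complex_space A" and space_K: "complex_space K"
    and A_mult: "x \<in> carrier A \<Longrightarrow> y \<in> carrier A \<Longrightarrow> x \<otimes>\<^bsub>A\<^esub> y \<in> carrier A"
    and A_unit: "\<one>\<^bsub>A\<^esub> \<in> carrier A" and A_star: "x \<in> carrier A \<Longrightarrow> star A x \<in> carrier A"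
    and K_mult: "h \<in> carrier K \<Longrightarrow> k \<in> carrier K \<Longrightarrow> h \<otimes>\<^bsub>K\<^esub> k \<in> carrier K"
    and K_star: "h \<in> carrier K \<Longrightarrow> star K h \<in> carrier K"
    and act_closed: "h \<in> carrier K \<Longrightarrow> x \<in> carrier A \<Longrightarrow> act h x \<in> carrier A"
    and comult_K: "h \<in> carrier K \<Longrightarrow> comult K h \<in> carrier (tensor_space K K)"
    and Cartan_K: "z \<in> Cartan_t K \<Longrightarrow> z \<in> carrier K"
begin

sublocale TK: tensor_product K K
  by (rule tensor_product.intro[OF space_K space_K])

definition crossed_relations where
  "crossed_relations = {basis (a \<otimes>\<^bsub>A\<^esub> act z \<one>\<^bsub>A\<^esub>) h - basis a (z \<otimes>\<^bsub>K\<^esub> h) | a z h.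
        a \<in> carrier A \<and> z \<in> Cartan_t K \<and> h \<in> carrier K}"

lemma crossed_null_span: "crossed_null K A act = formal.span (bilinear_relations A K \<union> crossed_relations)"
  by (simp add: crossed_null_def crossed_relations_def)

sublocale formal_quotient_space "carrier A \<times> carrier K" "crossed_null K A act"
proof
  show "formal.subspace (crossed_null K A act)"
    by (simp add: crossed_null_span)
  have "Poly_Mapping.keys u \<subseteq> carrier A \<times> carrier K" if u0: "u \<in> crossed_relations" for u
  proof -
    obtain a z h where u: "u = basis (a \<otimes>\<^bsub>A\<^esub> act z \<one>\<^bsub>A\<^esub>) h - basis a (z \<otimes>\<^bsub>K\<^esub> h)"
        "a \<in> carrier A" "z \<in> Cartan_t K" "h \<in> carrier K"
      using u0 unfolding crossed_relations_def by blast
    have "Poly_Mapping.keys (basis (a \<otimes>\<^bsub>A\<^esub> act z \<one>\<^bsub>A\<^esub>) h) \<subseteq> carrier A \<times> carrier K"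
        "Poly_Mapping.keys (basis a (z \<otimes>\<^bsub>K\<^esub> h)) \<subseteq> carrier A \<times> carrier K"
      using u(2-4) by (simp_all add: A_mult act_closed A_unit K_mult Cartan_K)
    then show ?thesis
      unfolding u(1) by (intro order_trans[OF keys_diff_subset Un_least])
  qed
  then show "Poly_Mapping.keys u \<subseteq> carrier A \<times> carrier K" if "u \<in> crossed_null K A act" for u
    using keys_span[of "bilinear_relations A K \<union> crossed_relations" "carrier A \<times> carrier K" u]
      keys_bilinear_relations[OF space_A space_K] that
    unfolding crossed_null_span by blast
qed

abbreviation X where "X \<equiv> crossed_space K A act"
abbreviation cl where "cl \<equiv> crossed_class K A act"
abbreviation AxK where "AxK \<equiv> crossed_product K A act"

lemma X_eq: "X = Q"
  by (simp add: crossed_space_def)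

lemma vanishes_crossed:
  "vanishes_on (crossed_null K A act) F \<longleftrightarrow> bilinear_on A K F \<and>
     (\<forall>a\<in>carrier A. \<forall>z\<in>Cartan_t K. \<forall>h\<in>carrier K. F (a \<otimes>\<^bsub>A\<^esub> act z \<one>\<^bsub>A\<^esub>) h = F a (z \<otimes>\<^bsub>K\<^esub> h))"
proof -
  have "vanishes_on (crossed_null K A act) F \<longleftrightarrow>
      vanishes_on (bilinear_relations A K) F \<and> vanishes_on crossed_relations F"
    unfolding crossed_null_span vanishes_on_span unfolding vanishes_on_def by blast
  moreover have "vanishes_on crossed_relations F \<longleftrightarrow>
     (\<forall>a\<in>carrier A. \<forall>z\<in>Cartan_t K. \<forall>h\<in>carrier K. F (a \<otimes>\<^bsub>A\<^esub> act z \<one>\<^bsub>A\<^esub>) h = F a (z \<otimes>\<^bsub>K\<^esub> h))"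
  proof
    assume v: "vanishes_on crossed_relations F"
    show "\<forall>a\<in>carrier A. \<forall>z\<in>Cartan_t K. \<forall>h\<in>carrier K. F (a \<otimes>\<^bsub>A\<^esub> act z \<one>\<^bsub>A\<^esub>) h = F a (z \<otimes>\<^bsub>K\<^esub> h)"
    proof (intro ballI)
      fix a z h assume "a \<in> carrier A" "z \<in> Cartan_t K" "h \<in> carrier K"
      then have "basis (a \<otimes>\<^bsub>A\<^esub> act z \<one>\<^bsub>A\<^esub>) h - basis a (z \<otimes>\<^bsub>K\<^esub> h) \<in> crossed_relations"
        unfolding crossed_relations_def by blast
      from bspec[OF v[unfolded vanishes_on_def] this]
      show "F (a \<otimes>\<^bsub>A\<^esub> act z \<one>\<^bsub>A\<^esub>) h = F a (z \<otimes>\<^bsub>K\<^esub> h)"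
        by (simp add: formal_eval_simps)
    qed
  next
    assume F: "\<forall>a\<in>carrier A. \<forall>z\<in>Cartan_t K. \<forall>h\<in>carrier K. F (a \<otimes>\<^bsub>A\<^esub> act z \<one>\<^bsub>A\<^esub>) h = F a (z \<otimes>\<^bsub>K\<^esub> h)"
    show "vanishes_on crossed_relations F"
      unfolding vanishes_on_def
    proof
      fix w assume "w \<in> crossed_relations"
      then obtain a z h where "w = basis (a \<otimes>\<^bsub>A\<^esub> act z \<one>\<^bsub>A\<^esub>) h - basis a (z \<otimes>\<^bsub>K\<^esub> h)"
          "a \<in> carrier A" "z \<in> Cartan_t K" "h \<in> carrier K"
        unfolding crossed_relations_def by blast
      then show "formal_eval (\<lambda>p. F (fst p) (snd p)) w = 0"
        using F by (simp add: formal_eval_simps)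
    qed
  qed
  ultimately show ?thesis by (simp add: vanishes_on_bilinear_relations)
qed

lemma cl_closed: "a \<in> carrier A \<Longrightarrow> h \<in> carrier K \<Longrightarrow> cl a h \<in> carrier X"
  unfolding X_eq crossed_class_def by (rule coset_closed) simp

lemma cl_eval: "vanishes_on (crossed_null K A act) F \<Longrightarrow> tensor_eval (cl a h) F = F a h"
  unfolding crossed_class_def by (simp add: tensor_eval_coset)

lemmas X_space = complex_space_Q[folded X_eq]
lemmas X_eval_linear = tensor_eval_linear[folded X_eq]
lemmas X_eval_cong = tensor_eval_cong[folded X_eq]
lemmas X_linear_eval_on = linear_tensor_eval_on[folded X_eq]
lemmas X_lift_closed = lift_closed[folded X_eq]
lemmas X_functional_lift = functional_lift[folded X_eq]
lemmas X_conj_lift_closed = conj_lift_closed[folded X_eq]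
lemmas X_functional_conj_lift = functional_conj_lift[folded X_eq]

lemma X_functional:
  assumes "linear_between X CC f"
  shows "vanishes_on (crossed_null K A act) (\<lambda>a h. f (cl a h))"
    and "t \<in> carrier X \<Longrightarrow> tensor_eval t (\<lambda>a h. f (cl a h)) = f t"
  using linear_functional_vanishes[of f] assms by (simp_all add: X_eq crossed_class_def)

lemma AxK_sel:
  "carrier AxK = carrier X" "\<zero>\<^bsub>AxK\<^esub> = \<zero>\<^bsub>X\<^esub>" "add AxK = add X" "smult AxK = smult X"
  "\<one>\<^bsub>AxK\<^esub> = cl \<one>\<^bsub>A\<^esub> \<one>\<^bsub>K\<^esub>"
  "mult AxK s t = lift X (\<lambda>a h. lift X (\<lambda>b k.
          lift X (\<lambda>h1 h2. cl (a \<otimes>\<^bsub>A\<^esub> act h1 b) (h2 \<otimes>\<^bsub>K\<^esub> k)) (comult K h)) t) s"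
  "star AxK = lift (conj_space X) (\<lambda>a h. lift (conj_space X)
          (\<lambda>h1 h2. cl (act (star K h1) (star A a)) (star K h2)) (comult K h))"
  by (simp_all add: crossed_product_def Let_def)

lemma AxK_linear: "linear_between AxK CC = linear_between X CC" "linear_between V AxK = linear_between V X"
  by (simp_all add: linear_between_def fun_eq_iff AxK_sel)

lemma AxK_space: "complex_space AxK"
proof (rule complex_spaceI)
  note V = complex_spaceD[OF X_space]
  interpret V: abelian_group X by (rule V(1))
  show "abelian_group AxK"
    by (rule abelian_groupI) (use V.l_neg in \<open>auto simp: AxK_sel V.a_ac intro!: bexI[of _ "\<ominus>\<^bsub>X\<^esub> _"]\<close>)
qed (simp_all add: AxK_sel complex_spaceD[OF X_space])

lemma inner_mult_closed:
  assumes "a \<in> carrier A" "h \<in> carrier K" "b \<in> carrier A" "k \<in> carrier K"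
  shows "lift X (\<lambda>h1 h2. cl (a \<otimes>\<^bsub>A\<^esub> act h1 b) (h2 \<otimes>\<^bsub>K\<^esub> k)) (comult K h) \<in> carrier X"
  by (rule TK.lift_closed'[OF X_space comult_K]) (use assms in \<open>auto intro!: cl_closed A_mult act_closed K_mult\<close>)

lemma AxK_mult_closed: "s \<in> carrier X \<Longrightarrow> t \<in> carrier X \<Longrightarrow> s \<otimes>\<^bsub>AxK\<^esub> t \<in> carrier X"
  unfolding AxK_sel by (intro X_lift_closed X_space inner_mult_closed) auto

lemma AxK_mult_eval:
  assumes s: "s \<in> carrier X" and t: "t \<in> carrier X" and f: "linear_between X CC f"
  shows "f (s \<otimes>\<^bsub>AxK\<^esub> t) = tensor_eval s (\<lambda>a h. tensor_eval t (\<lambda>b k.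
     tensor_eval (comult K h) (\<lambda>h1 h2. f (cl (a \<otimes>\<^bsub>A\<^esub> act h1 b) (h2 \<otimes>\<^bsub>K\<^esub> k)))))"
proof -
  have i1: "f (lift X (\<lambda>h1 h2. cl (a \<otimes>\<^bsub>A\<^esub> act h1 b) (h2 \<otimes>\<^bsub>K\<^esub> k)) (comult K h)) =
      tensor_eval (comult K h) (\<lambda>h1 h2. f (cl (a \<otimes>\<^bsub>A\<^esub> act h1 b) (h2 \<otimes>\<^bsub>K\<^esub> k)))"
    if "a \<in> carrier A" "h \<in> carrier K" "b \<in> carrier A" "k \<in> carrier K" for a b h k
    by (rule TK.functional_lift'[OF X_space comult_K _ f])
      (use that in \<open>auto intro!: cl_closed A_mult act_closed K_mult\<close>)
  have i2: "f (lift X (\<lambda>b k. lift X (\<lambda>h1 h2. cl (a \<otimes>\<^bsub>A\<^esub> act h1 b) (h2 \<otimes>\<^bsub>K\<^esub> k)) (comult K h)) t) =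
     tensor_eval t (\<lambda>b k. tensor_eval (comult K h) (\<lambda>h1 h2. f (cl (a \<otimes>\<^bsub>A\<^esub> act h1 b) (h2 \<otimes>\<^bsub>K\<^esub> k))))"
    if "a \<in> carrier A" "h \<in> carrier K" for a h
    by (subst X_functional_lift[OF X_space t _ f])
      (use that in \<open>auto intro!: inner_mult_closed X_eval_cong[OF t] i1\<close>)
  show ?thesis
    unfolding AxK_sel
    by (subst X_functional_lift[OF X_space s _ f])
      (auto intro!: inner_mult_closed X_lift_closed X_space t X_eval_cong[OF s] i2)
qed

lemma AxK_star_closed: "s \<in> carrier X \<Longrightarrow> star AxK s \<in> carrier X"
  unfolding AxK_sel
  by (intro X_conj_lift_closed X_space TK.conj_lift_closed' comult_K cl_closed act_closed K_star A_star) auto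

lemma AxK_star_eval:
  assumes s: "s \<in> carrier X" and f: "linear_between X CC f"
  shows "f (star AxK s) = cnj (tensor_eval s (\<lambda>a h. tensor_eval (comult K h)
     (\<lambda>h1 h2. cnj (f (cl (act (star K h1) (star A a)) (star K h2))))))"
proof -
  have cl: "lift (conj_space X) (\<lambda>h1 h2. cl (act (star K h1) (star A a)) (star K h2)) (comult K h) \<in> carrier X"
    if "a \<in> carrier A" "h \<in> carrier K" for a h
    by (rule TK.conj_lift_closed'[OF X_space comult_K])
      (use that in \<open>auto intro!: cl_closed act_closed K_star A_star\<close>)
  have "cnj (f (lift (conj_space X) (\<lambda>h1 h2. cl (act (star K h1) (star A a)) (star K h2)) (comult K h))) =
      tensor_eval (comult K h) (\<lambda>h1 h2. cnj (f (cl (act (star K h1) (star A a)) (star K h2))))"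
    if "a \<in> carrier A" "h \<in> carrier K" for a h
    by (subst TK.functional_conj_lift'[OF X_space comult_K _ f])
      (use that in \<open>auto intro!: cl_closed act_closed K_star A_star\<close>)
  then show ?thesis
    unfolding AxK_sel
    by (subst X_functional_conj_lift[OF X_space s _ f])
      (auto intro!: cl X_eval_cong[OF s] arg_cong[of _ _ cnj])
qed

lemma dual_action_closed:
  "t \<in> carrier X \<Longrightarrow> dual_action K A act \<psi> t \<in> carrier X"
  unfolding dual_action_def Let_def
  by (intro X_lift_closed X_space TK.lift_closed' comult_K complex_spaceD(2)[OF X_space] cl_closed) auto

lemma dual_action_eval:
  assumes t: "t \<in> carrier X" and f: "linear_between X CC f"
  shows "f (dual_action K A act \<psi> t) =
     tensor_eval t (\<lambda>a h. tensor_eval (comult K h) (\<lambda>h1 h2. \<psi> h2 * f (cl a h1)))"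
proof -
  have c: "lift X (\<lambda>h1 h2. \<psi> h2 \<odot>\<^bsub>X\<^esub> cl a h1) (comult K h) \<in> carrier X"
    if "a \<in> carrier A" "h \<in> carrier K" for a h
    by (rule TK.lift_closed'[OF X_space comult_K])
      (use that in \<open>auto intro!: complex_spaceD(2)[OF X_space] cl_closed\<close>)
  have i: "f (lift X (\<lambda>h1 h2. \<psi> h2 \<odot>\<^bsub>X\<^esub> cl a h1) (comult K h)) =
      tensor_eval (comult K h) (\<lambda>h1 h2. \<psi> h2 * f (cl a h1))" if "a \<in> carrier A" "h \<in> carrier K" for a h
    by (subst TK.functional_lift'[OF X_space comult_K _ f])
      (use that in \<open>auto intro!: complex_spaceD(2)[OF X_space] cl_closed TK.eval_cong[OF comult_K]
        simp: linear_betweenD(3)[OF f cl_closed]\<close>)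
  show ?thesis
    unfolding dual_action_def Let_def
    by (subst X_functional_lift[OF X_space t _ f]) (auto intro!: c i X_eval_cong[OF t])
qed

end

section \<open>Identities for the action\<close>

locale markov_action = markov_kac_algebra K \<tau> p lam + A: star_algebra A + left_action K A act
  for K :: "'k weak_kac" (structure) and \<tau> p lam and A :: "'a star_alg" and act :: "'k \<Rightarrow> 'a \<Rightarrow> 'a" (infixr "\<triangleright>" 75) +
  fixes n :: nat and u :: "nat \<Rightarrow> 'k"
  assumes u_closed [simp]: "i < n \<Longrightarrow> u i \<in> carrier K"
    and u_orth: "i < n \<Longrightarrow> j < n \<Longrightarrow> E (star K (u i) \<otimes> u j) = (if i = j then \<one> else \<zero>)"
    and u_complete: "klin f \<Longrightarrow> k \<in> carrier K \<Longrightarrow> (\<Sum>i<n. f (u i \<otimes> E (star K (u i) \<otimes> k))) = f k"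
begin

abbreviation alin :: "('a \<Rightarrow> complex) \<Rightarrow> bool" where "alin \<equiv> linear_between A CC"

lemma complex_space_A: "complex_space A"
  by (rule star_algebra_complex_space) (rule A.star_algebra_axioms)

lemma act_closed [simp]: "h \<in> carrier K \<Longrightarrow> a \<in> carrier A \<Longrightarrow> h \<triangleright> a \<in> carrier A"
  using linear_betweenD(1)[OF act_linear] .

lemma linear_act1 [lin]: "linear_between V K f \<Longrightarrow> a \<in> carrier A \<Longrightarrow> linear_between V A (\<lambda>x. f x \<triangleright> a)"
  by (auto simp: linear_between_def Pi_iff act_add act_smult)

lemma linear_act2 [lin]: "linear_between V A f \<Longrightarrow> h \<in> carrier K \<Longrightarrow> linear_between V A (\<lambda>x. h \<triangleright> f x)"
  by (rule linear_between_comp[OF act_linear])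

lemma linear_A_mult [lin]:
  "linear_between V A g \<Longrightarrow> b \<in> carrier A \<Longrightarrow> linear_between V A (\<lambda>x. g x \<otimes>\<^bsub>A\<^esub> b)"
  "linear_between V A g \<Longrightarrow> b \<in> carrier A \<Longrightarrow> linear_between V A (\<lambda>x. b \<otimes>\<^bsub>A\<^esub> g x)"
  by (rule A.linear_mult_left A.linear_mult_right; assumption)+

lemmas alin_comp = linear_between_comp[of A CC]

lemma A_functional_eqI:
  "x \<in> carrier A \<Longrightarrow> y \<in> carrier A \<Longrightarrow> (\<And>g. alin g \<Longrightarrow> g x = g y) \<Longrightarrow> x = y"
  by (rule linear_functional_separation[OF complex_space_A])

lemma act_mult_eval:
  assumes "alin g" "h \<in> carrier K" "a \<in> carrier A" "b \<in> carrier A"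
  shows "g (h \<triangleright> (a \<otimes>\<^bsub>A\<^esub> b)) = sw h (\<lambda>h1 h2. g ((h1 \<triangleright> a) \<otimes>\<^bsub>A\<^esub> (h2 \<triangleright> b)))"
  using assms by (simp add: act_mult sw_eval)
    (subst KK.functional_lift'[OF complex_space_A _ _ assms(1)], auto)

text \<open>Elements of \<open>R\<close> act by left multiplication, since Delta(z) = Delta(1) (z
  \<otimes> 1) and 1 acts trivially on the product.\<close>

lemma R_act:
  assumes z: "z \<in> R" and a: "a \<in> carrier A"
  shows "(z \<triangleright> \<one>\<^bsub>A\<^esub>) \<otimes>\<^bsub>A\<^esub> a = z \<triangleright> a"
proof (rule A_functional_eqI)
  fix g assume g: "alin g"
  have b: "kbil (\<lambda>h1 h2. g ((h1 \<triangleright> \<one>\<^bsub>A\<^esub>) \<otimes>\<^bsub>A\<^esub> (h2 \<triangleright> a)))" using a by (intro lin alin_comp[OF g]; simp)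
  have "g (\<one> \<triangleright> ((z \<triangleright> \<one>\<^bsub>A\<^esub>) \<otimes>\<^bsub>A\<^esub> a)) = sw \<one> (\<lambda>h1 h2. g (((h1 \<otimes> z) \<triangleright> \<one>\<^bsub>A\<^esub>) \<otimes>\<^bsub>A\<^esub> (h2 \<triangleright> a)))"
    using z a by (simp add: act_mult_eval[OF g] act_act cong: sw_cong_simp)
  also have "\<dots> = g (z \<triangleright> (\<one>\<^bsub>A\<^esub> \<otimes>\<^bsub>A\<^esub> a))"
    using z a by (simp only: sw_R_one_right[OF z b, symmetric] act_mult_eval[OF g] R_closed A.A_closed)
  finally show "g ((z \<triangleright> \<one>\<^bsub>A\<^esub>) \<otimes>\<^bsub>A\<^esub> a) = g (z \<triangleright> a)"
    using z a by (simp add: act_one)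
qed (use z a in simp_all)

text \<open>From 1_1 \<otimes> 1_2 z = 1_1 S(z) \<otimes> 1_2. The balancing relation of the crossed
  product can thus be read as a(z \<triangleright> 1) = S(z) \<triangleright> a, which is how the
  \<open>Q i\<close> absorb it.\<close>

lemma mult_R_act:
  assumes z: "z \<in> R" and a: "a \<in> carrier A"
  shows "a \<otimes>\<^bsub>A\<^esub> (z \<triangleright> \<one>\<^bsub>A\<^esub>) = S z \<triangleright> a"
proof (rule A_functional_eqI)
  fix g assume g: "alin g"
  have b: "kbil (\<lambda>h1 h2. g ((h1 \<triangleright> a) \<otimes>\<^bsub>A\<^esub> (h2 \<triangleright> \<one>\<^bsub>A\<^esub>)))" using a by (intro lin alin_comp[OF g]; simp)
  have "g (\<one> \<triangleright> (a \<otimes>\<^bsub>A\<^esub> (z \<triangleright> \<one>\<^bsub>A\<^esub>))) = sw \<one> (\<lambda>h1 h2. g ((h1 \<triangleright> a) \<otimes>\<^bsub>A\<^esub> ((h2 \<otimes> z) \<triangleright> \<one>\<^bsub>A\<^esub>)))"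
    using z a by (simp add: act_mult_eval[OF g] act_act cong: sw_cong_simp)
  also have "\<dots> = sw \<one> (\<lambda>h1 h2. g (((h1 \<otimes> S z) \<triangleright> a) \<otimes>\<^bsub>A\<^esub> (h2 \<triangleright> \<one>\<^bsub>A\<^esub>)))"
    by (rule sw_antipode_R_right[OF z _ b, symmetric]) simp
  also have "\<dots> = g (\<one> \<triangleright> ((S z \<triangleright> a) \<otimes>\<^bsub>A\<^esub> \<one>\<^bsub>A\<^esub>))"
    using z a by (simp only: act_mult_eval[OF g] A_closed A.A_closed act_closed antipode_closed R_closed)
      (simp add: act_act cong: sw_cong_simp)
  finally show "g (a \<otimes>\<^bsub>A\<^esub> (z \<triangleright> \<one>\<^bsub>A\<^esub>)) = g (S z \<triangleright> a)"
    using z a by (simp add: act_one)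
qed (use z a in simp_all)

definition hit :: "('k \<Rightarrow> complex) \<Rightarrow> 'k \<Rightarrow> 'k" where "hit \<phi> x = slice_right K \<phi> (comult K x)"

lemma hit_closed [simp]: "x \<in> carrier K \<Longrightarrow> hit \<phi> x \<in> carrier K"
  by (simp add: hit_def)

lemma hit_eval:
  assumes f: "klin f" and x: "x \<in> carrier K"
  shows "f (hit \<phi> x) = sw x (\<lambda>a b. \<phi> b * f a)"
  unfolding hit_def slice_right_def
  by (subst functional_lift_comult[OF f x]) (simp_all add: linear_betweenD[OF f] cong: sw_cong_simp)

lemma linear_hit [lin]:
  assumes "klin \<phi>"
  shows "linear_between V K g \<Longrightarrow> linear_between V K (\<lambda>x. hit \<phi> (g x))"
proof (erule linear_between_comp[rotated], rule linear_betweenI)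
  have l: "klin (\<lambda>x. sw x (\<lambda>a b. \<phi> b * f a))" if "klin f" for f
    by (intro lin klin_comp[OF that] klin_comp[OF assms])
  fix x y assume xy [simp]: "x \<in> carrier K" "y \<in> carrier K"
  show "hit \<phi> (x \<oplus> y) = hit \<phi> x \<oplus> hit \<phi> y"
  proof (rule functional_eqI)
    fix f assume f: "klin f"
    then show "f (hit \<phi> (x \<oplus> y)) = f (hit \<phi> x \<oplus> hit \<phi> y)"
      by (simp add: linear_betweenD[OF f] hit_eval[OF f] linear_betweenD[OF l[OF f]])
  qed simp_all
next
  have l: "klin (\<lambda>x. sw x (\<lambda>a b. \<phi> b * f a))" if "klin f" for f
    by (intro lin klin_comp[OF that] klin_comp[OF assms])
  fix c x assume x [simp]: "x \<in> carrier K"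
  show "hit \<phi> (c \<odot> x) = c \<odot> hit \<phi> x"
  proof (rule functional_eqI)
    fix f assume f: "klin f"
    then show "f (hit \<phi> (c \<odot> x)) = f (c \<odot> hit \<phi> x)"
      by (simp add: linear_betweenD[OF f] hit_eval[OF f] linear_betweenD[OF l[OF f]])
  qed simp_all
qed simp

lemma hit_counit: 
  assumes "x \<in> carrier K" "\<And>y. y \<in> carrier K \<Longrightarrow> \<phi> y = \<epsilon> y"
  shows "hit \<phi> x = x"
  by (rule functional_eqI)
    (use assms in \<open>simp_all add: hit_eval sw_counit_right cong: sw_cong_simp\<close>)

lemma hit_R:
  assumes \<phi>: "klin \<phi>" and z: "z \<in> R" and x: "x \<in> carrier K"
  shows "hit \<phi> (x \<otimes> z) = hit \<phi> x \<otimes> z"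
proof (rule functional_eqI)
  fix f assume f: "klin f"
  have b: "kbil (\<lambda>a b. \<phi> b * f a)" by (intro lin klin_comp[OF f] klin_comp[OF \<phi>])
  have l: "klin (\<lambda>y. f (y \<otimes> z))" using z by (intro lin klin_comp[OF f]; simp)
  show "f (hit \<phi> (x \<otimes> z)) = f (hit \<phi> x \<otimes> z)"
    using z x by (simp add: hit_eval[OF f] sw_R_right[OF z x b] hit_eval[OF l])
qed (use z x in simp_all)

definition Q :: "nat \<Rightarrow> 'k \<Rightarrow> 'k" where
  "Q i k = lift K (\<lambda>a b. \<tau> (b \<otimes> k) \<odot> a) (comult K (star K (u i)))"

lemma Q_eval:
  assumes f: "klin f" and i: "i < n" and k: "k \<in> carrier K"
  shows "f (Q i k) = sw (star K (u i)) (\<lambda>a b. f a * \<tau> (b \<otimes> k))"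
  unfolding Q_def using i
  by (subst functional_lift_comult[OF f]) (simp_all add: linear_betweenD[OF f] mult.commute cong: sw_cong_simp)

lemma Q_closed [simp]: "i < n \<Longrightarrow> Q i k \<in> carrier K"
  unfolding Q_def by (rule KK.lift_closed'[OF complex_space_K]) auto

text \<open>Q_i(k) = E(u_i^* k_2) S(k_1): a coordinate of k_2 over \<open>R\<close> times S(k_1).
  The defining form suits invariance arguments, this form suits the completeness of the u_i.\<close>

lemma Q_eval_E:
  assumes f: "klin f" and i: "i < n" and k: "k \<in> carrier K"
  shows "f (Q i k) = sw k (\<lambda>a b. f (E (star K (u i) \<otimes> b) \<otimes> S a))"
  using E_mult_antipode_left[OF f, of "star K (u i)" k] i k by (simp add: Q_eval[OF f])

lemma linear_Q [lin]:
  assumes i: "i < n"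
  shows "linear_between V K g \<Longrightarrow> linear_between V K (\<lambda>x. Q i (g x))"
proof (erule linear_between_comp[rotated], rule linear_betweenI)
  have l: "klin (\<lambda>x. sw (star K (u i)) (\<lambda>a b. f a * \<tau> (b \<otimes> x)))" if "klin f" for f
    by (intro lin; simp)
  fix x y assume xy [simp]: "x \<in> carrier K" "y \<in> carrier K"
  show "Q i (x \<oplus> y) = Q i x \<oplus> Q i y"
  proof (rule functional_eqI)
    fix f assume f: "klin f"
    then show "f (Q i (x \<oplus> y)) = f (Q i x \<oplus> Q i y)"
      using i by (simp add: linear_betweenD[OF f] Q_eval[OF f] linear_betweenD(2)[OF l[OF f]])
  qed (use i in simp_all)
next
  have l: "klin (\<lambda>x. sw (star K (u i)) (\<lambda>a b. f a * \<tau> (b \<otimes> x)))" if "klin f" for f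
    by (intro lin; simp)
  fix c x assume x [simp]: "x \<in> carrier K"
  show "Q i (c \<odot> x) = c \<odot> Q i x"
  proof (rule functional_eqI)
    fix f assume f: "klin f"
    then show "f (Q i (c \<odot> x)) = f (c \<odot> Q i x)"
      using i by (simp add: linear_betweenD[OF f] Q_eval[OF f] linear_betweenD(3)[OF l[OF f]])
  qed (use i in simp_all)
qed (use i in simp)

text \<open>Cyclicity of the trace brings \<open>z\<close> to the left of the second leg of
  Delta(\<open>star K (u i)\<close>), and \<open>sw_antipode_R_left\<close> transfers it as S(z) to
  the first.\<close>

lemma Q_R_right:
  assumes i: "i < n" and z: "z \<in> R" and k: "k \<in> carrier K"
  shows "Q i (k \<otimes> z) = S z \<otimes> Q i k"
proof (rule functional_eqI)
  fix f assume f: "klin f"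
  have b: "kbil (\<lambda>a b. f a * \<tau> (b \<otimes> k))" using k by (intro lin klin_comp[OF f]; simp)
  have l: "klin (\<lambda>y. f (S z \<otimes> y))" using z by (intro lin klin_comp[OF f]; simp)
  have "f (Q i (k \<otimes> z)) = sw (star K (u i)) (\<lambda>a b. f a * \<tau> ((z \<otimes> b) \<otimes> k))"
    using i z k by (simp add: Q_eval[OF f])
      (intro sw_cong, simp add: A_assoc tr_comm[of z "_ \<otimes> _"])
  also have "\<dots> = f (S z \<otimes> Q i k)"
    using i z k sw_antipode_R_left[OF z _ b, of "star K (u i)"] by (simp add: Q_eval[OF l])
  finally show "f (Q i (k \<otimes> z)) = f (S z \<otimes> Q i k)" .
qed (use i z k in simp_all)

lemma Q_R_left:
  assumes i: "i < n" and z: "z \<in> R" and k: "k \<in> carrier K"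
  shows "Q i (z \<otimes> k) = Q i k \<otimes> S z"
proof (rule functional_eqI)
  fix f assume f: "klin f"
  have b: "kbil (\<lambda>a b. f a * \<tau> (b \<otimes> k))" using k by (intro lin klin_comp[OF f]; simp)
  have l: "klin (\<lambda>y. f (y \<otimes> S z))" using z by (intro lin klin_comp[OF f]; simp)
  have "f (Q i (z \<otimes> k)) = sw (star K (u i)) (\<lambda>a b. f a * \<tau> ((b \<otimes> z) \<otimes> k))"
    using i z k by (simp add: Q_eval[OF f] A_assoc cong: sw_cong_simp)
  also have "\<dots> = f (Q i k \<otimes> S z)"
    using i z k sw_antipode_R_right[OF z _ b, of "star K (u i)"] by (simp add: Q_eval[OF l])
  finally show "f (Q i (z \<otimes> k)) = f (Q i k \<otimes> S z)" .
qed (use i z k in simp_all)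

text \<open>Applying \<open>eps_t\<close> to E(u_i^* k_2) S(k_1) gives E(u_i^* k_2) S(eps_s(k_1)),
  which is E(u_i^* k 1_2) S(1_1). The leg 1_2 lies in \<open>R\<close> and leaves \<open>E\<close>,
  and 1_2 S(1_1) = 1. Consequently Q_i(k) acts on the unit of \<open>A\<close> as E(u_i^* k)
  does.\<close>

lemma eps_t_Q:
  assumes i: "i < n" and k: "k \<in> carrier K"
  shows "eps_t K (Q i k) = E (star K (u i) \<otimes> k)"
proof (rule functional_eqI)
  fix f assume f: "klin f"
  let ?v = "star K (u i)"
  have v: "?v \<in> carrier K" using i by simp
  have l: "klin (\<lambda>x. f (eps_t K x))" by (intro lin klin_comp[OF f])
  have b1: "kbil (\<lambda>a b. f (E (?v \<otimes> b) \<otimes> S a))" using v by (intro lin klin_comp[OF f]; simp)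
  have b2: "kbil (\<lambda>a b. f (E (?v \<otimes> (k \<otimes> b)) \<otimes> S a))" using v k by (intro lin klin_comp[OF f]; simp)
  have b3: "kbil (\<lambda>a b. f (E (?v \<otimes> k) \<otimes> (b \<otimes> S a)))" using v k by (intro lin klin_comp[OF f]; simp)
  have l3: "klin (\<lambda>x. f (E (?v \<otimes> k) \<otimes> x))" using v k by (intro lin klin_comp[OF f]; simp)
  have "f (eps_t K (Q i k)) = sw k (\<lambda>a b. f (E (?v \<otimes> b) \<otimes> S (eps_s K a)))"
    using v k by (simp add: Q_eval_E[OF l i k] eps_t_mult_left eps_t_antipode cong: sw_cong_simp)
  also have "\<dots> = sw \<one> (\<lambda>a b. f (E (?v \<otimes> (k \<otimes> b)) \<otimes> S a))"
    by (rule sw_eps_s[OF b1 k])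
  also have "\<dots> = sw \<one> (\<lambda>a b. f (E (?v \<otimes> (k \<otimes> eps_t K b)) \<otimes> S a))"
    by (rule sw_one_eps_t[OF b2, symmetric])
  also have "\<dots> = sw \<one> (\<lambda>a b. f (E (?v \<otimes> k) \<otimes> (eps_t K b \<otimes> S a)))"
  proof (rule sw_cong)
    fix a b assume "a \<in> carrier K" "b \<in> carrier K"
    then show "f (E (?v \<otimes> (k \<otimes> eps_t K b)) \<otimes> S a) = f (E (?v \<otimes> k) \<otimes> (eps_t K b \<otimes> S a))"
      using E_right[of "eps_t K b" "?v \<otimes> k"] v k by (simp add: A_assoc)
  qed
  also have "\<dots> = sw \<one> (\<lambda>a b. f (E (?v \<otimes> k) \<otimes> (b \<otimes> S a)))"
    by (rule sw_one_eps_t[OF b3])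
  also have "\<dots> = f (E (?v \<otimes> k))"
    using antipode_eps_t_eval[OF l3, of \<one>] v k by simp
  finally show "f (eps_t K (Q i k)) = f (E (?v \<otimes> k))" .
qed (use i k in simp_all)

text \<open>With Q_l(k) = E(u_l^* k_2) S(k_1), balancing moves the factor in \<open>R\<close> to
  u_l, and completeness of the u_l sums u_l E(u_l^* k_2) to k_2.\<close>

lemma balanced_sum:
  assumes \<beta>: "kbil \<beta>" and bal: "\<And>v z w. v \<in> carrier K \<Longrightarrow> z \<in> R \<Longrightarrow> w \<in> carrier K \<Longrightarrow> \<beta> (v \<otimes> z) w = \<beta> v (z \<otimes> w)"
    and k: "k \<in> carrier K"
  shows "(\<Sum>l<n. \<beta> (u l) (Q l k)) = sw k (\<lambda>a b. \<beta> b (S a))"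
proof -
  note bl = bilinear_on_comp[OF \<beta>]
  have "(\<Sum>l<n. \<beta> (u l) (Q l k)) = (\<Sum>l<n. sw k (\<lambda>a b. \<beta> (u l \<otimes> E (star K (u l) \<otimes> b)) (S a)))"
  proof (rule sum.cong[OF refl])
    fix l assume "l \<in> {..<n}"
    then have l: "l < n" by simp
    have kl: "klin (\<beta> (u l))" using l by (intro lin bl; simp)
    show "\<beta> (u l) (Q l k) = sw k (\<lambda>a b. \<beta> (u l \<otimes> E (star K (u l) \<otimes> b)) (S a))"
      using l by (simp add: Q_eval_E[OF kl l k] bal cong: sw_cong_simp)
  qed
  also have "\<dots> = sw k (\<lambda>a b. \<beta> b (S a))"
    unfolding sw_sum
  proof (rule sw_cong)
    fix a b assume ab: "a \<in> carrier K" "b \<in> carrier K"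
    have kl: "klin (\<lambda>v. \<beta> v (S a))" using ab by (intro lin bl; simp)
    show "(\<Sum>l<n. \<beta> (u l \<otimes> E (star K (u l) \<otimes> b)) (S a)) = \<beta> b (S a)"
      by (rule u_complete[OF kl ab(2)])
  qed
  finally show ?thesis .
qed

text \<open>Unfold Q_i over v = u_i^* and let the first leg act on the product. By coassociativity
  the legs v_2 h_1 and v_3 h_2 form the coproduct of v' h, where v' is the second leg of v;
  \<open>left_invariance\<close> exchanges its first leg for S(y_1).\<close>

lemma Q_act_mult:
  assumes g: "alin g" and i: "i < n" and h: "h \<in> carrier K" and y: "y \<in> carrier K"
    and b: "b \<in> carrier A" and c: "c \<in> carrier A"
  shows "sw h (\<lambda>h1 h2. g (Q i (h2 \<otimes> y) \<triangleright> (b \<otimes>\<^bsub>A\<^esub> (h1 \<triangleright> c)))) =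
    sw y (\<lambda>y1 y2. g ((Q i (h \<otimes> y2) \<triangleright> b) \<otimes>\<^bsub>A\<^esub> (S y1 \<triangleright> c)))"
proof -
  note gl = alin_comp[OF g]
  let ?v = "star K (u i)"
  have v: "?v \<in> carrier K" using i by simp
  have "sw h (\<lambda>h1 h2. g (Q i (h2 \<otimes> y) \<triangleright> (b \<otimes>\<^bsub>A\<^esub> (h1 \<triangleright> c)))) =
     sw h (\<lambda>h1 h2. sw ?v (\<lambda>a1 a'. sw a' (\<lambda>a2 d. g ((a1 \<triangleright> b) \<otimes>\<^bsub>A\<^esub> ((a2 \<otimes> h1) \<triangleright> c)) * \<tau> (d \<otimes> (h2 \<otimes> y)))))"
  proof (rule sw_cong)
    fix h1 h2 assume hh: "h1 \<in> carrier K" "h2 \<in> carrier K"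
    have l: "klin (\<lambda>q. g (q \<triangleright> (b \<otimes>\<^bsub>A\<^esub> (h1 \<triangleright> c))))" using hh b c by (intro lin gl; simp)
    have t: "ktri (\<lambda>a1 a2 d. g ((a1 \<triangleright> b) \<otimes>\<^bsub>A\<^esub> ((a2 \<otimes> h1) \<triangleright> c)) * \<tau> (d \<otimes> (h2 \<otimes> y)))"
      using hh b c y by (intro lin gl; simp)
    have "g (Q i (h2 \<otimes> y) \<triangleright> (b \<otimes>\<^bsub>A\<^esub> (h1 \<triangleright> c))) =
        sw ?v (\<lambda>a d. sw a (\<lambda>a1 a2. g ((a1 \<triangleright> b) \<otimes>\<^bsub>A\<^esub> ((a2 \<otimes> h1) \<triangleright> c)) * \<tau> (d \<otimes> (h2 \<otimes> y))))"
      using hh b c y by (simp add: Q_eval[OF l i] act_mult_eval[OF g] act_act sw_multc cong: sw_cong_simp)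
    also have "\<dots> = sw ?v (\<lambda>a1 a'. sw a' (\<lambda>a2 d. g ((a1 \<triangleright> b) \<otimes>\<^bsub>A\<^esub> ((a2 \<otimes> h1) \<triangleright> c)) * \<tau> (d \<otimes> (h2 \<otimes> y))))"
      by (rule sw_coassoc[OF v t])
    finally show "g (Q i (h2 \<otimes> y) \<triangleright> (b \<otimes>\<^bsub>A\<^esub> (h1 \<triangleright> c))) = \<dots>" .
  qed
  also have "\<dots> = sw ?v (\<lambda>a1 a'. sw h (\<lambda>h1 h2. sw a' (\<lambda>a2 d. g ((a1 \<triangleright> b) \<otimes>\<^bsub>A\<^esub> ((a2 \<otimes> h1) \<triangleright> c)) * \<tau> (d \<otimes> (h2 \<otimes> y)))))"
    by (rule sw_swap)
  also have "\<dots> = sw ?v (\<lambda>a1 a'. sw y (\<lambda>y1 y2. g ((a1 \<triangleright> b) \<otimes>\<^bsub>A\<^esub> (S y1 \<triangleright> c)) * \<tau> (a' \<otimes> (h \<otimes> y2))))"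
  proof (rule sw_cong)
    fix a1 a' assume aa: "a1 \<in> carrier K" "a' \<in> carrier K"
    have l: "klin (\<lambda>q. g ((a1 \<triangleright> b) \<otimes>\<^bsub>A\<^esub> (q \<triangleright> c)))" using aa b c by (intro lin gl; simp)
    have bb: "kbil (\<lambda>x1 x2. g ((a1 \<triangleright> b) \<otimes>\<^bsub>A\<^esub> (x1 \<triangleright> c)) * \<tau> (x2 \<otimes> y))"
      using aa b c y by (intro lin gl; simp)
    have "sw h (\<lambda>h1 h2. sw a' (\<lambda>a2 d. g ((a1 \<triangleright> b) \<otimes>\<^bsub>A\<^esub> ((a2 \<otimes> h1) \<triangleright> c)) * \<tau> (d \<otimes> (h2 \<otimes> y)))) =
        sw a' (\<lambda>a2 d. sw h (\<lambda>h1 h2. g ((a1 \<triangleright> b) \<otimes>\<^bsub>A\<^esub> ((a2 \<otimes> h1) \<triangleright> c)) * \<tau> ((d \<otimes> h2) \<otimes> y)))"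
      using y by (subst sw_swap) (simp add: A_assoc cong: sw_cong_simp)
    also have "\<dots> = sw (a' \<otimes> h) (\<lambda>x1 x2. g ((a1 \<triangleright> b) \<otimes>\<^bsub>A\<^esub> (x1 \<triangleright> c)) * \<tau> (x2 \<otimes> y))"
      by (rule sw_mult[OF aa(2) h bb, symmetric])
    also have "\<dots> = sw y (\<lambda>y1 y2. g ((a1 \<triangleright> b) \<otimes>\<^bsub>A\<^esub> (S y1 \<triangleright> c)) * \<tau> ((a' \<otimes> h) \<otimes> y2))"
      by (rule left_invariance[OF l _ y]) (use aa h in simp)
    finally show "sw h (\<lambda>h1 h2. sw a' (\<lambda>a2 d. g ((a1 \<triangleright> b) \<otimes>\<^bsub>A\<^esub> ((a2 \<otimes> h1) \<triangleright> c)) * \<tau> (d \<otimes> (h2 \<otimes> y)))) =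
        sw y (\<lambda>y1 y2. g ((a1 \<triangleright> b) \<otimes>\<^bsub>A\<^esub> (S y1 \<triangleright> c)) * \<tau> (a' \<otimes> (h \<otimes> y2)))"
      using aa h by (simp add: A_assoc cong: sw_cong_simp)
  qed
  also have "\<dots> = sw y (\<lambda>y1 y2. sw ?v (\<lambda>a1 a'. g ((a1 \<triangleright> b) \<otimes>\<^bsub>A\<^esub> (S y1 \<triangleright> c)) * \<tau> (a' \<otimes> (h \<otimes> y2))))"
    by (rule sw_swap)
  also have "\<dots> = sw y (\<lambda>y1 y2. g ((Q i (h \<otimes> y2) \<triangleright> b) \<otimes>\<^bsub>A\<^esub> (S y1 \<triangleright> c)))"
  proof (rule sw_cong)
    fix y1 y2 assume yy: "y1 \<in> carrier K" "y2 \<in> carrier K"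
    have l: "klin (\<lambda>q. g ((q \<triangleright> b) \<otimes>\<^bsub>A\<^esub> (S y1 \<triangleright> c)))" using yy b c by (intro lin gl; simp)
    show "sw ?v (\<lambda>a1 a'. g ((a1 \<triangleright> b) \<otimes>\<^bsub>A\<^esub> (S y1 \<triangleright> c)) * \<tau> (a' \<otimes> (h \<otimes> y2))) =
        g ((Q i (h \<otimes> y2) \<triangleright> b) \<otimes>\<^bsub>A\<^esub> (S y1 \<triangleright> c))"
      using yy h by (simp add: Q_eval[OF l i])
  qed
  finally show ?thesis .
qed

text \<open>An instance of \<open>balanced_sum\<close>. The form is balanced because z in the
  argument of Q_i becomes left multiplication by S(z), which acts as right multiplication by z
  \<triangleright> 1, and this in turn acts as z on the next factor.\<close>

lemma sum_Q_act_Q_act: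
  assumes g: "alin g" and i: "i < n" and h: "h \<in> carrier K" and y: "y \<in> carrier K"
    and b: "b \<in> carrier A" and c: "c \<in> carrier A" and \<phi>: "klin \<phi>"
  shows "(\<Sum>l<n. g ((Q i (h \<otimes> hit \<phi> (u l)) \<triangleright> b) \<otimes>\<^bsub>A\<^esub> (Q l y \<triangleright> c))) =
    sw y (\<lambda>y1 y2. g ((Q i (h \<otimes> hit \<phi> y2) \<triangleright> b) \<otimes>\<^bsub>A\<^esub> (S y1 \<triangleright> c)))"
proof (rule balanced_sum[OF _ _ y])
  note gl = alin_comp[OF g]
  show "kbil (\<lambda>v w. g ((Q i (h \<otimes> hit \<phi> v) \<triangleright> b) \<otimes>\<^bsub>A\<^esub> (w \<triangleright> c)))"
    using h b c i by (intro lin gl linear_hit[OF \<phi>]; simp)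
  fix v z w assume v: "v \<in> carrier K" and z: "z \<in> R" and w: "w \<in> carrier K"
  let ?q = "Q i (h \<otimes> hit \<phi> v)"
  have q: "?q \<in> carrier K" using i by simp
  have "Q i (h \<otimes> hit \<phi> (v \<otimes> z)) = S z \<otimes> ?q"
    using h v z Q_R_right[OF i z, of "h \<otimes> hit \<phi> v"] by (simp add: hit_R[OF \<phi>] A_assoc)
  then have "(Q i (h \<otimes> hit \<phi> (v \<otimes> z)) \<triangleright> b) \<otimes>\<^bsub>A\<^esub> (w \<triangleright> c) = ((?q \<triangleright> b) \<otimes>\<^bsub>A\<^esub> (z \<triangleright> \<one>\<^bsub>A\<^esub>)) \<otimes>\<^bsub>A\<^esub> (w \<triangleright> c)"
    using q z b by (simp add: act_act mult_R_act)
  also have "\<dots> = (?q \<triangleright> b) \<otimes>\<^bsub>A\<^esub> ((z \<otimes> w) \<triangleright> c)"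
    using q z b c w by (simp add: A.A_assoc R_act act_act)
  finally show "g ((Q i (h \<otimes> hit \<phi> (v \<otimes> z)) \<triangleright> b) \<otimes>\<^bsub>A\<^esub> (w \<triangleright> c)) = g ((?q \<triangleright> b) \<otimes>\<^bsub>A\<^esub> ((z \<otimes> w) \<triangleright> c))"
    by simp
qed

text \<open>The product rule for matrix coefficients on the inner crossed product: both sides equal
  the expression in S(y_1) of \<open>Q_act_mult\<close>, the right one by
  \<open>sum_Q_act_Q_act\<close> with the counit, for which \<open>hit\<close> is the
  identity.\<close>

lemma Q_act_mult_sum:
  assumes g: "alin g" and i: "i < n" and h: "h \<in> carrier K" and y: "y \<in> carrier K"
    and b: "b \<in> carrier A" and c: "c \<in> carrier A"
  shows "sw h (\<lambda>h1 h2. g (Q i (h2 \<otimes> y) \<triangleright> (b \<otimes>\<^bsub>A\<^esub> (h1 \<triangleright> c)))) =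
    (\<Sum>l<n. g ((Q i (h \<otimes> u l) \<triangleright> b) \<otimes>\<^bsub>A\<^esub> (Q l y \<triangleright> c)))"
proof -
  have "sw y (\<lambda>y1 y2. g ((Q i (h \<otimes> hit \<epsilon> y2) \<triangleright> b) \<otimes>\<^bsub>A\<^esub> (S y1 \<triangleright> c))) =
      (\<Sum>l<n. g ((Q i (h \<otimes> hit \<epsilon> (u l)) \<triangleright> b) \<otimes>\<^bsub>A\<^esub> (Q l y \<triangleright> c)))"
    by (rule sum_Q_act_Q_act[OF assms counit_linear, symmetric])
  then show ?thesis
    by (simp add: Q_act_mult[OF assms] hit_counit cong: sw_cong_simp)
qed

text \<open>Written with S(y_1) and y_2, both sides are sums over the three-fold coproduct of
  \<open>w\<close> with \<open>\<phi>\<close> at the last leg; coassociativity identifies them. It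
  transfers the dual action from the right factor to the middle index of a matrix product.\<close>

lemma sum_Q_act_hit:
  assumes g: "alin g" and i: "i < n" and h: "h \<in> carrier K" and w: "w \<in> carrier K"
    and b: "b \<in> carrier A" and c: "c \<in> carrier A" and \<phi>: "klin \<phi>"
  shows "(\<Sum>l<n. g ((Q i (h \<otimes> u l) \<triangleright> b) \<otimes>\<^bsub>A\<^esub> (Q l (hit \<phi> w) \<triangleright> c))) =
    (\<Sum>l<n. g ((Q i (h \<otimes> hit \<phi> (u l)) \<triangleright> b) \<otimes>\<^bsub>A\<^esub> (Q l w \<triangleright> c)))"
proof -
  note gl = alin_comp[OF g]
  let ?G = "\<lambda>y1 y2. g ((Q i (h \<otimes> y2) \<triangleright> b) \<otimes>\<^bsub>A\<^esub> (S y1 \<triangleright> c))"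
  have G: "kbil ?G" using h b c i by (intro lin gl; simp)
  have l: "klin (\<lambda>x. sw x ?G)" by (intro lin G)
  have t: "ktri (\<lambda>y1 y2 y3. \<phi> y3 * ?G y1 y2)" using h b c i by (intro lin gl klin_comp[OF \<phi>]; simp)
  have "(\<Sum>l<n. g ((Q i (h \<otimes> u l) \<triangleright> b) \<otimes>\<^bsub>A\<^esub> (Q l (hit \<phi> w) \<triangleright> c))) = sw (hit \<phi> w) ?G"
    using Q_act_mult[OF g i h _ b c, of "hit \<phi> w"] Q_act_mult_sum[OF g i h _ b c, of "hit \<phi> w"] w by simp
  also have "\<dots> = sw w (\<lambda>a d. sw a (\<lambda>y1 y2. \<phi> d * ?G y1 y2))"
    by (simp add: hit_eval[OF l w] sw_cmult)
  also have "\<dots> = sw w (\<lambda>y1 a. sw a (\<lambda>y2 y3. \<phi> y3 * ?G y1 y2))"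
    by (rule sw_coassoc[OF w t])
  also have "\<dots> = sw w (\<lambda>y1 y2. ?G y1 (hit \<phi> y2))"
  proof (rule sw_cong)
    fix y1 y2 assume yy: "y1 \<in> carrier K" "y2 \<in> carrier K"
    have l: "klin (?G y1)" using yy h b c i by (intro lin gl; simp)
    show "sw y2 (\<lambda>y2 y3. \<phi> y3 * ?G y1 y2) = ?G y1 (hit \<phi> y2)"
      by (simp add: hit_eval[OF l yy(2)])
  qed
  also have "\<dots> = (\<Sum>l<n. g ((Q i (h \<otimes> hit \<phi> (u l)) \<triangleright> b) \<otimes>\<^bsub>A\<^esub> (Q l w \<triangleright> c)))"
    by (rule sum_Q_act_Q_act[OF g i h w b c \<phi>, symmetric])
  finally show ?thesis .
qed

text \<open>In Sweedler notation: \<open>h\<^sub>1 x\<^sub>1 \<tau>(v\<^sub>1 h\<^sub>2 x\<^sub>2) \<phi>(S(v\<^sub>2 h\<^sub>3)) = S(v\<^sub>1) \<tau>(v\<^sub>2 h x\<^sub>1) \<phi>(x\<^sub>2)\<close>.\<close>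

lemma star_identity:
  assumes f: "klin f" and \<phi>: "klin \<phi>" and h: "h \<in> carrier K" and x: "x \<in> carrier K" and v: "v \<in> carrier K"
  shows "sw h (\<lambda>h1 h'. sw h' (\<lambda>k1 k2. sw x (\<lambda>a b. f (h1 \<otimes> a) * sw v (\<lambda>c d. \<phi> (S (d \<otimes> k2)) * \<tau> (c \<otimes> (k1 \<otimes> b)))))) =
    sw v (\<lambda>c d. f (S c) * sw x (\<lambda>a b. \<phi> b * \<tau> (d \<otimes> (h \<otimes> a))))"
proof -
  note fl = klin_comp[OF f] klin_comp[OF \<phi>]
  let ?L = "\<lambda>c d h1 k1 k2. sw x (\<lambda>a b. \<phi> (S (d \<otimes> k2)) * (f (h1 \<otimes> a) * \<tau> (c \<otimes> (k1 \<otimes> b))))"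
  have "sw h (\<lambda>h1 h'. sw h' (\<lambda>k1 k2. sw x (\<lambda>a b. f (h1 \<otimes> a) * sw v (\<lambda>c d. \<phi> (S (d \<otimes> k2)) * \<tau> (c \<otimes> (k1 \<otimes> b)))))) =
      sw h (\<lambda>h1 h'. sw h' (\<lambda>k1 k2. sw v (\<lambda>c d. ?L c d h1 k1 k2)))"
  proof (intro sw_cong)
    fix h1 h' k1 k2
    have "sw x (\<lambda>a b. f (h1 \<otimes> a) * sw v (\<lambda>c d. \<phi> (S (d \<otimes> k2)) * \<tau> (c \<otimes> (k1 \<otimes> b)))) =
        sw x (\<lambda>a b. sw v (\<lambda>c d. \<phi> (S (d \<otimes> k2)) * (f (h1 \<otimes> a) * \<tau> (c \<otimes> (k1 \<otimes> b)))))"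
      by (simp add: mult.left_commute flip: sw_cmult)
    then show "sw x (\<lambda>a b. f (h1 \<otimes> a) * sw v (\<lambda>c d. \<phi> (S (d \<otimes> k2)) * \<tau> (c \<otimes> (k1 \<otimes> b)))) =
        sw v (\<lambda>c d. ?L c d h1 k1 k2)"
      by (simp only: sw_swap[of x v])
  qed
  also have "\<dots> = sw h (\<lambda>h' k2. sw h' (\<lambda>h1 k1. sw v (\<lambda>c d. ?L c d h1 k1 k2)))"
  proof -
    have t: "ktri (\<lambda>h1 k1 k2. sw v (\<lambda>c d. ?L c d h1 k1 k2))" by (intro lin fl; simp)
    show ?thesis by (rule sw_coassoc[OF h t, symmetric])
  qed
  also have "\<dots> = sw v (\<lambda>c d. sw h (\<lambda>h' k2. sw h' (\<lambda>h1 k1. ?L c d h1 k1 k2)))"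
    by (simp only: sw_swap[of _ v])
  \<comment> \<open>The pairs h_1 x_1 and h_2 x_2 form the coproduct of h' x, and
    \<open>left_invariance\<close> against c replaces it by the legs of c.\<close>
  also have "\<dots> = sw v (\<lambda>c d. sw h (\<lambda>h' k2. sw c (\<lambda>c1 c2. f (S c1) * (\<phi> (S (d \<otimes> k2)) * \<tau> (x \<otimes> (c2 \<otimes> h'))))))"
  proof (intro sw_cong)
    fix c d h' k2 assume cc: "c \<in> carrier K" "d \<in> carrier K" "h' \<in> carrier K" "k2 \<in> carrier K"
    have b: "kbil (\<lambda>x1 x2. f x1 * \<tau> (x2 \<otimes> c))" using cc by (intro lin fl; simp)
    have "sw h' (\<lambda>h1 k1. ?L c d h1 k1 k2) = \<phi> (S (d \<otimes> k2)) * sw (h' \<otimes> x) (\<lambda>x1 x2. f x1 * \<tau> (x2 \<otimes> c))"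
      using cc x by (simp add: sw_mult[OF _ _ b] sw_cmult tr_comm[of c] cong: sw_cong_simp)
    also have "sw (h' \<otimes> x) (\<lambda>x1 x2. f x1 * \<tau> (x2 \<otimes> c)) = sw c (\<lambda>c1 c2. f (S c1) * \<tau> ((h' \<otimes> x) \<otimes> c2))"
      by (rule left_invariance[OF f]) (use cc x in simp_all)
    also have "\<dots> = sw c (\<lambda>c1 c2. f (S c1) * \<tau> (x \<otimes> (c2 \<otimes> h')))"
    proof (rule sw_cong)
      fix c1 c2 assume "c1 \<in> carrier K" "c2 \<in> carrier K"
      then show "f (S c1) * \<tau> ((h' \<otimes> x) \<otimes> c2) = f (S c1) * \<tau> (x \<otimes> (c2 \<otimes> h'))"
        using cc x tr_comm[of h' "x \<otimes> c2"] by (simp add: A_assoc)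
    qed
    finally show "sw h' (\<lambda>h1 k1. ?L c d h1 k1 k2) = sw c (\<lambda>c1 c2. f (S c1) * (\<phi> (S (d \<otimes> k2)) * \<tau> (x \<otimes> (c2 \<otimes> h'))))"
      by (simp add: mult.left_commute flip: sw_cmult)
  qed
  also have "\<dots> = sw v (\<lambda>v' d. sw v' (\<lambda>c1 c2. sw h (\<lambda>h' k2. f (S c1) * (\<phi> (S (d \<otimes> k2)) * \<tau> (x \<otimes> (c2 \<otimes> h'))))))"
    by (simp only: sw_swap[of h])
  also have "\<dots> = sw v (\<lambda>c1 v'. sw v' (\<lambda>c2 d. sw h (\<lambda>h' k2. f (S c1) * (\<phi> (S (d \<otimes> k2)) * \<tau> (x \<otimes> (c2 \<otimes> h'))))))"
  proof -
    have t: "ktri (\<lambda>c1 c2 d. sw h (\<lambda>h' k2. f (S c1) * (\<phi> (S (d \<otimes> k2)) * \<tau> (x \<otimes> (c2 \<otimes> h')))))"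
      using x by (intro lin fl; simp)
    show ?thesis by (rule sw_coassoc[OF v t])
  qed
  also have "\<dots> = sw v (\<lambda>c d. f (S c) * sw x (\<lambda>a b. \<phi> b * \<tau> (d \<otimes> (h \<otimes> a))))"
  proof (rule sw_cong)
    fix c v' assume cc: "c \<in> carrier K" "v' \<in> carrier K"
    have b: "kbil (\<lambda>x1 x2. \<tau> (x \<otimes> x1) * \<phi> (S x2))" using x by (intro lin fl; simp)
    have l: "klin (\<lambda>y. \<phi> (S y))" by (intro lin fl)
    have "sw v' (\<lambda>c2 d. sw h (\<lambda>h' k2. f (S c) * (\<phi> (S (d \<otimes> k2)) * \<tau> (x \<otimes> (c2 \<otimes> h'))))) =
        f (S c) * sw (v' \<otimes> h) (\<lambda>x1 x2. \<tau> (x \<otimes> x1) * \<phi> (S x2))"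
    proof -
      have m: "sw (v' \<otimes> h) (\<lambda>x1 x2. \<tau> (x \<otimes> x1) * \<phi> (S x2)) =
          sw v' (\<lambda>c2 d. sw h (\<lambda>h' k2. \<tau> (x \<otimes> (c2 \<otimes> h')) * \<phi> (S (d \<otimes> k2))))"
        by (rule sw_mult[OF cc(2) h b])
      have "f (S c) * sw (v' \<otimes> h) (\<lambda>x1 x2. \<tau> (x \<otimes> x1) * \<phi> (S x2)) =
          f (S c) * sw v' (\<lambda>c2 d. sw h (\<lambda>h' k2. \<tau> (x \<otimes> (c2 \<otimes> h')) * \<phi> (S (d \<otimes> k2))))"
        by (rule arg_cong[OF m])
      also have "\<dots> = sw v' (\<lambda>c2 d. sw h (\<lambda>h' k2. f (S c) * (\<phi> (S (d \<otimes> k2)) * \<tau> (x \<otimes> (c2 \<otimes> h')))))"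
        unfolding sw_cmult by (simp only: mult.commute)
      finally show ?thesis by (rule sym)
    qed
    \<comment> \<open>The legs of v' and h have been collected into Delta(v' h), which
      \<open>right_invariance\<close> trades for the legs of x; the two antipodes cancel.\<close>
    also have "sw (v' \<otimes> h) (\<lambda>x1 x2. \<tau> (x \<otimes> x1) * \<phi> (S x2)) = sw x (\<lambda>a b. \<phi> (S (S b)) * \<tau> (a \<otimes> (v' \<otimes> h)))"
      by (rule right_invariance[OF l _ x]) (use cc h in simp)
    also have "\<dots> = sw x (\<lambda>a b. \<phi> b * \<tau> (v' \<otimes> (h \<otimes> a)))"
    proof (rule sw_cong)
      fix a b assume "a \<in> carrier K" "b \<in> carrier K"
      then show "\<phi> (S (S b)) * \<tau> (a \<otimes> (v' \<otimes> h)) = \<phi> b * \<tau> (v' \<otimes> (h \<otimes> a))"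
        using cc h tr_comm[of a "v' \<otimes> h"] by (simp add: A_assoc)
    qed
    finally show "sw v' (\<lambda>c2 d. sw h (\<lambda>h' k2. f (S c) * (\<phi> (S (d \<otimes> k2)) * \<tau> (x \<otimes> (c2 \<otimes> h'))))) =
        f (S c) * sw x (\<lambda>a b. \<phi> b * \<tau> (v' \<otimes> (h \<otimes> a)))" .
  qed
  finally show ?thesis .
qed

end

section \<open>The dual weak Kac algebra\<close>

lemma linear_between_cong:
  assumes "complex_space V" "\<And>v. v \<in> carrier V \<Longrightarrow> f v = g v"
  shows "linear_between V W f \<longleftrightarrow> linear_between V W g"
  using assms(2) complex_spaceD(2,9)[OF assms(1)] by (auto simp: linear_between_def Pi_iff)

context markov_kac_algebra begin

abbreviation Kd :: "('k \<Rightarrow> complex) weak_kac" where "Kd \<equiv> dual_kac K"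

lemma Kd_sel:
  "carrier Kd = {\<phi> \<in> extensional (carrier K). klin \<phi>}"
  "\<phi> \<otimes>\<^bsub>Kd\<^esub> \<psi> = restrict (\<lambda>x. lift CC (\<lambda>a b. \<phi> a * \<psi> b) (comult K x)) (carrier K)"
  "\<one>\<^bsub>Kd\<^esub> = restrict \<epsilon> (carrier K)" "\<zero>\<^bsub>Kd\<^esub> = restrict (\<lambda>x. 0) (carrier K)"
  "\<phi> \<oplus>\<^bsub>Kd\<^esub> \<psi> = restrict (\<lambda>x. \<phi> x + \<psi> x) (carrier K)"
  "c \<odot>\<^bsub>Kd\<^esub> \<phi> = restrict (\<lambda>x. c * \<phi> x) (carrier K)"
  "star Kd \<phi> = restrict (\<lambda>x. cnj (\<phi> (S (star K x)))) (carrier K)"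
  "counit Kd \<phi> = \<phi> \<one>"
  by (simp_all add: dual_kac_def dual_algebra_def Let_def)

lemma klin_restrict: "klin (restrict f (carrier K)) \<longleftrightarrow> klin f"
  by (rule linear_between_cong[OF complex_space_K]) simp

lemma restrict_in_Kd: "klin f \<Longrightarrow> restrict f (carrier K) \<in> carrier Kd"
  by (simp add: Kd_sel klin_restrict)

lemma Kd_klin: "\<phi> \<in> carrier Kd \<Longrightarrow> klin \<phi>"
  by (simp add: Kd_sel)

lemma Kd_eqI: "\<phi> \<in> carrier Kd \<Longrightarrow> \<psi> \<in> carrier Kd \<Longrightarrow> (\<And>x. x \<in> carrier K \<Longrightarrow> \<phi> x = \<psi> x) \<Longrightarrow> \<phi> = \<psi>"
  by (rule extensionalityI) (auto simp: Kd_sel)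

lemma klin_add: "klin f \<Longrightarrow> klin g \<Longrightarrow> klin (\<lambda>x. f x + g x)"
  by (simp add: linear_between_def distrib_left)

lemma Kd_eval:
  assumes "x \<in> carrier K"
  shows "(\<phi> \<otimes>\<^bsub>Kd\<^esub> \<psi>) x = sw x (\<lambda>a b. \<phi> a * \<psi> b)" "\<one>\<^bsub>Kd\<^esub> x = \<epsilon> x" "\<zero>\<^bsub>Kd\<^esub> x = 0"
    "(\<phi> \<oplus>\<^bsub>Kd\<^esub> \<psi>) x = \<phi> x + \<psi> x" "(c \<odot>\<^bsub>Kd\<^esub> \<phi>) x = c * \<phi> x" "star Kd \<phi> x = cnj (\<phi> (S (star K x)))"
  using assms by (simp_all add: Kd_sel(2-7) KK.lift_CC' sw_eval)

lemma Kd_closed: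
  "\<phi> \<in> carrier Kd \<Longrightarrow> \<psi> \<in> carrier Kd \<Longrightarrow> \<phi> \<otimes>\<^bsub>Kd\<^esub> \<psi> \<in> carrier Kd" "\<one>\<^bsub>Kd\<^esub> \<in> carrier Kd"
  "\<zero>\<^bsub>Kd\<^esub> \<in> carrier Kd" "\<phi> \<in> carrier Kd \<Longrightarrow> \<psi> \<in> carrier Kd \<Longrightarrow> \<phi> \<oplus>\<^bsub>Kd\<^esub> \<psi> \<in> carrier Kd"
  "\<phi> \<in> carrier Kd \<Longrightarrow> c \<odot>\<^bsub>Kd\<^esub> \<phi> \<in> carrier Kd" "\<phi> \<in> carrier Kd \<Longrightarrow> star Kd \<phi> \<in> carrier Kd"
proof -
  show "\<phi> \<otimes>\<^bsub>Kd\<^esub> \<psi> \<in> carrier Kd" if "\<phi> \<in> carrier Kd" "\<psi> \<in> carrier Kd"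
  proof -
    have "klin (\<lambda>x. sw x (\<lambda>a b. \<phi> a * \<psi> b))"
      by (intro lin klin_comp[OF Kd_klin[OF that(1)]] klin_comp[OF Kd_klin[OF that(2)]])
    moreover have "\<phi> \<otimes>\<^bsub>Kd\<^esub> \<psi> = restrict (\<lambda>x. sw x (\<lambda>a b. \<phi> a * \<psi> b)) (carrier K)"
      unfolding Kd_sel(2) by (rule restrict_ext) (simp add: KK.lift_CC' sw_eval)
    ultimately show ?thesis using restrict_in_Kd by simp
  qed
  show "\<one>\<^bsub>Kd\<^esub> \<in> carrier Kd" unfolding Kd_sel(3) by (rule restrict_in_Kd) (rule counit_linear)
  show "\<zero>\<^bsub>Kd\<^esub> \<in> carrier Kd" unfolding Kd_sel(4) by (rule restrict_in_Kd) (simp add: linear_between_def)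
  show "\<phi> \<oplus>\<^bsub>Kd\<^esub> \<psi> \<in> carrier Kd" if "\<phi> \<in> carrier Kd" "\<psi> \<in> carrier Kd"
    unfolding Kd_sel(5) by (intro restrict_in_Kd klin_add Kd_klin that)
  show "c \<odot>\<^bsub>Kd\<^esub> \<phi> \<in> carrier Kd" if "\<phi> \<in> carrier Kd"
    unfolding Kd_sel(6) by (intro restrict_in_Kd lin klin_comp[OF Kd_klin[OF that]])
  show "star Kd \<phi> \<in> carrier Kd" if "\<phi> \<in> carrier Kd"
  proof -
    have l: "klin (\<lambda>x. \<phi> (S x))" by (intro lin klin_comp[OF Kd_klin[OF that]])
    show ?thesis unfolding Kd_sel(7) by (rule restrict_in_Kd) (rule linear_cnj_star[OF l])
  qed
qed

lemma Kd_space: "complex_space Kd"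
proof (rule complex_spaceI)
  show "abelian_group Kd"
  proof (rule abelian_groupI)
    fix \<phi> assume \<phi>: "\<phi> \<in> carrier Kd"
    show "\<exists>\<psi>\<in>carrier Kd. \<psi> \<oplus>\<^bsub>Kd\<^esub> \<phi> = \<zero>\<^bsub>Kd\<^esub>"
      by (rule bexI[of _ "(-1) \<odot>\<^bsub>Kd\<^esub> \<phi>"], rule Kd_eqI)
        (use \<phi> in \<open>simp_all add: Kd_closed Kd_eval\<close>)
  qed (auto intro!: Kd_eqI simp: Kd_closed Kd_eval)
qed (auto intro!: Kd_eqI simp: Kd_closed Kd_eval algebra_simps)

lemma linear_ev [lin]: "x \<in> carrier K \<Longrightarrow> linear_between Kd CC (\<lambda>\<phi>. \<phi> x)"
  by (simp add: linear_between_def Kd_eval)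

sublocale TD: tensor_product Kd Kd
  by (rule tensor_product.intro[OF Kd_space Kd_space])

text \<open>The functionals \<open>ip r\<close> form the basis of the dual belonging to the
  orthonormal basis \<open>B\<close>.\<close>

lemma dual_expand:
  assumes B: "onb (carrier K) B" and F: "linear_between Kd CC F" and \<phi>: "\<phi> \<in> carrier Kd"
  shows "F \<phi> = (\<Sum>r\<in>B. \<phi> r * F (restrict (ip r) (carrier K)))"
proof -
  note Bc = onbD(4)[OF B]
  have ipK: "restrict (ip r) (carrier K) \<in> carrier Kd" if "r \<in> B" for r
    by (rule restrict_in_Kd) (rule klin_ip[OF Bc[OF that]])
  have c: "(\<phi> r) \<odot>\<^bsub>Kd\<^esub> restrict (ip r) (carrier K) \<in> carrier Kd" if "r \<in> B" for r
    by (rule Kd_closed(5)[OF ipK[OF that]])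
  have "\<phi> = finsum Kd (\<lambda>r. (\<phi> r) \<odot>\<^bsub>Kd\<^esub> restrict (ip r) (carrier K)) B"
  proof (rule Kd_eqI[OF \<phi>])
    interpret G: abelian_group Kd by (rule complex_spaceD(1)[OF Kd_space])
    show "finsum Kd (\<lambda>r. (\<phi> r) \<odot>\<^bsub>Kd\<^esub> restrict (ip r) (carrier K)) B \<in> carrier Kd"
      by (rule G.finsum_closed) (use c in auto)
    fix x assume x: "x \<in> carrier K"
    have "finsum Kd (\<lambda>r. (\<phi> r) \<odot>\<^bsub>Kd\<^esub> restrict (ip r) (carrier K)) B x =
        (\<Sum>r\<in>B. ((\<phi> r) \<odot>\<^bsub>Kd\<^esub> restrict (ip r) (carrier K)) x)"
      by (rule linear_functional_finsum[OF linear_ev[OF x] Kd_space onbD(2)[OF B] c])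
    also have "\<dots> = (\<Sum>r\<in>B. ip r x * \<phi> r)"
      using x by (simp add: Kd_eval mult.commute)
    also have "\<dots> = \<phi> x" by (rule onbD(6)[OF B x Kd_klin[OF \<phi>]])
    finally show "\<phi> x = finsum Kd (\<lambda>r. (\<phi> r) \<odot>\<^bsub>Kd\<^esub> restrict (ip r) (carrier K)) B x" by simp
  qed
  then have "F \<phi> = F (finsum Kd (\<lambda>r. (\<phi> r) \<odot>\<^bsub>Kd\<^esub> restrict (ip r) (carrier K)) B)" by simp
  also have "\<dots> = (\<Sum>r\<in>B. F ((\<phi> r) \<odot>\<^bsub>Kd\<^esub> restrict (ip r) (carrier K)))"
    by (rule linear_functional_finsum[OF F Kd_space onbD(2)[OF B] c])
  also have "\<dots> = (\<Sum>r\<in>B. \<phi> r * F (restrict (ip r) (carrier K)))"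
    using ipK by (simp add: linear_betweenD[OF F])
  finally show ?thesis .
qed

lemma tensor_space_Kd: "tensor_space (dual_algebra K) (dual_algebra K) = tensor_space Kd Kd"
  by (simp add: tensor_space_def tensor_null_def bilinear_relations_def dual_kac_def Let_def)

text \<open>The coproduct of the dual is a definite description, so unique existence has to be
  shown. With an orthonormal basis, the sum of \<phi>(_ r) \<otimes> \<open>ip r\<close> has the
  required values. Uniqueness holds because every bilinear form on the dual expands into evaluations
  at pairs of basis elements.\<close>

lemma comult_Kd:
  assumes \<phi>: "\<phi> \<in> carrier Kd"
  shows "comult Kd \<phi> \<in> carrier (tensor_space Kd Kd)"
    and "x \<in> carrier K \<Longrightarrow> y \<in> carrier K \<Longrightarrow> tensor_eval (comult Kd \<phi>) (\<lambda>\<alpha> \<beta>. \<alpha> x * \<beta> y) = \<phi> (x \<otimes> y)"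
proof -
  let ?T = "tensor_space Kd Kd"
  let ?P = "\<lambda>t. t \<in> carrier ?T \<and> (\<forall>x\<in>carrier K. \<forall>y\<in>carrier K. lift CC (\<lambda>\<alpha> \<beta>. \<alpha> x * \<beta> y) t = \<phi> (x \<otimes> y))"
  note fl = klin_comp[OF Kd_klin[OF \<phi>]]
  obtain B where B: "onb (carrier K) B" using onb_exists[OF ksubspace_carrier] by blast
  note Bc = onbD(4)[OF B]
  have bev: "bilinear_on Kd Kd (\<lambda>\<alpha> \<beta>. \<alpha> x * \<beta> y)" if "x \<in> carrier K" "y \<in> carrier K" for x y
    by (intro lin that)
  have "\<exists>!t. ?P t"
  proof (rule ex_ex1I)
    let ?a = "\<lambda>r. restrict (\<lambda>x. \<phi> (x \<otimes> r)) (carrier K)" and ?b = "\<lambda>r. restrict (ip r) (carrier K)"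
    have ab: "?a r \<in> carrier Kd" "?b r \<in> carrier Kd" if "r \<in> B" for r
      using restrict_in_Kd[OF klin_ip[OF Bc[OF that]]] Bc[OF that] by (simp_all) (intro restrict_in_Kd lin fl; simp)
    have c: "pure_tensor Kd Kd (?a r) (?b r) \<in> carrier ?T" if "r \<in> B" for r
      by (rule TD.pure_closed) (use ab[OF that] in auto)
    let ?t = "finsum ?T (\<lambda>r. pure_tensor Kd Kd (?a r) (?b r)) B"
    interpret G: abelian_group ?T by (rule complex_spaceD(1)[OF TD.space])
    have t: "?t \<in> carrier ?T" by (rule G.finsum_closed) (use c in auto)
    have "tensor_eval ?t (\<lambda>\<alpha> \<beta>. \<alpha> x * \<beta> y) = \<phi> (x \<otimes> y)" if xy: "x \<in> carrier K" "y \<in> carrier K" for x y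
    proof -
      have "tensor_eval ?t (\<lambda>\<alpha> \<beta>. \<alpha> x * \<beta> y) =
          (\<Sum>r\<in>B. tensor_eval (pure_tensor Kd Kd (?a r) (?b r)) (\<lambda>\<alpha> \<beta>. \<alpha> x * \<beta> y))"
        by (rule linear_functional_finsum[OF TD.eval_linear[OF bev[OF xy]] TD.space onbD(2)[OF B] c])
      also have "\<dots> = (\<Sum>r\<in>B. ip r y * \<phi> (x \<otimes> r))"
        using xy by (simp add: TD.pure_eval[OF bev[OF xy]] mult.commute)
      also have "\<dots> = \<phi> (x \<otimes> y)"
        by (rule onbD(6)[OF B xy(2)]) (use xy in \<open>intro lin fl; simp\<close>)
      finally show ?thesis .
    qed
    then have "?P ?t" using t by (simp add: TD.lift_CC')
    then show "\<exists>t. ?P t" by blast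
  next
    fix s t assume s: "?P s" and t: "?P t"
    have eq: "tensor_eval s (\<lambda>\<alpha> \<beta>. \<alpha> x * \<beta> y) = tensor_eval t (\<lambda>\<alpha> \<beta>. \<alpha> x * \<beta> y)"
      if "x \<in> carrier K" "y \<in> carrier K" for x y
      using s t that
      by (simp add: TD.lift_CC'[OF conjunct1[OF s], symmetric] TD.lift_CC'[OF conjunct1[OF t], symmetric])
    show "s = t"
    proof (rule TD.eval_eqI)
      fix F assume F: "bilinear_on Kd Kd F"
      let ?i = "\<lambda>r. restrict (ip r) (carrier K)"
      have iK: "?i r \<in> carrier Kd" if "r \<in> B" for r
        by (rule restrict_in_Kd) (rule klin_ip[OF Bc[OF that]])
      have ex: "tensor_eval w F = (\<Sum>r\<in>B. \<Sum>q\<in>B. tensor_eval w (\<lambda>\<alpha> \<beta>. \<alpha> r * \<beta> q) * F (?i r) (?i q))"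
        if w: "w \<in> carrier ?T" for w
      proof -
        have "tensor_eval w F = tensor_eval w (\<lambda>\<alpha> \<beta>. \<Sum>r\<in>B. \<Sum>q\<in>B. (\<alpha> r * \<beta> q) * F (?i r) (?i q))"
        proof (rule TD.eval_cong[OF w])
          fix \<alpha> \<beta> assume "(\<alpha>, \<beta>) \<in> carrier Kd \<times> carrier Kd"
          then have ab: "\<alpha> \<in> carrier Kd" "\<beta> \<in> carrier Kd" by auto
          have "F \<alpha> \<beta> = (\<Sum>r\<in>B. \<alpha> r * F (?i r) \<beta>)"
            by (rule dual_expand[OF B bilinear_onD(2)[OF F ab(2)] ab(1)])
          also have "\<dots> = (\<Sum>r\<in>B. \<Sum>q\<in>B. (\<alpha> r * \<beta> q) * F (?i r) (?i q))"
          proof (rule sum.cong[OF refl])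
            fix r assume r: "r \<in> B"
            have "F (?i r) \<beta> = (\<Sum>q\<in>B. \<beta> q * F (?i r) (?i q))"
              by (rule dual_expand[OF B bilinear_onD(1)[OF F iK[OF r]] ab(2)])
            then show "\<alpha> r * F (?i r) \<beta> = (\<Sum>q\<in>B. (\<alpha> r * \<beta> q) * F (?i r) (?i q))"
              by (simp add: sum_distrib_left mult.assoc)
          qed
          finally show "F \<alpha> \<beta> = (\<Sum>r\<in>B. \<Sum>q\<in>B. (\<alpha> r * \<beta> q) * F (?i r) (?i q))" .
        qed
        then show ?thesis by (simp only: tensor_eval_sum tensor_eval_multc)
      qed
      show "tensor_eval s F = tensor_eval t F"
        using s t Bc by (simp add: ex eq cong: sum.cong)
    qed (use s t in auto)
  qed
  then have "?P (THE t. ?P t)" by (rule theI')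
  moreover have "comult Kd \<phi> = (THE t. ?P t)"
    unfolding tensor_space_Kd[symmetric] by (subst (1) dual_kac_def) (simp add: Let_def)
  ultimately have "?P (comult Kd \<phi>)" by simp
  then show "comult Kd \<phi> \<in> carrier ?T"
    and "x \<in> carrier K \<Longrightarrow> y \<in> carrier K \<Longrightarrow> tensor_eval (comult Kd \<phi>) (\<lambda>\<alpha> \<beta>. \<alpha> x * \<beta> y) = \<phi> (x \<otimes> y)"
    using TD.lift_CC'[of "comult Kd \<phi>"] by auto
qed

lemma tensor_eval_sw_swap:
  "h \<in> carrier K \<Longrightarrow> tensor_eval t (\<lambda>a b. sw h (\<lambda>c d. F a b c d)) = sw h (\<lambda>c d. tensor_eval t (\<lambda>a b. F a b c d))"
  unfolding sw_eval by (rule tensor_eval_swap)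

sublocale SD: star_tensor_product Kd Kd
  by (intro star_tensor_product.intro star_tensor_product_axioms.intro TD.tensor_product_axioms)
    (simp_all add: Kd_closed)

lemma linear_Kd_mult [lin]:
  assumes "\<alpha> \<in> carrier Kd" "x \<in> carrier K"
  shows "linear_between Kd CC (\<lambda>\<gamma>. (\<alpha> \<otimes>\<^bsub>Kd\<^esub> \<gamma>) x)" "linear_between Kd CC (\<lambda>\<gamma>. (\<gamma> \<otimes>\<^bsub>Kd\<^esub> \<alpha>) x)"
proof -
  have "linear_between Kd CC (\<lambda>\<gamma>. sw x (\<lambda>a b. \<alpha> a * \<gamma> b))" "linear_between Kd CC (\<lambda>\<gamma>. sw x (\<lambda>a b. \<gamma> a * \<alpha> b))"
    by (intro lin; simp)+
  then show "linear_between Kd CC (\<lambda>\<gamma>. (\<alpha> \<otimes>\<^bsub>Kd\<^esub> \<gamma>) x)" "linear_between Kd CC (\<lambda>\<gamma>. (\<gamma> \<otimes>\<^bsub>Kd\<^esub> \<alpha>) x)"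
    using assms by (simp_all add: Kd_eval)
qed

text \<open>The coproduct of the unit \<epsilon> pairs with products of elements, so the definition
  evaluates at x to \<epsilon>(1_1 x) \<omega>(1_2). Thus \<open>eps_t\<close> of the dual is the
  transpose of \<open>eps_t\<close>.\<close>

lemma eps_t_Kd:
  assumes \<omega>: "\<omega> \<in> carrier Kd"
  shows "eps_t Kd \<omega> \<in> carrier Kd" "x \<in> carrier K \<Longrightarrow> eps_t Kd \<omega> x = \<omega> (eps_t K x)"
proof -
  let ?D = "comult Kd \<one>\<^bsub>Kd\<^esub>" and ?p = "pure_tensor Kd Kd \<omega> \<one>\<^bsub>Kd\<^esub>"
  let ?m = "?D \<otimes>\<^bsub>tensor_algebra Kd Kd\<^esub> ?p"
  have D: "?D \<in> carrier (tensor_space Kd Kd)" by (rule comult_Kd(1)) (rule Kd_closed)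
  have p: "?p \<in> carrier (tensor_space Kd Kd)" by (rule TD.pure_closed) (use \<omega> Kd_closed in auto)
  have m: "?m \<in> carrier (tensor_space Kd Kd)" by (rule SD.mult_closed[OF D p])
  show "eps_t Kd \<omega> \<in> carrier Kd"
    unfolding eps_t_def slice_left_def by (rule TD.lift_closed'[OF Kd_space m]) (simp add: Kd_closed)
  show "eps_t Kd \<omega> x = \<omega> (eps_t K x)" if x: "x \<in> carrier K"
  proof -
    have b: "bilinear_on Kd Kd (\<lambda>\<alpha> \<beta>. \<alpha> \<one> * \<beta> x)" using x by (intro lin; simp)
    have "eps_t Kd \<omega> x = tensor_eval ?m (\<lambda>\<alpha> \<beta>. (counit Kd \<alpha> \<odot>\<^bsub>Kd\<^esub> \<beta>) x)"
      unfolding eps_t_def slice_left_def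
      by (rule TD.functional_lift'[OF Kd_space m _ linear_ev[OF x]]) (simp add: Kd_closed)
    also have "\<dots> = tensor_eval ?m (\<lambda>\<alpha> \<beta>. \<alpha> \<one> * \<beta> x)"
      using x by (simp add: Kd_eval Kd_sel(8))
    also have "\<dots> = tensor_eval ?D (\<lambda>\<alpha> \<beta>. tensor_eval ?p (\<lambda>\<gamma> \<delta>. (\<alpha> \<otimes>\<^bsub>Kd\<^esub> \<gamma>) \<one> * (\<beta> \<otimes>\<^bsub>Kd\<^esub> \<delta>) x))"
      by (rule SD.mult_eval[OF D p b])
    also have "\<dots> = tensor_eval ?D (\<lambda>\<alpha> \<beta>. sw \<one> (\<lambda>a b. \<omega> b * (\<alpha> a * \<beta> x)))"
    proof (rule TD.eval_cong[OF D])
      fix \<alpha> \<beta> assume "(\<alpha>, \<beta>) \<in> carrier Kd \<times> carrier Kd"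
      then have ab: "\<alpha> \<in> carrier Kd" "\<beta> \<in> carrier Kd" by auto
      have b: "bilinear_on Kd Kd (\<lambda>\<gamma> \<delta>. (\<alpha> \<otimes>\<^bsub>Kd\<^esub> \<gamma>) \<one> * (\<beta> \<otimes>\<^bsub>Kd\<^esub> \<delta>) x)"
        using ab x by (intro lin; simp)
      have "sw x (\<lambda>a b. \<beta> a * \<one>\<^bsub>Kd\<^esub> b) = \<beta> x"
        using sw_counit_right[OF Kd_klin[OF ab(2)] x] by (simp add: Kd_eval mult.commute cong: sw_cong_simp)
      then show "tensor_eval ?p (\<lambda>\<gamma> \<delta>. (\<alpha> \<otimes>\<^bsub>Kd\<^esub> \<gamma>) \<one> * (\<beta> \<otimes>\<^bsub>Kd\<^esub> \<delta>) x) = sw \<one> (\<lambda>a b. \<omega> b * (\<alpha> a * \<beta> x))"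
        using x by (subst TD.pure_eval[OF b]) (simp add: Kd_eval(1) mult.left_commute mult.commute flip: sw_cmult)
    qed
    also have "\<dots> = sw \<one> (\<lambda>a b. \<omega> b * \<epsilon> (a \<otimes> x))"
      using x by (subst tensor_eval_sw_swap)
        (simp_all add: tensor_eval_cmult comult_Kd(2)[OF Kd_closed(2)] Kd_eval cong: sw_cong_simp)
    also have "\<dots> = \<omega> (eps_t K x)"
      using eps_t_eval[OF Kd_klin[OF \<omega>] x] by (simp add: mult.commute)
    finally show ?thesis .
  qed
qed

lemma Cartan_Kd:
  assumes "\<psi> \<in> Cartan_t Kd"
  shows "\<psi> \<in> carrier Kd" "x \<in> carrier K \<Longrightarrow> \<psi> (eps_t K x) = \<psi> x"
proof -
  obtain \<omega> where \<omega>: "\<omega> \<in> carrier Kd" "\<psi> = eps_t Kd \<omega>"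
    using assms unfolding Cartan_t_def by blast
  show "\<psi> \<in> carrier Kd" unfolding \<omega>(2) by (rule eps_t_Kd(1)[OF \<omega>(1)])
  show "\<psi> (eps_t K x) = \<psi> x" if "x \<in> carrier K"
    unfolding \<omega>(2) using that by (simp add: eps_t_Kd(2)[OF \<omega>(1)])
qed

text \<open>For z in \<open>R\<close> the trace turns \<epsilon>(z eps_t(x)) into \<epsilon>(z x),
  so the functional is a fixed point of the transposed \<open>eps_t\<close>. These elements carry
  the balancing of the outer crossed product in \<open>Theta_R_right\<close>.\<close>

lemma counit_in_Cartan_Kd:
  assumes z: "z \<in> R"
  shows "restrict (\<lambda>x. \<epsilon> (z \<otimes> x)) (carrier K) \<in> Cartan_t Kd"
proof -
  let ?\<psi> = "restrict (\<lambda>x. \<epsilon> (z \<otimes> x)) (carrier K)"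
  have \<psi>: "?\<psi> \<in> carrier Kd" using z by (intro restrict_in_Kd lin; simp)
  have "\<epsilon> (z \<otimes> eps_t K x) = \<epsilon> (z \<otimes> x)" if "x \<in> carrier K" for x
    using that z eps_t_mult_left[OF z that] tr_eps_t[of "z \<otimes> x"] tr_R[of "z \<otimes> eps_t K x"] by simp
  then have "?\<psi> = eps_t Kd ?\<psi>"
    by (intro Kd_eqI \<psi> eps_t_Kd) (simp add: eps_t_Kd[OF \<psi>])
  then show ?thesis using \<psi> unfolding Cartan_t_def by blast
qed

end

section \<open>The crossed product by \<open>K\<close> and the dual action on it\<close>

context markov_action begin

abbreviation AK where "AK \<equiv> crossed_product K A act"
abbreviation XX where "XX \<equiv> crossed_space K A act"
abbreviation cl where "cl \<equiv> crossed_class K A act"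
abbreviation hat where "hat \<equiv> dual_action K A act"

sublocale I: crossed_data K A act
  by unfold_locales (simp_all add: complex_space_A complex_space_K)

text \<open>eps_t(y_1) y_2 equals S(1_1) 1_2 y by \<open>sw_eps_t_left\<close>, and S(1_1) 1_2 =
  1.\<close>

lemma sw_eps_t_mult: "klin f \<Longrightarrow> y \<in> carrier K \<Longrightarrow> sw y (\<lambda>q r. f (eps_t K q \<otimes> r)) = f y"
proof -
  assume f: "klin f" and y: "y \<in> carrier K"
  have b: "kbil (\<lambda>q r. f (q \<otimes> r))" by (intro lin klin_comp[OF f]; simp)
  have l: "klin (\<lambda>x. f (x \<otimes> y))" using y by (intro lin klin_comp[OF f]; simp)
  have "sw y (\<lambda>q r. f (eps_t K q \<otimes> r)) = sw \<one> (\<lambda>q r. f ((S q \<otimes> r) \<otimes> y))"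
    using sw_eps_t_left[OF b y] y by (simp add: A_assoc cong: sw_cong_simp)
  also have "\<dots> = f y"
    using antipode_eps_s_eval[OF l, of \<one>] y by simp
  finally show ?thesis .
qed

context
  fixes \<Phi> assumes \<Phi>: "linear_between XX CC \<Phi>"
begin

lemma Phi_props:
  "bilinear_on A K (\<lambda>b h. \<Phi> (cl b h))"
  "b \<in> carrier A \<Longrightarrow> z \<in> R \<Longrightarrow> h \<in> carrier K \<Longrightarrow> \<Phi> (cl (b \<otimes>\<^bsub>A\<^esub> (z \<triangleright> \<one>\<^bsub>A\<^esub>)) h) = \<Phi> (cl b (z \<otimes> h))"
  using I.X_functional(1)[OF \<Phi>] by (auto simp: I.vanishes_crossed)

text \<open>The product is well defined in its right factor. Letting h_1 act on c(z \<triangleright>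
  1) yields (h_1 \<triangleright> c)(eps_t(h_2 z) \<triangleright> 1); the second factor crosses the
  tensor sign, and eps_t(h_2 z) h_3 reduces to h_2 z.\<close>

lemma crossed_mult_vanishes:
  assumes b: "b \<in> carrier A" and h: "h \<in> carrier K"
  shows "vanishes_on (crossed_null K A act) (\<lambda>c k. sw h (\<lambda>h1 h2. \<Phi> (cl (b \<otimes>\<^bsub>A\<^esub> (h1 \<triangleright> c)) (h2 \<otimes> k))))"
  unfolding I.vanishes_crossed
proof (intro conjI ballI)
  note pl = bilinear_on_comp[OF Phi_props(1)]
  show "bilinear_on A K (\<lambda>c k. sw h (\<lambda>h1 h2. \<Phi> (cl (b \<otimes>\<^bsub>A\<^esub> (h1 \<triangleright> c)) (h2 \<otimes> k))))"
    using b h by (intro lin pl; simp)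
  fix c z k assume c: "c \<in> carrier A" and z: "z \<in> R" and k: "k \<in> carrier K"
  have t: "ktri (\<lambda>p q h2. \<Phi> (cl (b \<otimes>\<^bsub>A\<^esub> (p \<triangleright> c)) (eps_t K (q \<otimes> z) \<otimes> (h2 \<otimes> k))))"
    using b c z k by (intro lin pl; simp)
  have "sw h (\<lambda>h1 h2. \<Phi> (cl (b \<otimes>\<^bsub>A\<^esub> (h1 \<triangleright> (c \<otimes>\<^bsub>A\<^esub> (z \<triangleright> \<one>\<^bsub>A\<^esub>)))) (h2 \<otimes> k))) =
      sw h (\<lambda>h1 h2. sw h1 (\<lambda>p q. \<Phi> (cl (b \<otimes>\<^bsub>A\<^esub> (p \<triangleright> c)) (eps_t K (q \<otimes> z) \<otimes> (h2 \<otimes> k)))))"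
  proof (rule sw_cong)
    fix h1 h2 assume hh: "h1 \<in> carrier K" "h2 \<in> carrier K"
    have g: "alin (\<lambda>a. \<Phi> (cl (b \<otimes>\<^bsub>A\<^esub> a) (h2 \<otimes> k)))" using b k hh by (intro lin pl; simp)
    have e: "\<Phi> (cl (b \<otimes>\<^bsub>A\<^esub> ((p \<triangleright> c) \<otimes>\<^bsub>A\<^esub> (q \<triangleright> (z \<triangleright> \<one>\<^bsub>A\<^esub>)))) (h2 \<otimes> k)) =
        \<Phi> (cl (b \<otimes>\<^bsub>A\<^esub> (p \<triangleright> c)) (eps_t K (q \<otimes> z) \<otimes> (h2 \<otimes> k)))" if "p \<in> carrier K" "q \<in> carrier K" for p q
    proof -
      have "q \<triangleright> (z \<triangleright> \<one>\<^bsub>A\<^esub>) = eps_t K (q \<otimes> z) \<triangleright> \<one>\<^bsub>A\<^esub>"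
        using that z act_unit[of "q \<otimes> z"] by (simp add: act_act)
      then have "b \<otimes>\<^bsub>A\<^esub> ((p \<triangleright> c) \<otimes>\<^bsub>A\<^esub> (q \<triangleright> (z \<triangleright> \<one>\<^bsub>A\<^esub>))) =
          (b \<otimes>\<^bsub>A\<^esub> (p \<triangleright> c)) \<otimes>\<^bsub>A\<^esub> (eps_t K (q \<otimes> z) \<triangleright> \<one>\<^bsub>A\<^esub>)"
        using that z b c by (simp add: A.A_assoc)
      then show ?thesis using that z b c k hh by (simp add: Phi_props(2))
    qed
    show "\<Phi> (cl (b \<otimes>\<^bsub>A\<^esub> (h1 \<triangleright> (c \<otimes>\<^bsub>A\<^esub> (z \<triangleright> \<one>\<^bsub>A\<^esub>)))) (h2 \<otimes> k)) =
        sw h1 (\<lambda>p q. \<Phi> (cl (b \<otimes>\<^bsub>A\<^esub> (p \<triangleright> c)) (eps_t K (q \<otimes> z) \<otimes> (h2 \<otimes> k))))"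
      using act_mult_eval[OF g hh(1) c, of "z \<triangleright> \<one>\<^bsub>A\<^esub>"] z by (simp add: e cong: sw_cong_simp)
  qed
  also have "\<dots> = sw h (\<lambda>p h'. sw h' (\<lambda>q h2. \<Phi> (cl (b \<otimes>\<^bsub>A\<^esub> (p \<triangleright> c)) (eps_t K (q \<otimes> z) \<otimes> (h2 \<otimes> k)))))"
    by (rule sw_coassoc[OF h t])
  also have "\<dots> = sw h (\<lambda>p h'. \<Phi> (cl (b \<otimes>\<^bsub>A\<^esub> (p \<triangleright> c)) (h' \<otimes> (z \<otimes> k))))"
  proof (rule sw_cong)
    fix p h' assume pp: "p \<in> carrier K" "h' \<in> carrier K"
    have l: "klin (\<lambda>y. \<Phi> (cl (b \<otimes>\<^bsub>A\<^esub> (p \<triangleright> c)) (y \<otimes> k)))" using b c k pp by (intro lin pl; simp)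
    have bb: "kbil (\<lambda>q h2. \<Phi> (cl (b \<otimes>\<^bsub>A\<^esub> (p \<triangleright> c)) (eps_t K q \<otimes> (h2 \<otimes> k))))" using b c k pp by (intro lin pl; simp)
    have "sw h' (\<lambda>q h2. \<Phi> (cl (b \<otimes>\<^bsub>A\<^esub> (p \<triangleright> c)) (eps_t K (q \<otimes> z) \<otimes> (h2 \<otimes> k)))) =
        sw (h' \<otimes> z) (\<lambda>q h2. \<Phi> (cl (b \<otimes>\<^bsub>A\<^esub> (p \<triangleright> c)) ((eps_t K q \<otimes> h2) \<otimes> k)))"
      using k pp by (subst sw_R_right[OF z pp(2) bb, symmetric]) (simp add: A_assoc cong: sw_cong_simp)
    then show "sw h' (\<lambda>q h2. \<Phi> (cl (b \<otimes>\<^bsub>A\<^esub> (p \<triangleright> c)) (eps_t K (q \<otimes> z) \<otimes> (h2 \<otimes> k)))) =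
        \<Phi> (cl (b \<otimes>\<^bsub>A\<^esub> (p \<triangleright> c)) (h' \<otimes> (z \<otimes> k)))"
      using sw_eps_t_mult[OF l, of "h' \<otimes> z"] pp z k by (simp add: A_assoc)
  qed
  finally show "sw h (\<lambda>h1 h2. \<Phi> (cl (b \<otimes>\<^bsub>A\<^esub> (h1 \<triangleright> (c \<otimes>\<^bsub>A\<^esub> (z \<triangleright> \<one>\<^bsub>A\<^esub>)))) (h2 \<otimes> k))) =
      sw h (\<lambda>h1 h2. \<Phi> (cl (b \<otimes>\<^bsub>A\<^esub> (h1 \<triangleright> c)) (h2 \<otimes> (z \<otimes> k))))" .
qed

lemma hat_vanishes:
  assumes \<psi>: "klin \<psi>"
  shows "vanishes_on (crossed_null K A act) (\<lambda>a h. sw h (\<lambda>h1 h2. \<psi> h2 * \<Phi> (cl a h1)))"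
  unfolding I.vanishes_crossed
proof (intro conjI ballI)
  note pl = bilinear_on_comp[OF Phi_props(1)] klin_comp[OF \<psi>]
  show "bilinear_on A K (\<lambda>a h. sw h (\<lambda>h1 h2. \<psi> h2 * \<Phi> (cl a h1)))"
    by (intro lin pl; simp)
  fix a z h assume a: "a \<in> carrier A" and z: "z \<in> R" and h: "h \<in> carrier K"
  have b: "kbil (\<lambda>h1 h2. \<psi> h2 * \<Phi> (cl a h1))" using a by (intro lin pl; simp)
  show "sw h (\<lambda>h1 h2. \<psi> h2 * \<Phi> (cl (a \<otimes>\<^bsub>A\<^esub> (z \<triangleright> \<one>\<^bsub>A\<^esub>)) h1)) = sw (z \<otimes> h) (\<lambda>h1 h2. \<psi> h2 * \<Phi> (cl a h1))"
    using a z by (simp add: sw_R_left[OF z h b] Phi_props(2) cong: sw_cong_simp)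
qed

lemma hat_eval:
  assumes "t \<in> carrier XX"
  shows "\<Phi> (hat \<psi> t) = tensor_eval t (\<lambda>a h. sw h (\<lambda>h1 h2. \<psi> h2 * \<Phi> (cl a h1)))"
  unfolding I.dual_action_eval[OF assms \<Phi>]
  by (rule I.X_eval_cong[OF assms]) (simp add: sw_eval)

lemma AK_mult_eval:
  assumes "s \<in> carrier XX" "t \<in> carrier XX"
  shows "\<Phi> (s \<otimes>\<^bsub>AK\<^esub> t) = tensor_eval s (\<lambda>b h. tensor_eval t (\<lambda>c k. sw h (\<lambda>h1 h2. \<Phi> (cl (b \<otimes>\<^bsub>A\<^esub> (h1 \<triangleright> c)) (h2 \<otimes> k)))))"
  unfolding I.AxK_mult_eval[OF assms \<Phi>]
  by (rule I.X_eval_cong[OF assms(1)], rule I.X_eval_cong[OF assms(2)]) (simp add: sw_eval)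

text \<open>The dual action sends the unit to [1 \<otimes> psi.1]. In the product h_1
  \<triangleright> 1 = eps_t(h_1) \<triangleright> 1 crosses the tensor sign, and eps_t(h_1) h_2 =
  h. This makes the balancing relation of the outer crossed product explicit.\<close>

lemma AK_mult_hat_one:
  assumes s: "s \<in> carrier XX" and \<psi>: "klin \<psi>"
  shows "\<Phi> (s \<otimes>\<^bsub>AK\<^esub> hat \<psi> \<one>\<^bsub>AK\<^esub>) = tensor_eval s (\<lambda>b h. \<Phi> (cl b (h \<otimes> hit \<psi> \<one>)))"
proof -
  have one: "\<one>\<^bsub>AK\<^esub> = cl \<one>\<^bsub>A\<^esub> \<one>" "\<one>\<^bsub>AK\<^esub> \<in> carrier XX"
    by (simp_all add: I.AxK_sel I.cl_closed)
  have h1: "hat \<psi> \<one>\<^bsub>AK\<^esub> \<in> carrier XX" by (rule I.dual_action_closed[OF one(2)])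
  note pl = bilinear_on_comp[OF Phi_props(1)]
  show ?thesis
    unfolding AK_mult_eval[OF s h1]
  proof (rule I.X_eval_cong[OF s])
    fix b h assume "(b, h) \<in> carrier A \<times> carrier K"
    then have b: "b \<in> carrier A" and h: "h \<in> carrier K" by auto
    let ?N = "\<lambda>c k. sw h (\<lambda>h1 h2. \<Phi> (cl (b \<otimes>\<^bsub>A\<^esub> (h1 \<triangleright> c)) (h2 \<otimes> k)))"
    note v = crossed_mult_vanishes[OF b h]
    note Nl = I.X_eval_linear[OF v]
    have lN: "klin (?N \<one>\<^bsub>A\<^esub>)" using b h by (intro lin pl; simp)
    let ?G = "\<lambda>a h. sw h (\<lambda>h1 h2. \<psi> h2 * tensor_eval (cl a h1) ?N)"
    have vG: "vanishes_on (crossed_null K A act) ?G"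
    proof -
      interpret P: crossed_data K A act by (rule I.crossed_data_axioms)
      have "vanishes_on (crossed_null K A act) (\<lambda>a h. sw h (\<lambda>h1 h2. \<psi> h2 * (\<lambda>t. tensor_eval t ?N) (cl a h1)))"
        unfolding I.vanishes_crossed
      proof (intro conjI ballI)
        have pb: "bilinear_on A K (\<lambda>b h. tensor_eval (cl b h) ?N)"
          using I.X_functional(1)[OF Nl] by (simp add: I.vanishes_crossed)
        have pr: "tensor_eval (cl (a \<otimes>\<^bsub>A\<^esub> (z \<triangleright> \<one>\<^bsub>A\<^esub>)) h) ?N = tensor_eval (cl a (z \<otimes> h)) ?N"
          if "a \<in> carrier A" "z \<in> R" "h \<in> carrier K" for a z h
          using I.X_functional(1)[OF Nl] that by (simp add: I.vanishes_crossed)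
        note ql = bilinear_on_comp[OF pb] klin_comp[OF \<psi>]
        show "bilinear_on A K (\<lambda>a h. sw h (\<lambda>h1 h2. \<psi> h2 * (\<lambda>t. tensor_eval t ?N) (cl a h1)))"
          by (intro lin ql; simp)
        fix a z h assume a: "a \<in> carrier A" and z: "z \<in> R" and h: "h \<in> carrier K"
        have bb: "kbil (\<lambda>h1 h2. \<psi> h2 * tensor_eval (cl a h1) ?N)" using a by (intro lin ql; simp)
        show "sw h (\<lambda>h1 h2. \<psi> h2 * (\<lambda>t. tensor_eval t ?N) (cl (a \<otimes>\<^bsub>A\<^esub> (z \<triangleright> \<one>\<^bsub>A\<^esub>)) h1)) =
            sw (z \<otimes> h) (\<lambda>h1 h2. \<psi> h2 * (\<lambda>t. tensor_eval t ?N) (cl a h1))"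
          using a z by (simp add: sw_R_left[OF z h bb] pr cong: sw_cong_simp)
      qed
      then show ?thesis by simp
    qed
    have "tensor_eval (hat \<psi> \<one>\<^bsub>AK\<^esub>) ?N = tensor_eval \<one>\<^bsub>AK\<^esub> ?G"
      unfolding I.dual_action_eval[OF one(2) Nl]
      by (rule I.X_eval_cong[OF one(2)]) (simp add: sw_eval)
    also have "\<dots> = ?G \<one>\<^bsub>A\<^esub> \<one>"
      unfolding one(1) by (rule I.cl_eval[OF vG])
    also have "\<dots> = ?N \<one>\<^bsub>A\<^esub> (hit \<psi> \<one>)"
      by (simp add: I.cl_eval[OF v] hit_eval[OF lN])
    also have "\<dots> = sw h (\<lambda>h1 h2. \<Phi> (cl b ((eps_t K h1 \<otimes> h2) \<otimes> hit \<psi> \<one>)))"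
    proof (rule sw_cong)
      fix h1 h2 assume hh: "h1 \<in> carrier K" "h2 \<in> carrier K"
      show "\<Phi> (cl (b \<otimes>\<^bsub>A\<^esub> (h1 \<triangleright> \<one>\<^bsub>A\<^esub>)) (h2 \<otimes> hit \<psi> \<one>)) = \<Phi> (cl b ((eps_t K h1 \<otimes> h2) \<otimes> hit \<psi> \<one>))"
        unfolding act_unit[OF hh(1)] using hh b by (simp add: Phi_props(2) A_assoc)
    qed
    also have "\<dots> = \<Phi> (cl b (h \<otimes> hit \<psi> \<one>))"
    proof -
      have l: "klin (\<lambda>y. \<Phi> (cl b (y \<otimes> hit \<psi> \<one>)))" using b by (intro lin pl; simp)
      show ?thesis by (rule sw_eps_t_mult[OF l h])
    qed
    finally show "tensor_eval (hat \<psi> \<one>\<^bsub>AK\<^esub>) ?N = \<Phi> (cl b (h \<otimes> hit \<psi> \<one>))" .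
  qed
qed

end

lemma crossed_data_outer: "crossed_data Kd AK hat"
  by (intro crossed_data.intro I.AxK_space Kd_space)
    (simp_all only: I.AxK_sel(1,5) I.AxK_mult_closed I.cl_closed I.AxK_star_closed Kd_closed
      I.dual_action_closed comult_Kd(1) Cartan_Kd(1) A.A_closed A_closed)

sublocale O: crossed_data Kd AK hat
  by (rule crossed_data_outer)

end

section \<open>The matrix coefficients of the double crossed product\<close>

lemma linear_between_functionals:
  assumes V: "complex_space V" and W: "complex_space W" and f: "\<And>x. x \<in> carrier V \<Longrightarrow> f x \<in> carrier W"
    and l: "\<And>g. linear_between W CC g \<Longrightarrow> linear_between V CC (\<lambda>x. g (f x))"
  shows "linear_between V W f"
proof (rule linear_betweenI[OF f])
  note Vs = complex_spaceD[OF V] and Ws = complex_spaceD[OF W]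
  fix x y assume xy: "x \<in> carrier V" "y \<in> carrier V"
  show "f (x \<oplus>\<^bsub>V\<^esub> y) = f x \<oplus>\<^bsub>W\<^esub> f y"
  proof (rule linear_functional_separation[OF W])
    fix g assume g: "linear_between W CC g"
    show "g (f (x \<oplus>\<^bsub>V\<^esub> y)) = g (f x \<oplus>\<^bsub>W\<^esub> f y)"
      using linear_betweenD(2)[OF l[OF g] xy] linear_betweenD(2)[OF g f[OF xy(1)] f[OF xy(2)]] by simp
  qed (use xy f Vs Ws in auto)
next
  note Vs = complex_spaceD[OF V] and Ws = complex_spaceD[OF W]
  fix c x assume x: "x \<in> carrier V"
  show "f (c \<odot>\<^bsub>V\<^esub> x) = c \<odot>\<^bsub>W\<^esub> f x"
  proof (rule linear_functional_separation[OF W])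
    fix g assume g: "linear_between W CC g"
    show "g (f (c \<odot>\<^bsub>V\<^esub> x)) = g (c \<odot>\<^bsub>W\<^esub> f x)"
      using linear_betweenD(3)[OF l[OF g] x] linear_betweenD(3)[OF g f[OF x]] by simp
  qed (use x f Vs Ws in auto)
qed

context markov_action begin

abbreviation XO where "XO \<equiv> crossed_space Kd AK hat"
abbreviation ocl where "ocl \<equiv> crossed_class Kd AK hat"
abbreviation AO where "AO \<equiv> crossed_product Kd AK hat"

lemma linear_hit1 [lin]:
  "linear_between V Kd g \<Longrightarrow> x \<in> carrier K \<Longrightarrow> linear_between V K (\<lambda>v. hit (g v) x)"
proof (erule linear_between_comp[rotated], rule linear_between_functionals[OF Kd_space complex_space_K])
  fix f assume x: "x \<in> carrier K" and f: "klin f"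
  show "linear_between Kd CC (\<lambda>\<phi>. f (hit \<phi> x))"
    unfolding hit_eval[OF f x] by (intro lin; simp)
qed simp

lemma hit_mult:
  assumes \<beta>: "\<beta> \<in> carrier Kd" and \<psi>: "\<psi> \<in> carrier Kd" and x: "x \<in> carrier K"
  shows "hit (\<beta> \<otimes>\<^bsub>Kd\<^esub> \<psi>) x = hit \<beta> (hit \<psi> x)"
proof (rule functional_eqI)
  fix f assume f: "klin f"
  note kl = klin_comp[OF f] klin_comp[OF Kd_klin[OF \<beta>]] klin_comp[OF Kd_klin[OF \<psi>]]
  have l: "klin (\<lambda>y. sw y (\<lambda>a b. \<beta> b * f a))" by (intro lin kl)
  have t: "ktri (\<lambda>a b d. \<psi> d * (\<beta> b * f a))" by (intro lin kl)
  have "f (hit (\<beta> \<otimes>\<^bsub>Kd\<^esub> \<psi>) x) = sw x (\<lambda>a y. sw y (\<lambda>b d. \<psi> d * (\<beta> b * f a)))"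
    unfolding hit_eval[OF f x]
    by (rule sw_cong) (simp add: Kd_eval(1) mult.left_commute mult.commute flip: sw_cmult)
  also have "\<dots> = sw x (\<lambda>y d. sw y (\<lambda>a b. \<psi> d * (\<beta> b * f a)))"
    by (rule sw_coassoc[OF x t, symmetric])
  also have "\<dots> = f (hit \<beta> (hit \<psi> x))"
    using x by (simp add: hit_eval[OF f] hit_eval[OF l] sw_cmult)
  finally show "f (hit (\<beta> \<otimes>\<^bsub>Kd\<^esub> \<psi>) x) = f (hit \<beta> (hit \<psi> x))" .
qed (use x in simp_all)

text \<open>Such a functional is unchanged by composition with \<open>eps_t\<close>, so psi.x = x_1
  \<psi>(eps_t(x_2)) = 1_1 x \<psi>(1_2).\<close>

lemma hit_Cartan:
  assumes \<psi>: "\<psi> \<in> Cartan_t Kd" and x: "x \<in> carrier K"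
  shows "hit \<psi> x = hit \<psi> \<one> \<otimes> x"
proof (rule functional_eqI)
  fix f assume f: "klin f"
  note kl = klin_comp[OF f] klin_comp[OF Kd_klin[OF Cartan_Kd(1)[OF \<psi>]]]
  have b: "kbil (\<lambda>a b. \<psi> b * f a)" by (intro lin kl)
  have l: "klin (\<lambda>y. f (y \<otimes> x))" using x by (intro lin kl)
  have "f (hit \<psi> x) = sw x (\<lambda>a b. \<psi> (eps_t K b) * f a)"
    unfolding hit_eval[OF f x] by (rule sw_cong) (simp add: Cartan_Kd(2)[OF \<psi>])
  also have "\<dots> = sw \<one> (\<lambda>a b. \<psi> b * f (a \<otimes> x))"
    by (rule sw_eps_t[OF b x])
  also have "\<dots> = f (hit \<psi> \<one> \<otimes> x)"
    by (simp add: hit_eval[OF l])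
  finally show "f (hit \<psi> x) = f (hit \<psi> \<one> \<otimes> x)" .
qed (use x in simp_all)

text \<open>With y = psi.x the element hit by the second leg of \<phi> is y, and the two legs of
  \<phi>, evaluated at k_2 and y_2, give \<phi>(k_2 y_2). The remaining factors k_1 y_1 complete the
  coproduct of k y.\<close>

lemma comult_hit:
  assumes f: "klin f" and \<phi>: "\<phi> \<in> carrier Kd" and \<psi>: "\<psi> \<in> carrier Kd" and k: "k \<in> carrier K" and x: "x \<in> carrier K"
  shows "tensor_eval (comult Kd \<phi>) (\<lambda>\<alpha> \<beta>. sw k (\<lambda>k1 k2. \<alpha> k2 * f (k1 \<otimes> hit (\<beta> \<otimes>\<^bsub>Kd\<^esub> \<psi>) x))) =
    f (hit \<phi> (k \<otimes> hit \<psi> x))"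
proof -
  let ?y = "hit \<psi> x"
  note kl = klin_comp[OF f] klin_comp[OF Kd_klin[OF \<phi>]]
  have y: "?y \<in> carrier K" using x by simp
  have "tensor_eval (comult Kd \<phi>) (\<lambda>\<alpha> \<beta>. sw k (\<lambda>k1 k2. \<alpha> k2 * f (k1 \<otimes> hit (\<beta> \<otimes>\<^bsub>Kd\<^esub> \<psi>) x))) =
      tensor_eval (comult Kd \<phi>) (\<lambda>\<alpha> \<beta>. sw k (\<lambda>k1 k2. sw ?y (\<lambda>y1 y2. (\<alpha> k2 * \<beta> y2) * f (k1 \<otimes> y1))))"
  proof (rule TD.eval_cong[OF comult_Kd(1)[OF \<phi>]])
    fix \<alpha> \<beta> assume "(\<alpha>, \<beta>) \<in> carrier Kd \<times> carrier Kd"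
    then have \<beta>: "\<beta> \<in> carrier Kd" by simp
    show "sw k (\<lambda>k1 k2. \<alpha> k2 * f (k1 \<otimes> hit (\<beta> \<otimes>\<^bsub>Kd\<^esub> \<psi>) x)) =
        sw k (\<lambda>k1 k2. sw ?y (\<lambda>y1 y2. (\<alpha> k2 * \<beta> y2) * f (k1 \<otimes> y1)))"
    proof (rule sw_cong)
      fix k1 k2 assume kk: "k1 \<in> carrier K" "k2 \<in> carrier K"
      have l: "klin (\<lambda>z. f (k1 \<otimes> z))" using kk by (intro lin kl)
      show "\<alpha> k2 * f (k1 \<otimes> hit (\<beta> \<otimes>\<^bsub>Kd\<^esub> \<psi>) x) = sw ?y (\<lambda>y1 y2. (\<alpha> k2 * \<beta> y2) * f (k1 \<otimes> y1))"
        unfolding hit_mult[OF \<beta> \<psi> x] hit_eval[OF l y] by (simp only: mult.assoc sw_cmult)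
    qed
  qed
  also have "\<dots> = sw k (\<lambda>k1 k2. sw ?y (\<lambda>y1 y2. tensor_eval (comult Kd \<phi>) (\<lambda>\<alpha> \<beta>. \<alpha> k2 * \<beta> y2) * f (k1 \<otimes> y1)))"
    by (simp only: tensor_eval_sw_swap[OF k] tensor_eval_sw_swap[OF y] tensor_eval_multc)
  also have "\<dots> = sw k (\<lambda>k1 k2. sw ?y (\<lambda>y1 y2. \<phi> (k2 \<otimes> y2) * f (k1 \<otimes> y1)))"
    by (intro sw_cong) (simp add: comult_Kd(2)[OF \<phi>])
  also have "\<dots> = sw (k \<otimes> ?y) (\<lambda>a b. \<phi> b * f a)"
    by (rule sw_mult[symmetric, OF k y]) (intro lin kl)
  also have "\<dots> = f (hit \<phi> (k \<otimes> ?y))"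
    using k y by (simp add: hit_eval[OF f])
  finally show ?thesis .
qed

text \<open>Q_i(z h y) = Q_i(h y) S(z), and S(z) acts on b as right multiplication by z
  \<triangleright> 1.\<close>

lemma coefficient_vanishes:
  assumes g: "alin g" and i: "i < n" and y: "y \<in> carrier K"
  shows "vanishes_on (crossed_null K A act) (\<lambda>b h. g (Q i (h \<otimes> y) \<triangleright> b))"
  unfolding I.vanishes_crossed
proof (intro conjI ballI)
  show "bilinear_on A K (\<lambda>b h. g (Q i (h \<otimes> y) \<triangleright> b))"
    using i y by (intro lin alin_comp[OF g]; simp)
  fix b z h assume *: "b \<in> carrier A" "z \<in> R" "h \<in> carrier K"
  then show "g (Q i (h \<otimes> y) \<triangleright> (b \<otimes>\<^bsub>A\<^esub> (z \<triangleright> \<one>\<^bsub>A\<^esub>))) = g (Q i ((z \<otimes> h) \<otimes> y) \<triangleright> b)"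
    using i y by (simp add: mult_R_act A_assoc Q_R_left act_act)
qed

text \<open>A matrix entry of an element of the inner crossed product, tested by \<open>g\<close>.
  The argument \<open>y\<close> is free because the outer crossed product substitutes phi.u_j for
  it.\<close>

definition coefficient :: "('a \<Rightarrow> complex) \<Rightarrow> nat \<Rightarrow> 'k \<Rightarrow> ('a, 'k) tensor \<Rightarrow> complex" where
  "coefficient g i y s = tensor_eval s (\<lambda>b h. g (Q i (h \<otimes> y) \<triangleright> b))"

lemma coefficient_linear:
  "alin g \<Longrightarrow> i < n \<Longrightarrow> y \<in> carrier K \<Longrightarrow> linear_between XX CC (coefficient g i y)"
  unfolding coefficient_def by (intro I.X_eval_linear coefficient_vanishes)

lemma coefficient_cl:
  "alin g \<Longrightarrow> i < n \<Longrightarrow> y \<in> carrier K \<Longrightarrow> coefficient g i y (cl b h) = g (Q i (h \<otimes> y) \<triangleright> b)"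
  unfolding coefficient_def by (intro I.cl_eval coefficient_vanishes)

text \<open>Balancing over the Cartan subalgebra of the dual: multiplying \<open>s\<close> by \<psi>
  \<triangleright> 1 replaces h by h (psi.1), and (psi.1)(phi.x) is the hit of x by the product of
  \<psi> and \<phi>.\<close>

lemma outer_coefficient_vanishes:
  assumes g: "alin g" and i: "i < n" and x: "x \<in> carrier K"
  shows "vanishes_on (crossed_null Kd AK hat) (\<lambda>s \<phi>. coefficient g i (hit \<phi> x) s)"
  unfolding O.vanishes_crossed
proof (intro conjI ballI)
  show "bilinear_on AK Kd (\<lambda>s \<phi>. coefficient g i (hit \<phi> x) s)"
  proof (rule bilinear_onI)
    fix \<phi> assume "\<phi> \<in> carrier Kd"
    show "linear_between AK CC (coefficient g i (hit \<phi> x))"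
      unfolding I.AxK_linear by (rule coefficient_linear[OF g i]) (use x in simp)
  next
    fix s assume "s \<in> carrier AK"
    then have s: "s \<in> carrier XX" by (simp add: I.AxK_sel)
    show "linear_between Kd CC (\<lambda>\<phi>. coefficient g i (hit \<phi> x) s)"
      unfolding coefficient_def
    proof (rule I.X_linear_eval_on[OF s])
      fix b h assume "(b, h) \<in> carrier A \<times> carrier K"
      then show "linear_between Kd CC (\<lambda>\<phi>. g (Q i (h \<otimes> hit \<phi> x) \<triangleright> b))"
        using i x by (intro lin alin_comp[OF g]; simp)
    qed
  qed
  fix s \<psi> \<phi> assume "s \<in> carrier AK" and \<psi>: "\<psi> \<in> Cartan_t Kd" and \<phi>: "\<phi> \<in> carrier Kd"
  then have s: "s \<in> carrier XX" by (simp add: I.AxK_sel)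
  have y: "hit \<phi> x \<in> carrier K" using x by simp
  have "coefficient g i (hit \<phi> x) (s \<otimes>\<^bsub>AK\<^esub> hat \<psi> \<one>\<^bsub>AK\<^esub>) =
      tensor_eval s (\<lambda>b h. coefficient g i (hit \<phi> x) (cl b (h \<otimes> hit \<psi> \<one>)))"
    by (rule AK_mult_hat_one[OF coefficient_linear[OF g i y] s Kd_klin[OF Cartan_Kd(1)[OF \<psi>]]])
  also have "\<dots> = coefficient g i (hit (\<psi> \<otimes>\<^bsub>Kd\<^esub> \<phi>) x) s"
    unfolding coefficient_def[of g i _ s]
  proof (rule I.X_eval_cong[OF s])
    fix b h assume "(b, h) \<in> carrier A \<times> carrier K"
    then have h: "h \<in> carrier K" by simp
    have "hit (\<psi> \<otimes>\<^bsub>Kd\<^esub> \<phi>) x = hit \<psi> \<one> \<otimes> hit \<phi> x"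
      using hit_Cartan[OF \<psi> y] by (simp add: hit_mult[OF Cartan_Kd(1)[OF \<psi>] \<phi> x])
    then show "coefficient g i (hit \<phi> x) (cl b (h \<otimes> hit \<psi> \<one>)) = g (Q i (h \<otimes> hit (\<psi> \<otimes>\<^bsub>Kd\<^esub> \<phi>) x) \<triangleright> b)"
      using h y by (simp add: coefficient_cl[OF g i y] A_assoc)
  qed
  finally show "coefficient g i (hit \<phi> x) (s \<otimes>\<^bsub>AK\<^esub> hat \<psi> \<one>\<^bsub>AK\<^esub>) = coefficient g i (hit (\<psi> \<otimes>\<^bsub>Kd\<^esub> \<phi>) x) s" .
qed

definition entry :: "nat \<Rightarrow> nat \<Rightarrow> (('a, 'k) tensor, 'k \<Rightarrow> complex) tensor \<Rightarrow> 'a" where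
  "entry i j z = lift A (\<lambda>s \<phi>. lift A (\<lambda>b h. Q i (h \<otimes> hit \<phi> (u j)) \<triangleright> b) s) z"

lemma inner_entry:
  assumes "i < n" "j < n" "s \<in> carrier XX"
  shows "lift A (\<lambda>b h. Q i (h \<otimes> hit \<phi> (u j)) \<triangleright> b) s \<in> carrier A"
    and "alin g \<Longrightarrow> g (lift A (\<lambda>b h. Q i (h \<otimes> hit \<phi> (u j)) \<triangleright> b) s) = coefficient g i (hit \<phi> (u j)) s"
  unfolding coefficient_def
  using assms by (auto intro!: I.X_lift_closed[OF complex_space_A] I.X_functional_lift[OF complex_space_A])

lemma entry_closed: "i < n \<Longrightarrow> j < n \<Longrightarrow> z \<in> carrier XO \<Longrightarrow> entry i j z \<in> carrier A"
  unfolding entry_def by (rule O.X_lift_closed[OF complex_space_A]) (auto simp: inner_entry I.AxK_sel)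

lemma entry_eval:
  assumes ij: "i < n" "j < n" and z: "z \<in> carrier XO" and g: "alin g"
  shows "g (entry i j z) = tensor_eval z (\<lambda>s \<phi>. coefficient g i (hit \<phi> (u j)) s)"
proof -
  have "g (entry i j z) = tensor_eval z (\<lambda>s \<phi>. g (lift A (\<lambda>b h. Q i (h \<otimes> hit \<phi> (u j)) \<triangleright> b) s))"
    unfolding entry_def by (rule O.X_functional_lift[OF complex_space_A z _ g]) (auto simp: inner_entry ij I.AxK_sel)
  also have "\<dots> = tensor_eval z (\<lambda>s \<phi>. coefficient g i (hit \<phi> (u j)) s)"
    by (rule O.X_eval_cong[OF z]) (auto simp: inner_entry(2)[OF ij _ g] I.AxK_sel)
  finally show ?thesis .
qed

lemma entry_linear: 
  assumes "i < n" "j < n"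
  shows "linear_between XO A (entry i j)"
proof (rule linear_between_functionals[OF O.X_space complex_space_A entry_closed[OF assms]])
  fix g assume g: "alin g"
  have l: "linear_between XO CC (\<lambda>z. tensor_eval z (\<lambda>s \<phi>. coefficient g i (hit \<phi> (u j)) s))"
    by (rule O.X_eval_linear[OF outer_coefficient_vanishes[OF g assms(1)]]) (use assms in simp)
  show "linear_between XO CC (\<lambda>z. g (entry i j z))"
    by (subst linear_between_cong[OF O.X_space entry_eval[OF assms _ g]]) (auto intro: l)
qed

lemma entry_ocl:
  assumes ij: "i < n" "j < n" and g: "alin g" and s: "s \<in> carrier XX" and \<phi>: "\<phi> \<in> carrier Kd"
  shows "g (entry i j (ocl s \<phi>)) = coefficient g i (hit \<phi> (u j)) s"
proof -
  have c: "ocl s \<phi> \<in> carrier XO" using s \<phi> by (intro O.cl_closed) (simp_all add: I.AxK_sel)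
  show ?thesis
    unfolding entry_eval[OF ij c g] by (rule O.cl_eval[OF outer_coefficient_vanishes[OF g ij(1)]]) (use ij in simp)
qed

lemma A_finsum_eval:
  "alin g \<Longrightarrow> finite B \<Longrightarrow> (\<And>i. i \<in> B \<Longrightarrow> f i \<in> carrier A) \<Longrightarrow> g (finsum A f B) = (\<Sum>i\<in>B. g (f i))"
  by (rule linear_functional_finsum[OF _ complex_space_A])

lemma A_finsum_closed: "finite B \<Longrightarrow> (\<And>i. i \<in> B \<Longrightarrow> f i \<in> carrier A) \<Longrightarrow> finsum A f B \<in> carrier A"
  using abelian_monoid.finsum_closed[OF abelian_group.axioms(1)[OF complex_spaceD(1)[OF complex_space_A]], of f B]
  by auto

text \<open>The entry is Q_i(u_j) \<triangleright> 1, which \<open>eps_t_Q\<close> identifies with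
  E(u_i^* u_j) \<triangleright> 1.\<close>

lemma entry_one:
  assumes ij: "i < n" "j < n"
  shows "entry i j \<one>\<^bsub>AO\<^esub> = (if i = j then \<one>\<^bsub>A\<^esub> else \<zero>\<^bsub>A\<^esub>)"
proof (rule A_functional_eqI)
  have o: "\<one>\<^bsub>AO\<^esub> \<in> carrier XO" "\<one>\<^bsub>AO\<^esub> = ocl (cl \<one>\<^bsub>A\<^esub> \<one>) \<one>\<^bsub>Kd\<^esub>" "cl \<one>\<^bsub>A\<^esub> \<one> \<in> carrier XX"
    by (simp_all add: O.AxK_sel O.cl_closed I.AxK_sel I.cl_closed Kd_closed)
  then show "entry i j \<one>\<^bsub>AO\<^esub> \<in> carrier A" using entry_closed[OF ij] by simp
  show "(if i = j then \<one>\<^bsub>A\<^esub> else \<zero>\<^bsub>A\<^esub>) \<in> carrier A" by simp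
  fix g assume g: "alin g"
  have h: "hit \<one>\<^bsub>Kd\<^esub> (u j) = u j" by (rule hit_counit) (simp_all add: ij Kd_eval)
  have "g (entry i j \<one>\<^bsub>AO\<^esub>) = g (Q i (\<one> \<otimes> u j) \<triangleright> \<one>\<^bsub>A\<^esub>)"
    unfolding o(2) entry_ocl[OF ij g o(3) Kd_closed(2)] h using ij by (intro coefficient_cl g) simp_all
  also have "Q i (\<one> \<otimes> u j) \<triangleright> \<one>\<^bsub>A\<^esub> = E (star K (u i) \<otimes> u j) \<triangleright> \<one>\<^bsub>A\<^esub>"
    using act_unit[of "Q i (u j)"] ij by (simp add: eps_t_Q)
  also have "\<dots> = (if i = j then \<one>\<^bsub>A\<^esub> else \<zero>\<^bsub>A\<^esub>)"
    using ij act_one[of "\<one>\<^bsub>A\<^esub>"] linear_between_zero[OF linear_act1[OF linear_between_id] complex_space_K complex_space_A, of "\<one>\<^bsub>A\<^esub>"]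
    by (simp add: u_orth)
  finally show "g (entry i j \<one>\<^bsub>AO\<^esub>) = g (if i = j then \<one>\<^bsub>A\<^esub> else \<zero>\<^bsub>A\<^esub>)" .
qed

text \<open>The product of [s \<otimes> phi] and [t \<otimes> psi] is [s (phi_1 \<triangleright> t)
  \<otimes> phi_2 psi]. \<open>Q_act_mult_sum\<close> splits its coefficient as a matrix product
  with u_l in the middle, \<open>comult_hit\<close> collects both legs of phi in front of k
  (psi.u_j), and \<open>sum_Q_act_hit\<close> moves phi to u_l, where the entry of the left factor
  has it.\<close>

lemma entry_mult:
  assumes ij: "i < n" "j < n" and z: "z \<in> carrier XO" and y: "y \<in> carrier XO"
  shows "entry i j (z \<otimes>\<^bsub>AO\<^esub> y) = finsum A (\<lambda>l. entry i l z \<otimes>\<^bsub>A\<^esub> entry l j y) {..<n}"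
proof (rule A_functional_eqI)
  have zy: "z \<otimes>\<^bsub>AO\<^esub> y \<in> carrier XO" by (rule O.AxK_mult_closed[OF z y])
  show "entry i j (z \<otimes>\<^bsub>AO\<^esub> y) \<in> carrier A" by (rule entry_closed[OF ij zy])
  have c: "entry i l z \<otimes>\<^bsub>A\<^esub> entry l j y \<in> carrier A" if "l \<in> {..<n}" for l
    using that ij z y by (simp add: entry_closed)
  show "finsum A (\<lambda>l. entry i l z \<otimes>\<^bsub>A\<^esub> entry l j y) {..<n} \<in> carrier A"
    by (rule A_finsum_closed) (use c in auto)
  fix g assume g: "alin g"
  note gl = alin_comp[OF g]
  let ?P = "\<lambda>l b h \<phi> c k \<psi>. g ((Q i (h \<otimes> hit \<phi> (u l)) \<triangleright> b) \<otimes>\<^bsub>A\<^esub> (Q l (k \<otimes> hit \<psi> (u j)) \<triangleright> c))"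
  have lin_entry: "linear_between XO CC (\<lambda>z. g (entry i j z))"
    by (rule linear_between_comp[OF g entry_linear[OF ij]])
  have "g (entry i j (z \<otimes>\<^bsub>AO\<^esub> y)) = tensor_eval z (\<lambda>s \<phi>. tensor_eval y (\<lambda>t \<psi>.
      tensor_eval (comult Kd \<phi>) (\<lambda>\<alpha> \<beta>. g (entry i j (ocl (s \<otimes>\<^bsub>AK\<^esub> hat \<alpha> t) (\<beta> \<otimes>\<^bsub>Kd\<^esub> \<psi>))))))"
    by (rule O.AxK_mult_eval[OF z y lin_entry])
  also have "\<dots> = tensor_eval z (\<lambda>s \<phi>. tensor_eval y (\<lambda>t \<psi>.
      tensor_eval s (\<lambda>b h. tensor_eval t (\<lambda>c k. \<Sum>l<n. ?P l b h \<phi> c k \<psi>))))"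
  proof (rule O.X_eval_cong[OF z], rule O.X_eval_cong[OF y])
    fix s \<phi> t \<psi> assume "(s, \<phi>) \<in> carrier AK \<times> carrier Kd" "(t, \<psi>) \<in> carrier AK \<times> carrier Kd"
    then have s: "s \<in> carrier XX" and t: "t \<in> carrier XX" and \<phi>: "\<phi> \<in> carrier Kd" and \<psi>: "\<psi> \<in> carrier Kd"
      by (auto simp: I.AxK_sel)
    let ?G = "\<lambda>b h c y. \<Sum>l<n. g ((Q i (h \<otimes> u l) \<triangleright> b) \<otimes>\<^bsub>A\<^esub> (Q l y \<triangleright> c))"
    have "tensor_eval (comult Kd \<phi>) (\<lambda>\<alpha> \<beta>. g (entry i j (ocl (s \<otimes>\<^bsub>AK\<^esub> hat \<alpha> t) (\<beta> \<otimes>\<^bsub>Kd\<^esub> \<psi>)))) =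
        tensor_eval (comult Kd \<phi>) (\<lambda>\<alpha> \<beta>. tensor_eval s (\<lambda>b h. tensor_eval t (\<lambda>c k.
          sw k (\<lambda>k1 k2. \<alpha> k2 * ?G b h c (k1 \<otimes> hit (\<beta> \<otimes>\<^bsub>Kd\<^esub> \<psi>) (u j))))))"
    proof (rule TD.eval_cong[OF comult_Kd(1)[OF \<phi>]])
      fix \<alpha> \<beta> assume "(\<alpha>, \<beta>) \<in> carrier Kd \<times> carrier Kd"
      then have \<alpha>: "\<alpha> \<in> carrier Kd" and \<beta>: "\<beta> \<in> carrier Kd" by auto
      let ?y = "hit (\<beta> \<otimes>\<^bsub>Kd\<^esub> \<psi>) (u j)"
      have yc: "?y \<in> carrier K" using ij by simp
      have ht: "hat \<alpha> t \<in> carrier XX" by (rule I.dual_action_closed[OF t])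
      have m: "s \<otimes>\<^bsub>AK\<^esub> hat \<alpha> t \<in> carrier XX" by (rule I.AxK_mult_closed[OF s ht])
      note \<Phi> = coefficient_linear[OF g ij(1) yc]
      let ?N = "\<lambda>b h c k. sw h (\<lambda>h1 h2. coefficient g i ?y (cl (b \<otimes>\<^bsub>A\<^esub> (h1 \<triangleright> c)) (h2 \<otimes> k)))"
      \<comment> \<open>The coefficients of a product in the inner crossed product already multiply
        like matrices.\<close>
      have N: "?N b h c k = ?G b h c (k \<otimes> ?y)"
        if "b \<in> carrier A" "h \<in> carrier K" "c \<in> carrier A" "k \<in> carrier K" for b h c k
      proof -
        have "?N b h c k = sw h (\<lambda>h1 h2. g (Q i (h2 \<otimes> (k \<otimes> ?y)) \<triangleright> (b \<otimes>\<^bsub>A\<^esub> (h1 \<triangleright> c))))"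
          using that yc by (intro sw_cong) (simp add: coefficient_cl[OF g ij(1) yc] A_assoc)
        also have "\<dots> = ?G b h c (k \<otimes> ?y)"
          by (rule Q_act_mult_sum[OF g ij(1)]) (use that yc in simp_all)
        finally show ?thesis .
      qed
      have "g (entry i j (ocl (s \<otimes>\<^bsub>AK\<^esub> hat \<alpha> t) (\<beta> \<otimes>\<^bsub>Kd\<^esub> \<psi>))) = coefficient g i ?y (s \<otimes>\<^bsub>AK\<^esub> hat \<alpha> t)"
        by (rule entry_ocl[OF ij g m Kd_closed(1)[OF \<beta> \<psi>]])
      also have "\<dots> = tensor_eval s (\<lambda>b h. tensor_eval (hat \<alpha> t) (?N b h))"
        by (rule AK_mult_eval[OF \<Phi> s ht])
      also have "\<dots> = tensor_eval s (\<lambda>b h. tensor_eval t (\<lambda>c k. sw k (\<lambda>k1 k2. \<alpha> k2 * ?G b h c (k1 \<otimes> ?y))))"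
      proof (rule I.X_eval_cong[OF s])
        fix b h assume "(b, h) \<in> carrier A \<times> carrier K"
        then have b: "b \<in> carrier A" and h: "h \<in> carrier K" by auto
        note v = crossed_mult_vanishes[OF \<Phi> b h]
        have "tensor_eval (hat \<alpha> t) (?N b h) = tensor_eval t (\<lambda>c k. sw k (\<lambda>k1 k2. \<alpha> k2 * tensor_eval (cl c k1) (?N b h)))"
          by (rule hat_eval[OF I.X_eval_linear[OF v] t])
        also have "\<dots> = tensor_eval t (\<lambda>c k. sw k (\<lambda>k1 k2. \<alpha> k2 * ?G b h c (k1 \<otimes> ?y)))"
        proof (rule I.X_eval_cong[OF t])
          fix c k assume "(c, k) \<in> carrier A \<times> carrier K"
          then show "sw k (\<lambda>k1 k2. \<alpha> k2 * tensor_eval (cl c k1) (?N b h)) = sw k (\<lambda>k1 k2. \<alpha> k2 * ?G b h c (k1 \<otimes> ?y))"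
            using b h by (intro sw_cong) (simp only: I.cl_eval[OF v] N mem_Sigma_iff)
        qed
        finally show "tensor_eval (hat \<alpha> t) (?N b h) = tensor_eval t (\<lambda>c k. sw k (\<lambda>k1 k2. \<alpha> k2 * ?G b h c (k1 \<otimes> ?y)))" .
      qed
      finally show "g (entry i j (ocl (s \<otimes>\<^bsub>AK\<^esub> hat \<alpha> t) (\<beta> \<otimes>\<^bsub>Kd\<^esub> \<psi>))) =
          tensor_eval s (\<lambda>b h. tensor_eval t (\<lambda>c k. sw k (\<lambda>k1 k2. \<alpha> k2 * ?G b h c (k1 \<otimes> ?y))))" .
    qed
    also have "\<dots> = tensor_eval s (\<lambda>b h. tensor_eval t (\<lambda>c k. tensor_eval (comult Kd \<phi>) (\<lambda>\<alpha> \<beta>.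
          sw k (\<lambda>k1 k2. \<alpha> k2 * ?G b h c (k1 \<otimes> hit (\<beta> \<otimes>\<^bsub>Kd\<^esub> \<psi>) (u j))))))"
      by (simp only: tensor_eval_swap[of "comult Kd \<phi>"])
    also have "\<dots> = tensor_eval s (\<lambda>b h. tensor_eval t (\<lambda>c k. \<Sum>l<n. ?P l b h \<phi> c k \<psi>))"
    proof (rule I.X_eval_cong[OF s], rule I.X_eval_cong[OF t])
      fix b h c k assume "(b, h) \<in> carrier A \<times> carrier K" "(c, k) \<in> carrier A \<times> carrier K"
      then have *: "b \<in> carrier A" "h \<in> carrier K" "c \<in> carrier A" "k \<in> carrier K" by auto
      have l: "klin (?G b h c)"
      proof (rule linear_sum)
        show "klin (\<lambda>y. g ((Q i (h \<otimes> u l) \<triangleright> b) \<otimes>\<^bsub>A\<^esub> (Q l y \<triangleright> c)))" if "l \<in> {..<n}" for l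
          using * that ij by (intro lin gl; simp)
      qed
      have "tensor_eval (comult Kd \<phi>) (\<lambda>\<alpha> \<beta>. sw k (\<lambda>k1 k2. \<alpha> k2 * ?G b h c (k1 \<otimes> hit (\<beta> \<otimes>\<^bsub>Kd\<^esub> \<psi>) (u j)))) =
          ?G b h c (hit \<phi> (k \<otimes> hit \<psi> (u j)))"
        by (rule comult_hit[OF l \<phi> \<psi> *(4)]) (use ij in simp)
      also have "\<dots> = (\<Sum>l<n. ?P l b h \<phi> c k \<psi>)"
        by (rule sum_Q_act_hit[OF g ij(1) *(2) _ *(1,3) Kd_klin[OF \<phi>]]) (use * ij in simp)
      finally show "tensor_eval (comult Kd \<phi>) (\<lambda>\<alpha> \<beta>. sw k (\<lambda>k1 k2. \<alpha> k2 * ?G b h c (k1 \<otimes> hit (\<beta> \<otimes>\<^bsub>Kd\<^esub> \<psi>) (u j)))) =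
          (\<Sum>l<n. ?P l b h \<phi> c k \<psi>)" .
    qed
    finally show "tensor_eval (comult Kd \<phi>) (\<lambda>\<alpha> \<beta>. g (entry i j (ocl (s \<otimes>\<^bsub>AK\<^esub> hat \<alpha> t) (\<beta> \<otimes>\<^bsub>Kd\<^esub> \<psi>)))) =
        tensor_eval s (\<lambda>b h. tensor_eval t (\<lambda>c k. \<Sum>l<n. ?P l b h \<phi> c k \<psi>))" .
  qed
  \<comment> \<open>The summand is now separated into a factor from \<open>z\<close> and one from
    \<open>y\<close>; it remains to reorder the evaluations and to recognize two entries.\<close>
  also have "\<dots> = (\<Sum>l<n. tensor_eval z (\<lambda>s \<phi>. tensor_eval s (\<lambda>b h. tensor_eval y (\<lambda>t \<psi>.
      tensor_eval t (\<lambda>c k. ?P l b h \<phi> c k \<psi>)))))"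
    by (simp only: tensor_eval_sum tensor_eval_swap[of y])
  also have "\<dots> = (\<Sum>l<n. g (entry i l z \<otimes>\<^bsub>A\<^esub> entry l j y))"
  proof (rule sum.cong[OF refl])
    fix l assume "l \<in> {..<n}"
    then have l: "l < n" by simp
    have My: "entry l j y \<in> carrier A" by (rule entry_closed[OF l ij(2) y])
    have g1: "alin (\<lambda>a. g (a \<otimes>\<^bsub>A\<^esub> entry l j y))" by (intro lin gl My)
    have "g (entry i l z \<otimes>\<^bsub>A\<^esub> entry l j y) = tensor_eval z (\<lambda>s \<phi>. coefficient (\<lambda>a. g (a \<otimes>\<^bsub>A\<^esub> entry l j y)) i (hit \<phi> (u l)) s)"
      by (rule entry_eval[OF ij(1) l z g1])
    also have "\<dots> = tensor_eval z (\<lambda>s \<phi>. tensor_eval s (\<lambda>b h. tensor_eval y (\<lambda>t \<psi>.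
      tensor_eval t (\<lambda>c k. ?P l b h \<phi> c k \<psi>))))"
    proof (rule O.X_eval_cong[OF z], unfold coefficient_def)
      fix s \<phi> assume "(s, \<phi>) \<in> carrier AK \<times> carrier Kd"
      then have s: "s \<in> carrier XX" by (simp add: I.AxK_sel)
      show "tensor_eval s (\<lambda>b h. g ((Q i (h \<otimes> hit \<phi> (u l)) \<triangleright> b) \<otimes>\<^bsub>A\<^esub> entry l j y)) =
         tensor_eval s (\<lambda>b h. tensor_eval y (\<lambda>t \<psi>. tensor_eval t (\<lambda>c k. ?P l b h \<phi> c k \<psi>)))"
      proof (rule I.X_eval_cong[OF s])
        fix b h assume "(b, h) \<in> carrier A \<times> carrier K"
        then have g2: "alin (\<lambda>a. g ((Q i (h \<otimes> hit \<phi> (u l)) \<triangleright> b) \<otimes>\<^bsub>A\<^esub> a))" using ij l by (intro lin gl; simp)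
        show "g ((Q i (h \<otimes> hit \<phi> (u l)) \<triangleright> b) \<otimes>\<^bsub>A\<^esub> entry l j y) =
            tensor_eval y (\<lambda>t \<psi>. tensor_eval t (\<lambda>c k. ?P l b h \<phi> c k \<psi>))"
          using entry_eval[OF l ij(2) y g2] by (simp only: coefficient_def)
      qed
    qed
    finally show "tensor_eval z (\<lambda>s \<phi>. tensor_eval s (\<lambda>b h. tensor_eval y (\<lambda>t \<psi>.
      tensor_eval t (\<lambda>c k. ?P l b h \<phi> c k \<psi>)))) = g (entry i l z \<otimes>\<^bsub>A\<^esub> entry l j y)" by simp
  qed
  also have "\<dots> = g (finsum A (\<lambda>l. entry i l z \<otimes>\<^bsub>A\<^esub> entry l j y) {..<n})"
    by (rule A_finsum_eval[OF g _ c, symmetric]) auto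
  finally show "g (entry i j (z \<otimes>\<^bsub>AO\<^esub> y)) = g (finsum A (\<lambda>l. entry i l z \<otimes>\<^bsub>A\<^esub> entry l j y) {..<n})" .
qed

end

context markov_action begin

lemma alin_cnj_star: "alin g \<Longrightarrow> alin (\<lambda>a. cnj (g (star A a)))"
  by (rule A.linear_cnj_star)

text \<open>Complex conjugation removes all stars from the left side and leaves the left side of
  \<open>star_identity\<close> with x = u_i and v = u_j^* . The right side of that identity is Q_j(h
  (phi.u_i)) under \<open>S\<close>, and \<open>act_star\<close> turns it into the star of the
  transposed entry.\<close>

lemma entry_star:
  assumes ij: "i < n" "j < n" and z: "z \<in> carrier XO"
  shows "entry i j (star AO z) = star A (entry j i z)"
proof (rule A_functional_eqI)
  have zs: "star AO z \<in> carrier XO" by (rule O.AxK_star_closed[OF z])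
  show "entry i j (star AO z) \<in> carrier A" by (rule entry_closed[OF ij zs])
  have Mz: "entry j i z \<in> carrier A" by (rule entry_closed[OF ij(2,1) z])
  show "star A (entry j i z) \<in> carrier A" using Mz by simp
  fix g assume g: "alin g"
  note gl = alin_comp[OF g]
  let ?x = "u i" and ?v = "star K (u j)"
  have x: "?x \<in> carrier K" and v: "?v \<in> carrier K" using ij by simp_all
  have lin_entry: "linear_between XO CC (\<lambda>z. g (entry i j z))"
    by (rule linear_between_comp[OF g entry_linear[OF ij]])
  \<comment> \<open>This is linear in y. By \<open>act_star\<close> its value at S(y) is the
    conjugate of \<open>g\<close> at the star of y \<triangleright> a.\<close>
  let ?f = "\<lambda>a y. cnj (g (star K y \<triangleright> star A a))"
  have f: "klin (?f a)" if "a \<in> carrier A" for a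
    by (rule linear_cnj_star, intro lin gl) (use that in simp)
  let ?R = "\<lambda>\<alpha> \<beta> a h. sw h (\<lambda>h1 h2. sw h2 (\<lambda>k1 k2. sw ?x (\<lambda>c d. ?f a (h1 \<otimes> c) *
      sw ?v (\<lambda>p q. (\<alpha> (S k2) * \<beta> (S q)) * \<tau> (p \<otimes> (k1 \<otimes> d))))))"
  \<comment> \<open>The involution is carried in turn through the coproduct of h_2, through
    \<open>hit\<close> for the coproduct of u_j, and through the coproduct of u_i^* in Q_i, each
    time by \<open>sw_star\<close>.\<close>
  have point: "sw (star K h2) (\<lambda>k1 k2. star Kd \<alpha> k2 * coefficient g i (hit (star Kd \<beta>) (u j)) (cl (star K h1 \<triangleright> star A a) k1)) =
      cnj (sw h2 (\<lambda>k1 k2. sw ?x (\<lambda>c d. ?f a (h1 \<otimes> c) * sw ?v (\<lambda>p q. (\<alpha> (S k2) * \<beta> (S q)) * \<tau> (p \<otimes> (k1 \<otimes> d))))))"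
    if h1: "h1 \<in> carrier K" and h2: "h2 \<in> carrier K" and a: "a \<in> carrier A"
      and \<alpha>: "\<alpha> \<in> carrier Kd" and \<beta>: "\<beta> \<in> carrier Kd" for h1 h2 a \<alpha> \<beta>
  proof -
    note al = klin_comp[OF Kd_klin[OF Kd_closed(6)[OF \<alpha>]]] and bl = klin_comp[OF Kd_klin[OF Kd_closed(6)[OF \<beta>]]]
    let ?w = "hit (star Kd \<beta>) (u j)"
    have w: "?w \<in> carrier K" using ij by simp
    let ?l = "\<lambda>q. g ((q \<otimes> star K h1) \<triangleright> star A a)"
    have l: "klin ?l" using h1 a by (intro lin gl; simp)
    have bil: "kbil (\<lambda>k1 k2. star Kd \<alpha> k2 * ?l (Q i (k1 \<otimes> ?w)))"
      using ij w h1 a by (intro lin gl al; simp)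
    have "sw (star K h2) (\<lambda>k1 k2. star Kd \<alpha> k2 * coefficient g i ?w (cl (star K h1 \<triangleright> star A a) k1)) =
        sw (star K h2) (\<lambda>k1 k2. star Kd \<alpha> k2 * ?l (Q i (k1 \<otimes> ?w)))"
    proof (rule sw_cong)
      fix k1 k2 assume "k1 \<in> carrier K" "k2 \<in> carrier K"
      then show "star Kd \<alpha> k2 * coefficient g i ?w (cl (star K h1 \<triangleright> star A a) k1) = star Kd \<alpha> k2 * ?l (Q i (k1 \<otimes> ?w))"
        using ij h1 a w by (simp add: coefficient_cl[OF g ij(1) w] act_act)
    qed
    also have "\<dots> = cnj (sw h2 (\<lambda>k1 k2. cnj (star Kd \<alpha> (star K k2) * ?l (Q i (star K k1 \<otimes> ?w)))))"
      by (rule sw_star[OF h2 bil])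
    also have "sw h2 (\<lambda>k1 k2. cnj (star Kd \<alpha> (star K k2) * ?l (Q i (star K k1 \<otimes> ?w)))) =
        sw h2 (\<lambda>k1 k2. sw ?x (\<lambda>c d. ?f a (h1 \<otimes> c) * sw ?v (\<lambda>p q. (\<alpha> (S k2) * \<beta> (S q)) * \<tau> (p \<otimes> (k1 \<otimes> d)))))"
    proof (rule sw_cong)
      fix k1 k2 assume kk: "k1 \<in> carrier K" "k2 \<in> carrier K"
      have k1: "star K k1 \<in> carrier K" using kk by simp
      have bil2: "kbil (\<lambda>c d. ?l c * \<tau> (d \<otimes> (star K k1 \<otimes> p)))" if "p \<in> carrier K" for p
        using that k1 h1 a by (intro lin klin_comp[OF l]; simp)
      have lp: "klin (\<lambda>p. sw (star K ?x) (\<lambda>c d. ?l c * \<tau> (d \<otimes> (star K k1 \<otimes> p))))"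
        using k1 by (intro lin; simp)
      have bil3: "kbil (\<lambda>p q. star Kd \<beta> q * sw (star K ?x) (\<lambda>c d. ?l c * \<tau> (d \<otimes> (star K k1 \<otimes> p))))"
        using k1 by (intro lin bl; simp)
      have e: "cnj (?l (star K c) * \<tau> (star K d \<otimes> (star K k1 \<otimes> star K p))) = ?f a (h1 \<otimes> c) * \<tau> (p \<otimes> (k1 \<otimes> d))"
        if "c \<in> carrier K" "d \<in> carrier K" "p \<in> carrier K" for c d p
      proof -
        have "star K d \<otimes> (star K k1 \<otimes> star K p) = star K (p \<otimes> (k1 \<otimes> d))"
          using that kk by (simp add: star_mult A_assoc)
        then have "\<tau> (star K d \<otimes> (star K k1 \<otimes> star K p)) = cnj (\<tau> (p \<otimes> (k1 \<otimes> d)))"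
          using that kk by (simp only: tr_star A_closed)
        moreover have "star K (h1 \<otimes> c) = star K c \<otimes> star K h1" using that h1 by (simp add: star_mult)
        ultimately show ?thesis by (simp only: complex_cnj_mult complex_cnj_cnj)
      qed
      have "?l (Q i (star K k1 \<otimes> ?w)) = sw (star K ?x) (\<lambda>c d. ?l c * \<tau> (d \<otimes> (star K k1 \<otimes> ?w)))"
        by (rule Q_eval[OF l ij(1)]) (use k1 w in simp)
      also have "\<dots> = sw (star K ?v) (\<lambda>p q. star Kd \<beta> q * sw (star K ?x) (\<lambda>c d. ?l c * \<tau> (d \<otimes> (star K k1 \<otimes> p))))"
        using hit_eval[OF lp, of "u j" "star Kd \<beta>"] ij by simp
      also have "\<dots> = cnj (sw ?v (\<lambda>p q. cnj (star Kd \<beta> (star K q) * sw (star K ?x) (\<lambda>c d. ?l c * \<tau> (d \<otimes> (star K k1 \<otimes> star K p))))))"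
        by (rule sw_star[OF v bil3])
      also have "sw ?v (\<lambda>p q. cnj (star Kd \<beta> (star K q) * sw (star K ?x) (\<lambda>c d. ?l c * \<tau> (d \<otimes> (star K k1 \<otimes> star K p))))) =
          sw ?v (\<lambda>p q. \<beta> (S q) * sw ?x (\<lambda>c d. ?f a (h1 \<otimes> c) * \<tau> (p \<otimes> (k1 \<otimes> d))))"
      proof (rule sw_cong)
        fix p q assume pq: "p \<in> carrier K" "q \<in> carrier K"
        have "sw (star K ?x) (\<lambda>c d. ?l c * \<tau> (d \<otimes> (star K k1 \<otimes> star K p))) =
            cnj (sw ?x (\<lambda>c d. cnj (?l (star K c) * \<tau> (star K d \<otimes> (star K k1 \<otimes> star K p)))))"
          by (rule sw_star[OF x bil2]) (use pq in simp)
        also have "sw ?x (\<lambda>c d. cnj (?l (star K c) * \<tau> (star K d \<otimes> (star K k1 \<otimes> star K p)))) =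
            sw ?x (\<lambda>c d. ?f a (h1 \<otimes> c) * \<tau> (p \<otimes> (k1 \<otimes> d)))"
          by (rule sw_cong) (rule e, use pq in simp_all)
        finally show "cnj (star Kd \<beta> (star K q) * sw (star K ?x) (\<lambda>c d. ?l c * \<tau> (d \<otimes> (star K k1 \<otimes> star K p)))) =
            \<beta> (S q) * sw ?x (\<lambda>c d. ?f a (h1 \<otimes> c) * \<tau> (p \<otimes> (k1 \<otimes> d)))"
          using pq by (simp add: Kd_eval)
      qed
      finally have "cnj (?l (Q i (star K k1 \<otimes> ?w))) =
          sw ?v (\<lambda>p q. \<beta> (S q) * sw ?x (\<lambda>c d. ?f a (h1 \<otimes> c) * \<tau> (p \<otimes> (k1 \<otimes> d))))"
        by (simp only: complex_cnj_cnj)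
      also have "\<dots> = sw ?v (\<lambda>p q. sw ?x (\<lambda>c d. \<beta> (S q) * (?f a (h1 \<otimes> c) * \<tau> (p \<otimes> (k1 \<otimes> d)))))"
        by (simp only: sw_cmult)
      also have "\<dots> = sw ?x (\<lambda>c d. sw ?v (\<lambda>p q. \<beta> (S q) * (?f a (h1 \<otimes> c) * \<tau> (p \<otimes> (k1 \<otimes> d)))))"
        by (rule sw_swap)
      finally have "cnj (star Kd \<alpha> (star K k2) * ?l (Q i (star K k1 \<otimes> ?w))) =
          sw ?x (\<lambda>c d. sw ?v (\<lambda>p q. \<alpha> (S k2) * (\<beta> (S q) * (?f a (h1 \<otimes> c) * \<tau> (p \<otimes> (k1 \<otimes> d))))))"
        using kk by (simp add: Kd_eval sw_cmult)
      also have "\<dots> = sw ?x (\<lambda>c d. sw ?v (\<lambda>p q. ?f a (h1 \<otimes> c) * ((\<alpha> (S k2) * \<beta> (S q)) * \<tau> (p \<otimes> (k1 \<otimes> d)))))"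
        by (simp only: mult_ac)
      also have "\<dots> = sw ?x (\<lambda>c d. ?f a (h1 \<otimes> c) * sw ?v (\<lambda>p q. (\<alpha> (S k2) * \<beta> (S q)) * \<tau> (p \<otimes> (k1 \<otimes> d))))"
        by (simp only: sw_cmult)
      finally show "cnj (star Kd \<alpha> (star K k2) * ?l (Q i (star K k1 \<otimes> ?w))) =
          sw ?x (\<lambda>c d. ?f a (h1 \<otimes> c) * sw ?v (\<lambda>p q. (\<alpha> (S k2) * \<beta> (S q)) * \<tau> (p \<otimes> (k1 \<otimes> d))))" .
    qed
    finally show ?thesis .
  qed
  have "g (entry i j (star AO z)) = cnj (tensor_eval z (\<lambda>s \<phi>. tensor_eval (comult Kd \<phi>)
      (\<lambda>\<alpha> \<beta>. cnj (g (entry i j (ocl (hat (star Kd \<alpha>) (star AK s)) (star Kd \<beta>)))))))"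
    by (rule O.AxK_star_eval[OF z lin_entry])
  also have "tensor_eval z (\<lambda>s \<phi>. tensor_eval (comult Kd \<phi>)
      (\<lambda>\<alpha> \<beta>. cnj (g (entry i j (ocl (hat (star Kd \<alpha>) (star AK s)) (star Kd \<beta>)))))) =
      tensor_eval z (\<lambda>s \<phi>. coefficient (\<lambda>a. cnj (g (star A a))) j (hit \<phi> (u i)) s)"
  proof (rule O.X_eval_cong[OF z])
    fix s \<phi> assume "(s, \<phi>) \<in> carrier AK \<times> carrier Kd"
    then have s: "s \<in> carrier XX" and \<phi>: "\<phi> \<in> carrier Kd" by (auto simp: I.AxK_sel)
    have ss: "star AK s \<in> carrier XX" by (rule I.AxK_star_closed[OF s])
    have "tensor_eval (comult Kd \<phi>) (\<lambda>\<alpha> \<beta>. cnj (g (entry i j (ocl (hat (star Kd \<alpha>) (star AK s)) (star Kd \<beta>))))) =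
        tensor_eval (comult Kd \<phi>) (\<lambda>\<alpha> \<beta>. tensor_eval s (?R \<alpha> \<beta>))"
    proof (rule TD.eval_cong[OF comult_Kd(1)[OF \<phi>]])
      fix \<alpha> \<beta> assume "(\<alpha>, \<beta>) \<in> carrier Kd \<times> carrier Kd"
      then have \<alpha>: "\<alpha> \<in> carrier Kd" and \<beta>: "\<beta> \<in> carrier Kd" by auto
      let ?w = "hit (star Kd \<beta>) (u j)"
      have w: "?w \<in> carrier K" using ij by simp
      have hs: "hat (star Kd \<alpha>) (star AK s) \<in> carrier XX" by (rule I.dual_action_closed[OF ss])
      note \<Phi> = coefficient_linear[OF g ij(1) w]
      note v2 = hat_vanishes[OF \<Phi> Kd_klin[OF Kd_closed(6)[OF \<alpha>]]]
      let ?H = "\<lambda>a h. sw h (\<lambda>h1 h2. star Kd \<alpha> h2 * coefficient g i ?w (cl a h1))"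
      have "g (entry i j (ocl (hat (star Kd \<alpha>) (star AK s)) (star Kd \<beta>))) = coefficient g i ?w (hat (star Kd \<alpha>) (star AK s))"
        by (rule entry_ocl[OF ij g hs Kd_closed(6)[OF \<beta>]])
      also have "\<dots> = tensor_eval (star AK s) ?H"
        by (rule hat_eval[OF \<Phi> ss])
      also have "\<dots> = cnj (tensor_eval s (\<lambda>a h. tensor_eval (comult K h)
          (\<lambda>h1 h2. cnj (tensor_eval (cl (star K h1 \<triangleright> star A a) (star K h2)) ?H))))"
        by (rule I.AxK_star_eval[OF s I.X_eval_linear[OF v2]])
      also have "tensor_eval s (\<lambda>a h. tensor_eval (comult K h)
          (\<lambda>h1 h2. cnj (tensor_eval (cl (star K h1 \<triangleright> star A a) (star K h2)) ?H))) = tensor_eval s (?R \<alpha> \<beta>)"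
      proof (rule I.X_eval_cong[OF s])
        fix a h assume "(a, h) \<in> carrier A \<times> carrier K"
        then have a: "a \<in> carrier A" and h: "h \<in> carrier K" by auto
        have "tensor_eval (comult K h) (\<lambda>h1 h2. cnj (tensor_eval (cl (star K h1 \<triangleright> star A a) (star K h2)) ?H)) =
            sw h (\<lambda>h1 h2. cnj (?H (star K h1 \<triangleright> star A a) (star K h2)))"
          unfolding I.cl_eval[OF v2] sw_eval[OF h] by (rule refl)
        also have "\<dots> = ?R \<alpha> \<beta> a h"
          by (rule sw_cong) (simp only: point a \<alpha> \<beta> complex_cnj_cnj)
        finally show "tensor_eval (comult K h) (\<lambda>h1 h2. cnj (tensor_eval (cl (star K h1 \<triangleright> star A a) (star K h2)) ?H)) =
            ?R \<alpha> \<beta> a h" .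
      qed
      finally show "cnj (g (entry i j (ocl (hat (star Kd \<alpha>) (star AK s)) (star Kd \<beta>)))) = tensor_eval s (?R \<alpha> \<beta>)"
        by (simp only: complex_cnj_cnj)
    qed
    also have "\<dots> = tensor_eval s (\<lambda>a h. tensor_eval (comult Kd \<phi>) (\<lambda>\<alpha> \<beta>. ?R \<alpha> \<beta> a h))"
      by (rule tensor_eval_swap)
    also have "\<dots> = coefficient (\<lambda>a. cnj (g (star A a))) j (hit \<phi> (u i)) s"
      unfolding coefficient_def
    proof (rule I.X_eval_cong[OF s])
      fix a h assume "(a, h) \<in> carrier A \<times> carrier K"
      then have a: "a \<in> carrier A" and h: "h \<in> carrier K" by auto
      have fS: "klin (\<lambda>y. ?f a (S y))" by (rule klin_comp[OF f[OF a] antipode_linear])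
      have "tensor_eval (comult Kd \<phi>) (\<lambda>\<alpha> \<beta>. ?R \<alpha> \<beta> a h) =
          sw h (\<lambda>h1 h2. tensor_eval (comult Kd \<phi>) (\<lambda>\<alpha> \<beta>. sw h2 (\<lambda>k1 k2. sw ?x (\<lambda>c d. ?f a (h1 \<otimes> c) *
            sw ?v (\<lambda>p q. (\<alpha> (S k2) * \<beta> (S q)) * \<tau> (p \<otimes> (k1 \<otimes> d)))))))"
        by (rule tensor_eval_sw_swap[OF h])
      also have "\<dots> = sw h (\<lambda>h1 h2. sw h2 (\<lambda>k1 k2. sw ?x (\<lambda>c d. ?f a (h1 \<otimes> c) *
          sw ?v (\<lambda>p q. \<phi> (S (q \<otimes> k2)) * \<tau> (p \<otimes> (k1 \<otimes> d))))))"
      proof (rule sw_cong)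
        fix h1 h2 assume hh: "h1 \<in> carrier K" "h2 \<in> carrier K"
        have "tensor_eval (comult Kd \<phi>) (\<lambda>\<alpha> \<beta>. sw h2 (\<lambda>k1 k2. sw ?x (\<lambda>c d. ?f a (h1 \<otimes> c) *
            sw ?v (\<lambda>p q. (\<alpha> (S k2) * \<beta> (S q)) * \<tau> (p \<otimes> (k1 \<otimes> d)))))) =
          sw h2 (\<lambda>k1 k2. sw ?x (\<lambda>c d. ?f a (h1 \<otimes> c) *
            sw ?v (\<lambda>p q. tensor_eval (comult Kd \<phi>) (\<lambda>\<alpha> \<beta>. \<alpha> (S k2) * \<beta> (S q)) * \<tau> (p \<otimes> (k1 \<otimes> d)))))"
          by (simp only: tensor_eval_sw_swap[OF hh(2)] tensor_eval_sw_swap[OF x] tensor_eval_cmult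
              tensor_eval_sw_swap[OF v] tensor_eval_multc)
        also have "\<dots> = sw h2 (\<lambda>k1 k2. sw ?x (\<lambda>c d. ?f a (h1 \<otimes> c) *
          sw ?v (\<lambda>p q. \<phi> (S (q \<otimes> k2)) * \<tau> (p \<otimes> (k1 \<otimes> d)))))"
        proof (intro sw_cong arg_cong[of _ _ "(*) _"])
          fix k1 k2 p q :: 'k assume "k2 \<in> carrier K" "q \<in> carrier K"
          then show "tensor_eval (comult Kd \<phi>) (\<lambda>\<alpha> \<beta>. \<alpha> (S k2) * \<beta> (S q)) * \<tau> (p \<otimes> (k1 \<otimes> d)) =
              \<phi> (S (q \<otimes> k2)) * \<tau> (p \<otimes> (k1 \<otimes> d))" for d
            by (simp add: comult_Kd(2)[OF \<phi>] antipode_mult)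
        qed
        finally show "tensor_eval (comult Kd \<phi>) (\<lambda>\<alpha> \<beta>. sw h2 (\<lambda>k1 k2. sw ?x (\<lambda>c d. ?f a (h1 \<otimes> c) *
            sw ?v (\<lambda>p q. (\<alpha> (S k2) * \<beta> (S q)) * \<tau> (p \<otimes> (k1 \<otimes> d)))))) =
          sw h2 (\<lambda>k1 k2. sw ?x (\<lambda>c d. ?f a (h1 \<otimes> c) *
          sw ?v (\<lambda>p q. \<phi> (S (q \<otimes> k2)) * \<tau> (p \<otimes> (k1 \<otimes> d)))))" .
      qed
      also have "\<dots> = sw ?v (\<lambda>c d. ?f a (S c) * sw ?x (\<lambda>p q. \<phi> q * \<tau> (d \<otimes> (h \<otimes> p))))"
        by (rule star_identity[OF f[OF a] Kd_klin[OF \<phi>] h x v])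
      also have "\<dots> = sw ?v (\<lambda>c d. ?f a (S c) * \<tau> (d \<otimes> (h \<otimes> hit \<phi> ?x)))"
      proof (rule sw_cong)
        fix c d assume cd: "c \<in> carrier K" "d \<in> carrier K"
        have l: "klin (\<lambda>y. \<tau> (d \<otimes> (h \<otimes> y)))" using cd h by (intro lin; simp)
        show "?f a (S c) * sw ?x (\<lambda>p q. \<phi> q * \<tau> (d \<otimes> (h \<otimes> p))) = ?f a (S c) * \<tau> (d \<otimes> (h \<otimes> hit \<phi> ?x))"
          by (simp only: hit_eval[OF l x])
      qed
      also have "\<dots> = ?f a (S (Q j (h \<otimes> hit \<phi> ?x)))"
        by (rule Q_eval[OF fS ij(2), symmetric]) (use h x in simp)
      also have "\<dots> = cnj (g (star A (Q j (h \<otimes> hit \<phi> ?x) \<triangleright> a)))"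
        using a h x ij by (simp add: act_star)
      finally show "tensor_eval (comult Kd \<phi>) (\<lambda>\<alpha> \<beta>. ?R \<alpha> \<beta> a h) = cnj (g (star A (Q j (h \<otimes> hit \<phi> ?x) \<triangleright> a)))" .
    qed
    finally show "tensor_eval (comult Kd \<phi>) (\<lambda>\<alpha> \<beta>. cnj (g (entry i j (ocl (hat (star Kd \<alpha>) (star AK s)) (star Kd \<beta>))))) =
        coefficient (\<lambda>a. cnj (g (star A a))) j (hit \<phi> (u i)) s" .
  qed
  also have "\<dots> = cnj (g (star A (entry j i z)))"
    by (rule entry_eval[OF ij(2,1) z alin_cnj_star[OF g], symmetric])
  finally show "g (entry i j (star AO z)) = g (star A (entry j i z))"
    by (simp only: complex_cnj_cnj)
qed

end

subsection \<open>The inverse\<close>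

context markov_action begin

abbreviation trd :: "'k \<Rightarrow> 'k \<Rightarrow> complex" where
  "trd q \<equiv> restrict (\<lambda>x. \<tau> (q \<otimes> x)) (carrier K)"

definition from_entry :: "nat \<Rightarrow> nat \<Rightarrow> 'a \<Rightarrow> (('a, 'k) tensor, 'k \<Rightarrow> complex) tensor" where
  "from_entry i j a = lift XO (\<lambda>p1 p2. lift XO (\<lambda>q1 q2.
     ocl (cl (p1 \<triangleright> a) (p2 \<otimes> q1)) (trd q2))
     (comult K (star K (u j)))) (comult K (u i))"

lemma tr_restrict_in_Kd: "q \<in> carrier K \<Longrightarrow> trd q \<in> carrier Kd"
  by (rule restrict_in_Kd) (intro lin; simp)

lemma ocl_closed: "b \<in> carrier A \<Longrightarrow> h \<in> carrier K \<Longrightarrow> \<phi> \<in> carrier Kd \<Longrightarrow> ocl (cl b h) \<phi> \<in> carrier XO"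
  by (rule O.cl_closed) (simp_all add: I.AxK_sel I.cl_closed)

lemma inner_from_entry_closed:
  assumes "j < n" "a \<in> carrier A" "p1 \<in> carrier K" "p2 \<in> carrier K"
  shows "lift XO (\<lambda>q1 q2. ocl (cl (p1 \<triangleright> a) (p2 \<otimes> q1)) (trd q2))
     (comult K (star K (u j))) \<in> carrier XO"
  by (rule KK.lift_closed'[OF O.X_space]) (use assms in \<open>auto intro!: ocl_closed tr_restrict_in_Kd\<close>)

lemma from_entry_closed: "i < n \<Longrightarrow> j < n \<Longrightarrow> a \<in> carrier A \<Longrightarrow> from_entry i j a \<in> carrier XO"
  unfolding from_entry_def by (rule KK.lift_closed'[OF O.X_space]) (auto intro!: inner_from_entry_closed)

lemma from_entry_eval:
  assumes ij: "i < n" "j < n" and a: "a \<in> carrier A" and \<Omega>: "linear_between XO CC \<Omega>"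
  shows "\<Omega> (from_entry i j a) = sw (u i) (\<lambda>p1 p2. sw (star K (u j)) (\<lambda>q1 q2.
     \<Omega> (ocl (cl (p1 \<triangleright> a) (p2 \<otimes> q1)) (trd q2))))"
proof -
  have "\<Omega> (from_entry i j a) = tensor_eval (comult K (u i)) (\<lambda>p1 p2. \<Omega> (lift XO (\<lambda>q1 q2.
     ocl (cl (p1 \<triangleright> a) (p2 \<otimes> q1)) (trd q2)) (comult K (star K (u j)))))"
    unfolding from_entry_def by (rule KK.functional_lift'[OF O.X_space _ _ \<Omega>]) (use ij a in \<open>auto intro!: inner_from_entry_closed\<close>)
  also have "\<dots> = sw (u i) (\<lambda>p1 p2. \<Omega> (lift XO (\<lambda>q1 q2.
     ocl (cl (p1 \<triangleright> a) (p2 \<otimes> q1)) (trd q2)) (comult K (star K (u j)))))"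
    using ij by (simp add: sw_eval)
  also have "\<dots> = sw (u i) (\<lambda>p1 p2. sw (star K (u j)) (\<lambda>q1 q2.
     \<Omega> (ocl (cl (p1 \<triangleright> a) (p2 \<otimes> q1)) (trd q2))))"
  proof (rule sw_cong)
    fix p1 p2 assume p: "p1 \<in> carrier K" "p2 \<in> carrier K"
    have "\<Omega> (lift XO (\<lambda>q1 q2. ocl (cl (p1 \<triangleright> a) (p2 \<otimes> q1)) (trd q2)) (comult K (star K (u j)))) =
        tensor_eval (comult K (star K (u j))) (\<lambda>q1 q2. \<Omega> (ocl (cl (p1 \<triangleright> a) (p2 \<otimes> q1)) (trd q2)))"
      by (rule KK.functional_lift'[OF O.X_space _ _ \<Omega>]) (use ij a p in \<open>auto intro!: ocl_closed tr_restrict_in_Kd\<close>)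
    then show "\<Omega> (lift XO (\<lambda>q1 q2. ocl (cl (p1 \<triangleright> a) (p2 \<otimes> q1)) (trd q2)) (comult K (star K (u j)))) =
        sw (star K (u j)) (\<lambda>q1 q2. \<Omega> (ocl (cl (p1 \<triangleright> a) (p2 \<otimes> q1)) (trd q2)))"
      using ij by (simp add: sw_eval)
  qed
  finally show ?thesis .
qed

text \<open>The legs q of u_j^* together with those of u_l form E(u_j^* u_l), which is 1 or 0. If it
  is 1, the legs p of u_i leave Q_k(p_2) \<triangleright> (p_1 \<triangleright> a), and this is
  E(u_k^* u_i) \<triangleright> a.\<close>

lemma entry_from_entry:
  assumes ij: "i < n" "j < n" and kl: "k < n" "l < n" and a: "a \<in> carrier A"
  shows "entry k l (from_entry i j a) = (if k = i \<and> l = j then a else \<zero>\<^bsub>A\<^esub>)"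
proof (rule A_functional_eqI)
  show "entry k l (from_entry i j a) \<in> carrier A" by (rule entry_closed[OF kl from_entry_closed[OF ij a]])
  show "(if k = i \<and> l = j then a else \<zero>\<^bsub>A\<^esub>) \<in> carrier A" using a by simp
  fix g assume g: "alin g"
  note gl = alin_comp[OF g]
  let ?v = "star K (u j)"
  have v: "?v \<in> carrier K" and ui: "u i \<in> carrier K" and ul: "u l \<in> carrier K" and uk: "star K (u k) \<in> carrier K"
    using ij kl by simp_all
  let ?e = "E (?v \<otimes> u l)"
  have lin_entry: "linear_between XO CC (\<lambda>z. g (entry k l z))"
    by (rule linear_between_comp[OF g entry_linear[OF kl]])
  have z0: "g (\<zero> \<triangleright> c) = 0" if "c \<in> carrier A" for c
    using linear_between_zero[OF linear_between_comp[OF g linear_act1[OF linear_between_id that]] complex_space_K complex_space_CC] by simp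
  have "g (entry k l (from_entry i j a)) = sw (u i) (\<lambda>p1 p2. sw ?v (\<lambda>q1 q2.
      g (entry k l (ocl (cl (p1 \<triangleright> a) (p2 \<otimes> q1)) (trd q2)))))"
    by (rule from_entry_eval[OF ij a lin_entry])
  also have "\<dots> = sw (u i) (\<lambda>p1 p2. g (Q k (p2 \<otimes> ?e) \<triangleright> (p1 \<triangleright> a)))"
  proof (rule sw_cong)
    fix p1 p2 assume p: "p1 \<in> carrier K" "p2 \<in> carrier K"
    let ?f = "\<lambda>y. g (Q k (p2 \<otimes> y) \<triangleright> (p1 \<triangleright> a))"
    have f: "klin ?f" using p a kl by (intro lin gl; simp)
    have b: "kbil (\<lambda>x1 x2. \<tau> x2 * ?f x1)" by (intro lin klin_comp[OF f])
    have "sw ?v (\<lambda>q1 q2. g (entry k l (ocl (cl (p1 \<triangleright> a) (p2 \<otimes> q1)) (trd q2)))) =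
        sw ?v (\<lambda>q1 q2. sw (u l) (\<lambda>y1 y2. \<tau> (q2 \<otimes> y2) * ?f (q1 \<otimes> y1)))"
    proof (rule sw_cong)
      fix q1 q2 assume q: "q1 \<in> carrier K" "q2 \<in> carrier K"
      let ?\<phi> = "trd q2"
      have c: "cl (p1 \<triangleright> a) (p2 \<otimes> q1) \<in> carrier XX" using p q a by (intro I.cl_closed; simp)
      have w: "hit ?\<phi> (u l) \<in> carrier K" using ul by simp
      have l: "klin (\<lambda>y. ?f (q1 \<otimes> y))" using q by (intro lin klin_comp[OF f])
      have "g (entry k l (ocl (cl (p1 \<triangleright> a) (p2 \<otimes> q1)) ?\<phi>)) = coefficient g k (hit ?\<phi> (u l)) (cl (p1 \<triangleright> a) (p2 \<otimes> q1))"
        by (rule entry_ocl[OF kl g c tr_restrict_in_Kd[OF q(2)]])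
      also have "\<dots> = ?f (q1 \<otimes> hit ?\<phi> (u l))"
        using p q w by (simp add: coefficient_cl[OF g kl(1) w] A_assoc)
      also have "\<dots> = sw (u l) (\<lambda>y1 y2. \<tau> (q2 \<otimes> y2) * ?f (q1 \<otimes> y1))"
        unfolding hit_eval[OF l ul] by (rule sw_cong) simp
      finally show "g (entry k l (ocl (cl (p1 \<triangleright> a) (p2 \<otimes> q1)) ?\<phi>)) = sw (u l) (\<lambda>y1 y2. \<tau> (q2 \<otimes> y2) * ?f (q1 \<otimes> y1))" .
    qed
    also have "\<dots> = sw (?v \<otimes> u l) (\<lambda>x1 x2. \<tau> x2 * ?f x1)"
      by (rule sw_mult[OF v ul b, symmetric])
    also have "\<dots> = ?f ?e"
      by (rule E_eval[OF f, symmetric]) (use v ul in simp)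
    finally show "sw ?v (\<lambda>q1 q2. g (entry k l (ocl (cl (p1 \<triangleright> a) (p2 \<otimes> q1)) (trd q2)))) = ?f ?e" .
  qed
  also have "\<dots> = g (if k = i \<and> l = j then a else \<zero>\<^bsub>A\<^esub>)"
  proof (cases "l = j")
    case False
    then have e: "?e = \<zero>" using u_orth[OF ij(2) kl(2)] by simp
    have "sw (u i) (\<lambda>p1 p2. g (Q k (p2 \<otimes> ?e) \<triangleright> (p1 \<triangleright> a))) = sw (u i) (\<lambda>p1 p2. 0)"
    proof (rule sw_cong)
      fix p1 p2 assume p: "p1 \<in> carrier K" "p2 \<in> carrier K"
      have l: "klin (\<lambda>y. g (Q k (p2 \<otimes> y) \<triangleright> (p1 \<triangleright> a)))" using p a kl by (intro lin gl; simp)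
      show "g (Q k (p2 \<otimes> ?e) \<triangleright> (p1 \<triangleright> a)) = 0"
        unfolding e using linear_between_zero[OF l complex_space_K complex_space_CC] by simp
    qed
    also have "\<dots> = 0" using sw_cmult[of "u i" 0 "\<lambda>_ _. 0"] by simp
    finally show ?thesis
      using False linear_between_zero[OF g complex_space_A complex_space_CC] by simp
  next
    case True
    then have e: "?e = \<one>" using u_orth[OF ij(2) kl(2)] by simp
    let ?c = "E (star K (u k) \<otimes> u i)"
    have c: "?c \<in> carrier K" using uk ui by simp
    have l: "klin (\<lambda>y. g ((?c \<otimes> y) \<triangleright> a))" using c a by (intro lin gl; simp)
    have b1: "kbil (\<lambda>y1 y2. g ((E (star K (u k) \<otimes> (u i \<otimes> y2)) \<otimes> S y1) \<triangleright> a))"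
      using uk ui a by (intro lin gl; simp)
    have b2: "kbil (\<lambda>y1 y2. g ((?c \<otimes> (y2 \<otimes> S y1)) \<triangleright> a))"
      using c a by (intro lin gl; simp)
    \<comment> \<open>The unit of \<open>A\<close> is inserted in order to apply
      \<open>Q_act_mult\<close> with y = 1 and b = 1; afterwards \<open>eps_t_Q\<close> replaces Q_k
      acting on that unit by an element of \<open>R\<close>.\<close>
    have "sw (u i) (\<lambda>p1 p2. g (Q k (p2 \<otimes> ?e) \<triangleright> (p1 \<triangleright> a))) =
        sw (u i) (\<lambda>p1 p2. g (Q k (p2 \<otimes> \<one>) \<triangleright> (\<one>\<^bsub>A\<^esub> \<otimes>\<^bsub>A\<^esub> (p1 \<triangleright> a))))"
      unfolding e by (rule sw_cong) (use a in simp)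
    also have "\<dots> = sw \<one> (\<lambda>y1 y2. g ((Q k (u i \<otimes> y2) \<triangleright> \<one>\<^bsub>A\<^esub>) \<otimes>\<^bsub>A\<^esub> (S y1 \<triangleright> a)))"
      by (rule Q_act_mult[OF g kl(1) ui]) (use a in simp_all)
    also have "\<dots> = sw \<one> (\<lambda>y1 y2. g ((E (star K (u k) \<otimes> (u i \<otimes> y2)) \<otimes> S y1) \<triangleright> a))"
    proof (rule sw_cong)
      fix y1 y2 assume y: "y1 \<in> carrier K" "y2 \<in> carrier K"
      have "Q k (u i \<otimes> y2) \<triangleright> \<one>\<^bsub>A\<^esub> = E (star K (u k) \<otimes> (u i \<otimes> y2)) \<triangleright> \<one>\<^bsub>A\<^esub>"
        using act_unit[of "Q k (u i \<otimes> y2)"] kl ui y by (simp add: eps_t_Q)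
      then show "g ((Q k (u i \<otimes> y2) \<triangleright> \<one>\<^bsub>A\<^esub>) \<otimes>\<^bsub>A\<^esub> (S y1 \<triangleright> a)) = g ((E (star K (u k) \<otimes> (u i \<otimes> y2)) \<otimes> S y1) \<triangleright> a)"
        using uk ui y a by (simp add: R_act act_act)
    qed
    also have "\<dots> = sw \<one> (\<lambda>y1 y2. g ((E (star K (u k) \<otimes> (u i \<otimes> eps_t K y2)) \<otimes> S y1) \<triangleright> a))"
      by (rule sw_one_eps_t[OF b1, symmetric])
    also have "\<dots> = sw \<one> (\<lambda>y1 y2. g ((?c \<otimes> (eps_t K y2 \<otimes> S y1)) \<triangleright> a))"
    proof (rule sw_cong)
      fix y1 y2 assume "y1 \<in> carrier K" "y2 \<in> carrier K"
      then show "g ((E (star K (u k) \<otimes> (u i \<otimes> eps_t K y2)) \<otimes> S y1) \<triangleright> a) = g ((?c \<otimes> (eps_t K y2 \<otimes> S y1)) \<triangleright> a)"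
        using E_right[of "eps_t K y2" "star K (u k) \<otimes> u i"] uk ui by (simp add: A_assoc)
    qed
    also have "\<dots> = sw \<one> (\<lambda>y1 y2. g ((?c \<otimes> (y2 \<otimes> S y1)) \<triangleright> a))"
      by (rule sw_one_eps_t[OF b2])
    also have "\<dots> = g (?c \<triangleright> a)"
      using antipode_eps_t_eval[OF l, of \<one>] c by simp
    also have "\<dots> = g (if k = i \<and> l = j then a else \<zero>\<^bsub>A\<^esub>)"
      using True u_orth[OF kl(1) ij(1)] z0[OF a] a linear_between_zero[OF g complex_space_A complex_space_CC]
      by (simp add: act_one)
    finally show ?thesis .
  qed
  finally show "g (entry k l (from_entry i j a)) = g (if k = i \<and> l = j then a else \<zero>\<^bsub>A\<^esub>)" .
qed

section \<open>Recovering an element of the double crossed product from its entries\<close>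

context
  fixes \<Omega> assumes \<Omega>: "linear_between XO CC \<Omega>"
begin

definition \<Theta> where "\<Theta> b h \<phi> = \<Omega> (ocl (cl b h) \<phi>)"

lemma outer_functional:
  "s \<in> carrier XX \<Longrightarrow> linear_between Kd CC (\<lambda>\<phi>. \<Omega> (ocl s \<phi>))"
  "\<phi> \<in> carrier Kd \<Longrightarrow> linear_between XX CC (\<lambda>s. \<Omega> (ocl s \<phi>))"
  "s \<in> carrier XX \<Longrightarrow> \<psi> \<in> Cartan_t Kd \<Longrightarrow> \<phi> \<in> carrier Kd \<Longrightarrow>
     \<Omega> (ocl (s \<otimes>\<^bsub>AK\<^esub> hat \<psi> \<one>\<^bsub>AK\<^esub>) \<phi>) = \<Omega> (ocl s (\<psi> \<otimes>\<^bsub>Kd\<^esub> \<phi>))"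
proof -
  have b: "bilinear_on AK Kd (\<lambda>s \<phi>. \<Omega> (ocl s \<phi>))"
    and r: "\<And>s \<psi> \<phi>. s \<in> carrier AK \<Longrightarrow> \<psi> \<in> Cartan_t Kd \<Longrightarrow> \<phi> \<in> carrier Kd \<Longrightarrow>
     \<Omega> (ocl (s \<otimes>\<^bsub>AK\<^esub> hat \<psi> \<one>\<^bsub>AK\<^esub>) \<phi>) = \<Omega> (ocl s (\<psi> \<otimes>\<^bsub>Kd\<^esub> \<phi>))"
    using O.X_functional(1)[OF \<Omega>] unfolding O.vanishes_crossed by blast+
  show "linear_between Kd CC (\<lambda>\<phi>. \<Omega> (ocl s \<phi>))" if "s \<in> carrier XX"
    by (rule bilinear_onD(1)[OF b]) (use that in \<open>simp add: I.AxK_sel\<close>)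
  show "linear_between XX CC (\<lambda>s. \<Omega> (ocl s \<phi>))" if "\<phi> \<in> carrier Kd"
    using bilinear_onD(2)[OF b that] by (simp only: I.AxK_linear)
  show "\<Omega> (ocl (s \<otimes>\<^bsub>AK\<^esub> hat \<psi> \<one>\<^bsub>AK\<^esub>) \<phi>) = \<Omega> (ocl s (\<psi> \<otimes>\<^bsub>Kd\<^esub> \<phi>))"
    if "s \<in> carrier XX" "\<psi> \<in> Cartan_t Kd" "\<phi> \<in> carrier Kd"
    using that r by (simp add: I.AxK_sel(1))
qed

lemma Theta_linear:
  "\<phi> \<in> carrier Kd \<Longrightarrow> bilinear_on A K (\<lambda>b h. \<Theta> b h \<phi>)"
  "b \<in> carrier A \<Longrightarrow> h \<in> carrier K \<Longrightarrow> linear_between Kd CC (\<Theta> b h)"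
  unfolding \<Theta>_def
  by (rule Phi_props(1)[OF outer_functional(2)], assumption) (intro outer_functional(1) I.cl_closed)

lemma Theta_lin:
  "linear_between V A f \<Longrightarrow> h \<in> carrier K \<Longrightarrow> \<phi> \<in> carrier Kd \<Longrightarrow> linear_between V CC (\<lambda>x. \<Theta> (f x) h \<phi>)"
  "linear_between V K f' \<Longrightarrow> b \<in> carrier A \<Longrightarrow> \<phi> \<in> carrier Kd \<Longrightarrow> linear_between V CC (\<lambda>x. \<Theta> b (f' x) \<phi>)"
  "linear_between V Kd f'' \<Longrightarrow> b \<in> carrier A \<Longrightarrow> h \<in> carrier K \<Longrightarrow> linear_between V CC (\<lambda>x. \<Theta> b h (f'' x))"
  using bilinear_on_comp[OF Theta_linear(1)] linear_between_comp[OF Theta_linear(2)] by blast+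

lemma Theta_R_left:
  assumes "b \<in> carrier A" "z \<in> R" "h \<in> carrier K" "\<phi> \<in> carrier Kd"
  shows "\<Theta> (S z \<triangleright> b) h \<phi> = \<Theta> b (z \<otimes> h) \<phi>"
  using Phi_props(2)[OF outer_functional(2)[OF assms(4)] assms(1-3)] assms
  by (simp add: \<Theta>_def mult_R_act)

text \<open>After testing with a functional \<open>F\<close> on the dual, \<open>dual_expand\<close>
  writes the value as a finite sum of terms \<phi>(x r) with constant coefficients.\<close>

lemma linear_dual_translate [lin]: "linear_between V K f \<Longrightarrow> klin \<phi> \<Longrightarrow>
   linear_between V Kd (\<lambda>x. restrict (\<lambda>y. \<phi> (f x \<otimes> y)) (carrier K))"
proof (erule linear_between_comp[rotated], rule linear_between_functionals[OF complex_space_K Kd_space])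
  fix x assume \<phi>: "klin \<phi>" and x: "x \<in> carrier K"
  show "restrict (\<lambda>y. \<phi> (x \<otimes> y)) (carrier K) \<in> carrier Kd"
    using x by (intro restrict_in_Kd lin klin_comp[OF \<phi>])
next
  fix F assume \<phi>: "klin \<phi>" and F: "linear_between Kd CC F"
  obtain B where B: "onb (carrier K) B" using onb_exists[OF ksubspace_carrier] by blast
  have l: "klin (\<lambda>x. \<Sum>r\<in>B. \<phi> (x \<otimes> r) * F (restrict (ip r) (carrier K)))"
    using onbD(4)[OF B] by (intro lin klin_comp[OF \<phi>]; simp)
  have "F (restrict (\<lambda>y. \<phi> (x \<otimes> y)) (carrier K)) = (\<Sum>r\<in>B. \<phi> (x \<otimes> r) * F (restrict (ip r) (carrier K)))"
    if "x \<in> carrier K" for x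
  proof -
    have "restrict (\<lambda>y. \<phi> (x \<otimes> y)) (carrier K) \<in> carrier Kd"
      using that by (intro restrict_in_Kd lin klin_comp[OF \<phi>])
    from dual_expand[OF B F this] show ?thesis using onbD(4)[OF B] by simp
  qed
  then show "klin (\<lambda>x. F (restrict (\<lambda>y. \<phi> (x \<otimes> y)) (carrier K)))"
    using l by (subst linear_between_cong[OF complex_space_K]) auto
qed

text \<open>The balancing of the outer crossed product for \<psi> = \<epsilon>(z _): here psi.1 =
  S(z), while the product of \<psi> and \<phi> is \<phi>(z _).\<close>

lemma Theta_R_right:
  assumes b: "b \<in> carrier A" and z: "z \<in> R" and h: "h \<in> carrier K" and \<phi>: "\<phi> \<in> carrier Kd"
  shows "\<Theta> b (h \<otimes> S z) \<phi> = \<Theta> b h (restrict (\<lambda>y. \<phi> (z \<otimes> y)) (carrier K))"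
proof -
  let ?\<psi> = "restrict (\<lambda>x. \<epsilon> (z \<otimes> x)) (carrier K)"
  note \<psi> = counit_in_Cartan_Kd[OF z]
  note \<Phi> = outer_functional(2)[OF \<phi>]
  have s: "cl b h \<in> carrier XX" by (rule I.cl_closed[OF b h])
  have hit: "hit ?\<psi> \<one> = S z"
  proof (rule functional_eqI)
    fix f assume f: "klin f"
    have "f (hit ?\<psi> \<one>) = sw \<one> (\<lambda>a b. \<epsilon> (z \<otimes> b) * f a)"
      by (simp add: hit_eval[OF f] cong: sw_cong_simp)
    also have "\<dots> = f (S z)" using eps_s_eval[OF f, of z] z by (simp add: eps_s_R)
    finally show "f (hit ?\<psi> \<one>) = f (S z)" .
  qed (use z in simp_all)
  have m: "?\<psi> \<otimes>\<^bsub>Kd\<^esub> \<phi> = restrict (\<lambda>y. \<phi> (z \<otimes> y)) (carrier K)"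
  proof (rule Kd_eqI)
    show "?\<psi> \<otimes>\<^bsub>Kd\<^esub> \<phi> \<in> carrier Kd" by (rule Kd_closed(1)[OF Cartan_Kd(1)[OF \<psi>] \<phi>])
    show "restrict (\<lambda>y. \<phi> (z \<otimes> y)) (carrier K) \<in> carrier Kd"
      using z by (intro restrict_in_Kd lin klin_comp[OF Kd_klin[OF \<phi>]]; simp)
    fix x assume x: "x \<in> carrier K"
    have bb: "kbil (\<lambda>a b. \<epsilon> a * \<phi> b)" by (intro lin klin_comp[OF Kd_klin[OF \<phi>]])
    have "(?\<psi> \<otimes>\<^bsub>Kd\<^esub> \<phi>) x = sw x (\<lambda>a b. \<epsilon> (z \<otimes> a) * \<phi> b)"
      using x by (simp add: Kd_eval(1) cong: sw_cong_simp)
    also have "\<dots> = \<phi> (z \<otimes> x)"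
      using sw_R_left[OF z x bb] sw_counit_left[OF Kd_klin[OF \<phi>], of "z \<otimes> x"] z x by simp
    finally show "(?\<psi> \<otimes>\<^bsub>Kd\<^esub> \<phi>) x = restrict (\<lambda>y. \<phi> (z \<otimes> y)) (carrier K) x" using x by simp
  qed
  have zS: "S z \<in> carrier K" using z by simp
  have v: "vanishes_on (crossed_null K A act) (\<lambda>b h. \<Omega> (ocl (cl b (h \<otimes> S z)) \<phi>))"
    unfolding I.vanishes_crossed
  proof (intro conjI ballI)
    show "bilinear_on A K (\<lambda>b h. \<Omega> (ocl (cl b (h \<otimes> S z)) \<phi>))"
      using zS by (intro lin bilinear_on_comp[OF Phi_props(1)[OF \<Phi>]]; simp)
    fix b' z' h' assume "b' \<in> carrier A" "z' \<in> R" "h' \<in> carrier K"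
    then show "\<Omega> (ocl (cl (b' \<otimes>\<^bsub>A\<^esub> (z' \<triangleright> \<one>\<^bsub>A\<^esub>)) (h' \<otimes> S z)) \<phi>) = \<Omega> (ocl (cl b' ((z' \<otimes> h') \<otimes> S z)) \<phi>)"
      using zS by (simp add: Phi_props(2)[OF \<Phi>] A_assoc)
  qed
  have "\<Theta> b h (restrict (\<lambda>y. \<phi> (z \<otimes> y)) (carrier K)) = \<Omega> (ocl (cl b h \<otimes>\<^bsub>AK\<^esub> hat ?\<psi> \<one>\<^bsub>AK\<^esub>) \<phi>)"
    unfolding \<Theta>_def m[symmetric] by (rule outer_functional(3)[OF s \<psi> \<phi>, symmetric])
  also have "\<dots> = tensor_eval (cl b h) (\<lambda>b h. \<Omega> (ocl (cl b (h \<otimes> hit ?\<psi> \<one>)) \<phi>))"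
    by (rule AK_mult_hat_one[OF \<Phi> s Kd_klin[OF Cartan_Kd(1)[OF \<psi>]]])
  also have "\<dots> = \<Theta> b (h \<otimes> S z) \<phi>"
    unfolding hit \<Theta>_def by (rule I.cl_eval[OF v])
  finally show ?thesis by simp
qed

lemma Theta_sw_lin:
  "linear_between V A f \<Longrightarrow> k \<in> carrier K \<Longrightarrow> linear_between V CC (\<lambda>x. sw y (\<lambda>q1 q2.
     \<Theta> (f x) (k \<otimes> q1) (trd q2)))"
  "linear_between V K f' \<Longrightarrow> a \<in> carrier A \<Longrightarrow> linear_between V CC (\<lambda>x. sw y (\<lambda>q1 q2.
     \<Theta> a (f' x \<otimes> q1) (trd q2)))"
proof -
  show "linear_between V CC (\<lambda>x. sw y (\<lambda>q1 q2. \<Theta> (f x) (k \<otimes> q1) (trd q2)))"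
    if "linear_between V A f" "k \<in> carrier K"
    by (rule linear_sw1, rule Theta_lin(1)[OF that(1)]) (use that(2) tr_restrict_in_Kd in simp_all)
  show "linear_between V CC (\<lambda>x. sw y (\<lambda>q1 q2. \<Theta> a (f' x \<otimes> q1) (trd q2)))"
    if "linear_between V K f'" "a \<in> carrier A"
    by (rule linear_sw1, rule Theta_lin(2)[OF linear_mult_left[OF that(1)]]) (use that(2) tr_restrict_in_Kd in simp_all)
qed

text \<open>\<open>balanced_sum\<close> turns the sum over i into k_2 \<triangleright> (S(k_1)
  \<triangleright> b) \<otimes> k_3. Here k_2 S(k_1) collapses to S(eps_t(k_1)), whose action on b
  crosses the tensor sign as eps_t(k_1), and eps_t(k_1) k_2 = k.\<close>

lemma Theta_sum_left:
  assumes b: "b \<in> carrier A" and k: "k \<in> carrier K" and y: "y \<in> carrier K"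
  shows "(\<Sum>i<n. sw (u i) (\<lambda>p1 p2. sw y (\<lambda>q1 q2.
      \<Theta> (p1 \<triangleright> (Q i k \<triangleright> b)) (p2 \<otimes> q1) (trd q2)))) =
    sw y (\<lambda>q1 q2. \<Theta> b (k \<otimes> q1) (trd q2))"
proof -
  let ?P = "\<lambda>a p. sw y (\<lambda>q1 q2. \<Theta> a (p \<otimes> q1) (trd q2))"
  note Pl = Theta_sw_lin[where y = y]
  have "(\<Sum>i<n. sw (u i) (\<lambda>p1 p2. ?P (p1 \<triangleright> (Q i k \<triangleright> b)) p2)) = sw k (\<lambda>c v. sw v (\<lambda>p1 p2. ?P (p1 \<triangleright> (S c \<triangleright> b)) p2))"
  proof (rule balanced_sum[OF _ _ k])
    show "kbil (\<lambda>v w. sw v (\<lambda>p1 p2. ?P (p1 \<triangleright> (w \<triangleright> b)) p2))"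
      using b by (intro lin Theta_lin; simp add: tr_restrict_in_Kd)
    fix v z w assume v: "v \<in> carrier K" and z: "z \<in> R" and w: "w \<in> carrier K"
    have bl: "kbil (\<lambda>p1 p2. ?P (p1 \<triangleright> (w \<triangleright> b)) p2)" using b w by (intro lin Theta_lin; simp add: tr_restrict_in_Kd)
    show "sw (v \<otimes> z) (\<lambda>p1 p2. ?P (p1 \<triangleright> (w \<triangleright> b)) p2) = sw v (\<lambda>p1 p2. ?P (p1 \<triangleright> ((z \<otimes> w) \<triangleright> b)) p2)"
      unfolding sw_R_right[OF z v bl] using b z w by (intro sw_cong) (simp add: act_act)
  qed
  also have "\<dots> = sw k (\<lambda>v p2. sw v (\<lambda>c p1. ?P (p1 \<triangleright> (S c \<triangleright> b)) p2))"
    by (rule sw_coassoc[OF k, symmetric]) (use b in \<open>intro lin Theta_lin; simp add: tr_restrict_in_Kd\<close>)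
  also have "\<dots> = sw k (\<lambda>v p2. ?P b (eps_t K v \<otimes> p2))"
  proof (rule sw_cong)
    fix v p2 assume vp: "v \<in> carrier K" "p2 \<in> carrier K"
    have l: "klin (\<lambda>x. ?P (x \<triangleright> b) p2)" using vp b by (intro lin Theta_lin; simp add: tr_restrict_in_Kd)
    have "sw v (\<lambda>c p1. ?P (p1 \<triangleright> (S c \<triangleright> b)) p2) = sw v (\<lambda>c p1. ?P ((p1 \<otimes> S c) \<triangleright> b) p2)"
      using b by (intro sw_cong) (simp add: act_act)
    also have "\<dots> = ?P (S (eps_t K v) \<triangleright> b) p2"
      by (rule antipode_eps_t_eval[OF l vp(1), symmetric])
    also have "\<dots> = ?P b (eps_t K v \<otimes> p2)"
      using vp b by (intro sw_cong) (simp add: Theta_R_left tr_restrict_in_Kd A_assoc)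
    finally show "sw v (\<lambda>c p1. ?P (p1 \<triangleright> (S c \<triangleright> b)) p2) = ?P b (eps_t K v \<otimes> p2)" .
  qed
  also have "\<dots> = ?P b k"
  proof (rule sw_eps_t_mult[OF _ k])
    show "klin (?P b)" using b by (intro Pl lin)
  qed
  finally show ?thesis .
qed

text \<open>Expanding the functional \<tau>(q_2 _) over the dual basis turns the legs of u_j^* into
  Q_j(r). \<open>balanced_sum\<close> then gives (phi.r_2) S(r_1), and coassociativity reduces this
  to S(eps_t(r_1)) \<phi>(r_2), that is 1_1 \<phi>(1_2 r). Summing over r again leaves 1_1 with the
  functional \<phi>(1_2 _); since 1_2 may be taken in \<open>R\<close>, \<open>Theta_R_right\<close>
  moves it back, and 1_1 S(1_2) = 1.\<close>

lemma Theta_sum_right: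
  assumes b: "b \<in> carrier A" and h: "h \<in> carrier K" and \<phi>: "\<phi> \<in> carrier Kd"
  shows "(\<Sum>j<n. sw (star K (u j)) (\<lambda>q1 q2.
      \<Theta> b ((h \<otimes> hit \<phi> (u j)) \<otimes> q1) (trd q2))) = \<Theta> b h \<phi>"
proof -
  let ?s = "\<lambda>q. restrict (\<lambda>x. \<phi> (q \<otimes> x)) (carrier K)"
  let ?F = "\<lambda>y \<omega>. \<Theta> b (h \<otimes> y) \<omega>"
  obtain B where B: "onb (carrier K) B" using onb_exists[OF ksubspace_carrier] by blast
  let ?i = "\<lambda>r. restrict (ip r) (carrier K)"
  note Bc = onbD(4)[OF B]
  have iK: "?i r \<in> carrier Kd" if "r \<in> B" for r
    by (rule restrict_in_Kd) (rule klin_ip[OF Bc[OF that]])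
  note pl = klin_comp[OF Kd_klin[OF \<phi>]]
  have sK: "?s q \<in> carrier Kd" if "q \<in> carrier K" for q
    using that by (intro restrict_in_Kd lin pl)
  have Fl: "linear_between Kd CC (?F y)" if "y \<in> carrier K" for y
    using that b h by (intro Theta_linear) simp_all
  have "(\<Sum>j<n. sw (star K (u j)) (\<lambda>q1 q2. \<Theta> b ((h \<otimes> hit \<phi> (u j)) \<otimes> q1) (trd q2))) =
      (\<Sum>j<n. \<Sum>r\<in>B. ?F (hit \<phi> (u j) \<otimes> Q j r) (?i r))"
  proof (rule sum.cong[OF refl])
    fix j assume "j \<in> {..<n}"
    then have j: "j < n" by simp
    have "sw (star K (u j)) (\<lambda>q1 q2. \<Theta> b ((h \<otimes> hit \<phi> (u j)) \<otimes> q1) (trd q2)) =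
        sw (star K (u j)) (\<lambda>q1 q2. \<Sum>r\<in>B. ?F (hit \<phi> (u j) \<otimes> q1) (?i r) * \<tau> (q2 \<otimes> r))"
    proof (rule sw_cong)
      fix q1 q2 assume q: "q1 \<in> carrier K" "q2 \<in> carrier K"
      have m: "hit \<phi> (u j) \<otimes> q1 \<in> carrier K" using j q by simp
      have "\<Theta> b ((h \<otimes> hit \<phi> (u j)) \<otimes> q1) (trd q2) = ?F (hit \<phi> (u j) \<otimes> q1) (trd q2)"
        using h j q by (simp add: A_assoc)
      also have "\<dots> = (\<Sum>r\<in>B. trd q2 r * ?F (hit \<phi> (u j) \<otimes> q1) (?i r))"
        by (rule dual_expand[OF B Fl[OF m] tr_restrict_in_Kd[OF q(2)]])
      also have "\<dots> = (\<Sum>r\<in>B. ?F (hit \<phi> (u j) \<otimes> q1) (?i r) * \<tau> (q2 \<otimes> r))"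
        by (rule sum.cong[OF refl]) (simp add: Bc mult.commute)
      finally show "\<Theta> b ((h \<otimes> hit \<phi> (u j)) \<otimes> q1) (trd q2) = (\<Sum>r\<in>B. ?F (hit \<phi> (u j) \<otimes> q1) (?i r) * \<tau> (q2 \<otimes> r))" .
    qed
    also have "\<dots> = (\<Sum>r\<in>B. sw (star K (u j)) (\<lambda>q1 q2. ?F (hit \<phi> (u j) \<otimes> q1) (?i r) * \<tau> (q2 \<otimes> r)))"
      by (rule sw_sum[symmetric])
    also have "\<dots> = (\<Sum>r\<in>B. ?F (hit \<phi> (u j) \<otimes> Q j r) (?i r))"
    proof (rule sum.cong[OF refl])
      fix r assume r: "r \<in> B"
      have l: "klin (\<lambda>x. ?F (hit \<phi> (u j) \<otimes> x) (?i r))"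
        using b h j iK[OF r] by (intro Theta_lin lin; simp)
      show "sw (star K (u j)) (\<lambda>q1 q2. ?F (hit \<phi> (u j) \<otimes> q1) (?i r) * \<tau> (q2 \<otimes> r)) = ?F (hit \<phi> (u j) \<otimes> Q j r) (?i r)"
        by (rule Q_eval[OF l j Bc[OF r], symmetric])
    qed
    finally show "sw (star K (u j)) (\<lambda>q1 q2. \<Theta> b ((h \<otimes> hit \<phi> (u j)) \<otimes> q1) (trd q2)) =
        (\<Sum>r\<in>B. ?F (hit \<phi> (u j) \<otimes> Q j r) (?i r))" .
  qed
  also have "\<dots> = (\<Sum>r\<in>B. \<Sum>j<n. ?F (hit \<phi> (u j) \<otimes> Q j r) (?i r))"
    by (rule sum.swap)
  also have "\<dots> = (\<Sum>r\<in>B. sw \<one> (\<lambda>c d. \<phi> (d \<otimes> r) * ?F c (?i r)))"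
  proof (rule sum.cong[OF refl])
    fix r assume rB: "r \<in> B"
    have r: "r \<in> carrier K" by (rule Bc[OF rB])
    note tl = Theta_lin(2)[OF _ b iK[OF rB]]
    have "(\<Sum>j<n. ?F (hit \<phi> (u j) \<otimes> Q j r) (?i r)) = sw r (\<lambda>c v. ?F (hit \<phi> v \<otimes> S c) (?i r))"
    proof (rule balanced_sum[OF _ _ r])
      show "kbil (\<lambda>v w. ?F (hit \<phi> v \<otimes> w) (?i r))"
        using h by (intro bilinear_onI tl lin linear_hit[OF Kd_klin[OF \<phi>]]; simp)
      fix v z w assume "v \<in> carrier K" "z \<in> R" "w \<in> carrier K"
      then show "?F (hit \<phi> (v \<otimes> z) \<otimes> w) (?i r) = ?F (hit \<phi> v \<otimes> (z \<otimes> w)) (?i r)"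
        by (simp add: hit_R[OF Kd_klin[OF \<phi>]] A_assoc)
    qed
    also have "\<dots> = sw r (\<lambda>c v. sw v (\<lambda>d e. \<phi> e * ?F (d \<otimes> S c) (?i r)))"
    proof (rule sw_cong)
      fix c v assume cv: "c \<in> carrier K" "v \<in> carrier K"
      have l: "klin (\<lambda>x. ?F (x \<otimes> S c) (?i r))" using h cv by (intro tl lin; simp)
      show "?F (hit \<phi> v \<otimes> S c) (?i r) = sw v (\<lambda>d e. \<phi> e * ?F (d \<otimes> S c) (?i r))"
        by (rule hit_eval[OF l cv(2)])
    qed
    also have "\<dots> = sw r (\<lambda>v e. sw v (\<lambda>c d. \<phi> e * ?F (d \<otimes> S c) (?i r)))"
      by (rule sw_coassoc[OF r, symmetric]) (use h in \<open>intro trilinear_onI linear_cmult linear_multc tl lin pl; simp\<close>)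
    also have "\<dots> = sw r (\<lambda>v e. \<phi> e * ?F (S (eps_t K v)) (?i r))"
    proof (rule sw_cong)
      fix v e assume ve: "v \<in> carrier K" "e \<in> carrier K"
      have l: "klin (\<lambda>x. ?F x (?i r))" using h by (intro tl lin; simp)
      show "sw v (\<lambda>c d. \<phi> e * ?F (d \<otimes> S c) (?i r)) = \<phi> e * ?F (S (eps_t K v)) (?i r)"
        by (simp only: sw_cmult antipode_eps_t_eval[OF l ve(1)])
    qed
    also have "\<dots> = sw \<one> (\<lambda>c d. \<phi> (d \<otimes> r) * ?F c (?i r))"
      by (rule sw_antipode_eps_t[OF _ r]) (use h in \<open>intro bilinear_onI linear_cmult linear_multc tl lin pl; simp\<close>)
    finally show "(\<Sum>j<n. ?F (hit \<phi> (u j) \<otimes> Q j r) (?i r)) = sw \<one> (\<lambda>c d. \<phi> (d \<otimes> r) * ?F c (?i r))" .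
  qed
  also have "\<dots> = sw \<one> (\<lambda>c d. \<Sum>r\<in>B. \<phi> (d \<otimes> r) * ?F c (?i r))"
    by (rule sw_sum)
  also have "\<dots> = sw \<one> (\<lambda>c d. ?F c (?s d))"
  proof (rule sw_cong)
    fix c d assume cd: "c \<in> carrier K" "d \<in> carrier K"
    have "?F c (?s d) = (\<Sum>r\<in>B. ?s d r * ?F c (?i r))"
      by (rule dual_expand[OF B Fl[OF cd(1)] sK[OF cd(2)]])
    also have "\<dots> = (\<Sum>r\<in>B. \<phi> (d \<otimes> r) * ?F c (?i r))"
      by (rule sum.cong[OF refl]) (simp add: Bc)
    finally show "(\<Sum>r\<in>B. \<phi> (d \<otimes> r) * ?F c (?i r)) = ?F c (?s d)" by simp
  qed
  also have "\<dots> = sw \<one> (\<lambda>c d. ?F c (?s (eps_t K d)))"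
    by (rule sw_one_eps_t[symmetric])
      (use b h sK in \<open>intro bilinear_onI Theta_lin linear_dual_translate[OF _ Kd_klin[OF \<phi>]] lin; simp\<close>)
  also have "\<dots> = sw \<one> (\<lambda>c d. ?F (c \<otimes> S (eps_t K d)) \<phi>)"
  proof (rule sw_cong)
    fix c d assume "c \<in> carrier K" "d \<in> carrier K"
    then show "?F c (?s (eps_t K d)) = ?F (c \<otimes> S (eps_t K d)) \<phi>"
      using Theta_R_right[OF b _ _ \<phi>, of "eps_t K d" "h \<otimes> c"] h by (simp add: A_assoc)
  qed
  also have "\<dots> = sw \<one> (\<lambda>c d. ?F (c \<otimes> S d) \<phi>)"
    by (rule sw_one_eps_t) (use b h \<phi> in \<open>intro bilinear_onI Theta_lin lin; simp\<close>)
  also have "\<dots> = ?F (eps_t K \<one>) \<phi>"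
    by (rule eps_t_antipode_eval[OF _ A_closed(1), symmetric]) (use b h \<phi> in \<open>intro Theta_lin lin; simp\<close>)
  also have "\<dots> = \<Theta> b h \<phi>" using h by simp
  finally show ?thesis .
qed

text \<open>Every functional recovers its value at \<open>z\<close> from the entries of
  \<open>z\<close>, so the entries determine \<open>z\<close>. On generators the sum over i is
  \<open>Theta_sum_left\<close> with k = h (phi.u_j), and the sum over j is
  \<open>Theta_sum_right\<close>.\<close>

lemma functional_entry:
  assumes z: "z \<in> carrier XO"
  shows "\<Omega> z = (\<Sum>j<n. \<Sum>i<n. \<Omega> (from_entry i j (entry i j z)))"
proof -
  let ?g = "\<lambda>i j a. sw (u i) (\<lambda>p1 p2. sw (star K (u j)) (\<lambda>q1 q2. \<Theta> (p1 \<triangleright> a) (p2 \<otimes> q1) (trd q2)))"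
  have g: "alin (?g i j)" for i j
    by (intro linear_sw1 Theta_lin lin; simp add: tr_restrict_in_Kd)
  have "(\<Sum>j<n. \<Sum>i<n. \<Omega> (from_entry i j (entry i j z))) =
      (\<Sum>j<n. \<Sum>i<n. tensor_eval z (\<lambda>s \<phi>. coefficient (?g i j) i (hit \<phi> (u j)) s))"
  proof (intro sum.cong refl)
    fix i j assume "i \<in> {..<n}" "j \<in> {..<n}"
    then have ij: "i < n" "j < n" by auto
    have "\<Omega> (from_entry i j (entry i j z)) = ?g i j (entry i j z)"
      unfolding from_entry_eval[OF ij entry_closed[OF ij z] \<Omega>] \<Theta>_def by (rule refl)
    then show "\<Omega> (from_entry i j (entry i j z)) = tensor_eval z (\<lambda>s \<phi>. coefficient (?g i j) i (hit \<phi> (u j)) s)"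
      using entry_eval[OF ij z g] by (rule trans)
  qed
  also have "\<dots> = tensor_eval z (\<lambda>s \<phi>. \<Sum>j<n. \<Sum>i<n. coefficient (?g i j) i (hit \<phi> (u j)) s)"
    by (simp only: tensor_eval_sum)
  also have "\<dots> = tensor_eval z (\<lambda>s \<phi>. \<Omega> (ocl s \<phi>))"
  proof (rule O.X_eval_cong[OF z])
    fix s \<phi> assume "(s, \<phi>) \<in> carrier AK \<times> carrier Kd"
    then have s: "s \<in> carrier XX" and \<phi>: "\<phi> \<in> carrier Kd" by (auto simp: I.AxK_sel)
    have "(\<Sum>j<n. \<Sum>i<n. coefficient (?g i j) i (hit \<phi> (u j)) s) =
        tensor_eval s (\<lambda>b h. \<Sum>j<n. \<Sum>i<n. ?g i j (Q i (h \<otimes> hit \<phi> (u j)) \<triangleright> b))"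
      unfolding coefficient_def by (simp only: tensor_eval_sum)
    also have "\<dots> = tensor_eval s (\<lambda>b h. \<Theta> b h \<phi>)"
    proof (rule I.X_eval_cong[OF s])
      fix b h assume "(b, h) \<in> carrier A \<times> carrier K"
      then have b: "b \<in> carrier A" and h: "h \<in> carrier K" by auto
      have "(\<Sum>j<n. \<Sum>i<n. ?g i j (Q i (h \<otimes> hit \<phi> (u j)) \<triangleright> b)) =
          (\<Sum>j<n. sw (star K (u j)) (\<lambda>q1 q2. \<Theta> b ((h \<otimes> hit \<phi> (u j)) \<otimes> q1) (trd q2)))"
        by (rule sum.cong[OF refl], rule Theta_sum_left[OF b]) (use h in simp_all)
      also have "\<dots> = \<Theta> b h \<phi>" by (rule Theta_sum_right[OF b h \<phi>])
      finally show "(\<Sum>j<n. \<Sum>i<n. ?g i j (Q i (h \<otimes> hit \<phi> (u j)) \<triangleright> b)) = \<Theta> b h \<phi>" .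
    qed
    also have "\<dots> = \<Omega> (ocl s \<phi>)"
      unfolding \<Theta>_def by (rule I.X_functional(2)[OF outer_functional(2)[OF \<phi>] s])
    finally show "(\<Sum>j<n. \<Sum>i<n. coefficient (?g i j) i (hit \<phi> (u j)) s) = \<Omega> (ocl s \<phi>)" .
  qed
  also have "\<dots> = \<Omega> z" by (rule O.X_functional(2)[OF \<Omega> z])
  finally show ?thesis by simp
qed

end

lemma entry_inject:
  assumes "z \<in> carrier XO" "y \<in> carrier XO" "\<And>i j. i < n \<Longrightarrow> j < n \<Longrightarrow> entry i j z = entry i j y"
  shows "z = y"
proof (rule linear_functional_separation[OF O.X_space assms(1,2)])
  fix \<Omega> assume \<Omega>: "linear_between XO CC \<Omega>"
  show "\<Omega> z = \<Omega> y"
    unfolding functional_entry[OF \<Omega> assms(1)] functional_entry[OF \<Omega> assms(2)] using assms(3) by simp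
qed

end

section \<open>The isomorphism\<close>

lemma matrix_algebra_sel:
  "carrier (matrix_algebra n) = carrier_mat n n" "x \<otimes>\<^bsub>matrix_algebra n\<^esub> y = x * y"
  "\<one>\<^bsub>matrix_algebra n\<^esub> = 1\<^sub>m n" "\<zero>\<^bsub>matrix_algebra n\<^esub> = 0\<^sub>m n n" "x \<oplus>\<^bsub>matrix_algebra n\<^esub> y = x + y"
  "c \<odot>\<^bsub>matrix_algebra n\<^esub> x = c \<cdot>\<^sub>m x" "star (matrix_algebra n) x = mat_adjoint x"
  by (simp_all add: matrix_algebra_def)

lemma complex_space_matrix: "complex_space (matrix_algebra n)"
proof (rule complex_spaceI)
  show "abelian_group (matrix_algebra n)"
  proof (rule abelian_groupI)
    fix x assume x: "x \<in> carrier (matrix_algebra n)"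
    show "\<exists>y\<in>carrier (matrix_algebra n). y \<oplus>\<^bsub>matrix_algebra n\<^esub> x = \<zero>\<^bsub>matrix_algebra n\<^esub>"
      by (rule bexI[of _ "- x"]) (use x in \<open>auto simp: matrix_algebra_sel\<close>)
  qed (auto simp: matrix_algebra_sel comm_add_mat assoc_add_mat)
qed (auto simp: matrix_algebra_sel add_smult_distrib_left_mat add_smult_distrib_right_mat)

definition matrix_unit :: "nat \<Rightarrow> nat \<Rightarrow> nat \<Rightarrow> complex mat" where
  "matrix_unit n i j = mat n n (\<lambda>(r, s). if r = i \<and> s = j then 1 else 0)"

lemma matrix_unit_closed [simp]: "matrix_unit n i j \<in> carrier_mat n n"
  by (simp add: matrix_unit_def)

lemma matrix_unit_index: "r < n \<Longrightarrow> s < n \<Longrightarrow> matrix_unit n i j $$ (r, s) = (if r = i \<and> s = j then 1 else 0)"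
  by (simp add: matrix_unit_def)

lemma matrix_unit_mult:
  assumes "j < n" "k < n"
  shows "matrix_unit n i j * matrix_unit n k l = (if j = k then matrix_unit n i l else 0\<^sub>m n n)"
proof (rule eq_matI)
  fix r s assume "r < dim_row (if j = k then matrix_unit n i l else 0\<^sub>m n n)"
    "s < dim_col (if j = k then matrix_unit n i l else 0\<^sub>m n n)"
  then have rs: "r < n" "s < n" by (auto simp: matrix_unit_def split: if_splits)
  have "(matrix_unit n i j * matrix_unit n k l) $$ (r, s) =
      (\<Sum>t = 0..<n. matrix_unit n i j $$ (r, t) * matrix_unit n k l $$ (t, s))"
    using rs by (simp add: times_mat_def scalar_prod_def matrix_unit_def)
  also have "\<dots> = (\<Sum>t = 0..<n. if t = j then (if r = i \<and> j = k \<and> s = l then 1 else 0) else 0)"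
    using rs by (intro sum.cong refl) (auto simp: matrix_unit_index)
  also have "\<dots> = (if j = k then matrix_unit n i l else 0\<^sub>m n n) $$ (r, s)"
    using rs assms by (auto simp: matrix_unit_index)
  finally show "(matrix_unit n i j * matrix_unit n k l) $$ (r, s) = (if j = k then matrix_unit n i l else 0\<^sub>m n n) $$ (r, s)" .
qed (auto simp: matrix_unit_def)

lemma mat_adjoint_closed: "x \<in> carrier_mat n n \<Longrightarrow> mat_adjoint x \<in> carrier_mat n n"
  by (simp add: mat_adjoint_def mat_of_rows_def)

lemma mat_adjoint_index:
  fixes x :: "complex mat"
  shows "x \<in> carrier_mat n n \<Longrightarrow> i < n \<Longrightarrow> j < n \<Longrightarrow> mat_adjoint x $$ (i, j) = cnj (x $$ (j, i))"
  by (simp add: mat_adjoint_def mat_of_rows_def)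

lemma matrix_unit_adjoint: "mat_adjoint (matrix_unit n i j) = matrix_unit n j i"
  using mat_adjoint_closed[OF matrix_unit_closed, of n i j]
  by (intro eq_matI) (auto simp: mat_adjoint_index[OF matrix_unit_closed] matrix_unit_index matrix_unit_def[of n j i])

text \<open>The matrix is the sum of its entries times matrix units, as is seen by applying the
  linear functionals that read off one entry.\<close>

lemma matrix_expand:
  assumes f: "linear_between (matrix_algebra n) CC f" and m: "m \<in> carrier_mat n n"
  shows "f m = (\<Sum>i<n. \<Sum>j<n. m $$ (i, j) * f (matrix_unit n i j))"
proof -
  let ?M = "matrix_algebra n" and ?I = "{..<n} \<times> {..<n}"
  let ?g = "\<lambda>(i, j). m $$ (i, j) \<odot>\<^bsub>?M\<^esub> matrix_unit n i j"
  have g: "?g q \<in> carrier ?M" for q by (cases q) (simp add: matrix_algebra_sel)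
  have c: "finsum ?M ?g ?I \<in> carrier ?M"
    by (rule abelian_monoid.finsum_closed[OF abelian_group.axioms(1)[OF complex_spaceD(1)[OF complex_space_matrix]]])
      (use g in auto)
  have "m = finsum ?M ?g ?I"
  proof (rule eq_matI)
    fix r s assume rs: "r < dim_row (finsum ?M ?g ?I)" "s < dim_col (finsum ?M ?g ?I)"
    then have rs: "r < n" "s < n" using c by (auto simp: matrix_algebra_sel)
    have l: "linear_between ?M CC (\<lambda>x. x $$ (r, s))"
      by (rule linear_betweenI) (use rs in \<open>auto simp: matrix_algebra_sel\<close>)
    have "finsum ?M ?g ?I $$ (r, s) = (\<Sum>q\<in>?I. ?g q $$ (r, s))"
      by (rule linear_functional_finsum[OF l complex_space_matrix _ g]) simp
    also have "\<dots> = (\<Sum>q\<in>?I. if q = (r, s) then m $$ (r, s) else 0)"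
      using rs by (intro sum.cong refl) (auto simp: matrix_algebra_sel matrix_unit_def split: if_splits)
    also have "\<dots> = m $$ (r, s)" using rs by (simp add: sum.delta)
    finally show "m $$ (r, s) = finsum ?M ?g ?I $$ (r, s)" by simp
  qed (use c m in \<open>auto simp: matrix_algebra_sel\<close>)
  then have "f m = f (finsum ?M ?g ?I)" by simp
  also have "\<dots> = (\<Sum>q\<in>?I. f (?g q))"
    by (rule linear_functional_finsum[OF f complex_space_matrix _ g]) simp
  also have "\<dots> = (\<Sum>(i, j)\<in>?I. m $$ (i, j) * f (matrix_unit n i j))"
    by (intro sum.cong refl) (auto simp: linear_betweenD(3)[OF f] matrix_algebra_sel(1))
  finally show ?thesis by (simp add: sum.cartesian_product)
qed

context markov_action begin

abbreviation Mat where "Mat \<equiv> matrix_algebra n"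
abbreviation TT where "TT \<equiv> tensor_space A Mat"
abbreviation TA where "TA \<equiv> tensor_algebra A Mat"

sublocale AM: star_tensor_product A Mat
  by (intro star_tensor_product.intro tensor_product.intro star_tensor_product_axioms.intro
      complex_space_A complex_space_matrix) (auto simp: matrix_algebra_sel mat_adjoint_closed)

definition entries :: "(('a, 'k) tensor, 'k \<Rightarrow> complex) tensor \<Rightarrow> ('a, complex mat) tensor" where
  "entries z = finsum TT (\<lambda>(i, j). pure_tensor A Mat (entry i j z) (matrix_unit n i j)) ({..<n} \<times> {..<n})"

lemma entries_summand:
  "z \<in> carrier XO \<Longrightarrow> q \<in> {..<n} \<times> {..<n} \<Longrightarrow>
   (\<lambda>(i, j). pure_tensor A Mat (entry i j z) (matrix_unit n i j)) q \<in> carrier TT"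
  by (auto intro!: AM.pure_closed simp: entry_closed matrix_algebra_sel(1))

lemma entries_closed: "z \<in> carrier XO \<Longrightarrow> entries z \<in> carrier TT"
  unfolding entries_def
  by (rule abelian_monoid.finsum_closed[OF abelian_group.axioms(1)[OF complex_spaceD(1)[OF AM.space]]])
    (use entries_summand in blast)

lemma entries_eval:
  assumes z: "z \<in> carrier XO" and H: "bilinear_on A Mat H"
  shows "tensor_eval (entries z) H = (\<Sum>i<n. \<Sum>j<n. H (entry i j z) (matrix_unit n i j))"
proof -
  have "tensor_eval (entries z) H = (\<Sum>q\<in>{..<n} \<times> {..<n}. tensor_eval
      ((\<lambda>(i, j). pure_tensor A Mat (entry i j z) (matrix_unit n i j)) q) H)"
    unfolding entries_def by (rule linear_functional_finsum[OF AM.eval_linear[OF H] AM.space _ entries_summand[OF z]]) auto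
  also have "\<dots> = (\<Sum>(i, j)\<in>{..<n} \<times> {..<n}. H (entry i j z) (matrix_unit n i j))"
    by (intro sum.cong refl) (auto simp: AM.pure_eval[OF H])
  finally show ?thesis by (simp add: sum.cartesian_product)
qed

lemma bilinear_matrix:
  assumes "bilinear_on A Mat H" "x \<in> carrier_mat n n"
  shows "alin (\<lambda>a. H a x)"
  by (rule bilinear_onD(2)[OF assms(1)]) (simp add: matrix_algebra_sel assms(2))

lemma entries_linear: "linear_between AO TA entries"
proof -
  have "linear_between XO TT entries"
  proof (rule linear_between_functionals[OF O.X_space AM.space entries_closed])
    fix f assume f: "linear_between TT CC f"
    have "bilinear_on A Mat (\<lambda>a m. f (pure_tensor A Mat a m))"
      using AM.linear_functional_vanishes(1)[folded tensor_space_def, OF f]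
      by (simp add: AM.vanishes_on_tensor_null pure_tensor_def)
    note H = this
    have e: "f (entries z) = (\<Sum>i<n. \<Sum>j<n. f (pure_tensor A Mat (entry i j z) (matrix_unit n i j)))" if "z \<in> carrier XO" for z
      using AM.linear_functional_vanishes(2)[folded tensor_space_def, OF f entries_closed[OF that]] entries_eval[OF that H]
      by (simp add: pure_tensor_def)
    have "linear_between XO CC (\<lambda>z. \<Sum>i<n. \<Sum>j<n. f (pure_tensor A Mat (entry i j z) (matrix_unit n i j)))"
    proof (intro linear_sum)
      fix i j assume "i \<in> {..<n}" "j \<in> {..<n}"
      then show "linear_between XO CC (\<lambda>z. f (pure_tensor A Mat (entry i j z) (matrix_unit n i j)))"
        by (intro linear_between_comp[OF bilinear_matrix[OF H] entry_linear]) auto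
    qed
    then show "linear_between XO CC (\<lambda>z. f (entries z))"
      using e by (subst linear_between_cong[OF O.X_space]) auto
  qed
  then show ?thesis
    by (simp add: linear_between_def O.AxK_sel tensor_algebra_sel)
qed

lemma H_zero: "bilinear_on A Mat H \<Longrightarrow> a \<in> carrier A \<Longrightarrow> H a (0\<^sub>m n n) = 0"
  using linear_between_zero[OF bilinear_onD(1) complex_space_matrix complex_space_CC] by (simp add: matrix_algebra_sel)

lemma entries_one: "entries \<one>\<^bsub>AO\<^esub> = \<one>\<^bsub>TA\<^esub>"
proof (rule AM.eval_eqI)
  have o: "\<one>\<^bsub>AO\<^esub> \<in> carrier XO"
    by (simp add: O.AxK_sel O.cl_closed I.AxK_sel I.cl_closed Kd_closed)
  show "entries \<one>\<^bsub>AO\<^esub> \<in> carrier TT" by (rule entries_closed[OF o])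
  show "\<one>\<^bsub>TA\<^esub> \<in> carrier TT" by (auto intro!: AM.pure_closed simp: tensor_algebra_sel matrix_algebra_sel)
  fix H assume H: "bilinear_on A Mat H"
  have z: "H \<zero>\<^bsub>A\<^esub> x = 0" if "x \<in> carrier_mat n n" for x
    using linear_between_zero[OF bilinear_matrix[OF H that] complex_space_A complex_space_CC] by simp
  have l: "linear_between Mat CC (H \<one>\<^bsub>A\<^esub>)" by (rule bilinear_onD(1)[OF H]) simp
  have "tensor_eval (entries \<one>\<^bsub>AO\<^esub>) H = (\<Sum>i<n. \<Sum>j<n. H (if i = j then \<one>\<^bsub>A\<^esub> else \<zero>\<^bsub>A\<^esub>) (matrix_unit n i j))"
    unfolding entries_eval[OF o H] by (intro sum.cong refl) (simp add: entry_one)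
  also have "\<dots> = (\<Sum>i<n. \<Sum>j<n. 1\<^sub>m n $$ (i, j) * H \<one>\<^bsub>A\<^esub> (matrix_unit n i j))"
    by (intro sum.cong refl) (auto simp: z)
  also have "\<dots> = H \<one>\<^bsub>A\<^esub> (1\<^sub>m n)" by (rule matrix_expand[OF l, symmetric]) simp
  also have "\<dots> = tensor_eval \<one>\<^bsub>TA\<^esub> H"
    by (simp add: tensor_algebra_sel AM.pure_eval[OF H] matrix_algebra_sel)
  finally show "tensor_eval (entries \<one>\<^bsub>AO\<^esub>) H = tensor_eval \<one>\<^bsub>TA\<^esub> H" .
qed

lemma entries_mult:
  assumes z: "z \<in> carrier XO" and y: "y \<in> carrier XO"
  shows "entries (z \<otimes>\<^bsub>AO\<^esub> y) = entries z \<otimes>\<^bsub>TA\<^esub> entries y"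
proof (rule AM.eval_eqI)
  have zy: "z \<otimes>\<^bsub>AO\<^esub> y \<in> carrier XO" by (rule O.AxK_mult_closed[OF z y])
  show "entries (z \<otimes>\<^bsub>AO\<^esub> y) \<in> carrier TT" by (rule entries_closed[OF zy])
  show "entries z \<otimes>\<^bsub>TA\<^esub> entries y \<in> carrier TT" by (rule AM.mult_closed[OF entries_closed[OF z] entries_closed[OF y]])
  fix H assume H: "bilinear_on A Mat H"
  let ?e = "matrix_unit n"
  have Hl: "linear_between V A f \<Longrightarrow> x \<in> carrier_mat n n \<Longrightarrow> linear_between V CC (\<lambda>v. H (f v) x)" for V :: "'a star_alg" and f x
    by (rule linear_between_comp[OF bilinear_matrix[OF H]])
  have Hr: "linear_between Mat CC (H a)" if "a \<in> carrier A" for a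
    by (rule bilinear_onD(1)[OF H that])
  have mr: "linear_between Mat Mat (\<lambda>x. x * b)" "linear_between Mat Mat (\<lambda>x. b * x)" if "b \<in> carrier_mat n n" for b
    using that by (auto intro!: linear_betweenI simp: matrix_algebra_sel add_mult_distrib_mat mult_add_distrib_mat
        mult_smult_distrib mult_smult_assoc_mat)
  have H1: "bilinear_on A Mat (\<lambda>c d. H (a \<otimes>\<^bsub>A\<^esub> c) (b \<otimes>\<^bsub>Mat\<^esub> d))" if "a \<in> carrier A" "b \<in> carrier Mat" for a b
  proof (rule bilinear_onI)
    show "linear_between Mat CC (\<lambda>d. H (a \<otimes>\<^bsub>A\<^esub> c) (b \<otimes>\<^bsub>Mat\<^esub> d))" if "c \<in> carrier A" for c
      unfolding matrix_algebra_sel(2)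
      by (rule linear_between_comp[OF Hr mr(2)]) (use that \<open>a \<in> carrier A\<close> \<open>b \<in> carrier Mat\<close> in \<open>simp_all add: matrix_algebra_sel\<close>)
    show "alin (\<lambda>c. H (a \<otimes>\<^bsub>A\<^esub> c) (b \<otimes>\<^bsub>Mat\<^esub> d))" if "d \<in> carrier Mat" for d
      by (rule Hl) (use that \<open>a \<in> carrier A\<close> \<open>b \<in> carrier Mat\<close> in \<open>auto simp: matrix_algebra_sel intro!: lin\<close>)
  qed
  have H2: "bilinear_on A Mat (\<lambda>a b. tensor_eval (entries y) (\<lambda>c d. H (a \<otimes>\<^bsub>A\<^esub> c) (b \<otimes>\<^bsub>Mat\<^esub> d)))"
  proof (rule bilinear_onI)
    show "linear_between Mat CC (\<lambda>b. tensor_eval (entries y) (\<lambda>c d. H (a \<otimes>\<^bsub>A\<^esub> c) (b \<otimes>\<^bsub>Mat\<^esub> d)))" if "a \<in> carrier A" for a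
    proof (rule AM.linear_eval_on[OF entries_closed[OF y]])
      fix c d assume "(c, d) \<in> carrier A \<times> carrier Mat"
      then show "linear_between Mat CC (\<lambda>b. H (a \<otimes>\<^bsub>A\<^esub> c) (b \<otimes>\<^bsub>Mat\<^esub> d))"
        unfolding matrix_algebra_sel(2)
        by (intro linear_between_comp[OF Hr mr(1)]) (use that in \<open>auto simp: matrix_algebra_sel\<close>)
    qed
    show "alin (\<lambda>a. tensor_eval (entries y) (\<lambda>c d. H (a \<otimes>\<^bsub>A\<^esub> c) (b \<otimes>\<^bsub>Mat\<^esub> d)))" if "b \<in> carrier Mat" for b
    proof (rule AM.linear_eval_on[OF entries_closed[OF y]])
      fix c d assume "(c, d) \<in> carrier A \<times> carrier Mat"
      then show "alin (\<lambda>a. H (a \<otimes>\<^bsub>A\<^esub> c) (b \<otimes>\<^bsub>Mat\<^esub> d))"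
        using that by (intro Hl) (auto simp: matrix_algebra_sel intro!: lin)
    qed
  qed
  have c: "entry i l z \<otimes>\<^bsub>A\<^esub> entry l' j y \<in> carrier A" if "i < n" "l < n" "l' < n" "j < n" for i l l' j
    using that z y by (simp add: entry_closed)
  have "tensor_eval (entries (z \<otimes>\<^bsub>AO\<^esub> y)) H = (\<Sum>i<n. \<Sum>j<n. \<Sum>l<n. H (entry i l z \<otimes>\<^bsub>A\<^esub> entry l j y) (?e i j))"
    unfolding entries_eval[OF zy H]
  proof (intro sum.cong refl)
    fix i j assume "i \<in> {..<n}" "j \<in> {..<n}"
    then have ij: "i < n" "j < n" by auto
    show "H (entry i j (z \<otimes>\<^bsub>AO\<^esub> y)) (?e i j) = (\<Sum>l<n. H (entry i l z \<otimes>\<^bsub>A\<^esub> entry l j y) (?e i j))"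
      unfolding entry_mult[OF ij z y]
      by (rule A_finsum_eval[OF bilinear_matrix[OF H]]) (use ij c in auto)
  qed
  also have "\<dots> = (\<Sum>i<n. \<Sum>l<n. \<Sum>j<n. H (entry i l z \<otimes>\<^bsub>A\<^esub> entry l j y) (?e i j))"
    by (rule sum.cong[OF refl]) (rule sum.swap)
  \<comment> \<open>The new index k contributes only for k = l, because the product of the matrix
    units (i, l) and (k, j) is 0 otherwise. In this form the sum runs over independent entries of
    \<open>z\<close> and \<open>y\<close>.\<close>
  also have "\<dots> = (\<Sum>i<n. \<Sum>l<n. \<Sum>k<n. \<Sum>j<n. H (entry i l z \<otimes>\<^bsub>A\<^esub> entry k j y) (?e i l * ?e k j))"
  proof (rule sum.cong[OF refl], rule sum.cong[OF refl])
    fix i l assume "i \<in> {..<n}" "l \<in> {..<n}"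
    then have il: "i < n" "l < n" by auto
    have "(\<Sum>k<n. \<Sum>j<n. H (entry i l z \<otimes>\<^bsub>A\<^esub> entry k j y) (?e i l * ?e k j)) =
        (\<Sum>k<n. if k = l then (\<Sum>j<n. H (entry i l z \<otimes>\<^bsub>A\<^esub> entry l j y) (?e i j)) else 0)"
      by (intro sum.cong refl) (use il in \<open>auto simp: matrix_unit_mult H_zero[OF H] c\<close>)
    also have "\<dots> = (\<Sum>j<n. H (entry i l z \<otimes>\<^bsub>A\<^esub> entry l j y) (?e i j))" using il by simp
    finally show "(\<Sum>j<n. H (entry i l z \<otimes>\<^bsub>A\<^esub> entry l j y) (?e i j)) =
        (\<Sum>k<n. \<Sum>j<n. H (entry i l z \<otimes>\<^bsub>A\<^esub> entry k j y) (?e i l * ?e k j))" by simp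
  qed
  also have "\<dots> = (\<Sum>i<n. \<Sum>l<n. tensor_eval (entries y) (\<lambda>c d. H (entry i l z \<otimes>\<^bsub>A\<^esub> c) (?e i l \<otimes>\<^bsub>Mat\<^esub> d)))"
  proof (intro sum.cong refl)
    fix i l assume "i \<in> {..<n}" "l \<in> {..<n}"
    then have "entry i l z \<in> carrier A" "?e i l \<in> carrier Mat" using z by (auto simp: entry_closed matrix_algebra_sel)
    from entries_eval[OF y H1[OF this]]
    show "(\<Sum>k<n. \<Sum>j<n. H (entry i l z \<otimes>\<^bsub>A\<^esub> entry k j y) (?e i l * ?e k j)) =
        tensor_eval (entries y) (\<lambda>c d. H (entry i l z \<otimes>\<^bsub>A\<^esub> c) (?e i l \<otimes>\<^bsub>Mat\<^esub> d))"
      by (simp only: matrix_algebra_sel(2))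
  qed
  also have "\<dots> = tensor_eval (entries z) (\<lambda>a b. tensor_eval (entries y) (\<lambda>c d. H (a \<otimes>\<^bsub>A\<^esub> c) (b \<otimes>\<^bsub>Mat\<^esub> d)))"
    by (rule entries_eval[OF z H2, symmetric])
  also have "\<dots> = tensor_eval (entries z \<otimes>\<^bsub>TA\<^esub> entries y) H"
    by (rule AM.mult_eval[OF entries_closed[OF z] entries_closed[OF y] H, symmetric])
  finally show "tensor_eval (entries (z \<otimes>\<^bsub>AO\<^esub> y)) H = tensor_eval (entries z \<otimes>\<^bsub>TA\<^esub> entries y) H" .
qed

lemma entries_star:
  assumes z: "z \<in> carrier XO"
  shows "entries (star AO z) = star TA (entries z)"
proof (rule AM.eval_eqI)
  have zs: "star AO z \<in> carrier XO" by (rule O.AxK_star_closed[OF z])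
  show "entries (star AO z) \<in> carrier TT" by (rule entries_closed[OF zs])
  show "star TA (entries z) \<in> carrier TT"
    unfolding tensor_algebra_sel
    by (intro AM.conj_lift_closed' AM.space entries_closed z AM.pure_closed) auto
  fix H assume H: "bilinear_on A Mat H"
  have adj: "mat_adjoint (x + y) = mat_adjoint x + mat_adjoint y" "mat_adjoint (c \<cdot>\<^sub>m x) = cnj c \<cdot>\<^sub>m mat_adjoint x"
    if "x \<in> carrier_mat n n" "y \<in> carrier_mat n n" for x y :: "complex mat" and c
    using that mat_adjoint_closed[of "x + y" n] mat_adjoint_closed[of "c \<cdot>\<^sub>m x" n] mat_adjoint_closed[of x n] mat_adjoint_closed[of y n]
    by (auto intro!: eq_matI simp: mat_adjoint_index[of _ n])
  have H': "bilinear_on A Mat (\<lambda>a b. cnj (H (star A a) (star Mat b)))"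
  proof (rule bilinear_onI)
    fix a assume "a \<in> carrier A"
    then have l: "linear_between Mat CC (H (star A a))" by (intro bilinear_onD(1)[OF H]) simp
    show "linear_between Mat CC (\<lambda>b. cnj (H (star A a) (star Mat b)))"
    proof (rule linear_betweenI)
      fix x y assume xy: "x \<in> carrier Mat" "y \<in> carrier Mat"
      then have "H (star A a) (mat_adjoint x + mat_adjoint y) = H (star A a) (mat_adjoint x) + H (star A a) (mat_adjoint y)"
        using linear_betweenD(2)[OF l, of "mat_adjoint x" "mat_adjoint y"] by (simp add: matrix_algebra_sel mat_adjoint_closed)
      then show "cnj (H (star A a) (star Mat (x \<oplus>\<^bsub>Mat\<^esub> y))) = cnj (H (star A a) (star Mat x)) \<oplus>\<^bsub>CC\<^esub> cnj (H (star A a) (star Mat y))"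
        using xy by (simp add: matrix_algebra_sel adj)
    next
      fix c x assume x: "x \<in> carrier Mat"
      then have "H (star A a) (cnj c \<cdot>\<^sub>m mat_adjoint x) = cnj c * H (star A a) (mat_adjoint x)"
        using linear_betweenD(3)[OF l, of "mat_adjoint x" "cnj c"] by (simp add: matrix_algebra_sel mat_adjoint_closed)
      then show "cnj (H (star A a) (star Mat (c \<odot>\<^bsub>Mat\<^esub> x))) = c \<odot>\<^bsub>CC\<^esub> cnj (H (star A a) (star Mat x))"
        using x by (simp add: matrix_algebra_sel adj(2)[OF _ x[unfolded matrix_algebra_sel]])
    qed simp
  next
    fix b assume "b \<in> carrier Mat"
    then have "star Mat b \<in> carrier_mat n n" by (simp add: matrix_algebra_sel mat_adjoint_closed)
    then show "alin (\<lambda>a. cnj (H (star A a) (star Mat b)))"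
      by (rule alin_cnj_star[OF bilinear_matrix[OF H]])
  qed
  have "tensor_eval (star TA (entries z)) H = cnj (\<Sum>i<n. \<Sum>j<n. cnj (H (star A (entry i j z)) (star Mat (matrix_unit n i j))))"
    unfolding AM.star_eval[OF entries_closed[OF z] H] entries_eval[OF z H'] by (rule refl)
  also have "\<dots> = (\<Sum>i<n. \<Sum>j<n. H (entry j i (star AO z)) (matrix_unit n j i))"
    by (simp add: entry_star[OF _ _ z] matrix_algebra_sel matrix_unit_adjoint)
  also have "\<dots> = tensor_eval (entries (star AO z)) H"
    unfolding entries_eval[OF zs H] by (rule sum.swap)
  finally show "tensor_eval (entries (star AO z)) H = tensor_eval (star TA (entries z)) H" by simp
qed

lemma entries_inject: "inj_on entries (carrier XO)"
proof (rule inj_onI)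
  fix z y assume z: "z \<in> carrier XO" and y: "y \<in> carrier XO" and eq: "entries z = entries y"
  show "z = y"
  proof (rule entry_inject[OF z y])
    fix i j assume ij: "i < n" "j < n"
    show "entry i j z = entry i j y"
    proof (rule A_functional_eqI)
      fix g assume g: "alin g"
      \<comment> \<open>This form reads off \<open>g\<close> of a single entry, because among the
        matrix units only the one at (i, j) has a nonzero (i, j) entry.\<close>
      let ?H = "\<lambda>a (m::complex mat). g a * m $$ (i, j)"
      have H: "bilinear_on A Mat ?H"
      proof (rule bilinear_onI)
        show "linear_between Mat CC (?H a)" for a
          by (rule linear_betweenI) (use ij in \<open>auto simp: matrix_algebra_sel algebra_simps\<close>)
        show "alin (\<lambda>a. ?H a m)" for m by (intro linear_multc g)
      qed
      have e: "tensor_eval (entries x) ?H = g (entry i j x)" if "x \<in> carrier XO" for x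
      proof -
        have "tensor_eval (entries x) ?H = (\<Sum>k<n. \<Sum>l<n. if l = j then (if k = i then g (entry i j x) else 0) else 0)"
          unfolding entries_eval[OF that H] by (intro sum.cong refl) (use ij in \<open>auto simp: matrix_unit_index\<close>)
        also have "\<dots> = g (entry i j x)" using ij by simp
        finally show ?thesis .
      qed
      show "g (entry i j z) = g (entry i j y)" using e[OF z] e[OF y] eq by simp
    qed (use ij z y in \<open>simp_all add: entry_closed\<close>)
  qed
qed

lemma entries_surj:
  assumes t: "t \<in> carrier TT"
  shows "\<exists>z\<in>carrier XO. entries z = t"
proof -
  let ?I = "{..<n} \<times> {..<n}"
  \<comment> \<open>The coefficient of \<open>t\<close> at the matrix unit (i, j). The preimage is
    the sum of all \<open>from_entry i j\<close> at these coefficients;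
    \<open>entry_from_entry\<close> shows that its entries are the right ones.\<close>
  let ?c = "\<lambda>i j. lift A (\<lambda>a m. (m $$ (i, j)) \<odot>\<^bsub>A\<^esub> a) t"
  have c: "?c i j \<in> carrier A" for i j
    by (rule AM.lift_closed'[OF complex_space_A t]) auto
  have ce: "g (?c i j) = tensor_eval t (\<lambda>a m. m $$ (i, j) * g a)" if g: "alin g" for g i j
  proof -
    have "g (?c i j) = tensor_eval t (\<lambda>a m. g ((m $$ (i, j)) \<odot>\<^bsub>A\<^esub> a))"
      by (rule AM.functional_lift'[OF complex_space_A t _ g]) auto
    also have "\<dots> = tensor_eval t (\<lambda>a m. m $$ (i, j) * g a)"
      by (rule AM.eval_cong[OF t]) (auto simp: linear_betweenD(3)[OF g])
    finally show ?thesis .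
  qed
  let ?g = "\<lambda>(i, j). from_entry i j (?c i j)"
  have g: "?g q \<in> carrier XO" if "q \<in> ?I" for q
    using that c by (auto intro!: from_entry_closed)
  let ?z = "finsum XO ?g ?I"
  have z: "?z \<in> carrier XO"
    by (rule abelian_monoid.finsum_closed[OF abelian_group.axioms(1)[OF complex_spaceD(1)[OF O.X_space]]])
      (use g in blast)
  have M: "entry k l ?z = ?c k l" if kl: "k < n" "l < n" for k l
  proof (rule A_functional_eqI[OF entry_closed[OF kl z] c])
    fix f assume f: "alin f"
    have f0: "f \<zero>\<^bsub>A\<^esub> = 0" using linear_between_zero[OF f complex_space_A complex_space_CC] by simp
    have "f (entry k l ?z) = (\<Sum>q\<in>?I. f (entry k l (?g q)))"
      by (rule linear_functional_finsum[OF linear_between_comp[OF f entry_linear[OF kl]] O.X_space _ g]) auto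
    also have "\<dots> = (\<Sum>q\<in>?I. if q = (k, l) then f (?c k l) else 0)"
      by (intro sum.cong refl) (use kl c f0 in \<open>auto simp: entry_from_entry split: if_splits\<close>)
    also have "\<dots> = f (?c k l)" using kl by (simp add: sum.delta)
    finally show "f (entry k l ?z) = f (?c k l)" .
  qed
  have "entries ?z = t"
  proof (rule AM.eval_eqI[OF entries_closed[OF z] t])
    fix H assume H: "bilinear_on A Mat H"
    have "tensor_eval (entries ?z) H = (\<Sum>i<n. \<Sum>j<n. tensor_eval t (\<lambda>a m. m $$ (i, j) * H a (matrix_unit n i j)))"
      unfolding entries_eval[OF z H]
    proof (intro sum.cong refl)
      fix i j assume "i \<in> {..<n}" "j \<in> {..<n}"
      then have ij: "i < n" "j < n" by auto
      show "H (entry i j ?z) (matrix_unit n i j) = tensor_eval t (\<lambda>a m. m $$ (i, j) * H a (matrix_unit n i j))"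
        unfolding M[OF ij] by (rule ce[OF bilinear_matrix[OF H]]) simp
    qed
    also have "\<dots> = tensor_eval t (\<lambda>a m. \<Sum>i<n. \<Sum>j<n. m $$ (i, j) * H a (matrix_unit n i j))"
      by (simp only: tensor_eval_sum)
    also have "\<dots> = tensor_eval t H"
    proof (rule AM.eval_cong[OF t])
      fix a m assume "(a, m) \<in> carrier A \<times> carrier Mat"
      then show "(\<Sum>i<n. \<Sum>j<n. m $$ (i, j) * H a (matrix_unit n i j)) = H a m"
        by (intro matrix_expand[symmetric] bilinear_onD(1)[OF H]) (auto simp: matrix_algebra_sel)
    qed
    finally show "tensor_eval (entries ?z) H = tensor_eval t H" .
  qed
  then show ?thesis using z by blast
qed

theorem duality: "star_isomorphic AO TA"
  unfolding star_isomorphic_def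
proof (rule bexI[of _ entries], intro conjI ballI)
  show "linear_between AO TA entries" by (rule entries_linear)
  show "entries (star AO z) = star TA (entries z)" if "z \<in> carrier AO" for z
    using that entries_star by (simp add: O.AxK_sel(1))
  have "entries \<in> Ring.ring_hom AO TA"
  proof (rule ring_hom_memI)
    show "entries (x \<oplus>\<^bsub>AO\<^esub> y) = entries x \<oplus>\<^bsub>TA\<^esub> entries y" if "x \<in> carrier AO" "y \<in> carrier AO" for x y
      by (rule linear_betweenD(2)[OF entries_linear that])
  qed (simp_all add: entries_one entries_mult O.AxK_sel(1) tensor_algebra_sel(1) entries_closed)
  moreover have "bij_betw entries (carrier AO) (carrier TA)"
    unfolding bij_betw_def O.AxK_sel(1) tensor_algebra_sel(1)
    using entries_inject entries_closed entries_surj by (auto simp: image_iff)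
  ultimately show "entries \<in> ring_iso AO TA" by (simp add: ring_iso_def)
qed

end

theorem theorem4p7:
  fixes K :: "'k weak_kac" and lam :: real
    and A :: "'a star_alg" and N :: "'a \<Rightarrow> real" and act :: "'k \<Rightarrow> 'a \<Rightarrow> 'a"
  assumes "weak_kac_algebra K"
    and "Markov_condition K lam"
    and "cstar_algebra A N"
    and "left_cstar_action K A N act"
  shows "\<exists>n::nat. real n = 1 / lam \<and>
    star_isomorphic
      (crossed_product (dual_kac K) (crossed_product K A act) (dual_action K A act))
      (tensor_algebra A (matrix_algebra n))"
proof -
  interpret weak_kac_algebra K by fact
  obtain p \<tau> where p: "is_Haar_projection K p" and \<tau>: "is_Haar_trace K \<tau>"
    and m: "slice_right K \<tau> (comult K p) = complex_of_real lam \<odot>\<^bsub>K\<^esub> \<one>\<^bsub>K\<^esub>" and lam: "lam > 0"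
    using assms(2) unfolding Markov_condition_def by blast
  interpret haar_kac_algebra K \<tau> by unfold_locales (rule \<tau>)
  interpret markov_kac_algebra K \<tau> p lam by unfold_locales (use p lam m in \<open>simp_all add: E_def\<close>)
  obtain n u where n: "real n = 1 / lam" and u: "\<And>i. i < n \<Longrightarrow> u i \<in> carrier K"
      "\<And>i j. i < n \<Longrightarrow> j < n \<Longrightarrow> E (star K (u i) \<otimes>\<^bsub>K\<^esub> u j) = (if i = j then \<one>\<^bsub>K\<^esub> else \<zero>\<^bsub>K\<^esub>)"
      "\<And>f k. klin f \<Longrightarrow> k \<in> carrier K \<Longrightarrow> (\<Sum>i<n. f (u i \<otimes>\<^bsub>K\<^esub> E (star K (u i) \<otimes>\<^bsub>K\<^esub> k))) = f k"
    using module_basis by blast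
  have "markov_action K \<tau> p lam A act n u"
    by (intro markov_action.intro markov_action_axioms.intro markov_kac_algebra_axioms
        cstar_algebra.axioms(1)[OF assms(3)] left_cstar_action.axioms(1)[OF assms(4)] u)
  from markov_action.duality[OF this] n show ?thesis by (intro exI[of _ n] conjI)
qed

end
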